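(* Let $\widehat{\mathfrak g}$ be of type $A_{2n}^{(2)}$ ($n\ge 1$), let $\lambda\in P^+$, and let $\boldsymbol\xi=(\xi^{\alpha})_{\alpha\in R^+}$ be a $\lambda$-compatible $|R^+|$-tuple of partitions. Assume that for every $\alpha\in R^+$ the partition $\xi^{\alpha}$ is either rectangular or special. Then $V(\boldsymbol\xi)$ is isomorphic to the quotient of $W_{\mathrm{loc}}(\lambda)$ by the submodule generated by the elements $$\{x_{-\alpha+d_\alpha s_\alpha\delta}\,w_\lambda:\alpha\in R^+\}\ \cup\ \{(x_{-\alpha+d_\alpha(s_\alpha-1)\delta})^{\xi^\alpha_{s_\alpha}+1}w_\lambda:\alpha\in R^+,\ \xi^\alpha\text{ special}\},$$ $$\{x_{-\frac{\alpha}{2}+(s_\alpha+\frac12)\delta}\,w_\lambda:\alpha\in R^+_\ell\}\ \cup\ \{(x_{-\frac{\alpha}{2}+(s_\alpha-\frac12)\delta})^{2\phi(\xi^\alpha;s_\alpha-1)+1}w_\lambda:\alpha\in R^+_\ell,\ \xi^\alpha\text{ special}\}.$$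
   Context: Everything is over $\mathbb C$; $\mathbb N=\{1,2,\dots\}$, $\mathbb Z_+=\{0,1,2,\dots\}$, and $\mathbf N=\{(r,s): r,s\in\frac12\mathbb N,\ r+s\in\mathbb N\}$. For $s\in\mathbb R$, $s_+=\max\{0,s\}$. For $x$ in an algebra and $b\in\mathbb Z_+$, $x^{(b)}=x^b/b!$. Setting. $\widehat{\mathfrak g}$ is the affine Kac–Moody algebra of type $A_{2n}^{(2)}$ with simple roots $\alpha_0,\dots,\alpha_n$ labelled as in Kac's book (Table Aff 2), $\mathfrak g$ is the finite-dimensional simple subalgebra with simple roots $\Delta=\{\alpha_1,\dots,\alpha_n\}$ (type $A_1$ if $n=1$, $C_n$ if $n\ge2$), $\mathfrak h$ its Cartan subalgebra, $\mathfrak n^\pm$ the sums of its positive/negative root spaces, $R=R^+\sqcup R^-$ its roots, $R_\ell,R_s$ its long and short roots (for $n=1$: $R_\ell=R$, $R_s=\emptyset$), $\alpha^\vee$ the coroot of $\alpha$, $P^+$ the dominant integral weights of $\mathfrak g$. Put $d_\alpha=2$ if $\alpha$ is long, $d_\alpha=1$ if $\alpha$ is short. $\delta$ is the non-divisible positive imaginary root. The positive real roots of $\widehat{\mathfrak g}$ are $R^+\cup(R_s+\mathbb N\delta)\cup(R_\ell+2\mathbb N\delta)\cup\frac12(R_\ell+(2\mathbb Z_++1)\delta)$. For a real root $\gamma$, $x_\gamma$ is a generator of the root space $\widehat{\mathfrak g}_\gamma$. Let $\widehat{\mathfrak n}^+$ be the sum of all positive root spaces. The hyperspecial twisted current algebra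 is $\mathfrak{Cg}=\mathfrak h\oplus\widehat{\mathfrak n}^+\oplus\mathfrak n^-$. Put $\mathfrak{Ch}_+=\bigoplus_{k>0}\widehat{\mathfrak g}_{k\delta}$ and let $\mathfrak{Cn}^+$ be the sum of the root spaces $\widehat{\mathfrak g}_\gamma$ with $\gamma\in R^+\cup(R_s^++\mathbb N\delta)\cup(R_\ell^++2\mathbb N\delta)\cup\frac12(R_\ell^++(2\mathbb Z_++1)\delta)$. $\mathfrak{Cg}$ is $\mathbb Z_+$-graded by the adjoint action of the scaling element $d$ ($\alpha_0(d)=1$, $\alpha_i(d)=0$ for $i\ne0$). Local Weyl module. $W_{\mathrm{loc}}(\lambda)$ is the $\mathfrak{Cg}$-module generated by $w_\lambda$ with defining relations $(\mathfrak{Cn}^+\oplus\mathfrak{Ch}_+)w_\lambda=0$, $hw_\lambda=\lambda(h)w_\lambda$ ($h\in\mathfrak h$), $x_{-\alpha}^{\lambda(\alpha^\vee)+1}w_\lambda=0$ ($\alpha\in R^+$). Partitions. $\boldsymbol\xi=(\xi^\alpha)_{\alpha\in R^+}$ is $\lambda$-compatible if each $\xi^\alpha=(\xi^\alpha_0\ge\xi^\alpha_1\ge\cdots\ge0)$ is a partition (indexed from $0$) with $|\xi^\alpha|:=\sum_{j\ge1}\xi^\alpha_j=\lambda(\alpha^\vee)$. $s_\alpha$ is the number of non-zero parts of $(\xi_1^\alpha\ge\xi_2^\alpha\ge\cdots)$; $s_\alpha=0$ if $|\xi^\alpha|=0$. For $\alpha\in R_\ell^+$, $k\in\mathbb Z_+$,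 $$\phi(\xi^\alpha;k)=\begin{cases}-\frac12\xi^\alpha_{k+1}+\sum_{j\ge k+1}\xi^\alpha_j & 0\le k\le s_\alpha-2,\\ (\xi^\alpha_{s_\alpha}-\frac12\xi^\alpha_{s_\alpha-1})_+ & k=s_\alpha-1,\\ 0&\text{else.}\end{cases}$$ A partition is rectangular if it is empty or of the form $(k^{c})$ ($k$ repeated $c$ times, $k,c\in\mathbb N$); it is special (a special fat hook) if it is of the form $(k_1^{c_1},k_2)$ with $k_1>k_2\ge1$, $c_1\ge1$. Here the whole partition $\xi^\alpha=(\xi_0^\alpha,\xi_1^\alpha,\dots)$ is meant. The module $V(\boldsymbol\xi)$ is the quotient of $W_{\mathrm{loc}}(\lambda)$ by the submodule generated by $(x_{\alpha+d_\alpha\delta})^{(s)}(x_{-\alpha})^{(s+r)}w_\lambda$ for $\alpha\in R^+$, $s,r\in\mathbb N$ with $s+r\ge1+rk+\sum_{j\ge k+1}\xi^\alpha_j$ for some $k\in\mathbb Z_+$, and $(x_{\frac\alpha2+\frac\delta2})^{(2s)}(x_{-\alpha})^{(s+r)}w_\lambda$ for $\alpha\in R_\ell^+$, $(r,s)\in\mathbf N$ with $s\ge\frac12+2rk+\phi(\xi^\alpha;k)$ for some $k\in\mathbb Z_+$. *)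

theory Defs
  imports Complex_Main "HOL-Library.Poly_Mapping"
begin

section \<open>Lie algebras over the complex numbers\<close>

locale lie_algebra = vector_space scale
  for scale :: "complex \<Rightarrow> 'g::ab_group_add \<Rightarrow> 'g" +
  fixes bracket :: "'g \<Rightarrow> 'g \<Rightarrow> 'g"
  assumes bracket_linear_right: "Vector_Spaces.linear scale scale (\<lambda>y. bracket x y)"
    and bracket_linear_left: "Vector_Spaces.linear scale scale (\<lambda>x. bracket x y)"
    and bracket_self: "bracket x x = 0"
    and jacobi: "bracket x (bracket y z) + bracket y (bracket z x) + bracket z (bracket x y) = 0"
begin

definition lie_subalgebra :: "'g set \<Rightarrow> bool" where
  "lie_subalgebra L \<longleftrightarrow> subspace L \<and> (\<forall>x\<in>L. \<forall>y\<in>L. bracket x y \<in> L)"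

definition lie_ideal :: "'g set \<Rightarrow> bool" where
  "lie_ideal J \<longleftrightarrow> subspace J \<and> (\<forall>x. \<forall>y\<in>J. bracket x y \<in> J)"

end

section \<open>Modules, quotients and the universal enveloping algebra\<close>

text \<open>A module over a set \<open>L\<close> of operators: a carrier with addition, scalar multiplication and
  an action of the elements of \<open>L\<close>.\<close>

record ('g, 'm) lie_mod =
  mcar :: "'m set"
  madd :: "'m \<Rightarrow> 'm \<Rightarrow> 'm"
  mscl :: "complex \<Rightarrow> 'm \<Rightarrow> 'm"
  mact :: "'g \<Rightarrow> 'm \<Rightarrow> 'm"

definition submodule :: "'g set \<Rightarrow> ('g, 'm) lie_mod \<Rightarrow> 'm set \<Rightarrow> bool" where
  "submodule L M N \<longleftrightarrow> N \<subseteq> mcar M \<and> N \<noteq> {} \<and>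
     (\<forall>u\<in>N. \<forall>v\<in>N. madd M u v \<in> N) \<and>
     (\<forall>c. \<forall>v\<in>N. mscl M c v \<in> N) \<and>
     (\<forall>x\<in>L. \<forall>v\<in>N. mact M x v \<in> N)"

definition submodule_gen :: "'g set \<Rightarrow> ('g, 'm) lie_mod \<Rightarrow> 'm set \<Rightarrow> 'm set" where
  "submodule_gen L M S = \<Inter>{N. submodule L M N \<and> S \<subseteq> N}"

definition coset :: "('g, 'm) lie_mod \<Rightarrow> 'm set \<Rightarrow> 'm \<Rightarrow> 'm set" where
  "coset M N v = {madd M v u | u. u \<in> N}"

text \<open>The operations on the cosets of \<open>N\<close>; adding \<open>N\<close> in \<open>mscl\<close> and \<open>mact\<close> makes the
  result a full coset, for instance for the scalar \<open>0\<close>.\<close>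

definition quot_mod :: "('g, 'm) lie_mod \<Rightarrow> 'm set \<Rightarrow> ('g, 'm set) lie_mod" where
  "quot_mod M N =
     \<lparr> mcar = coset M N ` mcar M,
       madd = (\<lambda>X Y. {madd M a b | a b. a \<in> X \<and> b \<in> Y}),
       mscl = (\<lambda>c X. {madd M (mscl M c a) u | a u. a \<in> X \<and> u \<in> N}),
       mact = (\<lambda>x X. {madd M (mact M x a) u | a u. a \<in> X \<and> u \<in> N}) \<rparr>"

definition module_iso :: "'g set \<Rightarrow> ('g, 'm) lie_mod \<Rightarrow> ('g, 'k) lie_mod \<Rightarrow> bool" where
  "module_iso L M M' \<longleftrightarrow> (\<exists>\<Phi>. bij_betw \<Phi> (mcar M) (mcar M') \<and>
     (\<forall>u\<in>mcar M. \<forall>v\<in>mcar M. \<Phi> (madd M u v) = madd M' (\<Phi> u) (\<Phi> v)) \<and>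
     (\<forall>c. \<forall>v\<in>mcar M. \<Phi> (mscl M c v) = mscl M' c (\<Phi> v)) \<and>
     (\<forall>x\<in>L. \<forall>v\<in>mcar M. \<Phi> (mact M x v) = mact M' x (\<Phi> v)))"

definition act_pow :: "('g, 'm) lie_mod \<Rightarrow> 'g \<Rightarrow> nat \<Rightarrow> 'm \<Rightarrow> 'm" where
  "act_pow M x b v = (mact M x ^^ b) v"

definition act_dpow :: "('g, 'm) lie_mod \<Rightarrow> 'g \<Rightarrow> nat \<Rightarrow> 'm \<Rightarrow> 'm" where
  "act_dpow M x b v = mscl M (1 / fact b) (act_pow M x b v)"

text \<open>The free monoid on \<open>'a\<close>, written additively, so that \<open>'a word \<Rightarrow>\<^sub>0 complex\<close> is the free
  associative unital algebra on \<open>'a\<close>, with the convolution product.\<close>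

datatype 'a word = Word (letters: "'a list")

instantiation word :: (type) monoid_add
begin

definition zero_word :: "'a word" where "zero_word = Word []"

definition plus_word :: "'a word \<Rightarrow> 'a word \<Rightarrow> 'a word" where
  "plus_word u v = Word (letters u @ letters v)"

instance
  by standard (simp_all add: zero_word_def plus_word_def)

end

type_synonym 'a free_alg = "'a word \<Rightarrow>\<^sub>0 complex"

definition gen :: "'a \<Rightarrow> 'a free_alg" where
  "gen x = Poly_Mapping.single (Word [x]) 1"

definition const :: "complex \<Rightarrow> 'a free_alg" where
  "const c = Poly_Mapping.single 0 c"

definition free_alg_on :: "'a set \<Rightarrow> 'a free_alg set" where
  "free_alg_on L = {p. \<forall>w\<in>Poly_Mapping.keys p. set (letters w) \<subseteq> L}"

context lie_algebra
begin

definition uea_relators :: "'g set \<Rightarrow> 'g free_alg set" where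
  "uea_relators L =
     {gen (x + y) - gen x - gen y | x y. x \<in> L \<and> y \<in> L}
     \<union> {gen (scale c x) - const c * gen x | c x. x \<in> L}
     \<union> {gen x * gen y - gen y * gen x - gen (bracket x y) | x y. x \<in> L \<and> y \<in> L}"

text \<open>The two-sided ideal generated by the relators in the free algebra on the set \<open>L\<close>.\<close>

definition uea_ideal :: "'g set \<Rightarrow> 'g free_alg set" where
  "uea_ideal L = \<Inter>{J. uea_relators L \<subseteq> J \<and> 0 \<in> J \<and> (\<forall>p\<in>J. \<forall>q\<in>J. p + q \<in> J) \<and>
     (\<forall>p\<in>J. \<forall>q\<in>free_alg_on L. q * p \<in> J \<and> p * q \<in> J)}"

text \<open>The universal enveloping algebra \<open>U(L)\<close> of a Lie subalgebra \<open>L\<close>, as a left \<open>L\<close>-module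
  under left multiplication, and its unit.\<close>

definition free_alg_mod :: "'g set \<Rightarrow> ('g, 'g free_alg) lie_mod" where
  "free_alg_mod L = \<lparr> mcar = free_alg_on L, madd = (+),
     mscl = (\<lambda>c p. const c * p), mact = (\<lambda>x p. gen x * p) \<rparr>"

definition uea :: "'g set \<Rightarrow> ('g, 'g free_alg set) lie_mod" where
  "uea L = quot_mod (free_alg_mod L) (uea_ideal L)"

definition uea_one :: "'g set \<Rightarrow> 'g free_alg set" where
  "uea_one L = coset (free_alg_mod L) (uea_ideal L) 1"

end

section \<open>The affine Kac--Moody algebra of type $A_{2n}^{(2)}$\<close>

text \<open>Labelling as in Kac's Table Aff 2: \<open>\<alpha>\<^sub>0\<close> is the shortest simple root and, for \<open>n \<ge> 2\<close>,
  \<open>\<alpha>\<^sub>n\<close> is the longest. The \<open>(i,j)\<close> entry is \<open>\<langle>\<alpha>\<^sub>i\<^sup>\<or>, \<alpha>\<^sub>j\<rangle>\<close>.\<close>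

definition gcm :: "nat \<Rightarrow> nat \<Rightarrow> nat \<Rightarrow> int" where
  "gcm n i j =
     (if i = j then 2
      else if n = 1 then (if i = 0 then -4 else -1)
      else if j = i + 1 then (if i = 0 \<or> j = n then -2 else -1)
      else if i = j + 1 then -1
      else 0)"

definition mark :: "nat \<Rightarrow> nat \<Rightarrow> nat" where
  "mark n i = (if i = n then 1 else 2)"

definition comark :: "nat \<Rightarrow> nat \<Rightarrow> nat" where
  "comark n i = (if i = 0 then 1 else 2)"

text \<open>Elements of the real span of the simple roots are represented by their coordinates:
  \<open>\<gamma>\<close> stands for \<open>\<Sum>i\<le>n. \<gamma> i \<cdot> \<alpha>\<^sub>i\<close>, and \<open>\<gamma> i = 0\<close> for \<open>i > n\<close>.\<close>

type_synonym weight = "nat \<Rightarrow> real"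

definition delta :: "nat \<Rightarrow> weight" where
  "delta n = (\<lambda>i. if i \<le> n then real (mark n i) else 0)"

text \<open>The weight \<open>a\<alpha> + b\<delta>\<close>.\<close>

definition wt :: "nat \<Rightarrow> real \<Rightarrow> weight \<Rightarrow> real \<Rightarrow> weight" where
  "wt n a \<alpha> b = (\<lambda>i. a * \<alpha> i + b * delta n i)"

text \<open>The normalized invariant form, \<open>(\<alpha>\<^sub>i|\<alpha>\<^sub>j) = a\<^sub>i\<^sup>\<or> a\<^sub>i\<^sup>-\<^sup>1 a\<^sub>i\<^sub>j\<close>.\<close>

definition form :: "nat \<Rightarrow> weight \<Rightarrow> weight \<Rightarrow> real" where
  "form n \<alpha> \<beta> = (\<Sum>i\<le>n. \<Sum>j\<le>n.
     \<alpha> i * \<beta> j * (real (comark n i) / real (mark n i)) * real_of_int (gcm n i j))"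

lemma gcm_mark_eq_0:
  assumes "1 \<le> n" "i \<le> n"
  shows "(\<Sum>j\<le>n. gcm n i j * int (mark n j)) = 0"
proof (cases "n = 1")
  case True
  then show ?thesis using assms
    by (cases i) (auto simp: gcm_def mark_def)
next
  case False
  with assms have n: "2 \<le> n" by simp
  let ?S = "{i - 1, i, i + 1} \<inter> {..n}"
  have "(\<Sum>j\<le>n. gcm n i j * int (mark n j)) = (\<Sum>j\<in>?S. gcm n i j * int (mark n j))"
    by (rule sum.mono_neutral_right) (use n in \<open>auto simp: gcm_def\<close>)
  also have "\<dots> = 0"
  proof (cases "i = 0")
    case True
    then have "?S = {0, 1}" using n by auto
    then show ?thesis using True n by (simp add: gcm_def mark_def)
  next
    case i0: False
    show ?thesis
    proof (cases "i = n")
      case True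
      then have "?S = {n - 1, n}" using n by auto
      moreover have "n - 1 \<noteq> n" "Suc (n - 1) = n" using n by auto
      ultimately show ?thesis using True n by (auto simp: gcm_def mark_def)
    next
      case False
      obtain m where m: "i = Suc m" using i0 by (cases i) auto
      have "?S = {m, Suc m, Suc (Suc m)}" using m False assms by auto
      then show ?thesis using m False n assms by (auto simp: gcm_def mark_def)
    qed
  qed
  finally show ?thesis .
qed

lemma comark_gcm_sym:
  assumes "1 \<le> n" "i \<le> n" "j \<le> n"
  shows "(real (comark n i) / real (mark n i)) * real_of_int (gcm n i j)
       = (real (comark n j) / real (mark n j)) * real_of_int (gcm n j i)"
  using assms by (auto simp: gcm_def mark_def comark_def)

record 'g km_data =
  scl :: "complex \<Rightarrow> 'g \<Rightarrow> 'g"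
  brk :: "'g \<Rightarrow> 'g \<Rightarrow> 'g"
  cartan :: "'g set"
  sroot :: "nat \<Rightarrow> 'g \<Rightarrow> complex"
  scoroot :: "nat \<Rightarrow> 'g"
  che :: "nat \<Rightarrow> 'g"
  chf :: "nat \<Rightarrow> 'g"

text \<open>The Kac--Moody algebra of the generalized Cartan matrix \<open>gcm n\<close>: a realization
  \<open>(cartan, sroot, scoroot)\<close>, whose Cartan subalgebra has dimension \<open>2(n+1) - n\<close> because the
  matrix has size \<open>n+1\<close> and rank \<open>n\<close>, together with Chevalley generators. That no non-zero ideal
  meets the Cartan subalgebra trivially says that the algebra is the quotient of the algebra
  presented by the relations below by its largest such ideal. The simple roots are linear
  functionals on the Cartan subalgebra; their values elsewhere are irrelevant.\<close>

locale affine_A2n2 = lie_algebra "scl G" "brk G"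
  for n :: nat and G :: "'g::ab_group_add km_data" +
  assumes n_pos: "1 \<le> n"
    and cartan_subspace: "subspace (cartan G)"
    and cartan_dim: "dim (cartan G) = n + 2"
    and sroot_add: "\<lbrakk>i \<le> n; h \<in> cartan G; h' \<in> cartan G\<rbrakk> \<Longrightarrow>
          sroot G i (h + h') = sroot G i h + sroot G i h'"
    and sroot_scl: "\<lbrakk>i \<le> n; h \<in> cartan G\<rbrakk> \<Longrightarrow> sroot G i (scl G c h) = c * sroot G i h"
    and sroot_independent:
          "\<And>b i. \<lbrakk>\<forall>h\<in>cartan G. (\<Sum>j\<le>n. b j * sroot G j h) = 0; i \<le> n\<rbrakk> \<Longrightarrow> b i = 0"
    and scoroot_in_cartan: "i \<le> n \<Longrightarrow> scoroot G i \<in> cartan G"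
    and scoroot_independent: "\<And>b i. \<lbrakk>(\<Sum>j\<le>n. scl G (b j) (scoroot G j)) = 0; i \<le> n\<rbrakk> \<Longrightarrow> b i = 0"
    and pairing: "\<lbrakk>i \<le> n; j \<le> n\<rbrakk> \<Longrightarrow> sroot G j (scoroot G i) = of_int (gcm n i j)"
    and brk_cartan: "\<lbrakk>h \<in> cartan G; h' \<in> cartan G\<rbrakk> \<Longrightarrow> brk G h h' = 0"
    and brk_e_f: "\<lbrakk>i \<le> n; j \<le> n\<rbrakk> \<Longrightarrow>
          brk G (che G i) (chf G j) = (if i = j then scoroot G i else 0)"
    and brk_cartan_e: "\<lbrakk>i \<le> n; h \<in> cartan G\<rbrakk> \<Longrightarrow>
          brk G h (che G i) = scl G (sroot G i h) (che G i)"
    and brk_cartan_f: "\<lbrakk>i \<le> n; h \<in> cartan G\<rbrakk> \<Longrightarrow>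
          brk G h (chf G i) = scl G (- sroot G i h) (chf G i)"
    and generated: "lie_subalgebra hull (cartan G \<union> che G ` {..n} \<union> chf G ` {..n}) = UNIV"
    and ideal_cartan: "\<lbrakk>lie_ideal J; J \<inter> cartan G = {0}\<rbrakk> \<Longrightarrow> J = {0}"
begin

definition wt_eval :: "weight \<Rightarrow> 'g \<Rightarrow> complex" where
  "wt_eval \<gamma> h = (\<Sum>i\<le>n. of_real (\<gamma> i) * sroot G i h)"

definition root_space :: "weight \<Rightarrow> 'g set" where
  "root_space \<gamma> = {x. \<forall>h\<in>cartan G. brk G h x = scl G (wt_eval \<gamma> h) x}"

definition affine_pos_roots :: "weight set" where
  "affine_pos_roots = {\<gamma>. (\<forall>i. \<gamma> i \<in> \<nat>) \<and> (\<forall>i>n. \<gamma> i = 0) \<and> \<gamma> \<noteq> (\<lambda>_. 0) \<and> root_space \<gamma> \<noteq> {0}}"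

subsection \<open>The finite-dimensional simple subalgebra and its roots\<close>

definition fin_alg :: "'g set" where
  "fin_alg = lie_subalgebra hull (che G ` {1..n} \<union> chf G ` {1..n})"

definition fin_cartan :: "'g set" where
  "fin_cartan = span (scoroot G ` {1..n})"

definition fin_root_space :: "weight \<Rightarrow> 'g set" where
  "fin_root_space \<alpha> = {x\<in>fin_alg. \<forall>h\<in>fin_cartan. brk G h x = scl G (wt_eval \<alpha> h) x}"

definition roots :: "weight set" where
  "roots = {\<alpha>. (\<forall>i. \<alpha> i \<in> \<int>) \<and> (\<forall>i. i \<notin> {1..n} \<longrightarrow> \<alpha> i = 0) \<and> \<alpha> \<noteq> (\<lambda>_. 0) \<and>
     fin_root_space \<alpha> \<noteq> {0}}"

definition pos_roots :: "weight set" where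
  "pos_roots = {\<alpha>\<in>roots. \<forall>i. 0 \<le> \<alpha> i}"

definition neg_roots :: "weight set" where
  "neg_roots = {\<alpha>\<in>roots. \<forall>i. \<alpha> i \<le> 0}"

definition long_roots :: "weight set" where
  "long_roots = {\<alpha>\<in>roots. \<forall>\<beta>\<in>roots. form n \<beta> \<beta> \<le> form n \<alpha> \<alpha>}"

definition short_roots :: "weight set" where
  "short_roots = roots - long_roots"

definition dd :: "weight \<Rightarrow> nat" where
  "dd \<alpha> = (if \<alpha> \<in> long_roots then 2 else 1)"

text \<open>\<open>\<alpha>\<^sup>\<or> = 2 \<nu>\<^sup>-\<^sup>1(\<alpha>) / (\<alpha>|\<alpha>)\<close>, where \<open>\<nu>\<^sup>-\<^sup>1(\<alpha>\<^sub>i) = a\<^sub>i\<^sup>\<or> a\<^sub>i\<^sup>-\<^sup>1 \<alpha>\<^sub>i\<^sup>\<or>\<close>.\<close>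

definition coroot :: "weight \<Rightarrow> 'g" where
  "coroot \<alpha> = (\<Sum>i\<le>n. scl G
     (of_real (2 / form n \<alpha> \<alpha> * \<alpha> i * (real (comark n i) / real (mark n i)))) (scoroot G i))"

definition dominant_integral :: "('g \<Rightarrow> complex) \<Rightarrow> bool" where
  "dominant_integral lam \<longleftrightarrow>
     (\<forall>h\<in>fin_cartan. \<forall>h'\<in>fin_cartan. lam (h + h') = lam h + lam h') \<and>
     (\<forall>c. \<forall>h\<in>fin_cartan. lam (scl G c h) = c * lam h) \<and>
     (\<forall>i\<in>{1..n}. lam (scoroot G i) \<in> \<nat>)"

subsection \<open>Real roots and the hyperspecial twisted current algebra\<close>

definition pos_real_roots :: "weight set" where
  "pos_real_roots = pos_roots
     \<union> {wt n 1 \<alpha> (real k) | \<alpha> k. \<alpha> \<in> short_roots \<and> 1 \<le> k}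
     \<union> {wt n 1 \<alpha> (2 * real k) | \<alpha> k. \<alpha> \<in> long_roots \<and> 1 \<le> k}
     \<union> {wt n (1/2) \<alpha> ((2 * real k + 1) / 2) | \<alpha> k. \<alpha> \<in> long_roots}"

definition real_roots :: "weight set" where
  "real_roots = pos_real_roots \<union> {(\<lambda>i. - \<gamma> i) | \<gamma>. \<gamma> \<in> pos_real_roots}"

definition root_vectors :: "(weight \<Rightarrow> 'g) \<Rightarrow> bool" where
  "root_vectors x \<longleftrightarrow> (\<forall>\<gamma>\<in>real_roots. span {x \<gamma>} = root_space \<gamma>)"

definition affine_nplus :: "'g set" where
  "affine_nplus = span (\<Union>\<gamma>\<in>affine_pos_roots. root_space \<gamma>)"

definition fin_nminus :: "'g set" where
  "fin_nminus = span (\<Union>\<alpha>\<in>neg_roots. fin_root_space \<alpha>)"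

definition Cg :: "'g set" where
  "Cg = span (fin_cartan \<union> affine_nplus \<union> fin_nminus)"

definition Chplus :: "'g set" where
  "Chplus = span (\<Union>k\<in>{1::nat..}. root_space (wt n 0 (\<lambda>_. 0) (real k)))"

definition Cnplus_roots :: "weight set" where
  "Cnplus_roots = pos_roots
     \<union> {wt n 1 \<alpha> (real k) | \<alpha> k. \<alpha> \<in> short_roots \<inter> pos_roots \<and> 1 \<le> k}
     \<union> {wt n 1 \<alpha> (2 * real k) | \<alpha> k. \<alpha> \<in> long_roots \<inter> pos_roots \<and> 1 \<le> k}
     \<union> {wt n (1/2) \<alpha> ((2 * real k + 1) / 2) | \<alpha> k. \<alpha> \<in> long_roots \<inter> pos_roots}"

definition Cnplus :: "'g set" where
  "Cnplus = span (\<Union>\<gamma>\<in>Cnplus_roots. root_space \<gamma>)"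

subsection \<open>Local Weyl modules\<close>

definition Wloc_relators ::
    "(weight \<Rightarrow> 'g) \<Rightarrow> ('g \<Rightarrow> complex) \<Rightarrow> 'g free_alg set set" where
  "Wloc_relators x lam = (let U = uea Cg; u = uea_one Cg in
     {mact U y u | y. y \<in> span (Cnplus \<union> Chplus)}
     \<union> {madd U (mact U h u) (mscl U (- lam h) u) | h. h \<in> fin_cartan}
     \<union> {act_pow U (x (wt n (-1) \<alpha> 0)) (k + 1) u | \<alpha> k.
          \<alpha> \<in> pos_roots \<and> of_nat k = lam (coroot \<alpha>)})"

definition Wloc_ker :: "(weight \<Rightarrow> 'g) \<Rightarrow> ('g \<Rightarrow> complex) \<Rightarrow> 'g free_alg set set" where
  "Wloc_ker x lam = submodule_gen Cg (uea Cg) (Wloc_relators x lam)"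

definition Wloc ::
    "(weight \<Rightarrow> 'g) \<Rightarrow> ('g \<Rightarrow> complex) \<Rightarrow> ('g, 'g free_alg set set) lie_mod" where
  "Wloc x lam = quot_mod (uea Cg) (Wloc_ker x lam)"

definition wloc :: "(weight \<Rightarrow> 'g) \<Rightarrow> ('g \<Rightarrow> complex) \<Rightarrow> 'g free_alg set set" where
  "wloc x lam = coset (uea Cg) (Wloc_ker x lam) (uea_one Cg)"

end

section \<open>Partitions\<close>

text \<open>Partitions are sequences with parts \<open>\<xi> 0 \<ge> \<xi> 1 \<ge> \<dots>\<close>. Beware that \<open>tail \<xi> 1\<close> (the size
  \<open>|\<xi>|\<close>) and \<open>nparts \<xi>\<close> (the number \<open>s\<close>) ignore the part \<open>\<xi> 0\<close>.\<close>

definition is_partition :: "(nat \<Rightarrow> nat) \<Rightarrow> bool" where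
  "is_partition \<xi> \<longleftrightarrow> antimono \<xi> \<and> finite {j. \<xi> j \<noteq> 0}"

definition tail :: "(nat \<Rightarrow> nat) \<Rightarrow> nat \<Rightarrow> nat" where
  "tail \<xi> k = (\<Sum>j | k \<le> j \<and> \<xi> j \<noteq> 0. \<xi> j)"

definition nparts :: "(nat \<Rightarrow> nat) \<Rightarrow> nat" where
  "nparts \<xi> = card {j. 1 \<le> j \<and> \<xi> j \<noteq> 0}"

definition phi :: "(nat \<Rightarrow> nat) \<Rightarrow> nat \<Rightarrow> real" where
  "phi \<xi> k =
     (if k + 2 \<le> nparts \<xi> then - real (\<xi> (k + 1)) / 2 + real (tail \<xi> (k + 1))
      else if k + 1 = nparts \<xi> then max 0 (real (\<xi> (nparts \<xi>)) - real (\<xi> (nparts \<xi> - 1)) / 2)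
      else 0)"

definition rectangular :: "(nat \<Rightarrow> nat) \<Rightarrow> bool" where
  "rectangular \<xi> \<longleftrightarrow> \<xi> = (\<lambda>_. 0) \<or>
     (\<exists>k c. 1 \<le> k \<and> 1 \<le> c \<and> \<xi> = (\<lambda>j. if j < c then k else 0))"

definition special :: "(nat \<Rightarrow> nat) \<Rightarrow> bool" where
  "special \<xi> \<longleftrightarrow> (\<exists>k1 k2 c. k2 < k1 \<and> 1 \<le> k2 \<and> 1 \<le> c \<and>
     \<xi> = (\<lambda>j. if j < c then k1 else if j = c then k2 else 0))"

definition bold_N :: "(real \<times> real) set" where
  "bold_N = {(r, s). (\<exists>p::nat. 1 \<le> p \<and> r = real p / 2) \<and> (\<exists>q::nat. 1 \<le> q \<and> s = real q / 2) \<and>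
     r + s \<in> \<nat>}"

section \<open>The modules $V(\xi)$\<close>

context affine_A2n2
begin

definition compatible :: "('g \<Rightarrow> complex) \<Rightarrow> (weight \<Rightarrow> nat \<Rightarrow> nat) \<Rightarrow> bool" where
  "compatible lam \<xi> \<longleftrightarrow>
     (\<forall>\<alpha>\<in>pos_roots. is_partition (\<xi> \<alpha>) \<and> of_nat (tail (\<xi> \<alpha>) 1) = lam (coroot \<alpha>))"

definition V_relators ::
    "(weight \<Rightarrow> 'g) \<Rightarrow> ('g \<Rightarrow> complex) \<Rightarrow> (weight \<Rightarrow> nat \<Rightarrow> nat) \<Rightarrow> 'g free_alg set set set" where
  "V_relators x lam \<xi> = (let W = Wloc x lam; w = wloc x lam in
     {act_dpow W (x (wt n 1 \<alpha> (real (dd \<alpha>)))) s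
        (act_dpow W (x (wt n (-1) \<alpha> 0)) (s + r) w) | \<alpha> s r.
        \<alpha> \<in> pos_roots \<and> 1 \<le> s \<and> 1 \<le> r \<and> (\<exists>k. 1 + r * k + tail (\<xi> \<alpha>) (k + 1) \<le> s + r)}
     \<union> {act_dpow W (x (wt n (1/2) \<alpha> (1/2))) a
        (act_dpow W (x (wt n (-1) \<alpha> 0)) b w) | \<alpha> r s a b.
        \<alpha> \<in> long_roots \<inter> pos_roots \<and> (r, s) \<in> bold_N \<and>
        real a = 2 * s \<and> real b = s + r \<and>
        (\<exists>k::nat. 1/2 + 2 * r * real k + phi (\<xi> \<alpha>) k \<le> s)})"

definition V ::
    "(weight \<Rightarrow> 'g) \<Rightarrow> ('g \<Rightarrow> complex) \<Rightarrow> (weight \<Rightarrow> nat \<Rightarrow> nat) \<Rightarrow>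
      ('g, 'g free_alg set set set) lie_mod" where
  "V x lam \<xi> = quot_mod (Wloc x lam) (submodule_gen Cg (Wloc x lam) (V_relators x lam \<xi>))"

end

end

theory Submission
  imports Defs "HOL-Computational_Algebra.Formal_Power_Series" "HOL-Library.Function_Algebras"
    "HOL-Library.Product_Plus"
begin

text \<open>Both modules are quotients of the local Weyl module, so it suffices that a submodule \<open>N\<close> contains one
  set of relators if and only if it contains the other, and this is checked for each positive root
  \<open>\<alpha>\<close> separately. Put \<open>F = x\<^bsub>\<alpha> + d\<delta>\<^esub>\<close>, \<open>Y\<^sub>i = x\<^bsub>-\<alpha> + id\<delta>\<^esub>\<close> and \<open>X = 0\<close>, or, for long \<open>\<alpha>\<close>,
  \<open>F = x\<^bsub>(\<alpha> + \<delta>)/2\<^esub>\<close>, \<open>Y\<^sub>i = x\<^bsub>(-\<alpha> + i\<delta>)/2\<^esub>\<close> and \<open>X\<^sub>i = x\<^bsub>-\<alpha> + i\<delta>/2\<^esub>\<close>. Let \<open>P\<^sub>m(z)\<close> be the coefficient of \<open>T\<^sup>m\<close>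
  in \<open>exp (T Y(z) + T\<^sup>2 X(z))\<close> with \<open>Y(z) = \<Sum> Y\<^sub>i z\<^sup>i\<close> and \<open>X(z) = \<Sum> X\<^sub>i z\<^sup>i\<close>. Then
  \<open>F P\<^sub>m = P\<^sub>m F + P\<^bsub>m-1\<^esub> H + P'\<^bsub>m-1\<^esub>\<close>, so that a defining relator of \<open>V(\<xi>)\<close> is, up to a non-zero scalar, a coefficient
  of \<open>P\<^sub>r(z) w\<close> at some \<open>z\<^sup>s\<close>. If \<open>Y\<^sub>i w = 0\<close> for \<open>i > t\<close>, the coefficient of \<open>P\<^sub>m(z) w\<close> at \<open>z\<^bsup>tm\<^esup>\<close> is \<open>Y\<^sub>t\<^sup>m w / m!\<close>, which
  yields the short list of relators. Conversely, these allow a normal form of words in the \<open>Y\<^sub>i\<close>, \<open>X\<^sub>i\<close>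
  whose degree is too small for the relators of \<open>V(\<xi>)\<close>, except for those killed by
  \<open>x\<^bsub>-\<alpha>\<^esub>\<^sup>k w = 0\<close> for \<open>k > \<lambda>(\<alpha>\<^sup>\<or>)\<close>. Root vectors with explicit structure constants are obtained by lifting
  from the vector representation by periodic matrices indexed by the integers: an element of
  non-zero weight of the Kac--Moody algebra that acts by zero lies in an ideal meeting the Cartan
  subalgebra trivially.\<close>

section \<open>Linear operators on finitely supported functions\<close>

text \<open>The Kac-Moody algebra is given by generation and by the absence of ideals, so no
  homomorphism out of it can be defined by prescribing images of generators. In place of the vector
  representation stands the subalgebra generated by the pairs (Chevalley generator, matrix) in the
  product of the algebra with the periodic matrices. What is needed of it is that at a nonzero
  weight the matrix determines the algebra component; structure constants then become matrix
  computations.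

  For a long root the half root brings in a second family. Its indices are counted in steps of
  \<delta>/2, with zeros where there is no root, so that one commutation identity serves both
  families; rescaling by powers of -1/2 and 1/4 produces the constants which that identity demands.

  In the converse direction the reduced relators bound the degree s of a nonzero coefficient of
  \<open>P r\<close>, because the top letters may occur only a limited number of times. The
  inequality that defines a relator is compatible with this bound only in degrees where a power of
  the vector of weight -\<alpha> kills the coefficient anyway.\<close>

definition pscale :: "complex \<Rightarrow> ('b \<Rightarrow>\<^sub>0 complex) \<Rightarrow> ('b \<Rightarrow>\<^sub>0 complex)" where
  "pscale c p = Poly_Mapping.map ((*) c) p"

lemma lookup_pscale [simp]: "Poly_Mapping.lookup (pscale c p) k = c * Poly_Mapping.lookup p k"
  unfolding pscale_def by transfer (simp add: when_def)

interpretation pscale: vector_space pscale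
  by standard (auto intro!: poly_mapping_eqI simp: lookup_add algebra_simps)

text \<open>A type of its own makes the operators an instance of \<open>ring_1\<close>, so that
  power series with operator coefficients can be formed. The index type \<open>'b\<close> is
  \<open>int\<close> for the vector representation and \<open>'g word\<close> for quotients of the
  free algebra.\<close>

typedef 'b lop = "{f :: ('b \<Rightarrow>\<^sub>0 complex) \<Rightarrow> ('b \<Rightarrow>\<^sub>0 complex). Vector_Spaces.linear pscale pscale f}"
  morphisms app Lop
  by (rule exI[of _ "\<lambda>x. x"]) (simp add: pscale.linear_ident)

lemma linear_pscaleI:
  assumes "\<And>x y. f (x + y) = f x + f y" "\<And>c x. f (pscale c x) = pscale c (f x)"
  shows "Vector_Spaces.linear pscale pscale f"
  using assms by unfold_locales auto

lemma app_linear: "Vector_Spaces.linear pscale pscale (app T)"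
  using app[of T] by simp

lemma app_add [simp]: "app T (x + y) = app T x + app T y"
  using app_linear[of T] unfolding linear_iff_module_hom module_hom_def module_hom_axioms_def by blast

lemma app_scale [simp]: "app T (pscale c x) = pscale c (app T x)"
  using app_linear[of T] unfolding linear_iff_module_hom module_hom_def module_hom_axioms_def by blast

lemma app_zero [simp]: "app T 0 = 0"
  using app_add[of T 0 0] by simp

lemma app_Lop: "Vector_Spaces.linear pscale pscale f \<Longrightarrow> app (Lop f) = f"
  by (simp add: Lop_inverse)

lemma lop_eqI: "(\<And>v. app S v = app T v) \<Longrightarrow> S = T"
  using app_inject by blast

instantiation lop :: (type) ring_1
begin

definition "zero_lop = Lop (\<lambda>_. 0)"
definition "one_lop = Lop (\<lambda>v. v)"
definition "plus_lop S T = Lop (\<lambda>v. app S v + app T v)"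
definition "minus_lop S T = Lop (\<lambda>v. app S v - app T v)"
definition "uminus_lop S = Lop (\<lambda>v. - app S v)"
definition "times_lop S T = Lop (\<lambda>v. app S (app T v))"

lemma app_lop [simp]:
  "app 0 v = 0" "app 1 v = v" "app (S + T) v = app S v + app T v"
  "app (S - T) v = app S v - app T v" "app (- S) v = - app S v" "app (S * T) v = app S (app T v)"
  unfolding zero_lop_def one_lop_def plus_lop_def minus_lop_def uminus_lop_def times_lop_def
  by (subst app_Lop; force intro!: linear_pscaleI simp: pscale.scale_right_distrib
      pscale.scale_right_diff_distrib)+

instance
proof
  show "(0 :: 'a lop) \<noteq> 1"
  proof
    assume "(0 :: 'a lop) = 1"
    then have "app (0 :: 'a lop) (Poly_Mapping.single undefined 1) =
        app 1 (Poly_Mapping.single undefined 1)" by simp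
    then show False
      by simp (metis lookup_single_eq lookup_zero zero_neq_one)
  qed
qed (auto intro!: lop_eqI)

end

definition lscale :: "complex \<Rightarrow> 'b lop \<Rightarrow> 'b lop" where
  "lscale c T = Lop (\<lambda>v. pscale c (app T v))"

lemma app_lscale [simp]: "app (lscale c T) v = pscale c (app T v)"
  unfolding lscale_def
  by (subst app_Lop; force intro!: linear_pscaleI simp: pscale.scale_right_distrib mult.commute)

lemma app_lop_sum: "app (sum f A) v = (\<Sum>i\<in>A. app (f i) v)"
  by (induction A rule: infinite_finite_induct) auto

interpretation lscale: vector_space lscale
  by standard (auto intro!: lop_eqI simp: pscale.scale_right_distrib pscale.scale_left_distrib)

lemma lscale_mult_left [simp]: "lscale c S * T = lscale c (S * T)"
  and lscale_mult_right [simp]: "S * lscale c T = lscale c (S * T)"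
  by (auto intro!: lop_eqI)

definition comm :: "'b lop \<Rightarrow> 'b lop \<Rightarrow> 'b lop" where
  "comm S T = S * T - T * S"

lemma lscale_linearI:
  assumes "\<And>x y. f (x + y) = f x + f y" "\<And>c x. f (lscale c x) = lscale c (f x)"
  shows "Vector_Spaces.linear lscale lscale f"
  using assms by unfold_locales auto

interpretation comm: lie_algebra lscale comm
proof (intro lie_algebra.intro lscale.vector_space_axioms lie_algebra_axioms.intro)
  show "Vector_Spaces.linear lscale lscale (comm x)" for x :: "'b lop"
    by (rule lscale_linearI)
       (simp_all add: comm_def algebra_simps lscale.scale_right_diff_distrib)
  show "Vector_Spaces.linear lscale lscale (\<lambda>x. comm x y)" for y :: "'b lop"
    by (rule lscale_linearI)
       (simp_all add: comm_def algebra_simps lscale.scale_right_diff_distrib)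
qed (simp_all add: comm_def algebra_simps)

lemma of_nat_lop: "of_nat k * (T :: 'b lop) = lscale (of_nat k) T"
  by (induction k) (auto simp: lscale.scale_left_distrib algebra_simps)

section \<open>Triangular decompositions\<close>

lemmas weight_apply = plus_fun_apply zero_fun_apply uminus_apply minus_apply

declare weight_apply [simp del]

definition unitw :: "nat \<Rightarrow> real \<Rightarrow> weight" where
  "unitw i c = (\<lambda>j. if j = i then c else 0)"

lemma unitw_apply: "unitw i c j = (if j = i then c else 0)"
  by (simp add: unitw_def)

lemma unitw_same [simp]: "unitw i c i = c"
  by (simp add: unitw_def)

lemma unitw_minus: "unitw i (- c) = - unitw i c"
  by (simp add: unitw_def fun_eq_iff weight_apply)

lemma unitw_eq_0 [simp]: "unitw i c = 0 \<longleftrightarrow> c = 0"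
  by (auto simp: unitw_def fun_eq_iff weight_apply)

context lie_algebra
begin

lemma bracket_add_right: "bracket x (y + z) = bracket x y + bracket x z"
  using bracket_linear_right[of x] unfolding linear_iff_module_hom module_hom_def module_hom_axioms_def
  by blast

lemma bracket_scale_right: "bracket x (scale c y) = scale c (bracket x y)"
  using bracket_linear_right[of x] unfolding linear_iff_module_hom module_hom_def module_hom_axioms_def
  by blast

lemma bracket_add_left: "bracket (x + y) z = bracket x z + bracket y z"
  using bracket_linear_left[of z] unfolding linear_iff_module_hom module_hom_def module_hom_axioms_def
  by blast

lemma bracket_scale_left: "bracket (scale c x) y = scale c (bracket x y)"
  using bracket_linear_left[of y] unfolding linear_iff_module_hom module_hom_def module_hom_axioms_def
  by blast

lemma bracket_zero [simp]: "bracket 0 x = 0" "bracket x 0 = 0"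
  using bracket_add_left[of 0 0 x] bracket_add_right[of x 0 0] by simp_all

lemma bracket_minus_right: "bracket x (- y) = - bracket x y"
  using bracket_add_right[of x y "- y"] by (simp add: eq_neg_iff_add_eq_0 add.commute)

lemma bracket_diff_right: "bracket x (y - z) = bracket x y - bracket x z"
  using bracket_add_right[of x y "- z"] by (simp add: bracket_minus_right)

lemma bracket_anticomm: "bracket x y = - bracket y x"
proof -
  have "bracket (x + y) (x + y) - bracket x x - bracket y y = 0" by (simp only: bracket_self) simp
  then have "bracket x y + bracket y x = 0"
    by (simp add: bracket_add_left bracket_add_right add.commute)
  then show ?thesis by (simp add: eq_neg_iff_add_eq_0)
qed

lemma bracket_bracket_left:
  "bracket (bracket x y) z = bracket x (bracket y z) - bracket y (bracket x z)"
proof -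
  have "bracket x (bracket y z) + bracket y (bracket z x) + bracket z (bracket x y) = 0"
    by (rule jacobi)
  then show ?thesis
    unfolding bracket_anticomm[of z x] bracket_anticomm[of z "bracket x y"]
    by (simp add: bracket_minus_right eq_diff_eq algebra_simps)
qed

text \<open>The weight \<open>\<gamma>\<close> is formal: it is a weight of \<open>z\<close> as soon as every \<open>e i\<close> has weight \<open>\<sigma>\<close> times the
  \<open>i\<close>-th unit vector.\<close>

inductive iter :: "nat \<Rightarrow> (nat \<Rightarrow> 'g) \<Rightarrow> real \<Rightarrow> weight \<Rightarrow> 'g \<Rightarrow> bool" for n e \<sigma> where
  iter_zero: "iter n e \<sigma> \<gamma> 0"
| iter_gen: "i \<le> n \<Longrightarrow> iter n e \<sigma> (unitw i \<sigma>) (e i)"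
| iter_bracket: "i \<le> n \<Longrightarrow> iter n e \<sigma> \<gamma> z \<Longrightarrow> iter n e \<sigma> (\<gamma> + unitw i \<sigma>) (bracket (e i) z)"
| iter_add: "iter n e \<sigma> \<gamma> y \<Longrightarrow> iter n e \<sigma> \<gamma> z \<Longrightarrow> iter n e \<sigma> \<gamma> (y + z)"
| iter_scale: "iter n e \<sigma> \<gamma> z \<Longrightarrow> iter n e \<sigma> \<gamma> (scale c z)"

lemma iter_sign:
  assumes "iter n e \<sigma> \<gamma> z" "\<sigma> * \<sigma> = 1" "z \<noteq> 0"
  shows "(\<forall>i. 0 \<le> \<sigma> * \<gamma> i) \<and> (\<exists>i\<le>n. 1 \<le> \<sigma> * \<gamma> i)"
  using assms
proof (induction rule: iter.induct)
  case (iter_gen i)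
  then show ?case by (auto simp: unitw_apply)
next
  case (iter_bracket i \<gamma> z)
  then have "z \<noteq> 0" by auto
  then have *: "\<forall>i. 0 \<le> \<sigma> * \<gamma> i" "\<exists>i\<le>n. 1 \<le> \<sigma> * \<gamma> i" using iter_bracket by auto
  have w: "\<sigma> * (\<gamma> + unitw i \<sigma>) k = \<sigma> * \<gamma> k + (if k = i then 1 else 0)" for k
    using \<open>\<sigma> * \<sigma> = 1\<close> by (simp add: unitw_apply weight_apply algebra_simps)
  obtain k where k: "k \<le> n" "1 \<le> \<sigma> * \<gamma> k" using * by blast
  have "1 \<le> \<sigma> * (\<gamma> + unitw i \<sigma>) k" unfolding w using k by (auto intro: add_increasing2)
  moreover have "0 \<le> \<sigma> * (\<gamma> + unitw i \<sigma>) k" for k unfolding w using * by (simp add: add_nonneg_nonneg)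
  ultimately show ?case using k(1) by blast
next
  case (iter_add \<gamma> y z)
  then have "y \<noteq> 0 \<or> z \<noteq> 0" by auto
  then show ?case using iter_add by blast
qed auto

lemma iter_weight:
  assumes "iter n e \<sigma> \<gamma> z" "\<And>i. i \<le> n \<Longrightarrow> bracket h (e i) = scale (of_real \<sigma> * b i) (e i)"
  shows "bracket h z = scale (\<Sum>i\<le>n. of_real (\<gamma> i) * b i) z"
  using assms(1)
proof (induction rule: iter.induct)
  case (iter_gen i)
  have "(\<Sum>j\<le>n. of_real ((unitw i \<sigma>) j) * b j) = (\<Sum>j\<le>n. if j = i then of_real \<sigma> * b i else 0)"
    by (rule sum.cong) (auto simp: unitw_apply)
  then have "(\<Sum>j\<le>n. of_real (unitw i \<sigma> j) * b j) = of_real \<sigma> * b i"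
    using iter_gen by simp
  then show ?case using iter_gen assms(2) by simp
next
  case (iter_bracket i \<gamma> z)
  have "(\<Sum>j\<le>n. of_real ((\<gamma> + unitw i \<sigma>) j) * b j) =
      (\<Sum>j\<le>n. of_real (\<gamma> j) * b j) + (\<Sum>j\<le>n. if j = i then of_real \<sigma> * b i else 0)"
    unfolding sum.distrib[symmetric] by (rule sum.cong) (simp_all add: unitw_apply weight_apply algebra_simps)
  also have "\<dots> = (\<Sum>j\<le>n. of_real (\<gamma> j) * b j) + of_real \<sigma> * b i"
    using iter_bracket by simp
  finally have s: "(\<Sum>j\<le>n. of_real ((\<gamma> + unitw i \<sigma>) j) * b j) =
      (\<Sum>j\<le>n. of_real (\<gamma> j) * b j) + of_real \<sigma> * b i" .
  have "bracket h (bracket (e i) z) = bracket (bracket h (e i)) z + bracket (e i) (bracket h z)"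
    by (simp add: bracket_bracket_left)
  also have "\<dots> = scale (of_real \<sigma> * b i) (bracket (e i) z)
      + scale (\<Sum>j\<le>n. of_real (\<gamma> j) * b j) (bracket (e i) z)"
    using iter_bracket assms(2) by (simp add: bracket_scale_left bracket_scale_right)
  finally show ?case unfolding s by (simp add: scale_left_distrib add.commute)
qed (auto simp: bracket_add_right bracket_scale_right scale_right_distrib mult.commute)

text \<open>A bracket with \<open>e j\<close> has this weight only if its inner factor has weight
  \<open>unitw i \<sigma> - unitw j \<sigma>\<close>, which \<open>iter_sign\<close> excludes for a
  nonzero factor.\<close>

lemma iter_generator:
  assumes "iter n e \<sigma> \<gamma> z" "\<gamma> = unitw i \<sigma>" "\<sigma> * \<sigma> = 1"
  shows "\<exists>c. z = scale c (e i)"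
  using assms(1,2)
proof (induction rule: iter.induct)
  case (iter_gen j)
  have "j = i"
  proof (rule ccontr)
    assume "j \<noteq> i"
    then have "\<sigma> = 0" using fun_cong[OF iter_gen(2), of j] by (simp add: unitw_apply)
    then show False using assms(3) by simp
  qed
  then show ?case by (intro exI[of _ 1]) simp
next
  case (iter_bracket j \<gamma> z)
  have "z = 0"
  proof (rule ccontr)
    assume "z \<noteq> 0"
    then have *: "\<forall>i. 0 \<le> \<sigma> * \<gamma> i" "\<exists>i\<le>n. 1 \<le> \<sigma> * \<gamma> i"
      using iter_sign[OF iter_bracket(2) assms(3)] by auto
    have g: "\<gamma> k = unitw i \<sigma> k - unitw j \<sigma> k" for k
      using fun_cong[OF iter_bracket(4), of k] by (simp add: weight_apply algebra_simps)
    show False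
    proof (cases "j = i")
      case True
      then show ?thesis using * by (auto simp: g)
    next
      case False
      then have "\<sigma> * \<gamma> j = - 1" using assms(3) by (simp add: g unitw_apply)
      then show ?thesis using *(1) by (metis neg_0_le_iff_le not_one_le_zero)
    qed
  qed
  then show ?case by (intro exI[of _ 0]) simp
next
  case (iter_add \<gamma> y z)
  then obtain c d where "y = scale c (e i)" "z = scale d (e i)" by auto
  then show ?case by (intro exI[of _ "c + d"]) (simp add: scale_left_distrib)
next
  case (iter_scale \<gamma> z c)
  then obtain d where "z = scale d (e i)" by auto
  then show ?case by (intro exI[of _ "c * d"]) simp
qed (auto intro: exI[of _ 0])

end

text \<open>Collects exactly what sorting brackets into lowering, Cartan and raising parts uses. It
  is instantiated with generators that are pairs of a Lie algebra element and a matrix.\<close>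

locale triangular = lie_algebra scale bracket
  for scale :: "complex \<Rightarrow> 'g::ab_group_add \<Rightarrow> 'g" and bracket +
  fixes n :: nat and H :: "'g set" and a :: "nat \<Rightarrow> 'g \<Rightarrow> complex" and e f :: "nat \<Rightarrow> 'g"
  assumes H_subspace: "subspace H"
    and bracket_H: "h \<in> H \<Longrightarrow> h' \<in> H \<Longrightarrow> bracket h h' = 0"
    and bracket_H_e: "i \<le> n \<Longrightarrow> h \<in> H \<Longrightarrow> bracket h (e i) = scale (a i h) (e i)"
    and bracket_H_f: "i \<le> n \<Longrightarrow> h \<in> H \<Longrightarrow> bracket h (f i) = scale (- a i h) (f i)"
    and bracket_e_f: "i \<le> n \<Longrightarrow> j \<le> n \<Longrightarrow> i \<noteq> j \<Longrightarrow> bracket (e i) (f j) = 0"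
    and bracket_e_f_same: "i \<le> n \<Longrightarrow> bracket (e i) (f i) \<in> H"
begin

text \<open>The symmetry between \<open>e\<close> and \<open>f\<close>: brackets with
  \<open>f i\<close> need no separate argument once those with \<open>e i\<close> are
  understood.\<close>

lemma swapped: "triangular scale bracket n H (\<lambda>i h. - a i h) f e"
proof
  fix i j assume "i \<le> n" "j \<le> n" "i \<noteq> j"
  then show "bracket (f i) (e j) = 0" using bracket_e_f[of j i] bracket_anticomm[of "f i" "e j"] by simp
next
  fix i assume "i \<le> n"
  then have "- bracket (e i) (f i) \<in> H" using bracket_e_f_same subspace_neg[OF H_subspace] by blast
  then show "bracket (f i) (e i) \<in> H" by (simp add: bracket_anticomm[of "f i"])
qed (simp_all add: H_subspace bracket_H bracket_H_e bracket_H_f)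

text \<open>By the Jacobi identity \<open>e i\<close> moves through a word in the
  \<open>f j\<close>. Only words in the \<open>f j\<close> remain, except for the bracket of
  \<open>e i\<close> with \<open>f i\<close> at the very end, which lies in \<open>H\<close> and
  occurs only in total weight 0.\<close>

lemma bracket_e_iter:
  assumes "iter n f (- \<sigma>) \<gamma> z" "i \<le> n" "\<sigma> * \<sigma> = 1"
  shows "\<exists>h q. bracket (e i) z = h + q \<and> h \<in> H \<and> (\<gamma> + unitw i \<sigma> \<noteq> 0 \<longrightarrow> h = 0) \<and>
    iter n f (- \<sigma>) (\<gamma> + unitw i \<sigma>) q"
  using assms(1)
proof (induction rule: iter.induct)
  case (iter_zero \<gamma>)
  show ?case
    by (intro exI[of _ 0]) (simp add: iter.iter_zero subspace_0[OF H_subspace])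
next
  case (iter_gen j)
  show ?case
  proof (cases "i = j")
    case True
    have "unitw i (- \<sigma>) + unitw i \<sigma> = (0 :: weight)" by (simp add: unitw_minus)
    then show ?thesis using True assms(2)
      by (intro exI[of _ "bracket (e i) (f i)"] exI[of _ 0])
         (simp add: iter.iter_zero bracket_e_f_same)
  next
    case False
    then show ?thesis using iter_gen assms(2)
      by (intro exI[of _ 0]) (simp add: iter.iter_zero bracket_e_f subspace_0[OF H_subspace])
  qed
next
  case (iter_bracket j \<gamma> z)
  then obtain h q where hq: "bracket (e i) z = h + q" "h \<in> H" "\<gamma> + unitw i \<sigma> \<noteq> 0 \<Longrightarrow> h = 0"
    "iter n f (- \<sigma>) (\<gamma> + unitw i \<sigma>) q" by auto
  have *: "bracket (e i) (bracket (f j) z) =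
      bracket (bracket (e i) (f j)) z + bracket (f j) h + bracket (f j) q"
    by (simp add: bracket_bracket_left hq bracket_add_right)
  have w: "\<gamma> + unitw j (- \<sigma>) + unitw i \<sigma> = \<gamma> + unitw i \<sigma> + unitw j (- \<sigma>)"
    by (simp add: add_ac)
  have 1: "iter n f (- \<sigma>) (\<gamma> + unitw j (- \<sigma>) + unitw i \<sigma>) (bracket (bracket (e i) (f j)) z)"
  proof (cases "i = j")
    case True
    define h' where "h' = bracket (e i) (f j)"
    have h': "h' \<in> H" using True assms(2) bracket_e_f_same by (simp add: h'_def)
    \<comment> \<open>The extra \<sigma> in the functional turns the factor -\<sigma> that
      \<open>iter_weight\<close> attaches to each generator into -1, since \<sigma>^2 = 1.\<close>
    have "bracket h' z = scale (\<Sum>k\<le>n. of_real (\<gamma> k) * (of_real \<sigma> * a k h')) z"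
    proof (rule iter_weight[OF iter_bracket(2)])
      fix k assume "k \<le> n"
      have "complex_of_real \<sigma> * complex_of_real \<sigma> = 1"
        using assms(3) by (metis of_real_1 of_real_mult)
      then show "bracket h' (f k) = scale (of_real (- \<sigma>) * (of_real \<sigma> * a k h')) (f k)"
        using bracket_H_f[OF \<open>k \<le> n\<close> h'] by (simp flip: mult.assoc)
    qed
    moreover have "\<gamma> + unitw j (- \<sigma>) + unitw i \<sigma> = \<gamma>" using True by (simp add: unitw_minus add.assoc)
    ultimately show ?thesis using iter_bracket(2) by (simp only: iter.iter_scale flip: h'_def)
  next
    case False
    then show ?thesis using bracket_e_f[OF assms(2) iter_bracket(1)] by (simp add: iter.iter_zero)
  qed
  have 2: "iter n f (- \<sigma>) (\<gamma> + unitw j (- \<sigma>) + unitw i \<sigma>) (bracket (f j) h)"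
  proof (cases "\<gamma> + unitw i \<sigma> = 0")
    case True
    have "bracket (f j) h = scale (a j h) (f j)"
      using bracket_H_f[OF iter_bracket(1) hq(2)] bracket_anticomm[of "f j" h] by simp
    then show ?thesis unfolding w True using iter_bracket(1) by (simp add: iter.iter_scale iter.iter_gen)
  next
    case False
    then show ?thesis using hq(3) by (simp add: iter.iter_zero)
  qed
  have 3: "iter n f (- \<sigma>) (\<gamma> + unitw j (- \<sigma>) + unitw i \<sigma>) (bracket (f j) q)"
    unfolding w using hq(4) iter_bracket(1) by (simp add: iter.iter_bracket)
  show ?case unfolding *
    by (intro exI[of _ 0] exI[of _ "bracket (bracket (e i) (f j)) z + bracket (f j) h + bracket (f j) q"])
       (simp add: subspace_0[OF H_subspace] iter.iter_add 1 2 3)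
next
  case (iter_add \<gamma> y z)
  then obtain h q h' q' where
    "bracket (e i) y = h + q" "h \<in> H" "\<gamma> + unitw i \<sigma> \<noteq> 0 \<Longrightarrow> h = 0"
    "iter n f (- \<sigma>) (\<gamma> + unitw i \<sigma>) q"
    "bracket (e i) z = h' + q'" "h' \<in> H" "\<gamma> + unitw i \<sigma> \<noteq> 0 \<Longrightarrow> h' = 0"
    "iter n f (- \<sigma>) (\<gamma> + unitw i \<sigma>) q'" by auto
  then show ?case
    by (intro exI[of _ "h + h'"] exI[of _ "q + q'"])
       (simp add: bracket_add_right subspace_add[OF H_subspace] iter.iter_add)
next
  case (iter_scale \<gamma> z c)
  then obtain h q where
    "bracket (e i) z = h + q" "h \<in> H" "\<gamma> + unitw i \<sigma> \<noteq> 0 \<Longrightarrow> h = 0"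
    "iter n f (- \<sigma>) (\<gamma> + unitw i \<sigma>) q" by auto
  then show ?case
    by (intro exI[of _ "scale c h"] exI[of _ "scale c q"])
       (simp add: bracket_scale_right scale_right_distrib subspace_scale[OF H_subspace] iter.iter_scale)
qed

text \<open>A component of the subalgebra generated by \<open>H\<close>, \<open>e\<close> and
  \<open>f\<close>. The weight is formal, so the decomposition need not be known to be direct: 0 is
  a piece of every weight.\<close>

definition piece :: "weight \<Rightarrow> 'g \<Rightarrow> bool" where
  "piece \<gamma> z \<longleftrightarrow> (\<exists>p h q. z = p + h + q \<and> iter n e 1 \<gamma> p \<and> h \<in> H \<and> (\<gamma> \<noteq> 0 \<longrightarrow> h = 0) \<and>
     iter n f (-1) \<gamma> q)"

lemma piece_pos: "iter n e 1 \<gamma> z \<Longrightarrow> piece \<gamma> z"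
  unfolding piece_def
  by (rule exI[of _ z], rule exI[of _ 0], rule exI[of _ 0])
     (simp add: iter_zero subspace_0[OF H_subspace])

lemma piece_neg: "iter n f (-1) \<gamma> z \<Longrightarrow> piece \<gamma> z"
  unfolding piece_def
  by (rule exI[of _ 0], rule exI[of _ 0], rule exI[of _ z])
     (simp add: iter_zero subspace_0[OF H_subspace])

lemma piece_H: "h \<in> H \<Longrightarrow> piece 0 h"
  unfolding piece_def
  by (rule exI[of _ 0], rule exI[of _ h], rule exI[of _ 0]) (simp add: iter_zero)

lemma piece_0: "piece \<gamma> 0"
  by (rule piece_pos) (rule iter_zero)

lemma piece_e: "i \<le> n \<Longrightarrow> piece (unitw i 1) (e i)"
  by (simp add: piece_pos iter_gen)

lemma piece_f: "i \<le> n \<Longrightarrow> piece (unitw i (-1)) (f i)"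
  by (simp add: piece_neg iter_gen)

lemma piece_add: "piece \<gamma> y \<Longrightarrow> piece \<gamma> z \<Longrightarrow> piece \<gamma> (y + z)"
proof -
  assume "piece \<gamma> y" "piece \<gamma> z"
  then obtain p h q p' h' q' where
    "y = p + h + q" "iter n e 1 \<gamma> p" "h \<in> H" "\<gamma> \<noteq> 0 \<longrightarrow> h = 0" "iter n f (-1) \<gamma> q"
    "z = p' + h' + q'" "iter n e 1 \<gamma> p'" "h' \<in> H" "\<gamma> \<noteq> 0 \<longrightarrow> h' = 0" "iter n f (-1) \<gamma> q'"
    unfolding piece_def by blast
  then show ?thesis unfolding piece_def
    by (intro exI[of _ "p + p'"] exI[of _ "h + h'"] exI[of _ "q + q'"])
       (simp add: iter_add subspace_add[OF H_subspace] algebra_simps)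
qed

lemma piece_scale: "piece \<gamma> z \<Longrightarrow> piece \<gamma> (scale c z)"
proof -
  assume "piece \<gamma> z"
  then obtain p h q where
    "z = p + h + q" "iter n e 1 \<gamma> p" "h \<in> H" "\<gamma> \<noteq> 0 \<longrightarrow> h = 0" "iter n f (-1) \<gamma> q"
    unfolding piece_def by blast
  then show ?thesis unfolding piece_def
    by (intro exI[of _ "scale c p"] exI[of _ "scale c h"] exI[of _ "scale c q"])
       (simp add: iter_scale subspace_scale[OF H_subspace] scale_right_distrib)
qed

lemma piece_minus: "piece \<gamma> z \<Longrightarrow> piece \<gamma> (- z)"
  using piece_scale[of \<gamma> z "- 1"] by simp

lemma piece_diff: "piece \<gamma> y \<Longrightarrow> piece \<gamma> z \<Longrightarrow> piece \<gamma> (y - z)"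
  using piece_add[of \<gamma> y "- z"] piece_minus[of \<gamma> z] by simp

lemma piece_bracket_e: "piece \<gamma> z \<Longrightarrow> i \<le> n \<Longrightarrow> piece (\<gamma> + unitw i 1) (bracket (e i) z)"
proof -
  assume "piece \<gamma> z" and i: "i \<le> n"
  then obtain p h q where *:
    "z = p + h + q" "iter n e 1 \<gamma> p" "h \<in> H" "\<gamma> \<noteq> 0 \<longrightarrow> h = 0" "iter n f (-1) \<gamma> q"
    unfolding piece_def by blast
  have "piece (\<gamma> + unitw i 1) (bracket (e i) p)"
    using * i by (simp add: piece_pos iter_bracket)
  moreover have "piece (\<gamma> + unitw i 1) (bracket (e i) h)"
  proof (cases "\<gamma> = 0")
    case True
    then show ?thesis
      using bracket_H_e[OF i *(3)] bracket_anticomm[of "e i" h] i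
      by (simp add: piece_minus piece_scale piece_e)
  qed (use * in \<open>simp add: piece_0\<close>)
  moreover have "piece (\<gamma> + unitw i 1) (bracket (e i) q)"
  proof -
    obtain h' q' where "bracket (e i) q = h' + q'" "h' \<in> H" "\<gamma> + unitw i 1 \<noteq> 0 \<longrightarrow> h' = 0"
      "iter n f (-1) (\<gamma> + unitw i 1) q'"
      using bracket_e_iter[OF *(5) i] by auto
    then show ?thesis unfolding piece_def
      by (intro exI[of _ 0] exI[of _ h'] exI[of _ q']) (auto simp: iter_zero)
  qed
  ultimately show ?thesis unfolding *(1) by (simp add: bracket_add_right piece_add)
qed

text \<open>Exchanging the generators negates formal weights, because \<open>iter\<close> with sign
  -\<sigma> at -\<gamma> is \<open>iter\<close> with sign \<sigma> at \<gamma>.\<close>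

lemma swapped_piece: "triangular.piece scale bracket n H f e \<gamma> z \<longleftrightarrow> piece (- \<gamma>) z"
proof -
  interpret sw: triangular scale bracket n H "\<lambda>i h. - a i h" f e by (rule swapped)
  have flip: "iter n g \<sigma> \<gamma> z \<Longrightarrow> iter n g (- \<sigma>) (- \<gamma>) z" for g \<sigma> \<gamma> z
  proof (induction rule: iter.induct)
    case (iter_gen i)
    show ?case using iter.iter_gen[OF iter_gen, of g "- \<sigma>"] by (simp add: unitw_minus)
  next
    case (iter_bracket i \<gamma> z)
    show ?case using iter.iter_bracket[OF iter_bracket(1,3)] by (simp add: unitw_minus)
  qed (simp_all add: iter.iter_zero iter.iter_add iter.iter_scale)
  have "iter n g 1 \<gamma> z \<longleftrightarrow> iter n g (-1) (- \<gamma>) z" for g z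
    using flip[of g 1 \<gamma> z] flip[of g "-1" "-\<gamma>" z] by auto
  moreover have "iter n g (-1) \<gamma> z \<longleftrightarrow> iter n g 1 (- \<gamma>) z" for g z
    using flip[of g "-1" \<gamma> z] flip[of g 1 "-\<gamma>" z] by auto
  ultimately have eq: "triangular.piece scale bracket n H f e \<gamma> z \<longleftrightarrow>
      (\<exists>p h q. z = p + h + q \<and> iter n f (-1) (- \<gamma>) p \<and> h \<in> H \<and> (\<gamma> \<noteq> 0 \<longrightarrow> h = 0) \<and> iter n e 1 (- \<gamma>) q)"
    unfolding sw.piece_def by simp
  have "p + h + q = q + h + p" for p h q :: 'g by (simp add: add_ac)
  then show ?thesis unfolding eq piece_def neg_equal_0_iff_equal by (intro iffI; elim exE conjE; metis)
qed

lemma piece_bracket_f: "piece \<gamma> z \<Longrightarrow> i \<le> n \<Longrightarrow> piece (\<gamma> + unitw i (-1)) (bracket (f i) z)"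
proof -
  interpret sw: triangular scale bracket n H "\<lambda>i h. - a i h" f e by (rule swapped)
  assume *: "piece \<gamma> z" "i \<le> n"
  show ?thesis
    using sw.piece_bracket_e[of "- \<gamma>" z i] * by (simp add: swapped_piece unitw_minus)
qed

text \<open>Induction on the word: the Jacobi identity trades the bracket with an iterated bracket
  for successive brackets with its letters.\<close>

lemma piece_bracket_iter_e:
  assumes "iter n e 1 \<gamma> y" "piece \<delta> z"
  shows "piece (\<gamma> + \<delta>) (bracket y z)"
  using assms
proof (induction arbitrary: \<delta> z rule: iter.induct)
  case (iter_gen i)
  then show ?case using piece_bracket_e[of \<delta> z i] by (simp add: add.commute)
next
  case (iter_bracket i \<gamma> y)
  have "piece (\<gamma> + unitw i 1 + \<delta>) (bracket (e i) (bracket y z))"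
    using piece_bracket_e[OF iter_bracket.IH[OF iter_bracket.prems] iter_bracket.hyps(1)]
    by (simp add: add_ac)
  moreover have "piece (\<gamma> + unitw i 1 + \<delta>) (bracket y (bracket (e i) z))"
    using iter_bracket.IH[OF piece_bracket_e[OF iter_bracket.prems iter_bracket.hyps(1)]]
    by (simp add: add_ac)
  ultimately show ?case by (simp add: bracket_bracket_left piece_diff)
qed (auto simp: bracket_add_left bracket_scale_left piece_0 piece_add piece_scale)

lemma piece_bracket_iter_f:
  assumes "iter n f (-1) \<gamma> y" "piece \<delta> z"
  shows "piece (\<gamma> + \<delta>) (bracket y z)"
  using assms
proof (induction arbitrary: \<delta> z rule: iter.induct)
  case (iter_gen i)
  then show ?case using piece_bracket_f[of \<delta> z i] by (simp add: add.commute)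
next
  case (iter_bracket i \<gamma> y)
  have "piece (\<gamma> + unitw i (-1) + \<delta>) (bracket (f i) (bracket y z))"
    using piece_bracket_f[OF iter_bracket.IH[OF iter_bracket.prems] iter_bracket.hyps(1)]
    by (simp add: add_ac)
  moreover have "piece (\<gamma> + unitw i (-1) + \<delta>) (bracket y (bracket (f i) z))"
    using iter_bracket.IH[OF piece_bracket_f[OF iter_bracket.prems iter_bracket.hyps(1)]]
    by (simp add: add_ac)
  ultimately show ?case by (simp add: bracket_bracket_left piece_diff)
qed (auto simp: bracket_add_left bracket_scale_left piece_0 piece_add piece_scale)

lemma piece_weight:
  assumes "piece \<gamma> z" "h \<in> H"
  shows "bracket h z = scale (\<Sum>i\<le>n. of_real (\<gamma> i) * a i h) z"
proof -
  obtain p h' q where *: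
    "z = p + h' + q" "iter n e 1 \<gamma> p" "h' \<in> H" "\<gamma> \<noteq> 0 \<longrightarrow> h' = 0" "iter n f (-1) \<gamma> q"
    using assms(1) unfolding piece_def by blast
  have "bracket h p = scale (\<Sum>i\<le>n. of_real (\<gamma> i) * a i h) p"
    by (rule iter_weight[OF *(2)]) (simp add: bracket_H_e assms(2))
  moreover have "bracket h q = scale (\<Sum>i\<le>n. of_real (\<gamma> i) * a i h) q"
    by (rule iter_weight[OF *(5)]) (simp add: bracket_H_f assms(2))
  moreover have "bracket h h' = scale (\<Sum>i\<le>n. of_real (\<gamma> i) * a i h) h'"
    using bracket_H[OF assms(2) *(3)] *(4) by (cases "\<gamma> = 0") (auto simp: weight_apply)
  ultimately show ?thesis unfolding *(1) by (simp add: bracket_add_right scale_right_distrib)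
qed

lemma piece_bracket:
  assumes "piece \<gamma> y" "piece \<delta> z"
  shows "piece (\<gamma> + \<delta>) (bracket y z)"
proof -
  obtain p h q where *:
    "y = p + h + q" "iter n e 1 \<gamma> p" "h \<in> H" "\<gamma> \<noteq> 0 \<longrightarrow> h = 0" "iter n f (-1) \<gamma> q"
    using assms(1) unfolding piece_def by blast
  have "piece (\<gamma> + \<delta>) (bracket h z)"
    using piece_weight[OF assms(2) *(3)] *(4) assms(2)
    by (cases "\<gamma> = 0") (auto simp: piece_scale piece_0)
  then show ?thesis unfolding *(1) bracket_add_left
    by (intro piece_add piece_bracket_iter_e[OF *(2) assms(2)] piece_bracket_iter_f[OF *(5) assms(2)])
qed

text \<open>The raising part would have a weight in the positive cone, and at a simple weight the
  lowering part is a multiple of the generator. This rigidity later makes the null ideal stable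
  under \<open>e i\<close>.\<close>

lemma piece_minus_simple:
  assumes "piece (unitw i (-1)) z" "i \<le> n"
  shows "\<exists>c. z = scale c (f i)"
proof -
  obtain p h q where *:
    "z = p + h + q" "iter n e 1 (unitw i (-1)) p" "unitw i (-1) \<noteq> (0 :: weight) \<longrightarrow> h = 0"
    "iter n f (-1) (unitw i (-1)) q"
    using assms(1) unfolding piece_def by blast
  have "h = 0" using * by simp
  moreover have "p = 0"
  proof (rule ccontr)
    assume "p \<noteq> 0"
    then have "0 \<le> unitw i (-1) i" using iter_sign[OF *(2)] by (simp del: unitw_same)
    then show False by simp
  qed
  ultimately show ?thesis using iter_generator[OF *(4), of i] *(1) by simp
qed

lemma piece_simple:
  assumes "piece (unitw i 1) z" "i \<le> n"
  shows "\<exists>c. z = scale c (e i)"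
proof -
  obtain p h q where *:
    "z = p + h + q" "iter n e 1 (unitw i 1) p" "unitw i 1 \<noteq> (0 :: weight) \<longrightarrow> h = 0"
    "iter n f (-1) (unitw i 1) q"
    using assms(1) unfolding piece_def by blast
  have "h = 0" using * by simp
  moreover have "q = 0"
  proof (rule ccontr)
    assume "q \<noteq> 0"
    then have "0 \<le> -1 * unitw i 1 i" using iter_sign[OF *(4)] by (simp del: unitw_same)
    then show False by simp
  qed
  ultimately show ?thesis using iter_generator[OF *(2), of i] *(1) by simp
qed

end

section \<open>Exponentials in a Heisenberg-type algebra\<close>

text \<open>\<open>P m\<close> is the coefficient of \<open>T\<^sup>m\<close> in \<open>exp (T Y + T\<^sup>2 X)\<close>; it is determined by the recursion
  expressing that the logarithmic derivative in \<open>T\<close> is \<open>Y + 2 T X\<close>. \<open>d\<close> is the derivation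
  with respect to the formal variable.\<close>

locale heisenberg_exp =
  fixes P :: "nat \<Rightarrow> 'a::ring_1" and Y X F H :: 'a and d :: "'a \<Rightarrow> 'a"
  assumes P_0: "P 0 = 1"
    and P_1: "P (Suc 0) = Y"
    and P_Suc_Suc: "of_nat (Suc (Suc m)) * P (Suc (Suc m)) = Y * P (Suc m) + 2 * (X * P m)"
    and torsion_free: "of_nat (Suc m) * a = (0 :: 'a) \<Longrightarrow> a = 0"
    and d_add: "d (a + b) = d a + d b"
    and d_mult: "d (a * b) = a * d b + d a * b"
    and dX_Y: "d X * Y = Y * d X"
    and dX_X: "d X * X = X * d X"
    and dY_X: "d Y * X = X * d Y"
    and FX_X: "(F * X - X * F) * X = X * (F * X - X * F)"
    and FY: "F * Y = Y * F + H"
    and HY: "H * Y = Y * H + 2 * (d Y - (F * X - X * F))"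
    and HX: "H * X = X * H + d X"
    and dY_Y: "d Y * Y = Y * d Y - 2 * d X"
    and FX_Y: "(F * X - X * F) * Y = Y * (F * X - X * F) + d X"
begin

text \<open>Shifted coefficients with value 0 before the start, so that one recursion covers every
  index.\<close>

definition p :: "nat \<Rightarrow> nat \<Rightarrow> 'a" where
  "p j m = (if j \<le> m then P (m - j) else 0)"

lemma p_0 [simp]: "p 0 m = P m"
  by (simp add: p_def)

lemma p_Suc [simp]: "p (Suc j) (Suc m) = p j m" "p (Suc j) 0 = 0"
  by (simp_all add: p_def)

lemma P_rec: "of_nat m * P m = Y * p (Suc 0) m + 2 * (X * p (Suc (Suc 0)) m)"
proof (cases m)
  case (Suc k)
  then show ?thesis using P_Suc_Suc[of "k - 1"] by (cases k) (simp_all add: P_0 P_1)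
qed simp

lemma d_1: "d 1 = 0"
  using d_mult[of 1 1] by simp

lemma d_0: "d 0 = 0"
  using d_add[of 0 0] by simp

lemma d_of_nat_mult: "d (of_nat k * a) = of_nat k * d a"
  by (induction k) (simp_all add: d_0 d_add algebra_simps)

lemma cancel: "of_nat (Suc k) * a = of_nat (Suc k) * b \<Longrightarrow> a = (b :: 'a)"
  using torsion_free[of k "a - b"] by (simp only: right_diff_distrib) simp

text \<open>Fits the two-term recursion; the guard leaves the shifted coefficient at 0 to its
  default value.\<close>

lemma P_induct [case_names 0 Suc]:
  assumes "Q 0" "\<And>k. Q k \<Longrightarrow> (0 < k \<Longrightarrow> Q (k - 1)) \<Longrightarrow> Q (Suc k)"
  shows "Q m"
proof (induction m rule: less_induct)
  case (less m)
  then show ?case using assms by (cases m) auto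
qed

lemma P_Suc_mult:
  "a * (of_nat (Suc k) * P (Suc k)) = a * (Y * P k) + 2 * (a * (X * p (Suc 0) k))"
proof -
  have "of_nat (Suc k) * P (Suc k) = Y * P k + 2 * (X * p (Suc 0) k)"
    using P_rec[of "Suc k"] by simp
  then show ?thesis by (simp add: distrib_left mult_2 mult_2_right)
qed

lemma of_nat_left_commute: "a * (of_nat k * b) = of_nat k * (a * (b :: 'a))"
  by (metis mult.assoc mult_of_nat_commute)

lemmas expand = distrib_left distrib_right left_diff_distrib right_diff_distrib mult.assoc
  mult_2 mult_2_right

lemma P_rec_left: "Y * p (Suc 0) m + 2 * (X * p (Suc (Suc 0)) m) = of_nat m * P m"
  "Y * P k + 2 * (X * p (Suc 0) k) = of_nat (Suc k) * P (Suc k)"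
  using P_rec[of m] P_rec[of "Suc k"] by simp_all

text \<open>In terms of E = exp (T Y + T^2 X): if [A, Y] = B and the other commutators vanish, then
  A E = E (A + T B).\<close>

lemma P_commute1:
  assumes AY: "A * Y = Y * A + B" and AX: "A * X = X * A" and BY: "B * Y = Y * B" and BX: "B * X = X * B"
  shows "A * P m = P m * A + p (Suc 0) m * B"
proof -
  have B: "B * P m = P m * B" for m
  proof (induction m rule: P_induct)
    case 0
    then show ?case by (simp add: P_0)
  next
    case (Suc k)
    have p1: "B * p (Suc 0) k = p (Suc 0) k * B"
      using Suc by (cases k) simp_all
    have "of_nat (Suc k) * (B * P (Suc k)) = B * (Y * P k) + 2 * (B * (X * p (Suc 0) k))"
      by (simp only: of_nat_left_commute[symmetric] P_Suc_mult)
    also have "\<dots> = (Y * P k + 2 * (X * p (Suc 0) k)) * B"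
      by (simp add: mult.assoc[symmetric] BY BX) (simp add: Suc p1 expand)
    also have "\<dots> = of_nat (Suc k) * (P (Suc k) * B)"
      by (simp only: P_rec_left mult.assoc)
    finally show ?case by (rule cancel)
  qed
  show ?thesis
  proof (induction m rule: P_induct)
    case 0
    then show ?case by (simp add: P_0)
  next
    case (Suc k)
    have p1: "A * p (Suc 0) k = p (Suc 0) k * A + p (Suc (Suc 0)) k * B"
      using Suc by (cases k) simp_all
    have "of_nat (Suc k) * (A * P (Suc k)) = A * (Y * P k) + 2 * (A * (X * p (Suc 0) k))"
      by (simp only: of_nat_left_commute[symmetric] P_Suc_mult)
    also have "\<dots> = (Y * A + B) * P k + 2 * (X * A * p (Suc 0) k)"
      by (simp add: mult.assoc[symmetric] AY AX)
    also have "\<dots> = (Y * P k + 2 * (X * p (Suc 0) k)) * A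
        + (P k + (Y * p (Suc 0) k + 2 * (X * p (Suc (Suc 0)) k))) * B"
      by (simp add: mult.assoc distrib_right Suc p1 B distrib_left mult_2 mult_2_right add_ac)
    also have "\<dots> = of_nat (Suc k) * (P (Suc k) * A) + (P k + of_nat k * P k) * B"
      by (simp only: P_rec_left mult.assoc)
    also have "\<dots> = of_nat (Suc k) * (P (Suc k) * A + P k * B)"
      by (simp add: expand add_ac)
    finally have "A * P (Suc k) = P (Suc k) * A + P k * B" by (rule cancel)
    then show ?case by simp
  qed
qed

text \<open>The inductive step of \<open>H_P\<close> with free variables for the coefficients.
  Collecting by the rightmost factor exposes three instances of the recursion.\<close>

lemma H_identity:
  "Y * (pk * h + 2 * (p1 * u) - 2 * (p2 * v)) + 2 * (pk * u - (p1 * v + p1 * v + p1 * v))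
     + 2 * (X * (p1 * h + 2 * (p2 * u) - 2 * (p3 * v))) + 2 * (p1 * v)
   = (Y * pk + 2 * (X * p1)) * h + 2 * ((pk + (Y * p1 + 2 * (X * p2))) * u)
     - 2 * ((2 * p1 + (Y * p2 + 2 * (X * p3))) * v)"
  by (simp add: expand algebra_simps)

lemma F_identity:
  "Y * (pk * f + p1 * h + p2 * v) + (pk * h + 2 * (p1 * (v - z)) - 2 * (p2 * w))
     + 2 * (X * (p1 * f + p2 * h + p3 * v)) + 2 * (p1 * z + p2 * w)
   = (Y * pk + 2 * (X * p1)) * f + (pk + (Y * p1 + 2 * (X * p2))) * h
     + (2 * p1 + (Y * p2 + 2 * (X * p3))) * v"
  by (simp add: expand algebra_simps)

abbreviation "Z \<equiv> F * X - X * F"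

lemma Z_P: "Z * P m = P m * Z + p (Suc 0) m * d X"
  by (rule P_commute1[OF FX_Y FX_X dX_Y dX_X])

lemma dY_P: "d Y * P m = P m * d Y - 2 * (p (Suc 0) m * d X)"
proof -
  have "d Y * P m = P m * d Y + p (Suc 0) m * (- (2 * d X))"
    by (rule P_commute1) (simp_all add: dY_Y dY_X dX_Y dX_X expand)
  then show ?thesis by (simp add: expand)
qed

lemma dX_P: "d X * P m = P m * d X"
  using P_commute1[of "d X" 0 m] by (simp add: dX_Y dX_X)

text \<open>E^-1 d(E) = T dY + T^2 dX + (T^2/2) [dY, Y], and [dY, Y] = - 2 dX, so the terms with dX
  cancel.\<close>

lemma d_P: "d (P m) = p (Suc 0) m * d Y"
proof (induction m rule: P_induct)
  case 0
  then show ?case by (simp add: P_0 d_1)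
next
  case (Suc k)
  have p1: "d (p (Suc 0) k) = p (Suc (Suc 0)) k * d Y"
    using Suc by (cases k) (simp_all add: d_0)
  have c: "d X * p (Suc 0) k = p (Suc 0) k * d X"
    by (cases k) (simp_all add: dX_P)
  have "of_nat (Suc k) * d (P (Suc k)) = d (Y * P k + 2 * (X * p (Suc 0) k))"
    using P_rec[of "Suc k"] by (simp only: d_of_nat_mult[symmetric]) simp
  also have "\<dots> = Y * (p (Suc 0) k * d Y) + d Y * P k + 2 * (X * (p (Suc (Suc 0)) k * d Y))
      + 2 * (d X * p (Suc 0) k)"
    by (simp add: d_add d_mult Suc p1 mult_2 add_ac)
  also have "\<dots> = P k * d Y + (Y * p (Suc 0) k + 2 * (X * p (Suc (Suc 0)) k)) * d Y"
    by (simp add: dY_P c expand add_ac)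
  also have "\<dots> = of_nat (Suc k) * (P k * d Y)"
    unfolding P_rec_left by (simp add: expand)
  finally have "d (P (Suc k)) = P k * d Y" by (rule cancel)
  then show ?case by simp
qed

text \<open>In terms of E this is H E = E (H + 2 T (dY - Z) - 2 T^2 dX): the order T^2 consists of
  [H, X] = dX and of half of [[H, Y], Y] = - 6 dX.\<close>

lemma H_P:
  "H * P m = P m * H + 2 * (p (Suc 0) m * (d Y - Z)) - 2 * (p (Suc (Suc 0)) m * d X)"
proof (induction m rule: P_induct)
  case 0
  then show ?case by (simp add: P_0)
next
  case (Suc k)
  let ?p1 = "p (Suc 0) k" and ?p2 = "p (Suc (Suc 0)) k" and ?p3 = "p (Suc (Suc (Suc 0))) k"
  have p1: "H * ?p1 = ?p1 * H + 2 * (?p2 * (d Y - Z)) - 2 * (?p3 * d X)"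
    using Suc by (cases k) simp_all
  \<comment> \<open>The recursion at index k - 1; for k = 0 both sides are 0.\<close>
  have r: "of_nat k * ?p1 - ?p1 = Y * ?p2 + 2 * (X * ?p3)"
    using P_rec[of "k - 1"] by (cases k) (simp_all add: algebra_simps)
  have "of_nat (Suc k) * (H * P (Suc k)) = H * Y * P k + 2 * (H * X * ?p1)"
    by (simp only: of_nat_left_commute[symmetric] P_Suc_mult mult.assoc)
  also have "\<dots> = Y * (H * P k) + 2 * ((d Y - Z) * P k) + 2 * (X * (H * ?p1)) + 2 * (d X * ?p1)"
    by (simp only: HY HX distrib_right distrib_left mult.assoc add_ac)
  also have "(d Y - Z) * P k = P k * (d Y - Z) - (?p1 * d X + ?p1 * d X + ?p1 * d X)"
    unfolding left_diff_distrib[of "d Y" Z] dY_P Z_P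
    by (simp add: right_diff_distrib mult_2 diff_diff_eq add_ac)
  also have "d X * ?p1 = ?p1 * d X"
    by (cases k) (simp_all add: dX_P)
  also have "Y * (H * P k) + 2 * (P k * (d Y - Z) - (?p1 * d X + ?p1 * d X + ?p1 * d X)) + 2 * (X * (H * ?p1)) + 2 * (?p1 * d X)
     = (Y * P k + 2 * (X * ?p1)) * H + 2 * ((P k + (Y * ?p1 + 2 * (X * ?p2))) * (d Y - Z))
       - 2 * ((2 * ?p1 + (Y * ?p2 + 2 * (X * ?p3))) * d X)"
    unfolding Suc.IH(1) p1
    by (rule H_identity)
  also have "\<dots> = of_nat (Suc k) * P (Suc k) * H + 2 * (of_nat (Suc k) * P k * (d Y - Z))
       - 2 * (of_nat (Suc k) * ?p1 * d X)"
    unfolding r[symmetric] P_rec_left by (simp add: expand)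
  also have "\<dots> = of_nat (Suc k) * (P (Suc k) * H + 2 * (P k * (d Y - Z)) - 2 * (?p1 * d X))"
    by (simp only: right_diff_distrib distrib_left mult_2 mult.assoc)
  finally have "H * P (Suc k) = P (Suc k) * H + 2 * (P k * (d Y - Z)) - 2 * (?p1 * d X)"
    by (rule cancel)
  then show ?case by simp
qed

text \<open>In terms of E this is F E = E (F + T H + T^2 dY). In the expansion of E^-1 F E by
  iterated commutators, the Z from [F, X] cancels against the one in half of [[F, Y], Y], and the dX
  of order T^3 cancel as well. By \<open>d_P\<close> the last term is T d(E).\<close>

theorem F_P: "F * P (Suc m) = P (Suc m) * F + P m * H + d (P m)"
proof -
  have "F * P m = P m * F + p (Suc 0) m * H + p (Suc (Suc 0)) m * d Y" for m
  proof (induction m rule: P_induct)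
    case 0
    then show ?case by (simp add: P_0)
  next
    case (Suc k)
    let ?p1 = "p (Suc 0) k" and ?p2 = "p (Suc (Suc 0)) k" and ?p3 = "p (Suc (Suc (Suc 0))) k"
    have p1: "F * ?p1 = ?p1 * F + ?p2 * H + ?p3 * d Y"
      using Suc by (cases k) simp_all
    define z where "z = Z"
    have z1: "z * ?p1 = ?p1 * z + ?p2 * d X"
      unfolding z_def by (cases k) (simp_all add: Z_P)
    have r: "of_nat k * ?p1 - ?p1 = Y * ?p2 + 2 * (X * ?p3)"
      using P_rec[of "k - 1"] by (cases k) (simp_all add: algebra_simps)
    have fx: "F * X = X * F + z" by (simp add: z_def)
    have "of_nat (Suc k) * (F * P (Suc k)) = F * Y * P k + 2 * (F * X * ?p1)"
      by (simp only: of_nat_left_commute[symmetric] P_Suc_mult mult.assoc)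
    also have "\<dots> = Y * (F * P k) + H * P k + 2 * (X * (F * ?p1)) + 2 * (z * ?p1)"
      by (simp only: FY fx distrib_right distrib_left mult.assoc add_ac)
    also have "\<dots> = (Y * P k + 2 * (X * ?p1)) * F + (P k + (Y * ?p1 + 2 * (X * ?p2))) * H
        + (2 * ?p1 + (Y * ?p2 + 2 * (X * ?p3))) * d Y"
      unfolding Suc.IH(1) p1 z1 H_P z_def[symmetric] by (rule F_identity)
    also have "\<dots> = of_nat (Suc k) * P (Suc k) * F + of_nat (Suc k) * P k * H + of_nat (Suc k) * ?p1 * d Y"
      unfolding r[symmetric] P_rec_left by (simp add: expand)
    also have "\<dots> = of_nat (Suc k) * (P (Suc k) * F + P k * H + ?p1 * d Y)"
      by (simp only: distrib_left mult.assoc)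
    finally have "F * P (Suc k) = P (Suc k) * F + P k * H + ?p1 * d Y" by (rule cancel)
    then show ?case by simp
  qed
  from this[of "Suc m"] show ?thesis by (simp add: d_P)
qed

end

section \<open>Periodic elementary matrices\<close>

abbreviation per :: "nat \<Rightarrow> int" where
  "per n \<equiv> 2 * int n + 1"

lemma per_dvd_iff: "- per n < x \<Longrightarrow> x < per n \<Longrightarrow> per n dvd x \<longleftrightarrow> x = 0"
  by (metis abs_of_nonneg abs_of_neg dvd_0_right linorder_not_less minus_less_iff not_less zdvd_not_zless
      abs_ge_zero dvd_abs_iff order_le_less zero_less_abs_iff)

lemma Lop_pointwise:
  fixes f :: "('b \<Rightarrow> complex) \<Rightarrow> 'b \<Rightarrow> complex"
  assumes fin: "\<And>v. finite {m. f (Poly_Mapping.lookup v) m \<noteq> 0}"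
    and add: "\<And>v w m. f (\<lambda>k. v k + w k) m = f v m + f w m"
    and scale: "\<And>c v m. f (\<lambda>k. c * v k) m = c * f v m"
  shows "Poly_Mapping.lookup (app (Lop (\<lambda>v. Abs_poly_mapping (f (Poly_Mapping.lookup v)))) v) m =
    f (Poly_Mapping.lookup v) m"
proof -
  have l: "Poly_Mapping.lookup (Abs_poly_mapping (f (Poly_Mapping.lookup v))) =
      f (Poly_Mapping.lookup v)" for v
    using fin by simp
  have "Vector_Spaces.linear pscale pscale (\<lambda>v. Abs_poly_mapping (f (Poly_Mapping.lookup v)))"
  proof (rule linear_pscaleI; rule poly_mapping_eqI)
    fix x y :: "'b \<Rightarrow>\<^sub>0 complex" and k
    have "Poly_Mapping.lookup (x + y) = (\<lambda>k. Poly_Mapping.lookup x k + Poly_Mapping.lookup y k)"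
      by (simp add: fun_eq_iff lookup_add)
    then show "Poly_Mapping.lookup (Abs_poly_mapping (f (Poly_Mapping.lookup (x + y)))) k =
      Poly_Mapping.lookup (Abs_poly_mapping (f (Poly_Mapping.lookup x)) +
        Abs_poly_mapping (f (Poly_Mapping.lookup y))) k"
      unfolding l lookup_add by (simp add: add)
  next
    fix c and x :: "'b \<Rightarrow>\<^sub>0 complex" and k
    have "Poly_Mapping.lookup (pscale c x) = (\<lambda>k. c * Poly_Mapping.lookup x k)"
      by (simp add: fun_eq_iff)
    then show "Poly_Mapping.lookup (Abs_poly_mapping (f (Poly_Mapping.lookup (pscale c x)))) k =
      Poly_Mapping.lookup (pscale c (Abs_poly_mapping (f (Poly_Mapping.lookup x)))) k"
      unfolding l lookup_pscale by (simp add: scale)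
  qed
  then show ?thesis by (simp add: app_Lop l)
qed

text \<open>The sum over \<open>k\<close> of the elementary matrices with entry at \<open>(a + k N, b + k N)\<close>, where
  \<open>N = 2 n + 1\<close>.\<close>

definition pm :: "nat \<Rightarrow> int \<Rightarrow> int \<Rightarrow> int lop" where
  "pm n a b = Lop (\<lambda>v. Abs_poly_mapping
     ((\<lambda>u m. if per n dvd m - a then u (m - a + b) else 0) (Poly_Mapping.lookup v)))"

definition diag :: "(int \<Rightarrow> complex) \<Rightarrow> int lop" where
  "diag \<theta> = Lop (\<lambda>v. Abs_poly_mapping ((\<lambda>u m. \<theta> m * u m) (Poly_Mapping.lookup v)))"

lemma lookup_pm [simp]:
  "Poly_Mapping.lookup (app (pm n a b) v) m =
    (if per n dvd m - a then Poly_Mapping.lookup v (m - a + b) else 0)"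
  unfolding pm_def
proof (subst Lop_pointwise)
  fix v :: "int \<Rightarrow>\<^sub>0 complex"
  have "{m. (if per n dvd m - a then Poly_Mapping.lookup v (m - a + b) else 0) \<noteq> 0}
      \<subseteq> (\<lambda>k. k + a - b) ` {k. Poly_Mapping.lookup v k \<noteq> 0}"
    by (force simp: image_iff split: if_splits intro: exI[of _ "x - a + b" for x])
  then show "finite {m. (if per n dvd m - a then Poly_Mapping.lookup v (m - a + b) else 0) \<noteq> 0}"
    by (rule finite_subset) simp
qed auto

lemma lookup_diag [simp]:
  "Poly_Mapping.lookup (app (diag \<theta>) v) m = \<theta> m * Poly_Mapping.lookup v m"
  unfolding diag_def
proof (subst Lop_pointwise)
  fix v :: "int \<Rightarrow>\<^sub>0 complex"
  have "{m. \<theta> m * Poly_Mapping.lookup v m \<noteq> 0} \<subseteq> {k. Poly_Mapping.lookup v k \<noteq> 0}" by auto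
  then show "finite {m. \<theta> m * Poly_Mapping.lookup v m \<noteq> 0}" by (rule finite_subset) simp
qed (auto simp: algebra_simps)

text \<open>With N the period, \<open>pm n a (b + k N)\<close> plays the role of t^k E_ab in the
  loop algebra of gl_N; this is multiplication of such elements.\<close>

lemma pm_mult: "pm n a b * pm n c d = (if per n dvd b - c then pm n a (d + b - c) else 0)"
proof (rule lop_eqI, rule poly_mapping_eqI)
  fix v m
  have "per n dvd m - a + b - c \<longleftrightarrow> per n dvd b - c" if "per n dvd m - a"
    using dvd_add_right_iff[OF that, of "b - c"] by (simp add: algebra_simps)
  then show "Poly_Mapping.lookup (app (pm n a b * pm n c d) v) m =
      Poly_Mapping.lookup (app (if per n dvd b - c then pm n a (d + b - c) else 0) v) m"
    by (auto simp: algebra_simps)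
qed

lemma pm_shift: "per n dvd k \<Longrightarrow> pm n (a + k) (b + k) = pm n a b"
proof (rule lop_eqI, rule poly_mapping_eqI)
  fix v m
  assume k: "per n dvd k"
  have "per n dvd m - (a + k) \<longleftrightarrow> per n dvd m - a"
    using dvd_diff_right_iff[of "per n" "m - a" k] k
    by (metis diff_diff_eq dvd_add_left_iff diff_add_cancel)
  then show "Poly_Mapping.lookup (app (pm n (a + k) (b + k)) v) m = Poly_Mapping.lookup (app (pm n a b) v) m"
    by (simp add: algebra_simps)
qed

lemma pm_cong: "per n dvd a - c \<Longrightarrow> b - a = d - c \<Longrightarrow> pm n a b = pm n c d"
proof -
  assume *: "per n dvd a - c" "b - a = d - c"
  then have "a = c + (a - c)" "b = d + (a - c)" by simp_all
  then show ?thesis using pm_shift[OF *(1), of c d] by metis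
qed

lemma pm_diag: "pm n a a = diag (\<lambda>m. if per n dvd m - a then 1 else 0)"
  by (rule lop_eqI, rule poly_mapping_eqI) simp

lemma diag_add: "diag \<theta> + diag \<eta> = diag (\<lambda>m. \<theta> m + \<eta> m)"
  and diag_diff: "diag \<theta> - diag \<eta> = diag (\<lambda>m. \<theta> m - \<eta> m)"
  and diag_scale: "lscale c (diag \<theta>) = diag (\<lambda>m. c * \<theta> m)"
  and diag_mult: "diag \<theta> * diag \<eta> = diag (\<lambda>m. \<theta> m * \<eta> m)"
  by (rule lop_eqI, rule poly_mapping_eqI, simp add: algebra_simps lookup_add lookup_minus)+

lemma comm_diag: "comm (diag \<theta>) (diag \<eta>) = 0"
  by (simp add: comm_def diag_mult mult.commute)

lemma comm_diag_pm:
  assumes "\<And>m m' k. per n dvd k \<Longrightarrow> \<theta> (m + k) - \<theta> m = \<theta> (m' + k) - \<theta> m'"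
  shows "comm (diag \<theta>) (pm n a b) = lscale (\<theta> a - \<theta> b) (pm n a b)"
proof (rule lop_eqI, rule poly_mapping_eqI)
  fix v m
  have "\<theta> m - \<theta> (m - a + b) = \<theta> a - \<theta> b" if "per n dvd m - a"
    using assms[OF that, of a b] by (simp add: algebra_simps)
  then show "Poly_Mapping.lookup (app (comm (diag \<theta>) (pm n a b)) v) m =
      Poly_Mapping.lookup (app (lscale (\<theta> a - \<theta> b) (pm n a b)) v) m"
    by (simp add: comm_def lookup_minus) (metis left_diff_distrib)
qed

section \<open>The weights of the vector representation\<close>

text \<open>For m \<ge> 0 the coordinate at i is minus the number of j with 0 \<le> j < m that are
  congruent to i or to -i-1 modulo 2n+1. Hence passing from m to m+1 subtracts one simple root, read
  off from the residue of m. For i = n the two classes coincide and are counted once.\<close>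

definition eps :: "nat \<Rightarrow> int \<Rightarrow> weight" where
  "eps n m = (\<lambda>i. if i < n then - of_int ((m - int i + 2 * int n) div per n + (m + int i) div per n)
     else if i = n then - of_int ((m + int n) div per n) else 0)"

lemma eps_shift: "eps n (m + per n * k) i = eps n m i - of_int k * delta n i"
proof -
  have "(m + per n * k - x + 2 * int n) div per n = (m - x + 2 * int n) div per n + k"
    "(m + per n * k + x) div per n = (m + x) div per n + k" for x
    using div_mult_self2[of "per n" "m - x + 2 * int n" k] div_mult_self2[of "per n" "m + x" k]
    by (simp_all add: algebra_simps)
  then show ?thesis by (simp add: eps_def delta_def mark_def)
qed

lemma minus_div: "0 < (p :: int) \<Longrightarrow> (- x) div p = - ((x + p - 1) div p)"
proof -
  assume p: "0 < p"
  have "x = p * (x div p) + x mod p" by simp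
  moreover have "0 \<le> x mod p" "x mod p < p" using p by simp_all
  ultimately show ?thesis
  proof (cases "x mod p = 0")
    case True
    then obtain y where y: "x = p * y" using mod_0_imp_dvd by blast
    have "(p * y + (p - 1)) div p = y" using p by (simp add: div_pos_pos_trivial)
    then show ?thesis using p by (simp add: y add_diff_eq flip: mult_minus_right)
  next
    case False
    define q r where "q = x div p" and "r = x mod p"
    have x: "x = p * q + r" "0 < r" "r < p" using p False
      using pos_mod_sign[OF p, of x] pos_mod_bound[OF p, of x] by (auto simp: q_def r_def order_less_le)
    have "(- x) div p = - q - 1"
    proof -
      have e: "- x = (p - r) + p * (- q - 1)" using x by (simp add: algebra_simps)
      have "p \<noteq> 0" using p by simp
      show ?thesis unfolding e div_mult_self2[OF \<open>p \<noteq> 0\<close>] using x by (simp add: div_pos_pos_trivial)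
    qed
    moreover have "(x + p - 1) div p = q + 1"
    proof -
      have e: "x + p - 1 = (r - 1) + p * (q + 1)" using x by (simp add: algebra_simps)
      have "p \<noteq> 0" using p by simp
      show ?thesis unfolding e div_mult_self2[OF \<open>p \<noteq> 0\<close>] using x by (simp add: div_pos_pos_trivial)
    qed
    ultimately show ?thesis by simp
  qed
qed

lemma eps_minus: "eps n (- m) = - eps n m"
proof
  fix i
  have 1: "(- m - int i + 2 * int n) div per n = - ((m + int i) div per n)"
    using minus_div[of "per n" "m + int i - 2 * int n"]
    by (simp add: algebra_simps)
  have 2: "(- m + int i) div per n = - ((m - int i + 2 * int n) div per n)"
    using minus_div[of "per n" "m - int i"] by (simp add: algebra_simps)
  have 3: "(- m + int n) div per n = - ((m + int n) div per n)"
    using minus_div[of "per n" "m - int n"] by (simp add: algebra_simps)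
  show "eps n (- m) i = (- eps n m) i"
    using 1 2 3 by (simp add: eps_def weight_apply)
qed

lemma div_step: "0 < (p :: int) \<Longrightarrow> (x + 1) div p = x div p + (if p dvd x + 1 then 1 else 0)"
proof -
  assume p: "0 < p"
  define q r where "q = x div p" and "r = x mod p"
  have x: "x = p * q + r" "0 \<le> r" "r < p" using p by (simp_all add: q_def r_def)
  show ?thesis
  proof (cases "r = p - 1")
    case True
    then have "x + 1 = p * (q + 1)" using x by (simp add: algebra_simps)
    then show ?thesis using p by (simp add: q_def[symmetric])
  next
    case False
    have e: "x + 1 = (r + 1) + p * q" using x by simp
    have "\<not> p dvd r + 1" using x False zdvd_not_zless[of "r + 1" p] by simp
    moreover have "(x + 1) div p = q" unfolding e using x False div_mult_self2[of p "r + 1" q] by simp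
    moreover have "p dvd x + 1 \<longleftrightarrow> p dvd r + 1" unfolding e by (rule dvd_add_left_iff) simp
    ultimately show ?thesis by (simp add: q_def[symmetric])
  qed
qed

lemma eps_step:
  "eps n m i - eps n (m + 1) i =
    (if i < n then (if per n dvd m - int i then 1 else 0) + (if per n dvd m + int i + 1 then 1 else 0)
     else if i = n \<and> per n dvd m - int n then 1 else 0)"
proof -
  have "per n dvd m - int i + 2 * int n + 1 \<longleftrightarrow> per n dvd m - int i" for i
    using dvd_add_triv_right_iff[of "per n" "m - int i"] by (simp add: algebra_simps)
  then have 1: "(m + 1 - int i + 2 * int n) div per n = (m - int i + 2 * int n) div per n +
      (if per n dvd m - int i then 1 else 0)" for i
    using div_step[of "per n" "m - int i + 2 * int n"] by (simp add: algebra_simps)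
  have 2: "(m + 1 + int i) div per n = (m + int i) div per n + (if per n dvd m + int i + 1 then 1 else 0)" for i
    using div_step[of "per n" "m + int i"] by (simp add: algebra_simps)
  have 3: "per n dvd m + int n + 1 \<longleftrightarrow> per n dvd m - int n"
    using dvd_add_triv_right_iff[of "per n" "m - int n"] by (simp add: algebra_simps)
  show ?thesis using 1[of i] 2[of i] 2[of n] 3 by (simp add: eps_def)
qed

lemma eps_simple: "i \<le> n \<Longrightarrow> eps n (int i) - eps n (int i + 1) = unitw i 1"
proof
  fix j assume i: "i \<le> n"
  have pos: "\<not> per n dvd int i + int n + 1" if "i < n"
    using per_dvd_iff[of n "int i + int n + 1"] that by auto
  have "per n dvd int i - int j \<longleftrightarrow> i = j" if "j \<le> n"
    using per_dvd_iff[of n "int i - int j"] i that by auto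
  moreover have "\<not> per n dvd int i + int j + 1" if "j < n"
    using per_dvd_iff[of n "int i + int j + 1"] i that by auto
  ultimately show "(eps n (int i) - eps n (int i + 1)) j = unitw i 1 j"
    unfolding weight_apply eps_step using i by (cases "i = n") (auto simp: unitw_apply)
qed

definition coroot_pairing :: "nat \<Rightarrow> nat \<Rightarrow> int \<Rightarrow> complex" where
  "coroot_pairing n i m = (\<Sum>j\<le>n. of_real (eps n m j) * of_int (gcm n i j))"

text \<open>A row of the Cartan matrix acts on the counting functions \<open>w\<close> as a second
  difference, and each first difference of \<open>w\<close> is a difference of two residue
  indicators.\<close>

lemma coroot_pairing:
  assumes "1 \<le> n" "i \<le> n"
  shows "coroot_pairing n i m = (let b = (\<lambda>x. if per n dvd m - x then 1 else 0) in
     if i = n then b (int n) - b (int n + 1)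
     else (if i = 0 then 2 else 1) * (b (int i) - b (int i + 1) + b (- int i - 1) - b (- int i)))"
proof -
  define w where "w j = (m - int j + 2 * int n) div per n + (m + int j) div per n" for j
  define b :: "int \<Rightarrow> int" where "b x = (if per n dvd m - x then 1 else 0)" for x
  \<comment> \<open>At j = n the two quotients in \<open>w\<close> agree, whence the factor
    1/2.\<close>
  have e: "eps n m j = (if j < n then - of_int (w j) else - of_int (w j) / 2)" if "j \<le> n" for j
    using that by (auto simp: eps_def w_def algebra_simps)
  have w: "w j - w (Suc j) = b (int j + 1) - b (- int j - 1)" for j
  proof -
    have "m - int j + 2 * int n = (m - int (Suc j) + 2 * int n) + 1" by simp
    moreover have "per n dvd m - int (Suc j) + 2 * int n + 1 \<longleftrightarrow> per n dvd m - (int j + 1)"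
      using dvd_add_triv_right_iff[of "per n" "m - (int j + 1)"] by (simp add: algebra_simps)
    ultimately have "(m - int j + 2 * int n) div per n =
        (m - int (Suc j) + 2 * int n) div per n + b (int j + 1)"
      using div_step[of "per n" "m - int (Suc j) + 2 * int n"] by (simp only: b_def)
    moreover have "(m + int (Suc j)) div per n = (m + int j) div per n + b (- int j - 1)"
      using div_step[of "per n" "m + int j"] by (simp add: b_def algebra_simps)
    ultimately show ?thesis by (simp add: w_def)
  qed
  have bn: "b (- int n) = b (int n + 1)"
    using dvd_add_triv_right_iff[of "per n" "m - (int n + 1)"] by (simp add: b_def algebra_simps)
  have s: "coroot_pairing n i m = (\<Sum>j\<in>S. of_real (eps n m j) * of_int (gcm n i j))"
    if "S \<subseteq> {..n}" "\<And>j. j \<le> n \<Longrightarrow> j \<notin> S \<Longrightarrow> gcm n i j = 0" for S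
    unfolding coroot_pairing_def by (rule sum.mono_neutral_right) (use that in auto)
  have "coroot_pairing n i m = of_int (if i = n then b (int n) - b (int n + 1)
     else (if i = 0 then 2 else 1) * (b (int i) - b (int i + 1) + b (- int i - 1) - b (- int i)))"
  proof (cases "i = 0")
    case True
    have "coroot_pairing n i m = (\<Sum>j\<in>{0, 1}. of_real (eps n m j) * of_int (gcm n i j))"
      by (rule s) (use assms True in \<open>auto simp: gcm_def\<close>)
    also have "\<dots> = of_int (- 2 * (w 0 - w (Suc 0)))"
      using assms True by (auto simp: e gcm_def)
    finally show ?thesis unfolding w using assms True by simp
  next
    case i: False
    show ?thesis
    proof (cases "i = n")
      case True
      have "coroot_pairing n i m = (\<Sum>j\<in>{n - 1, n}. of_real (eps n m j) * of_int (gcm n i j))"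
        by (rule s) (use assms True in \<open>auto simp: gcm_def\<close>)
      also have "\<dots> = of_int (w (n - 1) - w n)"
        using assms True by (auto simp: e gcm_def)
      also have "w (n - 1) - w n = b (int n) - b (- int n)"
        using w[of "n - 1"] assms by (simp add: of_nat_diff)
      finally show ?thesis using True bn by simp
    next
      case False
      then obtain k where k: "i = Suc k" "Suc k < n" using i assms by (cases i) auto
      have "coroot_pairing n i m = (\<Sum>j\<in>{k, Suc k, Suc (Suc k)}. of_real (eps n m j) * of_int (gcm n i j))"
        by (rule s) (use assms k in \<open>auto simp: gcm_def\<close>)
      also have "\<dots> = of_int ((w k - w (Suc k)) - (w (Suc k) - w (Suc (Suc k))))"
        using assms k by (auto simp: e gcm_def)
      finally have "coroot_pairing n i m = of_int ((w k - w (Suc k)) - (w (Suc k) - w (Suc (Suc k))))" .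
      moreover have "(w k - w (Suc k)) - (w (Suc k) - w (Suc (Suc k))) =
          b (int i) - b (int i + 1) + b (- int i - 1) - b (- int i)"
      proof -
        have "int (Suc k) = int k + 1" "- int (Suc k) = - int k - 1" by auto
        then show ?thesis unfolding w k(1) by (simp only:)
      qed
      ultimately show ?thesis using k by simp
    qed
  qed
  then show ?thesis by (auto simp: Let_def b_def)
qed

section \<open>Chevalley generators in the vector representation\<close>

definition sg :: "int \<Rightarrow> complex" where
  "sg k = (if even k then 1 else - 1)"

text \<open>Sending \<open>pm n a b\<close> to (-1)^(a+b) times \<open>pm n (- b) (- a)\<close> is
  an involutive antiautomorphism, and \<open>mX n a b\<close> lies in its eigenspace for -1, a Lie
  algebra. As the period is odd, the sign flips when b is shifted by one period; this is the twist
  of the loop algebra.\<close>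

definition mX :: "nat \<Rightarrow> int \<Rightarrow> int \<Rightarrow> int lop" where
  "mX n a b = pm n a b - lscale (sg (a + b)) (pm n (- b) (- a))"

text \<open>For i = n the two summands of \<open>mX\<close> coincide, so only one of them is
  taken.\<close>

definition mE :: "nat \<Rightarrow> nat \<Rightarrow> int lop" where
  "mE n i = (if i < n then mX n (int i) (int i + 1) else pm n (int n) (int n + 1))"

text \<open>The factor 2 at i = 0 is forced by the diagonal entry 2 of the Cartan matrix: without it
  the bracket of \<open>mE n 0\<close> and \<open>mF n 0\<close> would act on \<open>mE n 0\<close>
  by 1.\<close>

definition mF :: "nat \<Rightarrow> nat \<Rightarrow> int lop" where
  "mF n i = (if i < n then lscale (if i = 0 then 2 else 1) (mX n (int i + 1) (int i))
     else pm n (int n + 1) (int n))"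

lemma mE_alt: "i < n \<Longrightarrow> mE n i = pm n (int i) (int i + 1) + pm n (- int i - 1) (- int i)"
  by (simp add: mE_def mX_def sg_def)

lemma mF_alt: "i < n \<Longrightarrow> mF n i = lscale (if i = 0 then 2 else 1)
    (pm n (int i + 1) (int i) + pm n (- int i) (- int i - 1))"
  by (simp add: mF_def mX_def sg_def)

text \<open>Decides which products of summands of \<open>mE\<close> and \<open>mF\<close> survive in
  \<open>pm_mult\<close>.\<close>

lemma dvd_small:
  assumes "i < n" "j < n"
  shows "per n dvd (int i + 1) - (int j + 1) \<longleftrightarrow> i = j" "\<not> per n dvd (int i + 1) - (- int j)"
    "\<not> per n dvd - int i - (int j + 1)" "per n dvd - int i - (- int j) \<longleftrightarrow> i = j"
    "per n dvd int j - int i \<longleftrightarrow> i = j" "\<not> per n dvd int j - (- int i - 1)"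
    "\<not> per n dvd (- int j - 1) - int i" "per n dvd (- int j - 1) - (- int i - 1) \<longleftrightarrow> i = j"
    "\<not> per n dvd (int i + 1) - (int n + 1)" "\<not> per n dvd - int i - (int n + 1)"
    "\<not> per n dvd int n - int i" "\<not> per n dvd int n - (- int i - 1)"
    "\<not> per n dvd (int n + 1) - (int j + 1)" "\<not> per n dvd (int n + 1) - (- int j)"
    "\<not> per n dvd int j - int n" "\<not> per n dvd (- int j - 1) - int n"
  using assms by (subst per_dvd_iff; linarith)+

lemma comm_mE_mF:
  assumes "1 \<le> n" "i \<le> n" "j \<le> n"
  shows "comm (mE n i) (mF n j) = (if i = j then diag (coroot_pairing n i) else 0)"
proof -
  note simps = comm_def distrib_left distrib_right pm_mult lscale_mult_left lscale_mult_right
    if_True if_False add_0_left add_0_right lscale.scale_zero_right diff_self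
  consider "i = n" "j = n" | "i = n" "j < n" | "i < n" "j = n" | "i < n" "j < n"
    using assms by linarith
  then show ?thesis
  proof cases
    case 1
    then have "coroot_pairing n n = (\<lambda>m. (if per n dvd m - int n then 1 else 0) -
        (if per n dvd m - (int n + 1) then 1 else 0))"
      using assms by (simp add: coroot_pairing Let_def fun_eq_iff)
    then show ?thesis using 1 by (simp add: mE_def mF_def comm_def pm_mult pm_diag diag_diff)
  next
    case 2
    have "comm (mE n i) (mF n j) = 0"
      unfolding 2(1) mE_def[of n n] mF_alt[OF 2(2)]
      by (simp only: simps dvd_small[OF 2(2) 2(2)] less_irrefl)
    then show ?thesis using 2 by simp
  next
    case 3
    have "comm (mE n i) (mF n j) = 0"
      unfolding 3(2) mF_def[of n n] mE_alt[OF 3(1)]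
      by (simp only: simps dvd_small[OF 3(1) 3(1)] less_irrefl)
    then show ?thesis using 3 by simp
  next
    case 4
    show ?thesis
    proof (cases "i = j")
      case True
      let ?c = "if i = 0 then 2 else 1 :: complex"
      have "comm (mE n i) (mF n i) = lscale ?c (pm n (int i) (int i) + pm n (- int i - 1) (- int i - 1))
          - lscale ?c (pm n (int i + 1) (int i + 1) + pm n (- int i) (- int i))"
        unfolding mE_alt[OF 4(1)] mF_alt[OF 4(1)]
        by (simp only: simps dvd_small[OF 4(1) 4(1)]) (simp add: lscale.scale_right_distrib)
      also have "\<dots> = diag (coroot_pairing n i)"
        unfolding pm_diag diag_add diag_scale diag_diff
      proof (rule arg_cong[where f = diag], rule ext)
        fix m
        show "?c * ((if per n dvd m - int i then 1 else 0) + (if per n dvd m - (- int i - 1) then 1 else 0)) -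
            ?c * ((if per n dvd m - (int i + 1) then 1 else 0) + (if per n dvd m - - int i then 1 else 0)) =
            coroot_pairing n i m"
          using 4 assms unfolding coroot_pairing[OF assms(1,2)] Let_def
          by (simp only: right_diff_distrib distrib_left if_False less_irrefl) (simp add: algebra_simps)
      qed
      finally show ?thesis using True by simp
    next
      case False
      have "comm (mE n i) (mF n j) = 0"
        unfolding mE_alt[OF 4(1)] mF_alt[OF 4(2)]
        by (simp only: simps dvd_small[OF 4] False)
      then show ?thesis using False by simp
    qed
  qed
qed

lemma mE_nonzero:
  assumes "i \<le> n"
  shows "mE n i \<noteq> 0" "mF n i \<noteq> 0"
proof -
  have d: "\<not> per n dvd int i - (- int i - 1)" "\<not> per n dvd int i + 1 - (- int i)" if "i < n"
    using that by (subst per_dvd_iff; linarith)+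
  have "Poly_Mapping.lookup (app (mE n i) (Poly_Mapping.single (int i + 1) 1)) (int i) = 1"
  proof (cases "i < n")
    case True
    show ?thesis unfolding mE_alt[OF True] using d(1)[OF True] by (simp add: lookup_add)
  next
    case False
    then show ?thesis using assms by (simp add: mE_def)
  qed
  then show "mE n i \<noteq> 0" by auto
  have "Poly_Mapping.lookup (app (mF n i) (Poly_Mapping.single (int i) 1)) (int i + 1) \<noteq> 0"
  proof (cases "i < n")
    case True
    show ?thesis unfolding mF_alt[OF True] using d(2)[OF True] by (simp add: lookup_add)
  next
    case False
    then show ?thesis using assms by (simp add: mF_def)
  qed
  then show "mF n i \<noteq> 0" by auto
qed

text \<open>The index of the simple root \<open>eps n m - eps n (m + 1)\<close>.\<close>

definition fold_index :: "nat \<Rightarrow> nat \<Rightarrow> nat" where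
  "fold_index n m = (if m \<le> n then m else 2 * n - m)"

lemma mX_swap: "mX n a b = lscale (- sg (a + b)) (mX n (- b) (- a))"
proof -
  have "even (- b - a) \<longleftrightarrow> even (a + b)" by (metis even_minus minus_add_distrib uminus_add_conv_diff add.commute)
  then have "sg (- b + - a) = sg (a + b)" by (simp add: sg_def)
  moreover have "sg (a + b) * sg (a + b) = 1" by (simp add: sg_def)
  ultimately show ?thesis
    by (simp add: mX_def lscale.scale_right_diff_distrib)
qed

lemma mX_shift: "per n dvd k \<Longrightarrow> mX n (a + k) (b + k) = mX n a b"
proof -
  assume k: "per n dvd k"
  have "pm n (- (b + k)) (- (a + k)) = pm n (- b) (- a)"
    using pm_shift[of n "- k" "- b" "- a"] k by simp
  moreover have "sg (a + k + (b + k)) = sg (a + b)" by (simp add: sg_def)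
  ultimately show ?thesis unfolding mX_def pm_shift[OF k] by simp
qed

text \<open>The lowering generator belonging to the step from b to b+1 advances the first index. The
  constant is 2 exactly if a + b = 2n+1, when the two summands of \<open>mX n b a\<close> coincide,
  and 1 otherwise.\<close>

lemma mX_step_down:
  assumes "1 \<le> n" "a < b" "b < 2 * n"
  shows "\<exists>c. c \<noteq> 0 \<and>
    comm (mF n (fold_index n b)) (mX n (int b) (int a)) = lscale c (mX n (int b + 1) (int a))"
proof -
  have F: "mF n (fold_index n b) = (if b = n then pm n (int n + 1) (int n)
      else pm n (int b + 1) (int b) + pm n (- int b) (- int b - 1))"
  proof (cases "b \<le> n")
    case True
    then show ?thesis using assms by (auto simp: fold_index_def mF_alt mF_def[of n n])
  next
    case False
    have 1: "pm n (int (2 * n - b) + 1) (int (2 * n - b)) = pm n (- int b) (- int b - 1)"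
      using False assms by (intro pm_cong) (auto simp: of_nat_diff)
    have "- int (2 * n - b) - (int b + 1) = - per n" using False assms by (simp add: of_nat_diff)
    then have 2: "pm n (- int (2 * n - b)) (- int (2 * n - b) - 1) = pm n (int b + 1) (int b)"
      by (intro pm_cong) (simp_all only: dvd_minus_iff dvd_refl)
    have "2 * n - b < n" "2 * n - b \<noteq> 0" using False assms by auto
    then show ?thesis using False unfolding fold_index_def
      by (simp only: mF_alt 1 2 if_False lscale.scale_one) simp
  qed
  define s where "s = sg (int b + int a)"
  have m: "- (int b + 1) = - int b - 1" by simp
  have s': "sg (int b + 1 + int a) = - s" by (simp add: s_def sg_def)
  have d: "\<not> per n dvd int a - (int b + 1)" "\<not> per n dvd - int b - 1 - - int a"
    "per n dvd int b - (- int a) \<longleftrightarrow> a + b = 2 * n + 1"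
    "per n dvd - int b - 1 - int b \<longleftrightarrow> b = n" "per n dvd int a - (- int b) \<longleftrightarrow> a + b = 2 * n + 1"
    "per n dvd - int b - (int b + 1) \<longleftrightarrow> b = n"
  proof -
    show "\<not> per n dvd int a - (int b + 1)" "\<not> per n dvd - int b - 1 - - int a"
      using assms by (subst per_dvd_iff; linarith)+
    have "per n dvd int b + int a \<longleftrightarrow> per n dvd int b + int a - per n"
      by (rule iffI) (metis dvd_diff dvd_refl, metis dvd_add dvd_refl diff_add_cancel)
    then have 1: "per n dvd int b + int a \<longleftrightarrow> a + b = 2 * n + 1"
      using per_dvd_iff[of n "int b + int a - per n"] assms by auto
    then show "per n dvd int b - (- int a) \<longleftrightarrow> a + b = 2 * n + 1"
      "per n dvd int a - (- int b) \<longleftrightarrow> a + b = 2 * n + 1" by (simp_all add: add.commute)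
    have "per n dvd 2 * int b + 1 \<longleftrightarrow> per n dvd 2 * int b + 1 - per n"
      by (rule iffI) (metis dvd_diff dvd_refl, metis dvd_add dvd_refl diff_add_cancel)
    then have "per n dvd - (2 * int b + 1) \<longleftrightarrow> b = n"
      using per_dvd_iff[of n "2 * int b + 1 - per n"] assms unfolding dvd_minus_iff by auto
    moreover have "- int b - 1 - int b = - (2 * int b + 1)" "- int b - (int b + 1) = - (2 * int b + 1)"
      by simp_all
    ultimately show "per n dvd - int b - 1 - int b \<longleftrightarrow> b = n"
      "per n dvd - int b - (int b + 1) \<longleftrightarrow> b = n" by presburger+
  qed
  define u v where "u = pm n (int b + 1) (int a)" and "v = pm n (- int a) (- int b - 1)"
  have shift1: "pm n (- int b) (int a - int b - 1 - int b) = u" if "b = n"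
  proof -
    have "- int b - (int b + 1) = - per n" using that by simp
    then have "per n dvd - int b - (int b + 1)" by (metis dvd_minus_iff dvd_refl)
    then show ?thesis unfolding u_def by (rule pm_cong) simp
  qed
  have shift2: "pm n (int b) (int a - 1) = v" if "a + b = 2 * n + 1"
  proof -
    have "int b - - int a = per n" using that by simp
    then have "per n dvd int b - - int a" by simp
    then show ?thesis unfolding v_def by (rule pm_cong) simp
  qed
  define A1 A2 B1 B2 where "A1 = pm n (int b + 1) (int b)" and "A2 = pm n (- int b) (- int b - 1)"
    and "B1 = pm n (int b) (int a)" and "B2 = pm n (- int a) (- int b)"
  have prods: "A1 * B1 = u" "B2 * A2 = v" "A2 * B2 = 0" "B1 * A1 = 0"
    "A1 * B2 = (if a + b = 2 * n + 1 then u else 0)" "A2 * B1 = (if b = n then u else 0)"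
    "B1 * A2 = (if a + b = 2 * n + 1 then v else 0)" "B2 * A1 = (if b = n then v else 0)"
    unfolding A1_def A2_def B1_def B2_def pm_mult using d shift1 shift2
    by (simp_all add: u_def v_def algebra_simps) (simp add: minus_diff_commute)
  have X: "mX n (int b) (int a) = B1 - lscale s B2"
    by (simp add: mX_def s_def B1_def B2_def)
  have X': "mX n (int b + 1) (int a) = u + lscale s v"
    unfolding mX_def u_def v_def by (simp only: s' m lscale.scale_minus_left diff_minus_eq_add)
  show ?thesis
  proof (cases "b = n")
    case True
    then have "a + b \<noteq> 2 * n + 1" using assms by simp
    then have "comm A1 (B1 - lscale s B2) = u + lscale s v"
      using True by (simp add: comm_def distrib_left distrib_right left_diff_distrib right_diff_distrib prods)
    then show ?thesis using True unfolding F X X' by (intro exI[of _ 1]) (simp add: A1_def)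
  next
    case False
    have "s = - 1" if "a + b = 2 * n + 1"
    proof -
      have "int b + int a = per n" using that by simp
      then show ?thesis by (simp add: s_def sg_def)
    qed
    then have "comm (A1 + A2) (B1 - lscale s B2) =
        lscale (if a + b = 2 * n + 1 then 2 else 1) (u + lscale s v)"
      using False
      by (simp add: comm_def distrib_left distrib_right left_diff_distrib right_diff_distrib prods
          lscale.scale_right_diff_distrib lscale.scale_left_distrib[of 1 1, simplified])
    then show ?thesis using False unfolding F X X'
      by (intro exI[of _ "if a + b = 2 * n + 1 then 2 else 1"]) (simp add: A1_def A2_def)
  qed
qed

lemma mX_step_up:
  assumes "1 \<le> n" "1 \<le> b" "b < 2 * n"
  shows "\<exists>c. c \<noteq> 0 \<and>
    comm (mE n (fold_index n b)) (mX n 0 (int b)) = lscale c (mX n 0 (int b + 1))"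
proof -
  have E: "mE n (fold_index n b) = (if b = n then pm n (int n) (int n + 1)
      else pm n (int b) (int b + 1) + pm n (- int b - 1) (- int b))"
  proof (cases "b \<le> n")
    case True
    then show ?thesis using assms by (auto simp: fold_index_def mE_alt mE_def[of n n])
  next
    case False
    have 1: "pm n (int (2 * n - b)) (int (2 * n - b) + 1) = pm n (- int b - 1) (- int b)"
      using False assms by (intro pm_cong) (auto simp: of_nat_diff)
    have "(- int (2 * n - b) - 1) - int b = - per n" using False assms by (simp add: of_nat_diff)
    then have 2: "pm n (- int (2 * n - b) - 1) (- int (2 * n - b)) = pm n (int b) (int b + 1)"
      by (intro pm_cong) (simp_all only: dvd_minus_iff dvd_refl)
    have "2 * n - b < n" using False assms by auto
    then show ?thesis using False unfolding fold_index_def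
      by (simp only: mE_alt 1 2 if_False) simp
  qed
  define s where "s = sg (int b)"
  have m: "- (int b + 1) = - int b - 1" by simp
  have s': "sg (int b + 1) = - s" by (simp add: s_def sg_def)
  have d: "\<not> per n dvd int b + 1" "\<not> per n dvd int b" "\<not> per n dvd - int b"
    "\<not> per n dvd - int b - 1"
    "per n dvd int b - (- int b - 1) \<longleftrightarrow> b = n" "per n dvd int b + 1 - (- int b) \<longleftrightarrow> b = n"
  proof -
    show "\<not> per n dvd int b + 1" "\<not> per n dvd int b" "\<not> per n dvd - int b" "\<not> per n dvd - int b - 1"
      using assms by (subst per_dvd_iff; linarith)+
    have "per n dvd 2 * int b + 1 \<longleftrightarrow> per n dvd 2 * int b + 1 - per n"
      by (rule iffI) (metis dvd_diff dvd_refl, metis dvd_add dvd_refl diff_add_cancel)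
    then have "per n dvd 2 * int b + 1 \<longleftrightarrow> b = n"
      using per_dvd_iff[of n "2 * int b + 1 - per n"] assms by auto
    moreover have "int b - (- int b - 1) = 2 * int b + 1" "int b + 1 - (- int b) = 2 * int b + 1"
      by simp_all
    ultimately show "per n dvd int b - (- int b - 1) \<longleftrightarrow> b = n"
      "per n dvd int b + 1 - (- int b) \<longleftrightarrow> b = n" by presburger+
  qed
  define u v where "u = pm n 0 (int b + 1)" and "v = pm n (- int b - 1) 0"
  have shift2: "pm n (int b) (int b + 1 + int b) = v" if "b = n"
    unfolding v_def by (rule pm_cong) (use that in auto)
  define A1 A2 B1 B2 where "A1 = pm n (int b) (int b + 1)" and "A2 = pm n (- int b - 1) (- int b)"
    and "B1 = pm n 0 (int b)" and "B2 = pm n (- int b) 0"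
  have prods: "A1 * B1 = 0" "A2 * B2 = v" "A2 * B1 = 0" "B1 * A1 = u" "B2 * A1 = 0" "B2 * A2 = 0"
    "B1 * A2 = (if b = n then u else 0)" "A1 * B2 = (if b = n then v else 0)"
    unfolding A1_def A2_def B1_def B2_def pm_mult using d shift2
    by (simp_all add: u_def v_def algebra_simps)
  have X: "mX n 0 (int b) = B1 - lscale s B2"
    by (simp add: mX_def s_def B1_def B2_def)
  have X': "mX n 0 (int b + 1) = u + lscale s v"
    unfolding mX_def u_def v_def by (simp only: s' m lscale.scale_minus_left diff_minus_eq_add minus_zero add_0)
  show ?thesis
  proof (cases "b = n")
    case True
    then have "comm A1 (B1 - lscale s B2) = lscale (- 1) (u + lscale s v)"
      using True by (simp add: comm_def distrib_left distrib_right left_diff_distrib right_diff_distrib prods)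
    then show ?thesis using True unfolding E X X' by (intro exI[of _ "- 1"]) (simp add: A1_def)
  next
    case False
    then have "comm (A1 + A2) (B1 - lscale s B2) = lscale (- 1) (u + lscale s v)"
      using False
      by (simp add: comm_def distrib_left distrib_right left_diff_distrib right_diff_distrib prods)
    then show ?thesis using False unfolding E X X'
      by (intro exI[of _ "- 1"]) (simp add: A1_def A2_def)
  qed
qed

section \<open>The graph of the vector representation\<close>

lemma (in vector_space) span_UN_sum:
  assumes sub: "\<And>\<gamma>. \<gamma> \<in> \<Gamma> \<Longrightarrow> subspace (W \<gamma>)" and y: "y \<in> span (\<Union>\<gamma>\<in>\<Gamma>. W \<gamma>)"
  shows "\<exists>S t. finite S \<and> S \<subseteq> \<Gamma> \<and> (\<forall>\<gamma>\<in>S. t \<gamma> \<in> W \<gamma>) \<and> y = (\<Sum>\<gamma>\<in>S. t \<gamma>)"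
  using y
proof (induction rule: span_induct_alt)
  case base
  then show ?case by (intro exI[of _ "{}"]) simp
next
  case (step c x y)
  then obtain S t \<beta> where *: "finite S" "S \<subseteq> \<Gamma>" "\<forall>\<gamma>\<in>S. t \<gamma> \<in> W \<gamma>" "y = (\<Sum>\<gamma>\<in>S. t \<gamma>)"
    and \<beta>: "\<beta> \<in> \<Gamma>" "x \<in> W \<beta>" by blast
  define t' where "t' \<gamma> = (if \<gamma> = \<beta> then scale c x else 0) + (if \<gamma> \<in> S then t \<gamma> else 0)" for \<gamma>
  have "t' \<gamma> \<in> W \<gamma>" if "\<gamma> \<in> insert \<beta> S" for \<gamma>
  proof -
    have s: "subspace (W \<gamma>)" using that * \<beta> sub by auto
    show ?thesis unfolding t'_def
      by (intro subspace_add[OF s]) (use that * \<beta> subspace_0[OF s] subspace_scale[OF s] in auto)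
  qed
  moreover have "(\<Sum>\<gamma>\<in>insert \<beta> S. t' \<gamma>) = scale c x + y"
  proof -
    have "(\<Sum>\<gamma>\<in>insert \<beta> S. if \<gamma> \<in> S then t \<gamma> else 0) = (\<Sum>\<gamma>\<in>S. if \<gamma> \<in> S then t \<gamma> else 0)"
      by (rule sum.mono_neutral_right) (use * in auto)
    then show ?thesis using * by (simp add: t'_def sum.distrib)
  qed
  ultimately show ?case using * \<beta>
    by (intro exI[of _ "insert \<beta> S"] exI[of _ t']) auto
qed

lemma (in lie_algebra) eigenvectors_independent:
  assumes "finite S" "\<And>\<gamma> h. \<gamma> \<in> S \<Longrightarrow> h \<in> T \<Longrightarrow> bracket h (v \<gamma>) = scale (\<chi> \<gamma> h) (v \<gamma>)"
    and "\<And>\<gamma> \<beta>. \<gamma> \<in> S \<Longrightarrow> \<beta> \<in> S \<Longrightarrow> \<gamma> \<noteq> \<beta> \<Longrightarrow> \<exists>h\<in>T. \<chi> \<gamma> h \<noteq> \<chi> \<beta> h"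
    and "(\<Sum>\<gamma>\<in>S. v \<gamma>) = 0" "\<gamma> \<in> S"
  shows "v \<gamma> = 0"
  using assms
proof (induction S arbitrary: v \<gamma> rule: finite_induct)
  case (insert \<beta> S)
  have v: "v \<alpha> = 0" if \<alpha>: "\<alpha> \<in> S" for \<alpha>
  proof -
    obtain h where h: "h \<in> T" "\<chi> \<alpha> h \<noteq> \<chi> \<beta> h"
      using insert.prems(2)[of \<alpha> \<beta>] insert.hyps(2) \<alpha> by blast
    have "bracket h (\<Sum>\<gamma>\<in>insert \<beta> S. v \<gamma>) = (\<Sum>\<gamma>\<in>insert \<beta> S. bracket h (v \<gamma>))"
      using insert.hyps(1) by (induction S rule: finite_induct)
        (auto simp: bracket_add_right sum.insert_if)
    then have 0: "(\<Sum>\<gamma>\<in>insert \<beta> S. scale (\<chi> \<gamma> h) (v \<gamma>)) = 0"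
      using insert.prems(1) h(1) insert.prems(3) by simp
    have "(\<Sum>\<gamma>\<in>insert \<beta> S. scale (\<chi> \<gamma> h - \<chi> \<beta> h) (v \<gamma>)) = 0"
      using 0 insert.prems(3)
      by (simp only: scale_left_diff_distrib sum_subtractf flip: scale_sum_right) simp
    then have "(\<Sum>\<gamma>\<in>S. scale (\<chi> \<gamma> h - \<chi> \<beta> h) (v \<gamma>)) = 0"
      using insert.hyps by simp
    then have "scale (\<chi> \<alpha> h - \<chi> \<beta> h) (v \<alpha>) = 0"
      by (rule insert.IH[rotated 2]) (use insert.prems \<alpha> in \<open>auto simp: bracket_scale_right mult.commute\<close>)
    then show ?thesis using h by simp
  qed
  then have "v \<beta> = 0" using insert.prems(3) insert.hyps by simp
  then show ?case using v insert.prems(4) by blast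
qed simp

lemma (in lie_algebra) iter_support: "iter n e \<sigma> \<gamma> z \<Longrightarrow> z \<noteq> 0 \<Longrightarrow> i > n \<Longrightarrow> \<gamma> i = 0"
proof (induction rule: iter.induct)
  case (iter_bracket j \<gamma> z)
  then have "z \<noteq> 0" by auto
  then show ?case using iter_bracket by (simp add: weight_apply unitw_apply)
next
  case (iter_add \<gamma> y z)
  then have "y \<noteq> 0 \<or> z \<noteq> 0" by auto
  then show ?case using iter_add by blast
qed (auto simp: unitw_apply)

lemma (in triangular) piece_support:
  assumes "piece \<gamma> z" "z \<noteq> 0" "i > n"
  shows "\<gamma> i = 0"
proof (rule ccontr)
  assume i: "\<gamma> i \<noteq> 0"
  obtain p h q where *:
    "z = p + h + q" "iter n e 1 \<gamma> p" "h \<in> H" "\<gamma> \<noteq> 0 \<longrightarrow> h = 0" "iter n f (-1) \<gamma> q"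
    using assms(1) unfolding piece_def by blast
  have "\<gamma> \<noteq> 0" using i by (auto simp: weight_apply)
  then have "p \<noteq> 0 \<or> q \<noteq> 0" using * assms(2) by auto
  then show False using iter_support[OF *(2) _ assms(3)] iter_support[OF *(5) _ assms(3)] i by blast
qed

context affine_A2n2
begin

lemma wt_eval_add: "wt_eval (\<gamma> + \<delta>) h = wt_eval \<gamma> h + wt_eval \<delta> h"
  and wt_eval_diff: "wt_eval (\<gamma> - \<delta>) h = wt_eval \<gamma> h - wt_eval \<delta> h"
  and wt_eval_minus: "wt_eval (- \<gamma>) h = - wt_eval \<gamma> h"
  and wt_eval_0: "wt_eval 0 h = 0"
  by (simp_all add: wt_eval_def weight_apply algebra_simps sum.distrib sum_subtractf sum_negf)

lemma wt_eval_unitw: "i \<le> n \<Longrightarrow> wt_eval (unitw i c) h = of_real c * sroot G i h"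
proof -
  assume "i \<le> n"
  have "wt_eval (unitw i c) h = (\<Sum>j\<le>n. if j = i then of_real c * sroot G i h else 0)"
    unfolding wt_eval_def by (rule sum.cong) (auto simp: unitw_apply)
  then show ?thesis using \<open>i \<le> n\<close> by simp
qed

lemma wt_eval_add_right:
  "h \<in> cartan G \<Longrightarrow> h' \<in> cartan G \<Longrightarrow> wt_eval \<gamma> (h + h') = wt_eval \<gamma> h + wt_eval \<gamma> h'"
  by (simp add: wt_eval_def sroot_add sum.distrib distrib_left)

lemma wt_eval_scale_right: "h \<in> cartan G \<Longrightarrow> wt_eval \<gamma> (scl G c h) = c * wt_eval \<gamma> h"
  by (simp add: wt_eval_def sroot_scl sum_distrib_left algebra_simps)

lemma wt_eval_separates:
  assumes "\<gamma> \<noteq> \<delta>" "\<And>i. i > n \<Longrightarrow> \<gamma> i = \<delta> i"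
  shows "\<exists>h\<in>cartan G. wt_eval \<gamma> h \<noteq> wt_eval \<delta> h"
proof (rule ccontr)
  assume "\<not> ?thesis"
  then have "\<forall>h\<in>cartan G. (\<Sum>j\<le>n. of_real (\<gamma> j - \<delta> j) * sroot G j h) = 0"
    by (simp add: wt_eval_def left_diff_distrib sum_subtractf)
  then have "of_real (\<gamma> i - \<delta> i) = (0 :: complex)" if "i \<le> n" for i
    using sroot_independent[of "\<lambda>j. of_real (\<gamma> j - \<delta> j)" i] that by blast
  then have "\<gamma> i = \<delta> i" for i using assms(2)[of i] by (cases "i \<le> n") auto
  then show False using assms(1) by auto
qed

definition mH :: "'g \<Rightarrow> int lop" where
  "mH h = diag (\<lambda>m. wt_eval (eps n m) h)"

lemma mH_add: "h \<in> cartan G \<Longrightarrow> h' \<in> cartan G \<Longrightarrow> mH (h + h') = mH h + mH h'"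
  by (simp add: mH_def diag_add wt_eval_add_right)

lemma mH_scale: "h \<in> cartan G \<Longrightarrow> mH (scl G c h) = lscale c (mH h)"
  by (simp add: mH_def diag_scale wt_eval_scale_right)

lemma comm_mH_pm: "comm (mH h) (pm n a b) = lscale (wt_eval (eps n a - eps n b) h) (pm n a b)"
  unfolding mH_def wt_eval_diff
proof (rule comm_diag_pm)
  fix m m' k assume "per n dvd k"
  then obtain l where l: "k = per n * l" by (auto simp: dvd_def)
  have "eps n (m + k) - eps n m = eps n (m' + k) - eps n m'"
    unfolding l by (simp add: fun_eq_iff weight_apply eps_shift)
  then show "wt_eval (eps n (m + k)) h - wt_eval (eps n m) h =
      wt_eval (eps n (m' + k)) h - wt_eval (eps n m') h"
    unfolding wt_eval_diff[symmetric] by simp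
qed

lemma comm_mH_mX: "comm (mH h) (mX n a b) = lscale (wt_eval (eps n a - eps n b) h) (mX n a b)"
proof -
  have "eps n (- b) - eps n (- a) = eps n a - eps n b" by (simp add: eps_minus)
  then show ?thesis
    by (simp add: mX_def comm.bracket_diff_right comm.bracket_scale_right comm_mH_pm
        lscale.scale_right_diff_distrib mult.commute)
qed

lemma comm_mH_mE: "i \<le> n \<Longrightarrow> comm (mH h) (mE n i) = lscale (sroot G i h) (mE n i)"
  using eps_simple[of i n] wt_eval_unitw[of i 1 h]
  by (cases "i = n") (auto simp: mE_def comm_mH_mX comm_mH_pm)

lemma comm_mH_mF: "i \<le> n \<Longrightarrow> comm (mH h) (mF n i) = lscale (- sroot G i h) (mF n i)"
proof -
  assume i: "i \<le> n"
  have "eps n (int i + 1) - eps n (int i) = - unitw i 1" using eps_simple[OF i] by (metis minus_diff_eq)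
  then show ?thesis using i wt_eval_unitw[of i 1 h]
    by (cases "i = n") (auto simp: mF_def comm.bracket_scale_right comm_mH_mX comm_mH_pm wt_eval_minus mult.commute)
qed

lemma comm_mE_mF_coroot:
  assumes "i \<le> n" "j \<le> n"
  shows "comm (mE n i) (mF n j) = (if i = j then mH (scoroot G i) else 0)"
proof -
  have "coroot_pairing n i m = wt_eval (eps n m) (scoroot G i)" for m
    unfolding coroot_pairing_def wt_eval_def by (rule sum.cong) (use pairing assms in auto)
  then have "mH (scoroot G i) = diag (coroot_pairing n i)"
    by (simp add: mH_def) (metis (no_types))
  then show ?thesis using comm_mE_mF[OF n_pos assms] by auto
qed

section \<open>The product of the algebra with the matrices, and the graph generated inside
  it\<close>

definition pscl :: "complex \<Rightarrow> 'g \<times> int lop \<Rightarrow> 'g \<times> int lop" where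
  "pscl c z = (scl G c (fst z), lscale c (snd z))"

definition pbrk :: "'g \<times> int lop \<Rightarrow> 'g \<times> int lop \<Rightarrow> 'g \<times> int lop" where
  "pbrk y z = (brk G (fst y) (fst z), comm (snd y) (snd z))"

lemma pair_vector_space: "vector_space pscl"
  by standard (auto simp: pscl_def plus_prod_def scale_right_distrib scale_left_distrib
      lscale.scale_right_distrib lscale.scale_left_distrib)

lemma pair_lie_algebra: "lie_algebra pscl pbrk"
proof (intro lie_algebra.intro pair_vector_space lie_algebra_axioms.intro)
  interpret v: vector_space pscl by (rule pair_vector_space)
  have lin: "Vector_Spaces.linear pscl pscl k"
    if "\<And>x y. k (x + y) = k x + k y" "\<And>c x. k (pscl c x) = pscl c (k x)" for k
    using that by unfold_locales auto
  show "Vector_Spaces.linear pscl pscl (pbrk x)" for x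
    by (rule lin) (simp_all add: pscl_def pbrk_def plus_prod_def bracket_add_right bracket_scale_right
        comm.bracket_add_right comm.bracket_scale_right)
  show "Vector_Spaces.linear pscl pscl (\<lambda>x. pbrk x y)" for y
    by (rule lin) (simp_all add: pscl_def pbrk_def plus_prod_def bracket_add_left bracket_scale_left
        comm.bracket_add_left comm.bracket_scale_left)
  show "pbrk x x = 0" for x by (simp add: pbrk_def bracket_self comm.bracket_self zero_prod_def)
  show "pbrk x (pbrk y z) + pbrk y (pbrk z x) + pbrk z (pbrk x y) = 0" for x y z
    by (simp add: pbrk_def plus_prod_def jacobi comm.jacobi zero_prod_def)
qed

text \<open>The pieces of this triangular structure take over the role of the graph of the vector
  representation, without the assignment on generators being known to extend to a
  homomorphism.\<close>

lemma pair_triangular: "triangular pscl pbrk n ((\<lambda>h. (h, mH h)) ` cartan G)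
  (\<lambda>i z. sroot G i (fst z)) (\<lambda>i. (che G i, mE n i)) (\<lambda>i. (chf G i, mF n i))"
proof (intro triangular.intro pair_lie_algebra triangular_axioms.intro)
  interpret p: lie_algebra pscl pbrk by (rule pair_lie_algebra)
  have 0: "0 \<in> cartan G" using cartan_subspace by (rule subspace_0)
  have "mH 0 = 0" using mH_scale[OF 0, of 0] by simp
  then show "p.subspace ((\<lambda>h. (h, mH h)) ` cartan G)"
    using cartan_subspace 0
    by (auto simp: p.subspace_def subspace_def pscl_def plus_prod_def zero_prod_def mH_add mH_scale
        image_iff)
next
  fix z z' assume "z \<in> (\<lambda>h. (h, mH h)) ` cartan G" "z' \<in> (\<lambda>h. (h, mH h)) ` cartan G"
  then show "pbrk z z' = 0"
    by (auto simp: pbrk_def brk_cartan mH_def comm_diag zero_prod_def)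
next
  fix i z assume "i \<le> n" "z \<in> (\<lambda>h. (h, mH h)) ` cartan G"
  then show "pbrk z (che G i, mE n i) = pscl (sroot G i (fst z)) (che G i, mE n i)"
    "pbrk z (chf G i, mF n i) = pscl (- sroot G i (fst z)) (chf G i, mF n i)"
    by (auto simp: pbrk_def pscl_def brk_cartan_e brk_cartan_f comm_mH_mE comm_mH_mF)
next
  fix i j assume "i \<le> n" "j \<le> n" "i \<noteq> j"
  then show "pbrk (che G i, mE n i) (chf G j, mF n j) = 0"
    by (simp add: pbrk_def brk_e_f comm_mE_mF_coroot zero_prod_def)
next
  fix i assume "i \<le> n"
  then show "pbrk (che G i, mE n i) (chf G i, mF n i) \<in> (\<lambda>h. (h, mH h)) ` cartan G"
    by (simp add: pbrk_def brk_e_f comm_mE_mF_coroot scoroot_in_cartan)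
qed

end

sublocale affine_A2n2 \<subseteq> pair: triangular pscl pbrk n "(\<lambda>h. (h, mH h)) ` cartan G"
  "\<lambda>i z. sroot G i (fst z)" "\<lambda>i. (che G i, mE n i)" "\<lambda>i. (chf G i, mF n i)"
  by (rule pair_triangular)

context affine_A2n2
begin

lemma piece_root_space: "pair.piece \<gamma> (g, m) \<Longrightarrow> g \<in> root_space \<gamma>"
  unfolding root_space_def
proof safe
  fix h assume "pair.piece \<gamma> (g, m)" "h \<in> cartan G"
  then have "pbrk (h, mH h) (g, m) = pscl (\<Sum>i\<le>n. of_real (\<gamma> i) * sroot G i (fst (h, mH h))) (g, m)"
    by (intro pair.piece_weight) auto
  then show "brk G h g = scl G (wt_eval \<gamma> h) g"
    by (simp add: pbrk_def pscl_def wt_eval_def)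
qed

text \<open>The elements paired with \<open>0\<close> span an ideal that meets the Cartan subalgebra trivially and hence
  vanishes. So relations between operators of the vector representation lift to the algebra.\<close>

definition null_ideal :: "'g set" where
  "null_ideal = span (\<Union>\<gamma>\<in>{\<gamma>. \<gamma> \<noteq> 0}. {g. pair.piece \<gamma> (g, 0)})"

lemma subspace_null: "subspace {g. pair.piece \<gamma> (g, 0)}"
proof -
  have "pair.piece \<gamma> (x + y, 0)" if "pair.piece \<gamma> (x, 0)" "pair.piece \<gamma> (y, 0)" for x y
    using pair.piece_add[OF that] by (simp add: plus_prod_def)
  moreover have "pair.piece \<gamma> (scl G c x, 0)" if "pair.piece \<gamma> (x, 0)" for c x
    using pair.piece_scale[OF that, of c] by (simp add: pscl_def)
  moreover have "pair.piece \<gamma> (0, 0)"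
    using pair.piece_0[of \<gamma>] by (simp add: zero_prod_def)
  ultimately show ?thesis by (simp add: subspace_def)
qed

text \<open>Bracketing could shift the weight of a generator of the null ideal to 0, where it would
  leave the spanning set; the second hypothesis makes the bracket vanish in that case.\<close>

lemma null_ideal_generators:
  assumes "pair.piece \<gamma> (x, m)" "\<And>g. pair.piece (- \<gamma>) (g, 0) \<Longrightarrow> \<gamma> \<noteq> 0 \<Longrightarrow> brk G x g = 0"
    and "y \<in> null_ideal"
  shows "brk G x y \<in> null_ideal"
  using assms(3) unfolding null_ideal_def
proof (induction rule: span_induct_alt)
  case (step c g y)
  then obtain \<beta> where \<beta>: "\<beta> \<noteq> 0" "pair.piece \<beta> (g, 0)" by auto
  have "brk G x g \<in> span (\<Union>\<gamma>\<in>{\<gamma>. \<gamma> \<noteq> 0}. {g. pair.piece \<gamma> (g, 0)})"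
  proof (cases "\<gamma> + \<beta> = 0")
    case True
    then have "\<beta> = - \<gamma>" by (simp add: eq_neg_iff_add_eq_0 add.commute)
    then have "brk G x g = 0" using assms(2)[of g] \<beta> by auto
    then show ?thesis by (simp add: span_zero)
  next
    case False
    have "pair.piece (\<gamma> + \<beta>) (brk G x g, 0)"
      using pair.piece_bracket[OF assms(1) \<beta>(2)] by (simp add: pbrk_def)
    then show ?thesis using False by (intro span_base) auto
  qed
  then show ?case using step by (simp add: bracket_add_right bracket_scale_right span_add span_scale)
qed (simp add: span_zero)

text \<open>The elements that preserve the null ideal form a subalgebra, so generators suffice. If g
  has weight -\<alpha>_i and is paired with 0, then it is a multiple of \<open>chf G i\<close>, and
  the multiple is 0 because \<open>mF n i\<close> is not; hence \<open>che G i\<close> never moves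
  the ideal into weight 0.\<close>

lemma null_ideal_ideal: "lie_ideal null_ideal"
proof -
  let ?S = "{x. \<forall>y\<in>null_ideal. brk G x y \<in> null_ideal}"
  have sub: "subspace null_ideal" by (simp add: null_ideal_def)
  have "lie_subalgebra ?S"
    unfolding lie_subalgebra_def
  proof
    show "subspace ?S"
      using subspace_0[OF sub] subspace_add[OF sub] subspace_scale[OF sub]
      by (simp add: subspace_def bracket_add_left bracket_scale_left)
    show "\<forall>x\<in>?S. \<forall>y\<in>?S. brk G x y \<in> ?S"
      using subspace_diff[OF sub] by (simp add: bracket_bracket_left)
  qed
  moreover have "cartan G \<union> che G ` {..n} \<union> chf G ` {..n} \<subseteq> ?S"
  proof -
    have "brk G h y \<in> null_ideal" if "h \<in> cartan G" "y \<in> null_ideal" for h y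
      by (rule null_ideal_generators[of 0 h "mH h"]) (use that pair.piece_H in auto)
    moreover have "brk G (che G i) y \<in> null_ideal" if "i \<le> n" "y \<in> null_ideal" for i y
    proof (rule null_ideal_generators[OF pair.piece_e[OF that(1)] _ that(2)])
      fix g assume "pair.piece (- unitw i 1) (g, 0)"
      then obtain c where "(g, 0) = pscl c (chf G i, mF n i)"
        using pair.piece_minus_simple[of i "(g, 0)"] \<open>i \<le> n\<close> by (auto simp: unitw_minus)
      then have "g = 0" using mE_nonzero(2)[OF that(1)] by (auto simp: pscl_def)
      then show "brk G (che G i) g = 0" by simp
    qed
    moreover have "brk G (chf G i) y \<in> null_ideal" if "i \<le> n" "y \<in> null_ideal" for i y
    proof (rule null_ideal_generators[OF pair.piece_f[OF that(1)] _ that(2)])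
      fix g assume "pair.piece (- unitw i (-1)) (g, 0)"
      then obtain c where "(g, 0) = pscl c (che G i, mE n i)"
        using pair.piece_simple[of i "(g, 0)"] \<open>i \<le> n\<close> by (auto simp: unitw_minus)
      then have "g = 0" using mE_nonzero(1)[OF that(1)] by (auto simp: pscl_def)
      then show "brk G (chf G i) g = 0" by simp
    qed
    ultimately show ?thesis by auto
  qed
  ultimately have "lie_subalgebra hull (cartan G \<union> che G ` {..n} \<union> chf G ` {..n}) \<subseteq> ?S"
    by (intro hull_minimal)
  then show ?thesis using generated sub unfolding lie_ideal_def by blast
qed

text \<open>An element y of the intersection has weight 0 and is a sum of vectors of distinct
  nonzero weights. Entering -y at weight 0 gives a vanishing sum of eigenvectors with different
  eigenvalues.\<close>

lemma null_ideal_cartan: "null_ideal \<inter> cartan G = {0}"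
proof -
  have "y = 0" if y: "y \<in> null_ideal" "y \<in> cartan G" for y
  proof -
    obtain S t where S: "finite S" "S \<subseteq> {\<gamma>. \<gamma> \<noteq> 0}" "\<forall>\<gamma>\<in>S. pair.piece \<gamma> (t \<gamma>, 0)" "y = (\<Sum>\<gamma>\<in>S. t \<gamma>)"
      using span_UN_sum[of "{\<gamma>. \<gamma> \<noteq> 0}" "\<lambda>\<gamma>. {g. pair.piece \<gamma> (g, 0)}" y] subspace_null y(1)
      unfolding null_ideal_def by auto
    define S' where "S' = {\<gamma>\<in>S. t \<gamma> \<noteq> 0}"
    have S': "finite S'" "0 \<notin> S'" "(\<Sum>\<gamma>\<in>S'. t \<gamma>) = y"
      unfolding S(4) S'_def using S by (auto intro!: sum.mono_neutral_left)
    have supp: "\<gamma> i = 0" if "\<gamma> \<in> S'" "i > n" for \<gamma> i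
      using pair.piece_support[of \<gamma> "(t \<gamma>, 0)" i] that S by (auto simp: S'_def zero_prod_def)
    define v where "v \<gamma> = (if \<gamma> = 0 then - y else t \<gamma>)" for \<gamma>
    have "v 0 = 0"
    proof (rule eigenvectors_independent[of "insert 0 S'" "cartan G" v wt_eval])
      show "finite (insert 0 S')" using S' by simp
      show "(\<Sum>\<gamma>\<in>insert 0 S'. v \<gamma>) = 0"
      proof -
        have "(\<Sum>\<gamma>\<in>S'. v \<gamma>) = y" unfolding S'(3)[symmetric] v_def using S'(2) by (intro sum.cong) auto
        then show ?thesis using S' by (simp add: v_def)
      qed
    next
      fix \<gamma> h assume g: "\<gamma> \<in> insert 0 S'" "h \<in> cartan G"
      show "brk G h (v \<gamma>) = scl G (wt_eval \<gamma> h) (v \<gamma>)"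
      proof (cases "\<gamma> = 0")
        case True
        then show ?thesis using brk_cartan[OF g(2) y(2)] by (simp add: v_def wt_eval_0 bracket_minus_right)
      next
        case False
        then have "t \<gamma> \<in> root_space \<gamma>" using g S piece_root_space by (auto simp: S'_def)
        then show ?thesis using False g by (simp add: v_def root_space_def)
      qed
    next
      fix \<gamma> \<beta> assume "\<gamma> \<in> insert 0 S'" "\<beta> \<in> insert 0 S'" "\<gamma> \<noteq> \<beta>"
      then show "\<exists>h\<in>cartan G. wt_eval \<gamma> h \<noteq> wt_eval \<beta> h"
        using supp by (intro wt_eval_separates) (auto simp: weight_apply, metis)
    qed simp
    then show ?thesis by (simp add: v_def)
  qed
  moreover have "0 \<in> null_ideal" "0 \<in> cartan G"
    using cartan_subspace by (simp_all add: null_ideal_def span_zero subspace_0)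
  ultimately show ?thesis by auto
qed

lemma piece_null: "pair.piece \<gamma> (g, 0) \<Longrightarrow> \<gamma> \<noteq> 0 \<Longrightarrow> g = 0"
proof -
  assume "pair.piece \<gamma> (g, 0)" "\<gamma> \<noteq> 0"
  then have "g \<in> null_ideal" unfolding null_ideal_def by (intro span_base) auto
  then show "g = 0" using ideal_cartan[OF null_ideal_ideal null_ideal_cartan] by simp
qed

text \<open>Weight 0 must be excluded: the central element of the Cartan subalgebra is nonzero and
  is paired with the matrix 0.\<close>

lemma piece_unique: "pair.piece \<gamma> (g, m) \<Longrightarrow> pair.piece \<gamma> (g', m) \<Longrightarrow> \<gamma> \<noteq> 0 \<Longrightarrow> g = g'"
  using piece_null[of \<gamma> "g - g'"] pair.piece_diff[of \<gamma> "(g, m)" "(g', m)"]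
  by (simp add: minus_prod_def)

end

section \<open>Root vectors from the vector representation\<close>

lemma eps_0: "eps n 0 = 0"
proof -
  have "eps n 0 = - eps n 0" using eps_minus[of n 0] by simp
  then show ?thesis by (simp add: fun_eq_iff weight_apply)
qed

lemma eps_shift': "eps n (m + per n * k) = eps n m - wt n 0 0 (of_int k)"
  by (simp add: fun_eq_iff eps_shift weight_apply wt_def)

lemma eps_fold:
  assumes "m \<le> 2 * n"
  shows "eps n (int m) - eps n (int m + 1) = unitw (fold_index n m) 1"
proof (cases "m \<le> n")
  case True
  then show ?thesis by (simp add: fold_index_def eps_simple)
next
  case False
  define k where "k = 2 * n - m"
  have k: "k \<le> n" using False by (simp add: k_def)
  have "int m = - (int k + 1) + per n * 1" "int m + 1 = - int k + per n * 1"
    using assms by (simp_all add: k_def of_nat_diff)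
  then have "eps n (int m) - eps n (int m + 1) = eps n (int k) - eps n (int k + 1)"
    by (simp only: eps_shift' eps_minus) simp
  then show ?thesis using False k by (simp add: fold_index_def eps_simple k_def)
qed

lemma eps_diff_nonneg: "u \<le> v \<Longrightarrow> (eps n u - eps n v) i \<in> \<nat>"
proof (induction v rule: int_ge_induct)
  case (step v)
  have "eps n v i - eps n (v + 1) i \<in> \<nat>" unfolding eps_step by auto
  moreover have "(eps n u - eps n (v + 1)) i = (eps n u - eps n v) i + (eps n v i - eps n (v + 1) i)"
    by (simp add: weight_apply)
  ultimately show ?case using step Nats_add by metis
qed (simp add: weight_apply)

lemma eps_diff_nonzero: "1 \<le> n \<Longrightarrow> u < v \<Longrightarrow> eps n u \<noteq> eps n v"
proof
  assume n: "1 \<le> n" and uv: "u < v" and eq: "eps n u = eps n v"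
  define r where "r = u mod per n"
  have "0 \<le> r" "r < per n" unfolding r_def by (rule pos_mod_sign, simp, rule pos_mod_bound, simp)
  have "eps n u - eps n (u + 1) = unitw (fold_index n (nat r)) 1"
  proof -
    define q where "q = u div per n"
    have "u = r + per n * q" by (simp add: r_def q_def)
    then have u: "u = int (nat r) + per n * q" "u + 1 = (int (nat r) + 1) + per n * q"
      using \<open>0 \<le> r\<close> by simp_all
    have "eps n u - eps n (u + 1) = eps n (int (nat r)) - eps n (int (nat r) + 1)"
      unfolding u(2) by (subst u(1)) (simp only: eps_shift' diff_diff_eq2 diff_add_cancel)
    then show ?thesis using eps_fold[of "nat r" n] \<open>r < per n\<close> \<open>0 \<le> r\<close> by simp
  qed
  then have 1: "eps n u (fold_index n (nat r)) - eps n (u + 1) (fold_index n (nat r)) = 1"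
    by (metis minus_apply unitw_same)
  have "(eps n (u + 1) - eps n v) (fold_index n (nat r)) \<in> \<nat>" using uv by (intro eps_diff_nonneg) simp
  then have "0 \<le> (eps n (u + 1) - eps n v) (fold_index n (nat r))" by (auto elim: Nats_cases)
  then show False using 1 eq by (simp add: weight_apply)
qed

text \<open>Upward lifts are constructed only for pairs that contain the index 0; this composes two
  of them.\<close>

lemma mX_comm_through_0:
  assumes "\<not> per n dvd a" "\<not> per n dvd b" "\<not> per n dvd a - b"
  shows "comm (mX n a 0) (mX n 0 b) = mX n a b"
proof -
  have s: "sg a * sg b = sg (a + b)" by (simp add: sg_def)
  have ba: "\<not> per n dvd b - a" using assms(3) by (simp add: dvd_diff_commute)
  show ?thesis
    using assms ba
    by (simp add: comm_def mX_def left_diff_distrib right_diff_distrib pm_mult s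
        lscale.scale_right_diff_distrib lscale.scale_left_commute[of _ "sg b"] mult.commute[of "sg b"])
qed

lemma lscale_2: "lscale 2 x = x + x"
  using lscale.scale_left_distrib[of 1 1 x] by simp

lemma lscale_double: "lscale (2 * c) x = lscale c (x + x)" "lscale (c * 2) x = lscale c (x + x)"
  using lscale_2[of x] lscale.scale_scale[of c 2 x] by (simp_all add: mult.commute)

lemma lscale_3: "lscale 3 x = x + x + x" "lscale (3 * c) x = lscale c (x + x + x)"
  "lscale (c * 3) x = lscale c (x + x + x)"
proof -
  show 1: "lscale 3 x = x + x + x" for x :: "'a lop"
    using lscale.scale_left_distrib[of 2 1 x] by (simp add: lscale_2)
  show "lscale (3 * c) x = lscale c (x + x + x)" "lscale (c * 3) x = lscale c (x + x + x)"
    using 1[of x] lscale.scale_scale[of c 3 x] by (simp_all add: mult.commute)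
qed

text \<open>If the period divides a + b, the two summands of \<open>mX n b a\<close> agree up to
  sign; for odd a + b they add up, which explains both the hypothesis and the factor 2.\<close>

lemma mX_comm_from_0:
  assumes a: "\<not> per n dvd a" and b: "\<not> per n dvd b" and ab: "\<not> per n dvd a - b"
    and odd: "per n dvd a + b \<Longrightarrow> odd (a + b)"
  shows "comm (mX n 0 b) (mX n b a) = lscale (if per n dvd a + b then 2 else 1) (mX n 0 a)"
proof -
  define A1 A2 B1 B2 where "A1 = pm n 0 b" and "A2 = pm n (- b) 0"
    and "B1 = pm n b a" and "B2 = pm n (- a) (- b)"
  define u v where "u = pm n 0 a" and "v = pm n (- a) 0"
  have shift: "pm n b (a + b) = v" if "per n dvd a + b"
    unfolding v_def by (rule pm_cong) (use that in \<open>auto simp: add.commute\<close>)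
  have prods: "A1 * B1 = u" "A1 * B2 = (if per n dvd a + b then u else 0)" "A2 * B1 = 0" "A2 * B2 = 0"
    "B1 * A1 = 0" "B1 * A2 = (if per n dvd a + b then v else 0)" "B2 * A1 = 0" "B2 * A2 = v"
    unfolding A1_def A2_def B1_def B2_def pm_mult using assms shift
    by (auto simp: u_def v_def algebra_simps)
  have X: "mX n 0 b = A1 - lscale (sg b) A2" "mX n b a = B1 - lscale (sg (a + b)) B2"
    "mX n 0 a = u - lscale (sg a) v"
    by (simp_all add: mX_def A1_def A2_def B1_def B2_def u_def v_def add.commute)
  have s: "sg b * sg (a + b) = sg a" "sg (a + b) * sg b = sg a" by (simp_all add: sg_def)
  show ?thesis
  proof (cases "per n dvd a + b")
    case True
    then have t: "sg (a + b) = - 1" "sg b = - sg a" using odd by (auto simp: sg_def)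
    show ?thesis unfolding X t
      using True by (simp add: comm_def left_diff_distrib right_diff_distrib distrib_left distrib_right prods
          lscale.scale_right_diff_distrib lscale_double)
        (simp add: lscale_2)
  next
    case False
    then show ?thesis unfolding X
      by (simp add: comm_def left_diff_distrib right_diff_distrib prods s)
  qed
qed

text \<open>Sequences \<open>Y\<close>, \<open>X\<close>, \<open>H\<close> closed under bracketing with \<open>F\<close>: in all cases below \<open>F\<close> is a
  root vector for a positive root \<open>\<beta>\<close>, \<open>Y i\<close>, \<open>X i\<close> are root vectors for \<open>- \<beta>\<close>, \<open>- 2 \<beta>\<close> plus
  multiples of the degree, and \<open>H i\<close> is imaginary.\<close>

definition family ::
  "(complex \<Rightarrow> 'l \<Rightarrow> 'l) \<Rightarrow> ('l \<Rightarrow> 'l \<Rightarrow> 'l::ab_group_add) \<Rightarrow> 'l \<Rightarrow> (nat \<Rightarrow> 'l) \<Rightarrow> (nat \<Rightarrow> 'l) \<Rightarrow> (nat \<Rightarrow> 'l) \<Rightarrow>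
    (nat \<Rightarrow> complex) \<Rightarrow> (nat \<Rightarrow> nat \<Rightarrow> complex) \<Rightarrow> (nat \<Rightarrow> nat \<Rightarrow> complex) \<Rightarrow> (nat \<Rightarrow> nat \<Rightarrow> complex) \<Rightarrow> bool" where
  "family sc br F Y X H \<eta> \<mu> \<nu> \<tau> \<longleftrightarrow>
     (\<forall>i. br F (Y i) = H i) \<and>
     (\<forall>i. br F (X i) = sc (\<eta> i) (Y (Suc i))) \<and>
     (\<forall>i j. br (H i) (Y j) = sc (\<mu> i j) (Y (Suc (i + j)))) \<and>
     (\<forall>i j. br (H i) (X j) = sc (\<nu> i j) (X (Suc (i + j)))) \<and>
     (\<forall>i j. br (Y i) (Y j) = sc (\<tau> i j) (X (i + j))) \<and>
     (\<forall>i j. br (X i) (X j) = 0) \<and>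
     (\<forall>i j. br (X i) (Y j) = 0)"

definition sl2_family where
  "sl2_family sc br F Y H \<longleftrightarrow>
     family sc br F Y (\<lambda>_. 0) H (\<lambda>_. 0) (\<lambda>_ _. 2) (\<lambda>_ _. 0) (\<lambda>_ _. 0)"

text \<open>Indices count multiples of \<delta>/2, hence the gaps: -\<alpha>/2 + (i/2)\<delta> is a
  root only for odd i, and -\<alpha> + (i/2)\<delta> only if 4 divides i. The constants have period
  4; their sums over antidiagonals are what the commutation identity needs.\<close>

definition twisted_family where
  "twisted_family sc br F Y X H \<longleftrightarrow>
     (\<forall>i. even i \<longrightarrow> Y i = 0) \<and> (\<forall>i. \<not> 4 dvd i \<longrightarrow> X i = 0) \<and>
     family sc br F Y X H (\<lambda>i. if 4 dvd i then 1 else 0)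
      (\<lambda>i j. if i mod 4 = 1 then 6 else if i mod 4 = 3 then 2 else 0)
      (\<lambda>i j. if i mod 4 = 3 then 4 else 0)
      (\<lambda>i j. if i mod 4 = 1 \<and> j mod 4 = 3 then 4 else if i mod 4 = 3 \<and> j mod 4 = 1 then - 4 else 0)"

section \<open>Explicit families of matrices for short, half-long and long roots\<close>

definition Q :: "nat \<Rightarrow> int \<Rightarrow> int \<Rightarrow> int \<Rightarrow> int lop" where
  "Q n u v k = pm n u (v + per n * k)"

lemma Q_same: "Q n u v k * Q n v w l = Q n u w (k + l)"
proof -
  have "per n dvd v + per n * k - v" by simp
  moreover have "w + per n * l + (v + per n * k) - v = w + per n * (k + l)" by (simp add: distrib_left)
  ultimately show ?thesis by (simp only: Q_def pm_mult if_True)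
qed

lemma Q_diff: "\<not> per n dvd v - w \<Longrightarrow> Q n u v k * Q n w x l = 0"
proof -
  assume "\<not> per n dvd v - w"
  moreover have "v + per n * k - w = (v - w) + per n * k" by simp
  ultimately have "\<not> per n dvd v + per n * k - w" by (metis dvd_add_left_iff dvd_triv_left)
  then show ?thesis by (simp add: Q_def pm_mult)
qed

text \<open>For a short root \<open>eps n a - eps n b\<close>.\<close>

definition short_F where
  "short_F n a b = - (Q n a b 1 + lscale (sg (a + b)) (Q n (- b) (- a) 1))"

text \<open>Equals \<open>mX n b (a + p N)\<close> for the period N; N is odd, so the sign
  alternates with p. Likewise \<open>short_F\<close> is minus \<open>mX n a (b + N)\<close>, the
  minus sign making the constant of the family +2.\<close>

definition short_Y where
  "short_Y n a b p = Q n b a (int p) - lscale (sg (a + b + int p)) (Q n (- a) (- b) (int p))"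

lemma short_sl2_family:
  assumes "\<not> per n dvd a" "\<not> per n dvd b" "\<not> per n dvd a - b" "\<not> per n dvd a + b"
    "\<not> per n dvd 2 * a" "\<not> per n dvd 2 * b"
  shows "sl2_family lscale comm (short_F n a b) (short_Y n a b)
    (\<lambda>i. comm (short_F n a b) (short_Y n a b i))"
proof -
  have d: "\<not> per n dvd b - a" "\<not> per n dvd a - - a" "\<not> per n dvd - a - a" "\<not> per n dvd b - - b"
    "\<not> per n dvd - b - b" "\<not> per n dvd a - - b" "\<not> per n dvd - a - b" "\<not> per n dvd b - - a"
    "\<not> per n dvd - b - a" "\<not> per n dvd - a - - b" "\<not> per n dvd - b - - a"
  proof -
    have e: "- a - a = - (2 * a)" "- b - b = - (2 * b)" "- a - b = - (a + b)" "- b - a = - (a + b)"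
      by simp_all
    show "\<not> per n dvd - a - a" "\<not> per n dvd - b - b" "\<not> per n dvd - a - b" "\<not> per n dvd - b - a"
      unfolding e dvd_minus_iff using assms by simp_all
  qed (use assms in \<open>simp_all add: dvd_diff_commute add.commute\<close>)
  note Qd = d[THEN Q_diff] assms(3)[THEN Q_diff]
  have sg: "sg (x + int p) = sg x * sg (int p)" "sg x * sg x = 1" for x p by (simp_all add: sg_def)
  define s where "s = sg (a + b)"
  have s: "s * s = 1" "s * (s * x) = x" for x using sg(2)[of "a + b"] by (simp_all add: s_def flip: mult.assoc)
  have Y: "short_Y n a b p = Q n b a (int p) - lscale (s * sg (int p)) (Q n (- a) (- b) (int p))" for p
    by (simp add: short_Y_def sg(1) s_def)
  have F: "short_F n a b = - (Q n a b 1 + lscale s (Q n (- b) (- a) 1))"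
    by (simp add: short_F_def s_def)
  note simps = comm_def left_diff_distrib right_diff_distrib distrib_left distrib_right Q_same Qd
    lscale.scale_right_diff_distrib lscale.scale_right_distrib
  have H: "comm (short_F n a b) (short_Y n a b p) = Q n b b (int p + 1) - Q n a a (int p + 1)
     + lscale (sg (int p)) (Q n (- b) (- b) (int p + 1) - Q n (- a) (- a) (int p + 1))" for p
    unfolding F Y by (simp add: simps s add.commute[of 1])
  have HY: "comm (comm (short_F n a b) (short_Y n a b p)) (short_Y n a b q) =
      lscale 2 (short_Y n a b (Suc (p + q)))" for p q
  proof -
    define t r where "t = sg (int p)" and "r = sg (int q)"
    have "sg (int (Suc (p + q))) = - (t * r)" by (simp add: sg_def t_def r_def)
    then have Y': "short_Y n a b (Suc (p + q)) =
        Q n b a (int p + int q + 1) + lscale (s * t * r) (Q n (- a) (- b) (int p + int q + 1))"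
      unfolding Y by (simp add: add_ac mult_ac)
    have i: "int p + 1 + int q = int p + int q + 1" "int q + (int p + 1) = int p + int q + 1" by simp_all
    show ?thesis unfolding H Y' Y[of q] t_def[symmetric] r_def[symmetric]
      unfolding lscale_2 by (simp add: simps i mult_ac add_ac)
  qed
  have YY: "comm (short_Y n a b p) (short_Y n a b q) = 0" for p q
    unfolding Y by (simp add: simps)
  show ?thesis unfolding sl2_family_def family_def
    by (auto simp: HY YY)
qed

text \<open>An element of weight -\<delta> that takes each member of the short and of the half-long
  family to a nonzero multiple of the preceding one. By descent to degree 0 it shows that lifted
  root vectors do not vanish.\<close>

definition lowering where
  "lowering n a = lscale 2 (Q n 0 0 (- 1)) - Q n a a (- 1) - Q n (- a) (- a) (- 1)"

lemma lowering_comm: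
  assumes "\<not> per n dvd a"
  shows "comm (mX n (per n) a) (mX n a 0) = lowering n a"
proof -
  have s: "sg (per n + a) = - sg a" "sg a * sg a = 1" by (simp_all add: sg_def)
  have d: "\<not> per n dvd a - 0" "\<not> per n dvd 0 - a" "\<not> per n dvd - a - 0" "\<not> per n dvd 0 - - a"
    using assms by simp_all
  note Qd = d[THEN Q_diff]
  have X: "mX n (per n) a = Q n 0 a (- 1) + lscale (sg a) (Q n (- a) 0 (- 1))"
    "mX n a 0 = Q n a 0 0 - lscale (sg a) (Q n 0 (- a) 0)"
  proof -
    have "pm n (per n) a = Q n 0 a (- 1)" unfolding Q_def by (rule pm_cong) simp_all
    moreover have "pm n (- a) (- per n) = Q n (- a) 0 (- 1)" by (simp add: Q_def)
    ultimately show "mX n (per n) a = Q n 0 a (- 1) + lscale (sg a) (Q n (- a) 0 (- 1))"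
      unfolding mX_def s(1) by simp
    show "mX n a 0 = Q n a 0 0 - lscale (sg a) (Q n 0 (- a) 0)" by (simp add: mX_def Q_def)
  qed
  show ?thesis unfolding X lowering_def lscale_2
    by (simp add: comm_def left_diff_distrib right_diff_distrib distrib_left distrib_right Q_same Qd s
        lscale.scale_right_diff_distrib lscale.scale_right_distrib add_ac)
qed

lemma lowering_short:
  assumes "\<not> per n dvd a" "\<not> per n dvd b" "\<not> per n dvd a - b" "\<not> per n dvd a + b"
    "\<not> per n dvd 2 * a"
  shows "comm (lowering n a) (short_Y n a b (Suc p)) = short_Y n a b p"
proof -
  have e: "- a - a = - (2 * a)" "- a - b = - (a + b)" by simp_all
  have d: "\<not> per n dvd a - 0" "\<not> per n dvd 0 - a" "\<not> per n dvd - a - 0" "\<not> per n dvd 0 - - a"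
    "\<not> per n dvd b - a" "\<not> per n dvd a - b" "\<not> per n dvd - a - b" "\<not> per n dvd b - - a"
    "\<not> per n dvd - a - a" "\<not> per n dvd a - - a" "\<not> per n dvd 0 - b" "\<not> per n dvd - b - - a"
    "\<not> per n dvd - b - 0" "\<not> per n dvd - b - a"  "\<not> per n dvd a - - b"
    using assms unfolding e dvd_minus_iff by (simp_all add: dvd_diff_commute add.commute)
  note Qd = d[THEN Q_diff]
  have s: "sg (a + b + int (Suc p)) = - sg (a + b + int p)" by (simp add: sg_def)
  show ?thesis unfolding short_Y_def s lowering_def
    by (simp add: comm_def left_diff_distrib right_diff_distrib distrib_left distrib_right Q_same Qd
        lscale.scale_right_diff_distrib lscale.scale_right_distrib)
qed

text \<open>For half of a long root \<open>eps n i - eps n (- i + per n)\<close>. The signs make \<open>tw_y 0\<close> and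
  \<open>tw_x 0\<close> correspond under bracketing with \<open>tw_F\<close>.\<close>

definition tw_F where
  "tw_F n i = Q n i 0 1 + lscale (sg i) (Q n 0 (- i) 1)"

definition tw_x where
  "tw_x n i p = lscale (- sg i) (Q n (- i) i (2 * int p - 1))"

definition tw_y where
  "tw_y n i q = lscale (sg i) (Q n (- i) 0 (int q)) - lscale (sg (int q)) (Q n 0 i (int q))"

definition tw_h where
  "tw_h n i q = lscale (1 + sg (int q)) (Q n 0 0 (int q + 1)) - lscale (sg (int q)) (Q n i i (int q + 1))
     - Q n (- i) (- i) (int q + 1)"

lemma tw_comm:
  assumes "\<not> per n dvd i" "\<not> per n dvd 2 * i"
  shows "comm (tw_F n i) (tw_x n i p) = tw_y n i (2 * p)"
    "comm (tw_F n i) (tw_y n i q) = tw_h n i q"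
    "comm (tw_h n i q) (tw_y n i r) = lscale (- 2 - sg (int q)) (tw_y n i (Suc (q + r)))"
    "comm (tw_h n i q) (tw_x n i p) = (if even q then 0 else lscale (- 2) (tw_x n i (p + Suc q div 2)))"
    "comm (tw_y n i q) (tw_y n i r) =
      (if odd (q + r) then lscale (if even q then - 2 else 2) (tw_x n i (Suc (q + r) div 2)) else 0)"
    "comm (tw_x n i p) (tw_x n i p') = 0"
    "comm (tw_x n i p) (tw_y n i q) = 0"
    "comm (lowering n i) (tw_y n i (Suc q)) = lscale (- 3) (tw_y n i q)"
proof -
  have e: "- i - i = - (2 * i)" by simp
  have d: "\<not> per n dvd i - 0" "\<not> per n dvd 0 - i" "\<not> per n dvd - i - 0" "\<not> per n dvd 0 - - i"
    "\<not> per n dvd - i - i" "\<not> per n dvd i - - i"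
    using assms unfolding e dvd_minus_iff by simp_all
  note Qd = d[THEN Q_diff]
  define s where "s = sg i"
  have s: "s * s = 1" "s * (s * x) = x" for x by (simp_all add: s_def sg_def flip: mult.assoc)
  note simps = comm_def left_diff_distrib right_diff_distrib distrib_left distrib_right Q_same Qd s
    lscale.scale_right_diff_distrib lscale.scale_right_distrib
  note defs = tw_F_def tw_x_def tw_y_def tw_h_def lowering_def s_def[symmetric]
  show "comm (tw_F n i) (tw_x n i p) = tw_y n i (2 * p)"
    unfolding defs by (simp add: simps sg_def)
  show "comm (tw_F n i) (tw_y n i q) = tw_h n i q"
    unfolding defs by (simp add: simps add_ac lscale.scale_left_distrib)
  show "comm (tw_h n i q) (tw_y n i r) = lscale (- 2 - sg (int q)) (tw_y n i (Suc (q + r)))"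
  proof -
    have "int q + 1 + int r = 1 + (int q + int r)" "int r + (int q + 1) = 1 + (int q + int r)" by simp_all
    then show ?thesis unfolding defs
      by (auto simp: simps sg_def lscale_2 lscale_double lscale.scale_left_diff_distrib
          lscale.scale_right_distrib algebra_simps)
  qed
  show "comm (tw_x n i p) (tw_x n i p') = 0" "comm (tw_x n i p) (tw_y n i q) = 0"
    unfolding defs by (simp_all add: simps)
  show "comm (lowering n i) (tw_y n i (Suc q)) = lscale (- 3) (tw_y n i q)"
    unfolding defs by (auto simp: simps sg_def lscale_2 lscale_3 lscale_double
        lscale.scale_right_distrib algebra_simps)
  show "comm (tw_h n i q) (tw_x n i p) = (if even q then 0 else lscale (- 2) (tw_x n i (p + Suc q div 2)))"
  proof -
    have "tw_x n i (p + Suc q div 2) = lscale (- s) (Q n (- i) i (int q + 2 * int p))" if "odd q"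
    proof -
      have "2 * int (p + Suc q div 2) - 1 = int q + 2 * int p" using that by (auto elim!: oddE)
      then show ?thesis by (simp only: tw_x_def s_def)
    qed
    then show ?thesis unfolding tw_h_def tw_x_def[of n i p] s_def[symmetric]
      by (auto simp: simps sg_def lscale_2 lscale_double lscale.scale_right_distrib algebra_simps)
  qed
  show "comm (tw_y n i q) (tw_y n i r) =
      (if odd (q + r) then lscale (if even q then - 2 else 2) (tw_x n i (Suc (q + r) div 2)) else 0)"
  proof -
    have i: "2 * int (Suc (q + r) div 2) - 1 = int q + int r" if "odd (q + r)"
      using that by (auto elim!: oddE simp del: odd_add)
    show ?thesis unfolding defs using i
      by (auto simp: simps sg_def lscale_2 lscale_double lscale.scale_right_distrib algebra_simps)
  qed
qed

text \<open>In \<open>tw_comm\<close> an element \<open>tw_h n i q\<close> multiplies by -3 or -1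
  and raises q by one. Rescaling by (-1/2)^q contributes a factor -2 per step, giving 6 and 2, whose
  sum over a period of four indices is 8; (1/4)^p is the matching scale for
  \<open>tw_x\<close>.\<close>

definition tw_Y where
  "tw_Y n u i = (if odd i then lscale ((- 1 / 2) ^ (i div 2)) (tw_y n u (i div 2)) else 0)"

definition tw_X where
  "tw_X n u i = (if 4 dvd i then lscale ((1 / 4) ^ (i div 4)) (tw_x n u (i div 4)) else 0)"

lemma tw_family:
  assumes u: "\<not> per n dvd u" "\<not> per n dvd 2 * u"
  shows "twisted_family lscale comm (tw_F n u) (tw_Y n u) (tw_X n u) (\<lambda>i. comm (tw_F n u) (tw_Y n u i))"
proof -
  note tw = tw_comm[OF u]
  have pw: "(- 1 / 2 :: complex) ^ (2 * p) = (1 / 4) ^ p" for p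
    by (simp add: power_mult power2_eq_square)
  have pw': "(1 / 2 :: complex) ^ (2 * p) = (1 / 4) ^ p" for p
    by (simp add: power_mult power2_eq_square)
  have Y: "tw_Y n u (Suc (2 * q)) = lscale ((- 1 / 2) ^ q) (tw_y n u q)" for q
    by (simp add: tw_Y_def)
  have Y0: "tw_Y n u i = 0" if "even i" for i using that by (simp add: tw_Y_def)
  have X: "tw_X n u (4 * p) = lscale ((1 / 4) ^ p) (tw_x n u p)" for p
    by (simp add: tw_X_def)
  have X0: "tw_X n u i = 0" if "\<not> 4 dvd i" for i using that by (simp add: tw_X_def)
  have H: "comm (tw_F n u) (tw_Y n u (Suc (2 * q))) = lscale ((- 1 / 2) ^ q) (tw_h n u q)" for q
    by (simp add: Y comm.bracket_scale_right tw)
  have m4: "Suc (2 * q) mod 4 = (if even q then 1 else 3)" for q :: nat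
    by (cases "even q"; simp; presburger)
  have FX: "comm (tw_F n u) (tw_X n u i) = lscale (if 4 dvd i then 1 else 0) (tw_Y n u (Suc i))" for i
  proof (cases "4 dvd i")
    case True
    then obtain p where "i = 4 * p" by auto
    then show ?thesis using Y[of "2 * p"] by (simp add: X comm.bracket_scale_right tw pw pw')
  qed (simp add: X0)
  have HY: "comm (comm (tw_F n u) (tw_Y n u i)) (tw_Y n u j) =
      lscale (if i mod 4 = 1 then 6 else if i mod 4 = 3 then 2 else 0) (tw_Y n u (Suc (i + j)))" for i j
  proof (cases "odd i \<and> odd j")
    case True
    then obtain q r where qr: "i = Suc (2 * q)" "j = Suc (2 * r)" by (auto elim!: oddE)
    have "i mod 4 = (if even q then 1 else 3)" unfolding qr(1) by (rule m4)
    moreover have "Suc (i + j) = Suc (2 * Suc (q + r))" using qr by simp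
    ultimately show ?thesis unfolding qr(1,2)
      by (simp only: H Y comm.bracket_scale_right comm.bracket_scale_left tw lscale.scale_scale)
         (auto simp: sg_def power_add)
  next
    case False
    have "even i" if "i mod 4 \<noteq> 1" "i mod 4 \<noteq> 3" using that by presburger
    moreover have "odd i" if "i mod 4 = 1 \<or> i mod 4 = 3" using that by presburger
    ultimately show ?thesis using False by (auto simp: Y0)
  qed
  have HX: "comm (comm (tw_F n u) (tw_Y n u i)) (tw_X n u j) =
      lscale (if i mod 4 = 3 then 4 else 0) (tw_X n u (Suc (i + j)))" for i j
  proof (cases "odd i \<and> 4 dvd j")
    case True
    then obtain q p where qp: "i = Suc (2 * q)" "j = 4 * p" by (auto elim!: oddE)
    show ?thesis
    proof (cases "even q")
      case True
      then have "i mod 4 \<noteq> 3" unfolding qp by presburger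
      then show ?thesis unfolding qp using True
        by (simp add: H X comm.bracket_scale_right comm.bracket_scale_left tw)
    next
      case False
      then obtain l where l: "q = Suc (2 * l)" by (auto elim!: oddE)
      have "i mod 4 = 3" "Suc (i + j) = 4 * (p + Suc l)" unfolding qp l by presburger+
      moreover have "p + Suc q div 2 = p + Suc l" using l by simp
      moreover have "(- 1 / 2 :: complex) ^ q = - 1 / 2 * (1 / 4) ^ l" by (simp add: l pw pw')
      ultimately show ?thesis using False qp
        by (simp only: H X comm.bracket_scale_right comm.bracket_scale_left tw lscale.scale_scale)
           (simp add: power_add mult.commute)
    qed
  next
    case False
    have "\<not> 4 dvd Suc (i + j)" if "\<not> 4 dvd j" "i mod 4 = 3" using that by presburger
    moreover have "i mod 4 \<noteq> 3" if "even i" using that by presburger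
    ultimately show ?thesis using False by (auto simp: Y0 X0)
  qed
  have YY: "comm (tw_Y n u i) (tw_Y n u j) =
      lscale (if i mod 4 = 1 \<and> j mod 4 = 3 then 4 else if i mod 4 = 3 \<and> j mod 4 = 1 then - 4 else 0)
        (tw_X n u (i + j))" for i j
  proof (cases "odd i \<and> odd j")
    case True
    then obtain q r where qr: "i = Suc (2 * q)" "j = Suc (2 * r)" by (auto elim!: oddE)
    have m: "i mod 4 = (if even q then 1 else 3)" "j mod 4 = (if even r then 1 else 3)"
      unfolding qr by (rule m4)+
    show ?thesis
    proof (cases "odd (q + r)")
      case True
      then obtain k where k: "q + r = Suc (2 * k)" by (metis oddE Suc_eq_plus1)
      have ij: "i + j = 4 * Suc k" using qr k by simp
      have pk: "(- 1 / 2 :: complex) ^ q * (- 1 / 2) ^ r = - 1 / 2 * (1 / 4) ^ k"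
        unfolding power_add[symmetric] k by (simp add: pw pw')
      have "Suc (q + r) div 2 = Suc k" using k by simp
      moreover have "even q \<longleftrightarrow> odd r" using True by simp
      ultimately show ?thesis using True unfolding ij X m unfolding qr Y
        by (simp only: comm.bracket_scale_right comm.bracket_scale_left tw lscale.scale_scale if_True
            mult.assoc[symmetric] mult.commute[of "(- 1 / 2) ^ r"] pk) auto
    next
      case False
      then have "even q \<longleftrightarrow> even r" by simp
      then show ?thesis unfolding m unfolding qr Y using False
        by (simp add: comm.bracket_scale_right comm.bracket_scale_left tw)
    qed
  next
    case False
    have "even i \<or> even j" using False by simp
    moreover have "odd i" if "i mod 4 = 1 \<or> i mod 4 = 3" using that by presburger
    moreover have "odd j" if "j mod 4 = 1 \<or> j mod 4 = 3" using that by presburger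
    ultimately show ?thesis by (auto simp: Y0)
  qed
  have XX: "comm (tw_X n u i) (tw_X n u j) = 0" "comm (tw_X n u i) (tw_Y n u j) = 0" for i j
    by (auto simp: tw_X_def tw_Y_def comm.bracket_scale_right comm.bracket_scale_left tw)
  show ?thesis unfolding twisted_family_def family_def
    using Y0 X0 FX HY HX YY XX by simp
qed

definition long_F where
  "long_F n u = - Q n u (- u) 3"

definition long_Y where
  "long_Y n u p = Q n (- u) u (2 * int p - 1)"

lemma long_sl2_family:
  assumes "\<not> per n dvd 2 * u"
  shows "sl2_family lscale comm (long_F n u) (long_Y n u) (\<lambda>i. comm (long_F n u) (long_Y n u i))"
proof -
  have e: "- u - u = - (2 * u)" by simp
  have d: "\<not> per n dvd - u - u" "\<not> per n dvd u - - u"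
    using assms unfolding e dvd_minus_iff by simp_all
  note Qd = d[THEN Q_diff]
  note simps = comm_def left_diff_distrib right_diff_distrib distrib_left distrib_right Q_same Qd
  have i: "2 * int p + 2 + (2 * int q - 1) = 2 * int (Suc (p + q)) - 1"
    "2 * int q - 1 + (2 * int p + 2) = 2 * int (Suc (p + q)) - 1" for p q by simp_all
  have H: "comm (long_F n u) (long_Y n u p) = Q n (- u) (- u) (2 * int p + 2) - Q n u u (2 * int p + 2)" for p
    unfolding long_F_def long_Y_def by (simp add: simps add.commute)
  have HY: "comm (comm (long_F n u) (long_Y n u p)) (long_Y n u q) = lscale 2 (long_Y n u (Suc (p + q)))" for p q
    unfolding H lscale_2 unfolding long_Y_def by (simp only: simps i) simp
  have YY: "comm (long_Y n u p) (long_Y n u q) = 0" for p q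
    unfolding long_Y_def by (simp add: simps)
  show ?thesis unfolding sl2_family_def family_def by (auto simp: HY YY)
qed

text \<open>Yields a lift at weight \<alpha> + 2\<delta> from lifts at \<delta> and at (\<alpha> +
  \<delta>)/2.\<close>

lemma long_F_eq:
  assumes u: "\<not> per n dvd u" "\<not> per n dvd 2 * u"
  shows "comm (comm (tw_h n u 0) (tw_F n u)) (tw_F n u) = lscale (6 * sg u) (long_F n u)"
proof -
  have e: "- u - u = - (2 * u)" by simp
  have d: "\<not> per n dvd u - 0" "\<not> per n dvd 0 - u" "\<not> per n dvd - u - 0" "\<not> per n dvd 0 - - u"
    "\<not> per n dvd - u - u" "\<not> per n dvd u - - u"
    using assms unfolding e dvd_minus_iff by simp_all
  note Qd = d[THEN Q_diff]
  have s: "sg 0 = 1" by (simp add: sg_def)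
  show ?thesis unfolding tw_h_def tw_F_def long_F_def
    by (simp add: s comm_def left_diff_distrib right_diff_distrib distrib_left distrib_right Q_same Qd
        lscale.scale_right_diff_distrib lscale.scale_right_distrib)
       (simp flip: lscale.scale_left_distrib lscale.scale_left_diff_distrib lscale.scale_minus_left)
qed

section \<open>Lifting root vectors to the Kac--Moody algebra\<close>

context affine_A2n2
begin

definition liftable :: "weight \<Rightarrow> int lop \<Rightarrow> bool" where
  "liftable \<gamma> m \<longleftrightarrow> (\<exists>g. pair.piece \<gamma> (g, m))"

lemma piece_comm: "pair.piece \<gamma> (g, m) \<Longrightarrow> pair.piece \<delta> (g', m') \<Longrightarrow>
    pair.piece (\<gamma> + \<delta>) (brk G g g', comm m m')"
  using pair.piece_bracket[of \<gamma> "(g, m)" \<delta> "(g', m')"] by (simp add: pbrk_def)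

lemma piece_lscale: "pair.piece \<gamma> (g, m) \<Longrightarrow> pair.piece \<gamma> (scl G c g, lscale c m)"
  using pair.piece_scale[of \<gamma> "(g, m)" c] by (simp add: pscl_def)

lemma piece_zero: "pair.piece \<gamma> (0, 0)"
  using pair.piece_0[of \<gamma>] by (simp add: zero_prod_def)

lemma liftable_comm: "liftable \<gamma> m \<Longrightarrow> liftable \<delta> m' \<Longrightarrow> liftable (\<gamma> + \<delta>) (comm m m')"
  unfolding liftable_def using piece_comm by blast

lemma liftable_scale: "liftable \<gamma> m \<Longrightarrow> liftable \<gamma> (lscale c m)"
  unfolding liftable_def using piece_lscale by blast

lemma liftable_unscale: "liftable \<gamma> (lscale c m) \<Longrightarrow> c \<noteq> 0 \<Longrightarrow> liftable \<gamma> m"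
  using liftable_scale[of \<gamma> "lscale c m" "1 / c"] by simp

lemma liftable_0: "liftable \<gamma> 0"
  unfolding liftable_def using piece_zero by blast

lemma fin_alg_subalgebra: "lie_subalgebra fin_alg"
  unfolding fin_alg_def
  by (rule hull_in) (auto simp: lie_subalgebra_def intro: subspace_Inter)

lemma chf_fin_alg: "1 \<le> i \<Longrightarrow> i \<le> n \<Longrightarrow> chf G i \<in> fin_alg"
  unfolding fin_alg_def by (rule hull_inc) auto

text \<open>Each step brackets with one lowering generator. For a \<ge> 1 only generators with index
  at least 1 occur, so the lift stays in the finite-dimensional subalgebra.\<close>

lemma lift_mX_down:
  assumes "a < b" "b \<le> 2 * n"
  shows "\<exists>g. pair.piece (eps n (int b) - eps n (int a)) (g, mX n (int b) (int a)) \<and> (1 \<le> a \<longrightarrow> g \<in> fin_alg)"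
  using assms
proof (induction b)
  case (Suc b)
  let ?k = "fold_index n b"
  have k: "?k \<le> n" "1 \<le> b \<longrightarrow> 1 \<le> ?k" using Suc.prems by (auto simp: fold_index_def)
  have w: "eps n (int b + 1) - eps n (int b) = unitw ?k (- 1)"
    using eps_fold[of b n] Suc.prems unfolding unitw_minus by (metis minus_diff_eq Suc_leD)
  have f: "pair.piece (unitw ?k (- 1)) (chf G ?k, mF n ?k)" using k pair.piece_f by blast
  show ?case
  proof (cases "a = b")
    case True
    \<comment> \<open>An adjacent pair is a simple root vector up to a factor 1/2 at b = 0, 2 at b =
      n and 1 elsewhere, by the normalization of \<open>mF\<close>; beyond n the step folds back to
      2n - b.\<close>
    have "\<exists>c. mX n (int b + 1) (int b) = lscale c (mF n ?k)"
    proof -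
      consider "b < n" | "b = n" | "n < b" by linarith
      then show ?thesis
      proof cases
        case 1
        then show ?thesis
          by (intro exI[of _ "if b = 0 then 1 / 2 else 1"]) (simp add: fold_index_def mF_def)
      next
        case 2
        have "pm n (- int n) (- int n - 1) = pm n (int n + 1) (int n)"
          by (rule pm_cong[symmetric]) simp_all
        then have "mX n (int b + 1) (int b) = lscale 2 (mF n ?k)"
          using 2 by (simp add: fold_index_def mF_def mX_def sg_def lscale_2)
        then show ?thesis by blast
      next
        case 3
        have "mX n (int b + 1) (int b) = lscale (- sg (int b + 1 + int b)) (mX n (- int b) (- (int b + 1)))"
          by (rule mX_swap)
        also have "- sg (int b + 1 + int b) = 1" by (simp add: sg_def)
        also have "mX n (- int b) (- (int b + 1)) = mX n (- int b + per n) (- (int b + 1) + per n)"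
          by (rule mX_shift[symmetric]) simp
        finally have "mX n (int b + 1) (int b) =
            lscale 1 (mX n (- int b + per n) (- (int b + 1) + per n))" .
        moreover have "- int b + per n = int ?k + 1" "- (int b + 1) + per n = int ?k"
          using 3 Suc.prems by (simp_all add: fold_index_def of_nat_diff)
        ultimately have "mX n (int b + 1) (int b) = lscale 1 (mX n (int ?k + 1) (int ?k))"
          by (simp only:)
        moreover have "?k < n" "?k \<noteq> 0" using 3 Suc.prems by (auto simp: fold_index_def)
        ultimately show ?thesis by (intro exI[of _ 1]) (simp add: mF_def)
      qed
    qed
    then obtain c where c: "mX n (int b + 1) (int b) = lscale c (mF n ?k)" by blast
    have "pair.piece (eps n (int (Suc b)) - eps n (int b)) (scl G c (chf G ?k), mX n (int (Suc b)) (int b))"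
    proof -
      have "int (Suc b) = int b + 1" by simp
      then show ?thesis using piece_lscale[OF f, of c] by (simp only: w c)
    qed
    moreover have "scl G c (chf G ?k) \<in> fin_alg" if "1 \<le> a"
      using that True k chf_fin_alg fin_alg_subalgebra
      by (auto simp: lie_subalgebra_def intro: subspace_scale)
    ultimately show ?thesis using True by blast
  next
    case False
    then have ab: "a < b" using Suc.prems by simp
    then obtain g where g: "pair.piece (eps n (int b) - eps n (int a)) (g, mX n (int b) (int a))"
      "1 \<le> a \<longrightarrow> g \<in> fin_alg" using Suc.IH[OF ab Suc_leD[OF Suc.prems(2)]] by blast
    obtain c where c: "c \<noteq> 0"
      "comm (mF n ?k) (mX n (int b) (int a)) = lscale c (mX n (int b + 1) (int a))"
      using mX_step_down[OF n_pos ab] Suc.prems by auto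
    have "pair.piece (unitw ?k (- 1) + (eps n (int b) - eps n (int a)))
        (scl G (1 / c) (brk G (chf G ?k) g), lscale (1 / c) (lscale c (mX n (int b + 1) (int a))))"
      using piece_lscale[OF piece_comm[OF f g(1)], of "1 / c"] by (simp add: c)
    then have "pair.piece (eps n (int b + 1) - eps n (int a))
        (scl G (1 / c) (brk G (chf G ?k) g), mX n (int b + 1) (int a))"
      unfolding w[symmetric] using c(1) by simp
    moreover have "scl G (1 / c) (brk G (chf G ?k) g) \<in> fin_alg" if "1 \<le> a"
      using that ab g(2) k chf_fin_alg fin_alg_subalgebra
      by (auto simp: lie_subalgebra_def intro: subspace_scale)
    ultimately show ?thesis by (auto simp: add.commute)
  qed
qed simp

lemma lift_mX_up:
  assumes "1 \<le> b" "b \<le> 2 * n"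
  shows "liftable (eps n 0 - eps n (int b)) (mX n 0 (int b))"
  using assms
proof (induction b)
  case (Suc b)
  let ?k = "fold_index n b"
  have k: "?k \<le> n" using Suc.prems by (auto simp: fold_index_def)
  have w: "eps n (int b) - eps n (int b + 1) = unitw ?k 1"
    using eps_fold[of b n] Suc.prems by simp
  have e: "liftable (unitw ?k 1) (mE n ?k)" using k pair.piece_e unfolding liftable_def by blast
  show ?case
  proof (cases "b = 0")
    case True
    then show ?thesis using e n_pos w by (simp add: fold_index_def mE_def)
  next
    case False
    then have g: "liftable (eps n 0 - eps n (int b)) (mX n 0 (int b))"
      using Suc.prems by (intro Suc.IH) auto
    obtain c where c: "c \<noteq> 0"
      "comm (mE n ?k) (mX n 0 (int b)) = lscale c (mX n 0 (int b + 1))"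
      using mX_step_up[OF n_pos, of b] False Suc.prems by auto
    have "liftable (unitw ?k 1 + (eps n 0 - eps n (int b))) (mX n 0 (int b + 1))"
      using liftable_comm[OF e g] c liftable_unscale by metis
    moreover have "unitw ?k 1 + (eps n 0 - eps n (int b)) = eps n 0 - eps n (int (Suc b))"
      unfolding w[symmetric] by (simp add: add.commute)
    moreover have "int b + 1 = int (Suc b)" by simp
    ultimately show ?thesis by (simp only:)
  qed
qed simp

lemma che_nonzero: "i \<le> n \<Longrightarrow> che G i \<noteq> 0"
proof
  assume i: "i \<le> n" and "che G i = 0"
  then have "scoroot G i = 0" using brk_e_f[of i i] by simp
  then have "(\<Sum>j\<le>n. scl G (if j = i then 1 else 0) (scoroot G j)) = 0"
    by (intro sum.neutral) auto
  then show False using scoroot_independent[of "\<lambda>j. if j = i then 1 else 0" i] i by simp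
qed

lemma per_ndvd: "0 < x \<Longrightarrow> x < per n \<Longrightarrow> \<not> per n dvd x" "0 < x \<Longrightarrow> x < per n \<Longrightarrow> \<not> per n dvd - x"
  using per_dvd_iff[of n x] by simp_all

text \<open>Bracketing with a lift of \<open>mX n b 1\<close> leads back to the simple root vector \<open>che G 0\<close>.\<close>

lemma mX_0_lift_nonzero:
  assumes "1 \<le> b" "b \<le> 2 * n" "pair.piece (eps n 0 - eps n (int b)) (g, mX n 0 (int b))"
  shows "g \<noteq> 0"
proof
  assume g: "g = 0"
  have e: "pair.piece (unitw 0 1) (che G 0, mX n 0 1)"
    using pair.piece_e[of 0] n_pos by (simp add: mE_def)
  have w: "eps n 0 - eps n 1 = unitw 0 1" using eps_simple[of 0 n] by simp
  have "pair.piece (unitw 0 1) (0, mX n 0 1)"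
  proof (cases "b = 1")
    case True
    then show ?thesis using assms g w by simp
  next
    case False
    then obtain g' where g': "pair.piece (eps n (int b) - eps n 1) (g', mX n (int b) 1)"
      using lift_mX_down[of 1 b] assms by auto
    have d: "\<not> per n dvd 1" "\<not> per n dvd int b" "\<not> per n dvd 1 - int b"
      using per_ndvd(1)[of 1] per_ndvd(1)[of "int b"] per_ndvd(2)[of "int b - 1"] False assms n_pos
      by auto
    have o: "odd (1 + int b)" if "per n dvd 1 + int b"
    proof -
      have "per n dvd 1 + int b - per n" using that by (simp only: dvd_diff dvd_refl)
      then have "1 + int b = per n" using per_dvd_iff[of n "1 + int b - per n"] assms by auto
      then show ?thesis by simp
    qed
    define c :: complex where "c = (if per n dvd 1 + int b then 2 else 1)"
    have "c \<noteq> 0" by (simp add: c_def)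
    have "pair.piece (eps n 0 - eps n (int b) + (eps n (int b) - eps n 1)) (0, lscale c (mX n 0 1))"
      using piece_comm[OF assms(3) g'] mX_comm_from_0[OF d o] by (simp add: g c_def)
    then show ?thesis using piece_lscale[of _ 0 "lscale c (mX n 0 1)" "1 / c"] \<open>c \<noteq> 0\<close> w by simp
  qed
  moreover have "unitw 0 1 \<noteq> (0 :: weight)" by simp
  ultimately have "che G 0 = 0" using piece_unique[OF e] by blast
  then show False using che_nonzero[of 0] by simp
qed

lemma wt_add: "wt n a \<alpha> b + wt n c \<alpha> d = wt n (a + c) \<alpha> (b + d)"
  by (simp add: wt_def fun_eq_iff weight_apply algebra_simps)

lemma wt_nonzero:
  assumes "\<alpha> \<noteq> 0" "\<alpha> 0 = 0" "a \<noteq> 0 \<or> b \<noteq> 0"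
  shows "wt n a \<alpha> b \<noteq> 0"
proof
  assume 0: "wt n a \<alpha> b = 0"
  then have z: "wt n a \<alpha> b i = 0" for i by (simp add: weight_apply)
  have "0 \<noteq> n" using n_pos by simp
  then have "b = 0" using z[of 0] assms(2) n_pos by (simp add: wt_def delta_def mark_def split: if_splits)
  then have "a * \<alpha> i = 0" for i using z[of i] by (simp add: wt_def)
  then have "a = 0" using assms(1) by (auto simp: fun_eq_iff weight_apply)
  then show False using assms(3) \<open>b = 0\<close> by simp
qed

text \<open>Apart from the definition of H, every identity of a family lives at a weight with
  nonzero \<alpha>-coefficient, where the matrix determines the element. The imaginary elements are
  defined as brackets, so they need no such comparison.\<close>

lemma lift_family:
  assumes fam: "family lscale comm F Y X H \<eta> \<mu> \<nu> \<tau>"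
    and \<alpha>: "\<alpha> \<noteq> 0" "\<alpha> 0 = 0" and e: "e > 0" "d > 0"
    and F: "pair.piece (wt n e \<alpha> d) (F', F)"
    and Y: "\<And>i. pair.piece (wt n (- e) \<alpha> (real i * d)) (Y' i, Y i)"
    and X: "\<And>i. pair.piece (wt n (- 2 * e) \<alpha> (real i * d)) (X' i, X i)"
  shows "family (scl G) (brk G) F' Y' X' (\<lambda>i. brk G F' (Y' i)) \<eta> \<mu> \<nu> \<tau>"
proof -
  note fam' = fam[unfolded family_def]
  have H: "pair.piece (wt n 0 \<alpha> (real (Suc i) * d)) (brk G F' (Y' i), H i)" for i
    using piece_comm[OF F Y[of i]] fam' by (simp add: wt_add algebra_simps)
  have uniq: "g = g'" if "pair.piece (wt n a \<alpha> b) (g, m)" "pair.piece (wt n a \<alpha> b) (g', m')" "m = m'"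
    "a \<noteq> 0 \<or> b \<noteq> 0" for g g' m m' a b
    using piece_unique[OF that(1)] that wt_nonzero[OF \<alpha> that(4)] by blast
  have "brk G F' (X' i) = scl G (\<eta> i) (Y' (Suc i))" for i
    by (rule uniq[OF piece_comm[OF F X[of i], unfolded wt_add] _ ])
       (use piece_lscale[OF Y[of "Suc i"], of "\<eta> i"] fam' e in \<open>auto simp: algebra_simps\<close>)
  moreover have "brk G (brk G F' (Y' i)) (Y' j) = scl G (\<mu> i j) (Y' (Suc (i + j)))" for i j
    by (rule uniq[OF piece_comm[OF H[of i] Y[of j], unfolded wt_add] _ ])
       (use piece_lscale[OF Y[of "Suc (i + j)"], of "\<mu> i j"] fam' e in \<open>auto simp: algebra_simps\<close>)
  moreover have "brk G (brk G F' (Y' i)) (X' j) = scl G (\<nu> i j) (X' (Suc (i + j)))" for i j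
    by (rule uniq[OF piece_comm[OF H[of i] X[of j], unfolded wt_add] _ ])
       (use piece_lscale[OF X[of "Suc (i + j)"], of "\<nu> i j"] fam' e in \<open>auto simp: algebra_simps\<close>)
  moreover have "brk G (Y' i) (Y' j) = scl G (\<tau> i j) (X' (i + j))" for i j
    by (rule uniq[OF piece_comm[OF Y[of i] Y[of j], unfolded wt_add] _ ])
       (use piece_lscale[OF X[of "i + j"], of "\<tau> i j"] fam' e in \<open>auto simp: algebra_simps\<close>)
  moreover have "brk G (X' i) (X' j) = 0" for i j
    by (rule uniq[OF piece_comm[OF X[of i] X[of j], unfolded wt_add] piece_zero])
       (use fam' e in auto)
  moreover have "brk G (X' i) (Y' j) = 0" for i j
    by (rule uniq[OF piece_comm[OF X[of i] Y[of j], unfolded wt_add] piece_zero])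
       (use fam' e in auto)
  ultimately show ?thesis unfolding family_def by simp
qed

end

section \<open>The finite root system\<close>

lemma gcm_row_sum:
  fixes x :: "nat \<Rightarrow> real"
  assumes "1 \<le> i" "i \<le> n"
  shows "(\<Sum>j\<le>n. x j * of_int (gcm n i j)) = (if i = n then 2 * x n - x (n - 1)
    else 2 * x i - x (i - 1) - (if i + 1 = n then 2 else 1) * x (i + 1))"
proof -
  have s: "(\<Sum>j\<le>n. x j * of_int (gcm n i j)) = (\<Sum>j\<in>S. x j * of_int (gcm n i j))"
    if "S \<subseteq> {..n}" "\<And>j. j \<le> n \<Longrightarrow> j \<notin> S \<Longrightarrow> gcm n i j = 0" for S
    by (rule sum.mono_neutral_right) (use that in auto)
  show ?thesis
  proof (cases "i = n")
    case True
    have "(\<Sum>j\<le>n. x j * of_int (gcm n i j)) = (\<Sum>j\<in>{n - 1, n}. x j * of_int (gcm n i j))"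
      by (rule s) (use assms True in \<open>auto simp: gcm_def\<close>)
    also have "\<dots> = 2 * x n - x (n - 1)" using assms True by (auto simp: gcm_def)
    finally show ?thesis using True by simp
  next
    case False
    then obtain k where k: "i = Suc k" "Suc k < n" using assms by (cases i) auto
    have "(\<Sum>j\<le>n. x j * of_int (gcm n i j)) = (\<Sum>j\<in>{k, Suc k, Suc (Suc k)}. x j * of_int (gcm n i j))"
      by (rule s) (use assms k in \<open>auto simp: gcm_def\<close>)
    also have "\<dots> = 2 * x i - x (i - 1) - (if i + 1 = n then 2 else 1) * x (i + 1)"
      using k by (auto simp: gcm_def)
    finally show ?thesis using False by simp
  qed
qed

text \<open>Read from row n upwards, the equations give \<open>x (n - k) = 2 * x n\<close> for k
  \<ge> 1; then \<open>x 0 = 0\<close> forces \<open>x n = 0\<close>.\<close>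

lemma gcm_nondegenerate:
  fixes x :: "nat \<Rightarrow> real"
  assumes n: "1 \<le> n" and x0: "x 0 = 0"
    and rows: "\<And>i. 1 \<le> i \<Longrightarrow> i \<le> n \<Longrightarrow> (\<Sum>j\<le>n. x j * of_int (gcm n i j)) = 0" and j: "j \<le> n"
  shows "x j = 0"
proof -
  have r: "x (n - k) = 2 * x n" if "1 \<le> k" "k \<le> n" for k
    using that
  proof (induction k rule: less_induct)
    case (less k)
    show ?case
    proof (cases "k = 1")
      case True
      then show ?thesis using rows[of n] gcm_row_sum[of n n x] n by simp
    next
      case False
      define i where "i = n - (k - 1)"
      have i: "1 \<le> i" "i < n" "n - k = i - 1" using less.prems False by (auto simp: i_def)
      have "x i = 2 * x n" using less.IH[of "k - 1"] less.prems False by (simp add: i_def)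
      moreover have "x (i + 1) = (if i + 1 = n then x n else 2 * x n)"
        using less.IH[of "k - 2"] less.prems False by (auto simp: i_def Suc_diff_le eval_nat_numeral)
      moreover have "2 * x i - x (i - 1) - (if i + 1 = n then 2 else 1) * x (i + 1) = 0"
        using rows[of i] gcm_row_sum[of i n x] i by simp
      ultimately show ?thesis unfolding i(3) by (auto split: if_splits)
    qed
  qed
  have "x n = 0" using r[of n] n x0 by simp
  then show ?thesis using r[of "n - j"] j by (cases "j = n") auto
qed

text \<open>Coordinates with respect to the orthonormal basis of the finite root system.\<close>

definition orth :: "nat \<Rightarrow> nat \<Rightarrow> weight \<Rightarrow> real" where
  "orth n i \<gamma> = (if i = n then 2 * \<gamma> n - \<gamma> (n - 1) else \<gamma> i - \<gamma> (i - 1))"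

text \<open>Summation by parts; the double bond between n - 1 and n changes only boundary terms,
  which complete the last square.\<close>

lemma form_eq_sum_squares:
  assumes "1 \<le> n" "\<gamma> 0 = 0"
  shows "form n \<gamma> \<gamma> = (\<Sum>i=1..n. (orth n i \<gamma>)\<^sup>2)"
proof -
  have "form n \<gamma> \<gamma> = (\<Sum>i\<le>n. \<gamma> i * (real (comark n i) / real (mark n i)) * (\<Sum>j\<le>n. \<gamma> j * real_of_int (gcm n i j)))"
    unfolding form_def by (simp add: sum_distrib_left sum_divide_distrib algebra_simps)
  also have "\<dots> = (\<Sum>i=1..n. \<gamma> i * (real (comark n i) / real (mark n i)) * (\<Sum>j\<le>n. \<gamma> j * real_of_int (gcm n i j)))"
    by (rule sum.mono_neutral_right) (use assms(2) in \<open>auto simp: not_less_eq_eq\<close>)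
  also have "\<dots> = (\<Sum>i=1..n. if i = n then 2 * \<gamma> n * (2 * \<gamma> n - \<gamma> (n - 1))
      else \<gamma> i * (2 * \<gamma> i - \<gamma> (i - 1) - (if i + 1 = n then 2 else 1) * \<gamma> (i + 1)))"
    by (rule sum.cong) (use assms in \<open>auto simp: gcm_row_sum mark_def comark_def\<close>)
  also have "\<dots> = (\<Sum>i=1..<n. \<gamma> i * (2 * \<gamma> i - \<gamma> (i - 1) - (if i + 1 = n then 2 else 1) * \<gamma> (i + 1)))
      + 2 * \<gamma> n * (2 * \<gamma> n - \<gamma> (n - 1))"
  proof -
    have "{1..n} = insert n {1..<n}" using assms by auto
    then show ?thesis by simp
  qed
  also have "(\<Sum>i=1..<n. \<gamma> i * (2 * \<gamma> i - \<gamma> (i - 1) - (if i + 1 = n then 2 else 1) * \<gamma> (i + 1)))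
      = (\<Sum>i=1..<n. (\<gamma> i - \<gamma> (i - 1))\<^sup>2) + (\<gamma> (n - 1))\<^sup>2 - 2 * \<gamma> (n - 1) * \<gamma> n"
  proof -
    have "(\<Sum>i=1..<m. \<gamma> i * (2 * \<gamma> i - \<gamma> (i - 1) - \<gamma> (i + 1)))
      = (\<Sum>i=1..<m. (\<gamma> i - \<gamma> (i - 1))\<^sup>2) + (\<gamma> (m - 1))\<^sup>2 - \<gamma> (m - 1) * \<gamma> m" if "1 \<le> m" for m
      using that
    proof (induction m rule: dec_induct)
      case base
      then show ?case using assms by simp
    next
      case (step m)
      then show ?case by (simp add: power2_eq_square algebra_simps)
    qed
    note 1 = this[OF assms(1)]
    have "(\<Sum>i=1..<n. \<gamma> i * (2 * \<gamma> i - \<gamma> (i - 1) - (if i + 1 = n then 2 else 1) * \<gamma> (i + 1)))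
       = (\<Sum>i=1..<n. \<gamma> i * (2 * \<gamma> i - \<gamma> (i - 1) - \<gamma> (i + 1)) - (if i = n - 1 then \<gamma> (n - 1) * \<gamma> n else 0))"
      by (rule sum.cong) (auto simp: algebra_simps)
    also have "\<dots> = (\<Sum>i=1..<n. \<gamma> i * (2 * \<gamma> i - \<gamma> (i - 1) - \<gamma> (i + 1))) - \<gamma> (n - 1) * \<gamma> n"
      using assms by (cases "n = 1") (auto simp: sum_subtractf)
    finally show ?thesis unfolding 1 by simp
  qed
  also have "(\<Sum>i=1..<n. (\<gamma> i - \<gamma> (i - 1))\<^sup>2) + (\<gamma> (n - 1))\<^sup>2 - 2 * \<gamma> (n - 1) * \<gamma> n + 2 * \<gamma> n * (2 * \<gamma> n - \<gamma> (n - 1))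
     = (\<Sum>i=1..<n. (\<gamma> i - \<gamma> (i - 1))\<^sup>2) + (2 * \<gamma> n - \<gamma> (n - 1))\<^sup>2"
    by (simp add: power2_eq_square algebra_simps)
  also have "\<dots> = (\<Sum>i=1..n. (orth n i \<gamma>)\<^sup>2)"
  proof -
    have "{1..n} = insert n {1..<n}" using assms by auto
    then show ?thesis by (simp add: orth_def)
  qed
  finally show ?thesis .
qed

text \<open>For 1 \<le> m \<le> n, \<open>eps n m\<close> thus has the coordinates of the m-th basis
  vector and \<open>eps n (2n+1-m)\<close> those of its negative.\<close>

lemma orth_eps:
  assumes "1 \<le> i" "i \<le> n"
  shows "orth n i (eps n m) = (if per n dvd m - int i then 1 else 0) - (if per n dvd m + int i then 1 else 0)"
proof -
  define w where "w j = (m - int j + 2 * int n) div per n + (m + int j) div per n" for j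
  have e: "eps n m j = (if j < n then - of_int (w j) else - of_int (w j) / 2)" if "j \<le> n" for j
    using that by (auto simp: eps_def w_def algebra_simps)
  obtain k where k: "i = Suc k" using assms by (cases i) auto
  have "orth n i (eps n m) = of_int (w k - w (Suc k))"
    using assms k by (auto simp: orth_def e)
  also have "w k - w (Suc k) = (if per n dvd m - int i then 1 else 0) - (if per n dvd m + int i then 1 else 0)"
  proof -
    have 1: "m - int k + 2 * int n = (m - int i + 2 * int n) + 1" using k by simp
    have 2: "per n dvd m - int i + 2 * int n + 1 \<longleftrightarrow> per n dvd m - int i"
      using dvd_add_triv_right_iff[of "per n" "m - int i"] by (simp add: algebra_simps)
    have "(m - int i + 2 * int n + 1) div per n = (m - int i + 2 * int n) div per n +
        (if per n dvd m - int i + 2 * int n + 1 then 1 else 0)"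
      by (rule div_step) simp
    then have "(m - int k + 2 * int n) div per n =
        (m - int i + 2 * int n) div per n + (if per n dvd m - int i then 1 else 0)"
      by (simp only: 1 2)
    moreover have "(m + int i) div per n = (m + int k) div per n + (if per n dvd m + int i then 1 else 0)"
      using div_step[of "per n" "m + int k"] k by (simp add: algebra_simps)
    ultimately show ?thesis by (simp only: w_def k)
  qed
  finally show ?thesis by simp
qed

text \<open>For a + b = 2n+1 the difference is plus or minus twice a basis vector; otherwise it is a
  combination of two different basis vectors with signs.\<close>

lemma form_eps:
  assumes n: "1 \<le> n" and a: "1 \<le> a" "a \<le> 2 * n" and b: "1 \<le> b" "b \<le> 2 * n" and ab: "a \<noteq> b"
  shows "form n (eps n (int a) - eps n (int b)) (eps n (int a) - eps n (int b)) =
    (if a + b = 2 * n + 1 then 4 else 2)"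
proof -
  define idx where "idx m = (if m \<le> n then m else 2 * n + 1 - m)" for m
  define s :: "nat \<Rightarrow> real" where "s m = (if m \<le> n then 1 else - 1)" for m
  have o: "orth n i (eps n (int m)) = (if i = idx m then s m else 0)"
    if "1 \<le> i" "i \<le> n" "1 \<le> m" "m \<le> 2 * n" for i m
  proof -
    have "per n dvd int m - int i \<longleftrightarrow> m = i" using per_dvd_iff[of n "int m - int i"] that by auto
    moreover have "per n dvd int m + int i \<longleftrightarrow> m + i = 2 * n + 1"
    proof -
      have "per n dvd int m + int i \<longleftrightarrow> per n dvd int m + int i - per n"
        by (rule iffI) (metis dvd_diff dvd_refl, metis dvd_add dvd_refl diff_add_cancel)
      also have "\<dots> \<longleftrightarrow> m + i = 2 * n + 1"
        using per_dvd_iff[of n "int m + int i - per n"] that by auto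
      finally show ?thesis .
    qed
    ultimately show ?thesis unfolding orth_eps[OF that(1,2)] using that by (auto simp: idx_def s_def)
  qed
  have idx: "1 \<le> idx m" "idx m \<le> n" if "1 \<le> m" "m \<le> 2 * n" for m
    using that by (auto simp: idx_def)
  have z: "(eps n (int a) - eps n (int b)) 0 = 0"
  proof -
    have "eps n (int m) 0 = - 1" if "1 \<le> m" "m \<le> 2 * n" for m
    proof -
      have "(int m + 2 * int n) div per n = 1"
        using that div_add_self2[of "per n" "int m - 1"] by (simp add: algebra_simps div_pos_pos_trivial)
      moreover have "int m div per n = 0" using that by (intro div_pos_pos_trivial) auto
      ultimately show ?thesis using n by (simp add: eps_def)
    qed
    then show ?thesis using a b by (simp add: weight_apply)
  qed
  have lin: "orth n i (\<gamma> - \<beta>) = orth n i \<gamma> - orth n i \<beta>" for i \<gamma> \<beta>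
    by (simp add: orth_def weight_apply)
  have "form n (eps n (int a) - eps n (int b)) (eps n (int a) - eps n (int b)) =
    (\<Sum>i=1..n. ((if i = idx a then s a else 0) - (if i = idx b then s b else 0))\<^sup>2)"
    unfolding form_eq_sum_squares[where \<gamma> = "eps n (int a) - eps n (int b)", OF n z] lin
    by (rule sum.cong) (use a b in \<open>auto simp: o\<close>)
  also have "\<dots> = (if a + b = 2 * n + 1 then 4 else 2)"
  proof (cases "idx a = idx b")
    case True
    then have t: "a + b = 2 * n + 1" "(s a - s b)\<^sup>2 = 4"
      using a b ab by (auto simp: idx_def s_def split: if_splits)
    have "(\<Sum>i=1..n. ((if i = idx a then s a else 0) - (if i = idx b then s b else 0))\<^sup>2) =
        (\<Sum>i=1..n. if i = idx a then (s a - s b)\<^sup>2 else 0)"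
      by (rule sum.cong) (use True in auto)
    then show ?thesis using t idx[OF a] by simp
  next
    case False
    then have t: "a + b \<noteq> 2 * n + 1" using a b by (auto simp: idx_def split: if_splits)
    have "(\<Sum>i=1..n. ((if i = idx a then s a else 0) - (if i = idx b then s b else 0))\<^sup>2) =
        (\<Sum>i=1..n. (if i = idx a then 1 else 0) + (if i = idx b then 1 else 0))"
      by (rule sum.cong) (use False in \<open>auto simp: s_def\<close>)
    then show ?thesis using t idx[OF a] idx[OF b] by (simp add: sum.distrib)
  qed
  finally show ?thesis .
qed

text \<open>Shifting both indices by the same multiple of the period puts a into one period; the
  vanishing coordinate at \<alpha>_0 then forces b into that period and away from the index
  0.\<close>

lemma eps_diff_reduce:
  assumes n: "1 \<le> n" and z: "(eps n a - eps n b) 0 = 0" and nz: "eps n a \<noteq> eps n b"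
  shows "\<exists>a' b'. 1 \<le> a' \<and> a' \<le> 2 * n \<and> 1 \<le> b' \<and> b' \<le> 2 * n \<and> a' \<noteq> b' \<and>
    eps n a - eps n b = eps n (int a') - eps n (int b')"
proof -
  define q r where "q = a div per n" and "r = a mod per n"
  define b1 where "b1 = b - per n * q"
  have "a = r + per n * q" "b = b1 + per n * q" by (simp_all add: q_def r_def b1_def)
  then have e: "eps n a - eps n b = eps n r - eps n b1" by (simp only: eps_shift') simp
  have r: "0 \<le> r" "r < per n" unfolding r_def by (rule pos_mod_sign, simp, rule pos_mod_bound, simp)
  define q' r' where "q' = b1 div per n" and "r' = b1 mod per n"
  have b1: "b1 = r' + per n * q'" by (simp add: q'_def r'_def)
  have r': "0 \<le> r'" "r' < per n" unfolding r'_def by (rule pos_mod_sign, simp, rule pos_mod_bound, simp)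
  have c: "eps n m 0 = (if m = 0 then 0 else - 1)" if "0 \<le> m" "m < per n" for m
  proof -
    have "(m + 2 * int n) div per n = 1" if "m \<noteq> 0"
      using that \<open>0 \<le> m\<close> \<open>m < per n\<close> div_add_self2[of "per n" "m - 1"]
      by (simp add: algebra_simps div_pos_pos_trivial)
    moreover have "m div per n = 0" using that by (intro div_pos_pos_trivial) auto
    ultimately show ?thesis using n by (auto simp: eps_def div_pos_pos_trivial)
  qed
  have "eps n b1 0 = eps n r' 0 - 2 * of_int q'"
    unfolding b1 eps_shift using n by (simp add: delta_def mark_def)
  \<comment> \<open>Within a period this coordinate is 0 or -1, and it drops by 2 per period, so
    equality leaves no room for a nonzero \<open>q'\<close>.\<close>
  then have *: "(if r = 0 then 0 else - 1) = (if r' = 0 then 0 else - 1) - 2 * real_of_int q'"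
    using z unfolding e weight_apply c[OF r] by (simp add: c[OF r'])
  then have "q' = 0"
    by (auto split: if_splits)
  then have "b1 = r'" "r = 0 \<longleftrightarrow> r' = 0" using * b1 by (auto split: if_splits)
  moreover have "r \<noteq> r'" using e nz calculation by auto
  ultimately show ?thesis using r r' e
    by (intro exI[of _ "nat r"] exI[of _ "nat r'"]) auto
qed

section \<open>Roots as differences of weights of the vector representation\<close>

context affine_A2n2
begin

text \<open>All matrices that can accompany an element of weight \<gamma>. If \<gamma> is not a
  difference of two weights, only 0 is left, and then the element itself vanishes; this confines the
  possible roots.\<close>

definition mspan :: "weight \<Rightarrow> int lop set" where
  "mspan \<gamma> = lscale.span {pm n a b | a b. eps n a - eps n b = \<gamma>}"

lemma mspan_mult:
  assumes "m \<in> mspan \<gamma>" "m' \<in> mspan \<delta>"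
  shows "m * m' \<in> mspan (\<gamma> + \<delta>)"
proof -
  have base: "pm n a b * pm n c d \<in> mspan (eps n a - eps n b + (eps n c - eps n d))" for a b c d
  proof (cases "per n dvd b - c")
    case True
    then obtain k where k: "b = c + per n * k" by (metis dvd_def diff_eq_eq add.commute)
    have "pm n a (d + b - c) \<in> mspan (eps n a - eps n (d + b - c))"
      unfolding mspan_def by (intro lscale.span_base) blast
    moreover have "d + b - c = d + per n * k" using k by simp
    then have "eps n a - eps n (d + b - c) = eps n a - eps n b + (eps n c - eps n d)"
      unfolding k by (simp only: eps_shift') simp
    ultimately show ?thesis using True by (simp add: pm_mult)
  next
    case False
    then show ?thesis by (simp add: pm_mult mspan_def lscale.span_zero)
  qed
  have "pm n a b * m' \<in> mspan (eps n a - eps n b + \<delta>)" for a b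
    using assms(2) unfolding mspan_def[of \<delta>]
  proof (induction rule: lscale.span_induct_alt)
    case (step c x y)
    then obtain p q where "x = pm n p q" "\<delta> = eps n p - eps n q" by blast
    then have "pm n a b * x \<in> mspan (eps n a - eps n b + \<delta>)" using base by simp
    then show ?case using step
      by (simp add: distrib_left) (simp add: mspan_def lscale.span_add lscale.span_scale)
  qed (simp add: mspan_def lscale.span_zero)
  note left = this
  show ?thesis using assms(1) unfolding mspan_def[of \<gamma>]
  proof (induction rule: lscale.span_induct_alt)
    case (step c x y)
    then have "x * m' \<in> mspan (\<gamma> + \<delta>)" using left by blast
    then show ?case using step
      by (simp add: distrib_right) (simp add: mspan_def lscale.span_add lscale.span_scale)
  qed (simp add: mspan_def lscale.span_zero)
qed

lemma mspan_comm: "m \<in> mspan \<gamma> \<Longrightarrow> m' \<in> mspan \<delta> \<Longrightarrow> comm m m' \<in> mspan (\<gamma> + \<delta>)"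
  using mspan_mult[of m \<gamma> m' \<delta>] mspan_mult[of m' \<delta> m \<gamma>]
  by (simp add: comm_def mspan_def lscale.span_diff add.commute)

lemma mX_mspan: "mX n a b \<in> mspan (eps n a - eps n b)"
proof -
  have "eps n (- b) - eps n (- a) = eps n a - eps n b" by (simp add: eps_minus)
  then have "pm n a b \<in> mspan (eps n a - eps n b)" "pm n (- b) (- a) \<in> mspan (eps n a - eps n b)"
    unfolding mspan_def by (auto intro!: lscale.span_base)
  then show ?thesis unfolding mX_def by (simp add: mspan_def lscale.span_diff lscale.span_scale)
qed

lemma pm_mspan: "pm n a b \<in> mspan (eps n a - eps n b)"
  unfolding mspan_def by (auto intro!: lscale.span_base)

lemma mE_mspan: "i \<le> n \<Longrightarrow> mE n i \<in> mspan (unitw i 1)"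
  unfolding eps_simple[symmetric] by (auto simp: mE_def mX_mspan pm_mspan)

lemma mF_mspan: "i \<le> n \<Longrightarrow> mF n i \<in> mspan (unitw i (- 1))"
proof -
  assume i: "i \<le> n"
  have w: "unitw i (- 1) = eps n (int i + 1) - eps n (int i)"
    unfolding unitw_minus eps_simple[OF i, symmetric] by simp
  have "mX n (int i + 1) (int i) \<in> mspan (unitw i (- 1))" "pm n (int i + 1) (int i) \<in> mspan (unitw i (- 1))"
    unfolding w by (rule mX_mspan, rule pm_mspan)
  then show ?thesis using i by (auto simp: mF_def mspan_def intro: lscale.span_scale)
qed

lemma iter_mspan:
  assumes "pair.iter n e \<sigma> \<gamma> z" "\<And>i. i \<le> n \<Longrightarrow> snd (e i) \<in> mspan (unitw i \<sigma>)"
  shows "snd z \<in> mspan \<gamma>"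
  using assms(1)
proof (induction rule: pair.iter.induct)
  case (iter_bracket i \<gamma> z)
  then show ?case using mspan_comm[OF assms(2)] by (simp add: pbrk_def add.commute[of \<gamma>])
qed (use assms(2) in \<open>auto simp: mspan_def pscl_def lscale.span_zero zero_prod_def plus_prod_def
      intro: lscale.span_add lscale.span_scale\<close>)

lemma piece_weight_eps:
  assumes "pair.piece \<gamma> (g, m)" "\<gamma> \<noteq> 0" "g \<noteq> 0"
  shows "\<exists>a b. \<gamma> = eps n a - eps n b"
proof (rule ccontr)
  assume "\<not> ?thesis"
  then have "{pm n a b | a b. eps n a - eps n b = \<gamma>} = {}" by auto
  then have 0: "mspan \<gamma> = {0}" unfolding mspan_def by (simp only: lscale.span_empty)
  obtain p h q where *: "(g, m) = p + h + q" "pair.iter n (\<lambda>i. (che G i, mE n i)) 1 \<gamma> p"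
    "\<gamma> \<noteq> 0 \<longrightarrow> h = 0" "pair.iter n (\<lambda>i. (chf G i, mF n i)) (- 1) \<gamma> q"
    using assms(1) unfolding pair.piece_def by blast
  have "snd p \<in> mspan \<gamma>" by (rule iter_mspan[OF *(2)]) (simp add: mE_mspan)
  moreover have "snd q \<in> mspan \<gamma>" by (rule iter_mspan[OF *(4)]) (simp add: mF_mspan)
  ultimately have "snd (p + h + q) = 0" using *(3) assms(2) 0 by (simp add: plus_prod_def)
  then have "m = 0" using *(1) by (metis snd_conv)
  then show False using piece_null assms by blast
qed

lemma fin_cartan_cartan: "fin_cartan \<subseteq> cartan G"
  unfolding fin_cartan_def
  by (rule span_minimal) (use scoroot_in_cartan cartan_subspace in auto)

text \<open>The affine Cartan matrix is singular, but on weights without \<alpha>_0-coordinate its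
  rows 1 to n are nondegenerate, so the finite coroots already tell such weights apart.\<close>

lemma fin_separates:
  assumes "\<gamma> \<noteq> \<delta>" "\<And>i. i \<notin> {1..n} \<Longrightarrow> \<gamma> i = 0" "\<And>i. i \<notin> {1..n} \<Longrightarrow> \<delta> i = 0"
  shows "\<exists>h\<in>fin_cartan. wt_eval \<gamma> h \<noteq> wt_eval \<delta> h"
proof (rule ccontr)
  assume neg: "\<not> ?thesis"
  have "(\<Sum>j\<le>n. (\<gamma> j - \<delta> j) * real_of_int (gcm n i j)) = 0" if i: "1 \<le> i" "i \<le> n" for i
  proof -
    have "scoroot G i \<in> fin_cartan" unfolding fin_cartan_def using i by (intro span_base) auto
    then have "wt_eval \<gamma> (scoroot G i) - wt_eval \<delta> (scoroot G i) = 0" using neg by auto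
    also have "wt_eval \<gamma> (scoroot G i) - wt_eval \<delta> (scoroot G i) =
        of_real (\<Sum>j\<le>n. (\<gamma> j - \<delta> j) * real_of_int (gcm n i j))"
      unfolding wt_eval_def using i by (simp add: pairing sum_subtractf[symmetric] left_diff_distrib)
    finally show ?thesis by (simp only: of_real_eq_0_iff)
  qed
  then have "\<gamma> j - \<delta> j = 0" if "j \<le> n" for j
    using gcm_nondegenerate[OF n_pos, of "\<lambda>j. \<gamma> j - \<delta> j" j] assms(2)[of 0] assms(3)[of 0] that by auto
  moreover have "\<gamma> j = \<delta> j" if "j > n" for j using assms(2,3)[of j] that by auto
  ultimately show False using assms(1) by (auto simp: fun_eq_iff) (metis not_less)
qed

definition fin_weights :: "weight set" where
  "fin_weights = {\<gamma>. \<forall>i. i \<notin> {1..n} \<longrightarrow> \<gamma> i = 0}"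

lemma subspace_piece: "pair.subspace {z. pair.piece \<gamma> z}"
  unfolding pair.subspace_def using pair.piece_0 pair.piece_add pair.piece_scale by blast

lemma fin_alg_pieces: "fin_alg \<subseteq> fst ` pair.span (\<Union>\<gamma>\<in>fin_weights. {z. pair.piece \<gamma> z})"
  (is "_ \<subseteq> fst ` ?L")
proof -
  have sub: "pair.subspace ?L" by simp
  have base: "pbrk z z' \<in> ?L" if "z \<in> (\<Union>\<gamma>\<in>fin_weights. {z. pair.piece \<gamma> z})"
    "z' \<in> (\<Union>\<gamma>\<in>fin_weights. {z. pair.piece \<gamma> z})" for z z'
  proof -
    obtain \<gamma> \<delta> where *: "\<gamma> \<in> fin_weights" "\<delta> \<in> fin_weights" "pair.piece \<gamma> z" "pair.piece \<delta> z'"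
      using \<open>z \<in> _\<close> \<open>z' \<in> _\<close> by auto
    then have "\<gamma> + \<delta> \<in> fin_weights" by (auto simp: fin_weights_def weight_apply)
    then show ?thesis using pair.piece_bracket[OF *(3,4)] by (intro pair.span_base) blast
  qed
  have left: "pbrk z z' \<in> ?L" if "z \<in> (\<Union>\<gamma>\<in>fin_weights. {z. pair.piece \<gamma> z})" "z' \<in> ?L" for z z'
    using that(2)
  proof (induction rule: pair.span_induct_alt)
    case (step c x y)
    then show ?case using base[OF that(1)]
      by (simp add: pair.bracket_add_right pair.bracket_scale_right pair.span_add pair.span_scale)
  qed (simp add: pair.span_zero)
  have br: "pbrk z z' \<in> ?L" if "z \<in> ?L" "z' \<in> ?L" for z z'
    using that(1)
  proof (induction rule: pair.span_induct_alt)
    case (step c x y)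
    then show ?case using left[OF _ that(2)]
      by (simp add: pair.bracket_add_left pair.bracket_scale_left pair.span_add pair.span_scale)
  qed (simp add: pair.span_zero)
  have "lie_subalgebra (fst ` ?L)"
    unfolding lie_subalgebra_def
  proof (intro conjI ballI)
    have "0 \<in> fst ` ?L" using pair.span_zero by force
    moreover have "x + y \<in> fst ` ?L" if x: "x \<in> fst ` ?L" "y \<in> fst ` ?L" for x y
    proof -
      obtain z z' where "z \<in> ?L" "z' \<in> ?L" "x = fst z" "y = fst z'" using x by blast
      then have "z + z' \<in> ?L" "x + y = fst (z + z')" by (simp_all add: pair.span_add)
      then show ?thesis by (simp only: imageI)
    qed
    moreover have "scl G c x \<in> fst ` ?L" if x: "x \<in> fst ` ?L" for c x
    proof -
      obtain z where "z \<in> ?L" "x = fst z" using x by blast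
      then have "pscl c z \<in> ?L" "scl G c x = fst (pscl c z)"
        by (simp add: pair.span_scale, simp add: pscl_def)
      then show ?thesis by (simp only: imageI)
    qed
    ultimately show "subspace (fst ` ?L)" by (simp add: subspace_def)
    fix x y assume x: "x \<in> fst ` ?L" and y: "y \<in> fst ` ?L"
    obtain z where "z \<in> ?L" "x = fst z" using x by blast
    moreover obtain z' where "z' \<in> ?L" "y = fst z'" using y by blast
    ultimately have "pbrk z z' \<in> ?L" "brk G x y = fst (pbrk z z')"
      by (simp add: br, simp add: pbrk_def)
    then show "brk G x y \<in> fst ` ?L" by (simp only: imageI)
  qed
  moreover have "che G ` {1..n} \<union> chf G ` {1..n} \<subseteq> fst ` ?L"
  proof -
    have "unitw i c \<in> fin_weights" if "1 \<le> i" "i \<le> n" for i c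
      using that by (auto simp: fin_weights_def unitw_apply)
    then have "(che G i, mE n i) \<in> ?L" "(chf G i, mF n i) \<in> ?L" if "1 \<le> i" "i \<le> n" for i
      using that pair.piece_e[of i] pair.piece_f[of i] by (auto intro!: pair.span_base)
    then show ?thesis by force
  qed
  ultimately show ?thesis unfolding fin_alg_def by (intro hull_minimal)
qed

text \<open>Root spaces are defined by eigenvalues, pieces by formal weights. Distinct finite
  weights have distinct eigenvalues on \<open>fin_cartan\<close>, so in a decomposition of g into
  pieces only the one at \<alpha> survives.\<close>

lemma fin_root_space_piece:
  assumes g: "g \<in> fin_root_space \<alpha>" "g \<noteq> 0" and \<alpha>: "\<alpha> \<in> fin_weights"
  shows "\<exists>m. pair.piece \<alpha> (g, m)"
proof -
  have "g \<in> fst ` pair.span (\<Union>\<gamma>\<in>fin_weights. {z. pair.piece \<gamma> z})"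
    using fin_alg_pieces g(1) unfolding fin_root_space_def by blast
  then obtain z where z: "z \<in> pair.span (\<Union>\<gamma>\<in>fin_weights. {z. pair.piece \<gamma> z})" "g = fst z" by blast
  obtain S t where S: "finite S" "S \<subseteq> fin_weights" "\<forall>\<gamma>\<in>S. t \<gamma> \<in> {z. pair.piece \<gamma> z}" "z = (\<Sum>\<gamma>\<in>S. t \<gamma>)"
    using pair.span_UN_sum[OF subspace_piece z(1)] by blast
  have sum: "g = (\<Sum>\<gamma>\<in>S. fst (t \<gamma>))" unfolding z(2) S(4) by (rule fst_sum)
  define v where "v \<gamma> = (if \<gamma> \<in> S then fst (t \<gamma>) else 0) - (if \<gamma> = \<alpha> then g else 0)" for \<gamma>
  have "v \<alpha> = 0"
  proof (rule eigenvectors_independent[of "insert \<alpha> S" fin_cartan v wt_eval])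
    show "finite (insert \<alpha> S)" using S by simp
    have "(\<Sum>\<gamma>\<in>insert \<alpha> S. if \<gamma> \<in> S then fst (t \<gamma>) else 0) = (\<Sum>\<gamma>\<in>S. if \<gamma> \<in> S then fst (t \<gamma>) else 0)"
      by (rule sum.mono_neutral_right) (use S in auto)
    then show "(\<Sum>\<gamma>\<in>insert \<alpha> S. v \<gamma>) = 0"
      unfolding v_def sum_subtractf using S(1) by (simp add: sum[symmetric])
  next
    fix \<gamma> h assume *: "\<gamma> \<in> insert \<alpha> S" "h \<in> fin_cartan"
    have "brk G h (fst (t \<gamma>)) = scl G (wt_eval \<gamma> h) (fst (t \<gamma>))" if "\<gamma> \<in> S"
      using piece_root_space[of \<gamma> "fst (t \<gamma>)" "snd (t \<gamma>)"] S(3) that * fin_cartan_cartan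
      by (auto simp: root_space_def)
    moreover have "brk G h g = scl G (wt_eval \<alpha> h) g" using g * by (simp add: fin_root_space_def)
    ultimately show "brk G h (v \<gamma>) = scl G (wt_eval \<gamma> h) (v \<gamma>)"
      by (auto simp: v_def bracket_diff_right scale_right_diff_distrib)
  next
    fix \<gamma> \<beta> assume *: "\<gamma> \<in> insert \<alpha> S" "\<beta> \<in> insert \<alpha> S" "\<gamma> \<noteq> \<beta>"
    then have "\<gamma> \<in> fin_weights" "\<beta> \<in> fin_weights" using S \<alpha> by auto
    then show "\<exists>h\<in>fin_cartan. wt_eval \<gamma> h \<noteq> wt_eval \<beta> h"
      unfolding fin_weights_def using fin_separates[OF *(3)] by blast
  qed simp
  then have "(if \<alpha> \<in> S then fst (t \<alpha>) else 0) = g" by (simp add: v_def)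
  then have "\<alpha> \<in> S" "fst (t \<alpha>) = g" using g(2) by (simp_all split: if_splits)
  then have "pair.piece \<alpha> (fst (t \<alpha>), snd (t \<alpha>))"
    unfolding prod.collapse using S(3) \<open>\<alpha> \<in> S\<close> by blast
  then show ?thesis using \<open>fst (t \<alpha>) = g\<close> by (simp only:) blast
qed

lemma roots_eps:
  assumes "\<alpha> \<in> roots"
  shows "\<exists>a b. 1 \<le> a \<and> a \<le> 2 * n \<and> 1 \<le> b \<and> b \<le> 2 * n \<and> a \<noteq> b \<and> \<alpha> = eps n (int a) - eps n (int b)"
proof -
  have \<alpha>: "\<alpha> \<in> fin_weights" "\<alpha> \<noteq> 0" "fin_root_space \<alpha> \<noteq> {0}"
    using assms by (auto simp: roots_def fin_weights_def zero_fun_def)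
  have "0 \<in> fin_root_space \<alpha>"
    using fin_alg_subalgebra by (simp add: fin_root_space_def lie_subalgebra_def subspace_0)
  then obtain g where g: "g \<in> fin_root_space \<alpha>" "g \<noteq> 0" using \<alpha> by auto
  then obtain m where "pair.piece \<alpha> (g, m)" using fin_root_space_piece \<alpha> by blast
  then obtain a b where ab: "\<alpha> = eps n a - eps n b" using piece_weight_eps \<alpha> g by blast
  have "\<alpha> 0 = 0" using \<alpha>(1) by (simp add: fin_weights_def)
  then show ?thesis using eps_diff_reduce[OF n_pos, of a b] \<alpha>(2) unfolding ab by auto
qed

lemma pos_roots_eps:
  assumes "\<alpha> \<in> pos_roots"
  shows "\<exists>a b. 1 \<le> a \<and> a < b \<and> b \<le> 2 * n \<and> \<alpha> = eps n (int a) - eps n (int b)"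
proof -
  obtain a b where ab: "1 \<le> a" "a \<le> 2 * n" "1 \<le> b" "b \<le> 2 * n" "a \<noteq> b" "\<alpha> = eps n (int a) - eps n (int b)"
    using assms roots_eps[of \<alpha>] unfolding pos_roots_def by blast
  have "a < b"
  proof (rule ccontr)
    assume "\<not> a < b"
    then have "int b < int a" using ab by simp
    have "(eps n (int b) - eps n (int a)) i = 0" for i
    proof -
      have "(eps n (int b) - eps n (int a)) i \<in> \<nat>" using \<open>int b < int a\<close> by (intro eps_diff_nonneg) simp
      then have "0 \<le> (eps n (int b) - eps n (int a)) i" by (auto elim: Nats_cases)
      moreover have "0 \<le> \<alpha> i" using assms by (simp add: pos_roots_def)
      ultimately show ?thesis unfolding ab(6) by (simp add: weight_apply)
    qed
    then have "eps n (int b) = eps n (int a)" by (simp add: fun_eq_iff weight_apply)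
    then show False using eps_diff_nonzero[OF n_pos \<open>int b < int a\<close>] by simp
  qed
  then show ?thesis using ab by blast
qed

text \<open>Fixes the squared length of long roots: by \<open>form_eps\<close> no root exceeds 4,
  and \<alpha>_n attains it.\<close>

lemma longest_root: "unitw n 1 \<in> roots" "form n (unitw n 1) (unitw n 1) = 4"
proof -
  have "che G n \<in> fin_alg" unfolding fin_alg_def using n_pos by (intro hull_inc) auto
  moreover have "brk G h (che G n) = scl G (wt_eval (unitw n 1) h) (che G n)" if "h \<in> fin_cartan" for h
    using brk_cartan_e[of n h] that fin_cartan_cartan by (auto simp: wt_eval_unitw)
  ultimately have "che G n \<in> fin_root_space (unitw n 1)" by (simp add: fin_root_space_def)
  then have "fin_root_space (unitw n 1) \<noteq> {0}" using che_nonzero[of n] by auto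
  moreover have "unitw n 1 \<noteq> (\<lambda>_. 0)" using unitw_eq_0[of n 1] by (simp add: zero_fun_def)
  ultimately show "unitw n 1 \<in> roots" using n_pos by (auto simp: roots_def unitw_apply)
  have "unitw n 1 = eps n (int n) - eps n (int (n + 1))" using eps_simple[of n n] by (simp add: add.commute)
  then show "form n (unitw n 1) (unitw n 1) = 4"
    using form_eps[of n n "n + 1"] n_pos by simp
qed

lemma long_root_iff:
  assumes "\<alpha> \<in> roots" "1 \<le> a" "a \<le> 2 * n" "1 \<le> b" "b \<le> 2 * n" "a \<noteq> b" "\<alpha> = eps n (int a) - eps n (int b)"
  shows "\<alpha> \<in> long_roots \<longleftrightarrow> a + b = 2 * n + 1"
proof -
  have f: "form n \<alpha> \<alpha> = (if a + b = 2 * n + 1 then 4 else 2)"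
    unfolding assms(7) by (rule form_eps[OF n_pos assms(2-6)])
  have le: "form n \<beta> \<beta> \<le> 4" if "\<beta> \<in> roots" for \<beta>
    using roots_eps[OF that] form_eps[OF n_pos] by fastforce
  show ?thesis
  proof
    assume "\<alpha> \<in> long_roots"
    then have "4 \<le> form n \<alpha> \<alpha>" using longest_root by (auto simp: long_roots_def)
    then show "a + b = 2 * n + 1" using f by (auto split: if_splits)
  qed (use f le assms(1) in \<open>auto simp: long_roots_def\<close>)
qed

end

section \<open>Families of root vectors attached to the positive roots\<close>

lemma wt_eps_diff:
  assumes "\<alpha> = eps n u - eps n v"
  shows "wt n 1 \<alpha> (of_int k) = eps n u - eps n (v + per n * k)"
    "wt n (- 1) \<alpha> (of_int k) = eps n v - eps n (u + per n * k)"
  unfolding assms eps_shift' by (simp_all add: wt_def fun_eq_iff weight_apply algebra_simps)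

text \<open>The partner index is the reflection of u, so \<alpha> = 2 \<open>eps n u\<close> +
  \<delta>, and half roots become differences with an index divisible by the period.\<close>

lemma wt_eps_half:
  assumes "\<alpha> = eps n u - eps n (per n - u)"
  shows "wt n (1 / 2) \<alpha> (of_int k + 1 / 2) = eps n u - eps n (per n * (k + 1))"
    "wt n (- 1 / 2) \<alpha> (of_int k + 1 / 2) = eps n (- u) - eps n (per n * k)"
proof -
  have 1: "eps n (per n - u) = - eps n u - wt n 0 0 1"
    using eps_shift'[of n "- u" 1] by (simp add: eps_minus)
  have 2: "eps n (per n * j) = - wt n 0 0 (of_int j)" for j
    using eps_shift'[of n 0 j] by (simp add: eps_0)
  show "wt n (1 / 2) \<alpha> (of_int k + 1 / 2) = eps n u - eps n (per n * (k + 1))"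
    "wt n (- 1 / 2) \<alpha> (of_int k + 1 / 2) = eps n (- u) - eps n (per n * k)"
    unfolding assms 1 2 eps_minus by (simp_all add: wt_def fun_eq_iff weight_apply algebra_simps)
qed

lemma wt_eps_imaginary: "wt n 0 \<alpha> (of_int k) = eps n 0 - eps n (per n * k)"
  using eps_shift'[of n 0 k] by (simp add: eps_0 wt_def fun_eq_iff weight_apply)

context affine_A2n2
begin

lemma liftable_lowering:
  assumes "1 \<le> a" "a \<le> 2 * n"
  shows "liftable (wt n 0 \<alpha> (- 1)) (lowering n (int a))"
proof -
  have d: "\<not> per n dvd int a" using per_ndvd(1)[of "int a"] assms by auto
  define b where "b = 2 * n + 1 - a"
  have b: "0 < b" "b \<le> 2 * n" "int b = per n - int a" using assms by (auto simp: b_def of_nat_diff)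
  have "liftable (eps n (int b) - eps n (int 0)) (mX n (int b) (int 0))"
    using lift_mX_down[OF b(1,2)] unfolding liftable_def by blast
  then have "liftable (eps n (int b) - eps n 0) (mX n (int b) 0)" by simp
  moreover have e: "mX n (per n) (int a) = lscale (- sg (per n + int a)) (mX n (int b) 0)"
    using mX_swap[of n "per n" "int a"] mX_shift[of n "per n" "- int a" "- per n"]
    by (simp add: b(3) algebra_simps)
  ultimately have 1: "liftable (eps n (int b) - eps n 0) (mX n (per n) (int a))"
    unfolding e by (intro liftable_scale)
  have 2: "liftable (eps n (int a) - eps n (int 0)) (mX n (int a) (int 0))"
    using lift_mX_down[of 0 a] assms unfolding liftable_def by auto
  have "eps n (int b) = - eps n (int a) - wt n 0 0 1"
    using eps_shift'[of n "- int a" 1] b(3) by (simp add: eps_minus)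
  then have "eps n (int b) - eps n 0 + (eps n (int a) - eps n (int 0)) = wt n 0 \<alpha> (- 1)"
    by (simp add: eps_0 wt_def fun_eq_iff weight_apply)
  then show ?thesis using liftable_comm[OF 1 2] lowering_comm[OF d] by simp
qed

definition sl2_root_family :: "weight \<Rightarrow> real \<Rightarrow> 'g \<Rightarrow> (nat \<Rightarrow> 'g) \<Rightarrow> bool" where
  "sl2_root_family \<alpha> d F Y \<longleftrightarrow>
     sl2_family (scl G) (brk G) F Y (\<lambda>i. brk G F (Y i)) \<and>
     F \<in> root_space (wt n 1 \<alpha> d) \<and> F \<noteq> 0 \<and>
     (\<forall>i. Y i \<in> root_space (wt n (- 1) \<alpha> (real i * d)) \<and> Y i \<noteq> 0)"

definition twisted_root_family :: "weight \<Rightarrow> 'g \<Rightarrow> (nat \<Rightarrow> 'g) \<Rightarrow> (nat \<Rightarrow> 'g) \<Rightarrow> bool" where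
  "twisted_root_family \<alpha> F Y X \<longleftrightarrow>
     twisted_family (scl G) (brk G) F Y X (\<lambda>i. brk G F (Y i)) \<and>
     F \<in> root_space (wt n (1 / 2) \<alpha> (1 / 2)) \<and> F \<noteq> 0 \<and>
     (\<forall>i. Y i \<in> root_space (wt n (- 1 / 2) \<alpha> (real i / 2)) \<and> (odd i \<longrightarrow> Y i \<noteq> 0)) \<and>
     (\<forall>i. X i \<in> root_space (wt n (- 1) \<alpha> (real i / 2)) \<and> (4 dvd i \<longrightarrow> X i \<noteq> 0))"

lemma sl2_root_familyI:
  assumes fam: "sl2_family lscale comm F Y (\<lambda>i. comm F (Y i))"
    and \<alpha>: "\<alpha> \<noteq> 0" "\<alpha> 0 = 0" and d: "d > 0"
    and F: "liftable (wt n 1 \<alpha> d) F"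
    and Y: "\<And>i. liftable (wt n (- 1) \<alpha> (real i * d)) (Y i)"
    and nz: "\<And>i g. pair.piece (wt n (- 1) \<alpha> (real i * d)) (g, Y i) \<Longrightarrow> g \<noteq> 0"
  shows "\<exists>F' Y'. sl2_root_family \<alpha> d F' Y' \<and> pair.piece (wt n 1 \<alpha> d) (F', F) \<and>
    (\<forall>i. pair.piece (wt n (- 1) \<alpha> (real i * d)) (Y' i, Y i))"
proof -
  obtain F' where F': "pair.piece (wt n 1 \<alpha> d) (F', F)" using F unfolding liftable_def by blast
  have "\<forall>i. \<exists>g. pair.piece (wt n (- 1) \<alpha> (real i * d)) (g, Y i)"
    using Y unfolding liftable_def by blast
  then have "\<exists>g. \<forall>i. pair.piece (wt n (- 1) \<alpha> (real i * d)) (g i, Y i)" by (rule choice)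
  then obtain Y' where Y': "\<And>i. pair.piece (wt n (- 1) \<alpha> (real i * d)) (Y' i, Y i)" by blast
  have "family (scl G) (brk G) F' Y' (\<lambda>_. 0) (\<lambda>i. brk G F' (Y' i)) (\<lambda>_. 0) (\<lambda>_ _. 2) (\<lambda>_ _. 0) (\<lambda>_ _. 0)"
  proof (rule lift_family[OF fam[unfolded sl2_family_def] \<alpha> _ d F'])
    show "pair.piece (wt n (- 1) \<alpha> (real i * d)) (Y' i, Y i)" for i by (rule Y')
    show "pair.piece (wt n (- 2 * 1) \<alpha> (real i * d)) (0, 0)" for i by (rule piece_zero)
  qed simp
  then have f: "sl2_family (scl G) (brk G) F' Y' (\<lambda>i. brk G F' (Y' i))"
    unfolding sl2_family_def .
  then have "\<forall>i j. brk G (brk G F' (Y' i)) (Y' j) = scl G 2 (Y' (Suc (i + j)))"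
    unfolding sl2_family_def family_def by blast
  from this[rule_format, of 0 0] have "brk G (brk G F' (Y' 0)) (Y' 0) = scl G 2 (Y' 1)" by simp
  moreover have "Y' 1 \<noteq> 0" by (rule nz[OF Y'])
  ultimately have F'0: "F' \<noteq> 0" by auto
  have "sl2_root_family \<alpha> d F' Y'" unfolding sl2_root_family_def
    by (intro conjI allI f piece_root_space[OF F'] F'0 piece_root_space[OF Y'] nz[OF Y'])
  then show ?thesis using F' Y' by blast
qed

lemma short_root_family:
  assumes ab: "1 \<le> a" "a < b" "b \<le> 2 * n" "a + b \<noteq> 2 * n + 1"
    and \<alpha>: "\<alpha> = eps n (int a) - eps n (int b)"
  shows "\<exists>F Y. sl2_root_family \<alpha> 1 F Y \<and> Y 0 \<in> fin_alg"
proof -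
  let ?u = "int a" and ?v = "int b"
  have odd: "\<not> per n dvd 2 * x" if "0 < x" "x < per n" for x
  proof
    assume "per n dvd 2 * x"
    moreover have "coprime (per n) 2" by simp
    ultimately have "per n dvd x" by (simp add: coprime_dvd_mult_right_iff)
    then show False using per_ndvd(1) that by blast
  qed
  have sum: "\<not> per n dvd ?u + ?v"
  proof
    assume "per n dvd ?u + ?v"
    then have "per n dvd ?u + ?v - per n" by (simp only: dvd_diff dvd_refl)
    then have "?u + ?v - per n = 0" using per_dvd_iff[of n "?u + ?v - per n"] ab by auto
    then show False using ab by simp
  qed
  have d: "\<not> per n dvd ?u" "\<not> per n dvd ?v" "\<not> per n dvd ?u - ?v" "\<not> per n dvd ?u + ?v"
    "\<not> per n dvd 2 * ?u" "\<not> per n dvd 2 * ?v"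
    using ab per_ndvd(1)[of ?u] per_ndvd(1)[of ?v] per_ndvd(2)[of "?v - ?u"] odd[of ?u] odd[of ?v] sum
    by auto
  have z: "(eps n ?u - eps n ?v) 0 = 0"
  proof -
    have "eps n (int m) 0 = - 1" if "1 \<le> m" "m \<le> 2 * n" for m
    proof -
      have "(int m + 2 * int n) div per n = 1"
        using that div_add_self2[of "per n" "int m - 1"] by (simp add: algebra_simps div_pos_pos_trivial)
      moreover have "int m div per n = 0" using that by (intro div_pos_pos_trivial) auto
      ultimately show ?thesis using n_pos by (simp add: eps_def)
    qed
    then show ?thesis using ab by (simp add: weight_apply)
  qed
  have \<alpha>0: "\<alpha> \<noteq> 0" "\<alpha> 0 = 0" unfolding \<alpha> using z eps_diff_nonzero[OF n_pos, of ?u ?v] ab by auto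
  have Y0: "short_Y n ?u ?v 0 = mX n ?v ?u"
    by (simp add: short_Y_def mX_def Q_def add.commute)
  obtain g0 where g0: "pair.piece (eps n ?v - eps n ?u) (g0, mX n ?v ?u)" "g0 \<in> fin_alg"
    using lift_mX_down[of a b] ab by auto
  have w0: "wt n (- 1) \<alpha> 0 = eps n ?v - eps n ?u"
    unfolding \<alpha> by (simp add: wt_def fun_eq_iff weight_apply)
  \<comment> \<open>The root \<alpha> + \<delta> is split at the index 0 into two weights;
    \<open>mX_swap\<close> rewrites the first factor so that its first index is 0, as
    \<open>lift_mX_up\<close> requires.\<close>
  have F: "liftable (wt n 1 \<alpha> 1) (short_F n ?u ?v)"
  proof -
    define c where "c = 2 * n + 1 - a"
    have c: "1 \<le> c" "c \<le> 2 * n" "int c = per n - ?u" using ab by (auto simp: c_def of_nat_diff)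
    have e: "mX n (?u - per n) 0 = lscale (- sg (?u - per n)) (mX n 0 (int c))"
      using mX_swap[of n "?u - per n" 0] by (simp add: c(3))
    have 1: "liftable (eps n 0 - eps n (int c)) (mX n (?u - per n) 0)"
      unfolding e by (rule liftable_scale[OF lift_mX_up[OF c(1,2)]])
    have 2: "liftable (eps n 0 - eps n ?v) (mX n 0 ?v)" using lift_mX_up[of b] ab by simp
    have d': "\<not> per n dvd ?u - per n" "\<not> per n dvd ?u - per n - ?v"
    proof -
      show "\<not> per n dvd ?u - per n" using d(1) by (metis dvd_add dvd_refl diff_add_cancel)
      have "?u - per n - ?v = (?u - ?v) - per n" by simp
      then show "\<not> per n dvd ?u - per n - ?v" using d(3) by (metis dvd_add dvd_refl diff_add_cancel)
    qed
    have "mX n (?u - per n) ?v = - short_F n ?u ?v"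
    proof -
      have "pm n (?u - per n) ?v = Q n ?u ?v 1"
        unfolding Q_def by (rule pm_cong, rule dvdI[of _ _ "- 1"]) simp_all
      moreover have "pm n (- ?v) (- (?u - per n)) = Q n (- ?v) (- ?u) 1" by (simp add: Q_def)
      moreover have "sg (?u - per n + ?v) = - sg (?u + ?v)" by (simp add: sg_def)
      ultimately show ?thesis by (simp add: mX_def short_F_def)
    qed
    then have "comm (mX n (?u - per n) 0) (mX n 0 ?v) = - short_F n ?u ?v"
      using mX_comm_through_0[OF d'(1) d(2) d'(2)] by simp
    then have "liftable (eps n 0 - eps n (int c) + (eps n 0 - eps n ?v)) (lscale (- 1) (short_F n ?u ?v))"
      using liftable_comm[OF 1 2] by simp
    moreover have "eps n 0 - eps n (int c) + (eps n 0 - eps n ?v) = wt n 1 \<alpha> 1"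
    proof -
      have "eps n (int c) = - eps n ?u - wt n 0 0 1"
        using eps_shift'[of n "- ?u" 1] c(3) by (simp add: eps_minus)
      then show ?thesis unfolding \<alpha> by (simp add: eps_0 wt_def fun_eq_iff weight_apply)
    qed
    ultimately show ?thesis using liftable_unscale[of _ "- 1"] by simp
  qed
  note fam = short_sl2_family[OF d]
  \<comment> \<open>The bracket of F with Y 0 raises the degree by one with factor 2, so lifts of F
    and Y 0 produce all the others.\<close>
  have Y: "liftable (wt n (- 1) \<alpha> (real p * 1)) (short_Y n ?u ?v p)" for p
  proof (induction p)
    case 0
    then show ?case using g0 unfolding Y0 by (auto simp: w0 liftable_def)
  next
    case (Suc p)
    have y0: "liftable (wt n (- 1) \<alpha> 0) (short_Y n ?u ?v 0)" using g0 unfolding Y0 by (auto simp: w0 liftable_def)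
    have "liftable (wt n 1 \<alpha> 1 + wt n (- 1) \<alpha> 0 + wt n (- 1) \<alpha> (real p * 1))
        (comm (comm (short_F n ?u ?v) (short_Y n ?u ?v 0)) (short_Y n ?u ?v p))"
      by (intro liftable_comm F y0 Suc)
    also have "comm (comm (short_F n ?u ?v) (short_Y n ?u ?v 0)) (short_Y n ?u ?v p) =
        lscale 2 (short_Y n ?u ?v (Suc p))"
      using fam by (simp add: sl2_family_def family_def)
    finally show ?case using liftable_unscale[of _ 2] by (simp add: wt_add add.commute)
  qed
  \<comment> \<open>\<open>lowering\<close> descends to p = 0. There, bracketing with a lift of
    \<open>mX n 0 b\<close> gives a lift of \<open>mX n 0 a\<close>, which is nonzero.\<close>
  have nz: "g \<noteq> 0" if "pair.piece (wt n (- 1) \<alpha> (real p * 1)) (g, short_Y n ?u ?v p)" for p g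
    using that
  proof (induction p arbitrary: g)
    case 0
    obtain g' where g': "pair.piece (eps n 0 - eps n ?v) (g', mX n 0 ?v)"
      using lift_mX_up[of b] ab unfolding liftable_def by auto
    have "pair.piece (eps n 0 - eps n ?v + (eps n ?v - eps n ?u)) (brk G g' g, comm (mX n 0 ?v) (mX n ?v ?u))"
      using piece_comm[OF g' , of "eps n ?v - eps n ?u" g "mX n ?v ?u"] 0 unfolding Y0 by (simp add: w0)
    moreover have "comm (mX n 0 ?v) (mX n ?v ?u) = mX n 0 ?u"
      using mX_comm_from_0[OF d(1,2,3)] d(4) by simp
    ultimately have "brk G g' g \<noteq> 0" using mX_0_lift_nonzero[of a] ab by simp
    then show ?case by auto
  next
    case (Suc p)
    obtain g' where g': "pair.piece (wt n 0 \<alpha> (- 1)) (g', lowering n ?u)"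
      using liftable_lowering[of a \<alpha>] ab unfolding liftable_def by auto
    have "pair.piece (wt n (- 1) \<alpha> (real p * 1)) (brk G g' g, short_Y n ?u ?v p)"
      using piece_comm[OF g' Suc.prems] lowering_short[OF d(1-5)] by (simp add: wt_add)
    then have "brk G g' g \<noteq> 0" by (rule Suc.IH)
    then show ?case by auto
  qed
  have "\<exists>F' Y'. sl2_root_family \<alpha> 1 F' Y' \<and> pair.piece (wt n 1 \<alpha> 1) (F', short_F n ?u ?v) \<and>
      (\<forall>i. pair.piece (wt n (- 1) \<alpha> (real i * 1)) (Y' i, short_Y n ?u ?v i))"
    by (rule sl2_root_familyI[OF fam \<alpha>0 _ F Y]) (simp, rule nz)
  then obtain F' Y' where FY: "sl2_root_family \<alpha> 1 F' Y'"
    "\<And>i. pair.piece (wt n (- 1) \<alpha> (real i * 1)) (Y' i, short_Y n ?u ?v i)" by blast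
  have "pair.piece (eps n ?v - eps n ?u) (Y' 0, mX n ?v ?u)" using FY(2)[of 0] unfolding Y0 by (simp add: w0)
  moreover have "eps n ?v - eps n ?u \<noteq> 0" using eps_diff_nonzero[OF n_pos, of ?u ?v] ab by auto
  ultimately have "Y' 0 = g0" using piece_unique g0(1) by blast
  then show ?thesis using FY(1) g0(2) by blast
qed

lemma long_root_families:
  assumes ab: "1 \<le> a" "a < b" "a + b = 2 * n + 1"
    and \<alpha>: "\<alpha> = eps n (int a) - eps n (int b)"
  shows "\<exists>F Y. sl2_root_family \<alpha> 2 F Y \<and> Y 0 \<in> fin_alg"
    "\<exists>F Y X. twisted_root_family \<alpha> F Y X"
proof -
  let ?u = "int a" and ?v = "int b"
  have v: "?v = per n - ?u" using ab by simp
  have d1: "\<not> per n dvd ?u" using per_ndvd(1)[of ?u] ab by auto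
  have d2: "\<not> per n dvd 2 * ?u" using per_ndvd(1)[of "2 * ?u"] ab by auto
  note d = d1 d2
  have z: "(eps n ?u - eps n ?v) 0 = 0"
  proof -
    have "eps n (int m) 0 = - 1" if "1 \<le> m" "m \<le> 2 * n" for m
    proof -
      have "(int m + 2 * int n) div per n = 1"
        using that div_add_self2[of "per n" "int m - 1"] by (simp add: algebra_simps div_pos_pos_trivial)
      moreover have "int m div per n = 0" using that by (intro div_pos_pos_trivial) auto
      ultimately show ?thesis using n_pos by (simp add: eps_def)
    qed
    then show ?thesis using ab by (simp add: weight_apply)
  qed
  have \<alpha>0: "\<alpha> \<noteq> 0" "\<alpha> 0 = 0" unfolding \<alpha> using z eps_diff_nonzero[OF n_pos, of ?u ?v] ab by auto
  have \<alpha>': "\<alpha> = eps n ?u - eps n (per n - ?u)" using \<alpha> v by simp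
  note half = wt_eps_half[OF \<alpha>']
  have F: "liftable (wt n (1 / 2) \<alpha> (1 / 2)) (tw_F n ?u)"
  proof -
    have "mX n 0 ?v = lscale (sg ?u) (tw_F n ?u)"
    proof -
      have "sg ?v = - sg ?u" using v by (simp add: sg_def)
      moreover have "pm n 0 ?v = Q n 0 (- ?u) 1" "pm n (- ?v) 0 = Q n ?u 0 1"
        unfolding Q_def v by (simp, rule pm_cong, rule dvdI[of _ _ "- 1"]) simp_all
      moreover have "sg ?u * sg ?u = 1" by (simp add: sg_def)
      ultimately show ?thesis by (simp add: mX_def tw_F_def lscale.scale_right_distrib add.commute)
    qed
    then have "liftable (eps n 0 - eps n ?v) (lscale (sg ?u) (tw_F n ?u))"
      using lift_mX_up[of b] ab by auto
    moreover have "eps n 0 - eps n ?v = wt n (1 / 2) \<alpha> (1 / 2)"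
    proof -
      have "eps n ?v = - eps n ?u - wt n 0 0 1" unfolding v
        using eps_shift'[of n "- ?u" 1] by (simp add: eps_minus)
      moreover have "eps n (per n) = - wt n 0 0 1" using eps_shift'[of n 0 1] by (simp add: eps_0)
      ultimately show ?thesis using half(1)[of 0] by (simp add: eps_0 add.commute)
    qed
    ultimately show ?thesis using liftable_unscale[of _ "sg ?u"] by (simp add: sg_def split: if_splits)
  qed
  \<comment> \<open>Because a + b is the period, the two summands of \<open>mX\<close>
    coincide.\<close>
  have mX0: "mX n ?v ?u = lscale 2 (Q n (- ?u) ?u (- 1))"
  proof -
    have "pm n ?v ?u = Q n (- ?u) ?u (- 1)" unfolding Q_def v by (rule pm_cong) simp_all
    moreover have "pm n (- ?u) (- ?v) = Q n (- ?u) ?u (- 1)"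
      unfolding Q_def v by (rule pm_cong) simp_all
    moreover have "sg (?v + ?u) = - 1" using v by (simp add: sg_def)
    ultimately show ?thesis by (simp add: mX_def lscale_2)
  qed
  have w0: "wt n (- 1) \<alpha> 0 = eps n ?v - eps n ?u"
    unfolding \<alpha> by (simp add: wt_def fun_eq_iff weight_apply)
  obtain g0 where g0: "pair.piece (eps n ?v - eps n ?u) (g0, mX n ?v ?u)" "g0 \<in> fin_alg"
    using lift_mX_down[of a b] ab by auto
  have Q0: "liftable (wt n (- 1) \<alpha> 0) (Q n (- ?u) ?u (- 1))"
    using g0(1) liftable_unscale[of _ 2] unfolding w0 mX0 liftable_def by auto
  note tw = tw_comm[OF d]
  have x0: "liftable (wt n (- 1) \<alpha> 0) (tw_x n ?u 0)"
    using liftable_scale[OF Q0, of "- sg ?u"] by (simp add: tw_x_def)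
  have y0: "liftable (wt n (- 1 / 2) \<alpha> (1 / 2)) (tw_y n ?u 0)"
    using liftable_comm[OF F x0] by (simp add: tw wt_add)
  have h0: "liftable (wt n 0 \<alpha> 1) (tw_h n ?u 0)"
    using liftable_comm[OF F y0] by (simp add: tw wt_add)
  have y: "liftable (wt n (- 1 / 2) \<alpha> (real q + 1 / 2)) (tw_y n ?u q)" for q
  proof (induction q)
    case 0
    then show ?case using y0 by simp
  next
    case (Suc q)
    have "liftable (wt n 0 \<alpha> 1 + wt n (- 1 / 2) \<alpha> (real q + 1 / 2)) (lscale (- 3) (tw_y n ?u (Suc q)))"
      using liftable_comm[OF h0 Suc] tw(3)[of 0 q] by (simp add: sg_def)
    then show ?case using liftable_unscale[of _ "- 3"] by (simp add: wt_add algebra_simps)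
  qed
  \<comment> \<open>For p > 0, \<open>tw_x\<close> at p is -1/2 times the bracket of
    \<open>tw_y\<close> at 0 and at 2p - 1.\<close>
  have x: "liftable (wt n (- 1) \<alpha> (2 * real p)) (tw_x n ?u p)" for p
  proof (cases p)
    case 0
    then show ?thesis using x0 by simp
  next
    case (Suc k)
    have "comm (tw_y n ?u 0) (tw_y n ?u (Suc (2 * k))) = lscale (- 2) (tw_x n ?u p)"
      using tw(5)[of 0 "Suc (2 * k)"] Suc by simp
    then have "liftable (wt n (- 1 / 2) \<alpha> (1 / 2) + wt n (- 1 / 2) \<alpha> (real (Suc (2 * k)) + 1 / 2))
        (lscale (- 2) (tw_x n ?u p))"
      using liftable_comm[OF y0 y[of "Suc (2 * k)"]] by simp
    then show ?thesis using liftable_unscale[of _ "- 2"] Suc by (simp add: wt_add algebra_simps)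
  qed
  have nzy: "g \<noteq> 0" if "pair.piece (wt n (- 1 / 2) \<alpha> (real q + 1 / 2)) (g, tw_y n ?u q)" for q g
    using that
  proof (induction q arbitrary: g)
    case 0
    have "sg 0 = 1" by (simp add: sg_def)
    then have "mX n 0 ?u = lscale (- 1) (tw_y n ?u 0)" by (simp add: mX_def tw_y_def Q_def)
    moreover have "eps n 0 - eps n ?u = wt n (- 1 / 2) \<alpha> (1 / 2)"
      using half(2)[of 0] by (simp add: eps_0 eps_minus)
    ultimately have "pair.piece (eps n 0 - eps n ?u) (scl G (- 1) g, mX n 0 ?u)"
      using piece_lscale[OF 0, of "- 1"] by simp
    then have "scl G (- 1) g \<noteq> 0"
      using ab by (intro mX_0_lift_nonzero[of a "scl G (- 1) g"]) simp_all
    then show ?case by auto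
  next
    case (Suc q)
    obtain g' where g': "pair.piece (wt n 0 \<alpha> (- 1)) (g', lowering n ?u)"
      using liftable_lowering[of a \<alpha>] ab unfolding liftable_def by auto
    have "pair.piece (wt n (- 1 / 2) \<alpha> (real q + 1 / 2)) (brk G g' g, lscale (- 3) (tw_y n ?u q))"
      using piece_comm[OF g' Suc.prems] by (simp add: wt_add tw add.commute)
    then have "pair.piece (wt n (- 1 / 2) \<alpha> (real q + 1 / 2)) (scl G (- 1 / 3) (brk G g' g), tw_y n ?u q)"
      using piece_lscale[of _ "brk G g' g" "lscale (- 3) (tw_y n ?u q)" "- 1 / 3"] by simp
    then have "scl G (- 1 / 3) (brk G g' g) \<noteq> 0" by (rule Suc.IH)
    then show ?case by auto
  qed
  obtain F' where F': "pair.piece (wt n (1 / 2) \<alpha> (1 / 2)) (F', tw_F n ?u)"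
    using F unfolding liftable_def by blast
  \<comment> \<open>The bracket with a lift of \<open>tw_F\<close> leads to degree 2p of
    \<open>tw_y\<close>, which is already known to lift to nonzero vectors.\<close>
  have nzx: "g \<noteq> 0" if "pair.piece (wt n (- 1) \<alpha> (2 * real p)) (g, tw_x n ?u p)" for p g
  proof -
    have "pair.piece (wt n (- 1 / 2) \<alpha> (real (2 * p) + 1 / 2)) (brk G F' g, tw_y n ?u (2 * p))"
      using piece_comm[OF F' that] by (simp add: wt_add tw add.commute)
    then have "brk G F' g \<noteq> 0" by (rule nzy)
    then show ?thesis by auto
  qed
  have Y: "liftable (wt n (- 1 / 2) \<alpha> (real i * (1 / 2))) (tw_Y n ?u i)" for i
  proof (cases "odd i")
    case True
    then obtain q where "i = Suc (2 * q)" by (metis oddE Suc_eq_plus1)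
    then show ?thesis using liftable_scale[OF y[of q], of "(- 1 / 2) ^ q"] by (simp add: tw_Y_def add.commute add_divide_distrib)
  qed (simp add: tw_Y_def liftable_0)
  have X: "liftable (wt n (- 1) \<alpha> (real i * (1 / 2))) (tw_X n ?u i)" for i
  proof (cases "4 dvd i")
    case True
    then obtain p where "i = 4 * p" by auto
    then show ?thesis using liftable_scale[OF x[of p], of "(1 / 4) ^ p"] by (simp add: tw_X_def)
  qed (simp add: tw_X_def liftable_0)
  have "\<forall>i. \<exists>g. pair.piece (wt n (- 1 / 2) \<alpha> (real i * (1 / 2))) (g, tw_Y n ?u i)"
    using Y unfolding liftable_def by blast
  then have "\<exists>g. \<forall>i. pair.piece (wt n (- 1 / 2) \<alpha> (real i * (1 / 2))) (g i, tw_Y n ?u i)" by (rule choice)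
  then obtain Y' where Y': "\<And>i. pair.piece (wt n (- 1 / 2) \<alpha> (real i * (1 / 2))) (Y' i, tw_Y n ?u i)" by blast
  have "\<forall>i. \<exists>g. pair.piece (wt n (- 1) \<alpha> (real i * (1 / 2))) (g, tw_X n ?u i)"
    using X unfolding liftable_def by blast
  then have "\<exists>g. \<forall>i. pair.piece (wt n (- 1) \<alpha> (real i * (1 / 2))) (g i, tw_X n ?u i)" by (rule choice)
  then obtain X' where X': "\<And>i. pair.piece (wt n (- 1) \<alpha> (real i * (1 / 2))) (X' i, tw_X n ?u i)" by blast
  note fam = tw_family[OF d, unfolded twisted_family_def]
  have Y'0: "Y' i = 0" if "even i" for i
    using Y'[of i] that piece_null wt_nonzero[OF \<alpha>0] by (auto simp: tw_Y_def)
  have X'0: "X' i = 0" if "\<not> 4 dvd i" for i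
    using X'[of i] that piece_null wt_nonzero[OF \<alpha>0] by (auto simp: tw_X_def)
  have fam': "family (scl G) (brk G) F' Y' X' (\<lambda>i. brk G F' (Y' i)) (\<lambda>i. if 4 dvd i then 1 else 0)
      (\<lambda>i j. if i mod 4 = 1 then 6 else if i mod 4 = 3 then 2 else 0)
      (\<lambda>i j. if i mod 4 = 3 then 4 else 0)
      (\<lambda>i j. if i mod 4 = 1 \<and> j mod 4 = 3 then 4 else if i mod 4 = 3 \<and> j mod 4 = 1 then - 4 else 0)"
    by (rule lift_family[OF conjunct2[OF conjunct2[OF fam]] \<alpha>0, of "1 / 2" "1 / 2"])
       (use F' Y' X' in simp_all)
  then have tf: "twisted_family (scl G) (brk G) F' Y' X' (\<lambda>i. brk G F' (Y' i))"
    unfolding twisted_family_def using Y'0 X'0 by blast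
  have nY: "Y' i \<noteq> 0" if odd_i: "odd i" for i
  proof -
    obtain q where q: "i = Suc (2 * q)" using odd_i by (metis oddE Suc_eq_plus1)
    have "pair.piece (wt n (- 1 / 2) \<alpha> (real q + 1 / 2)) (scl G (1 / (- 1 / 2) ^ q) (Y' i), tw_y n ?u q)"
      using piece_lscale[OF Y'[of i], of "1 / (- 1 / 2) ^ q"]
      by (simp add: q tw_Y_def add.commute add_divide_distrib)
    then have "scl G (1 / (- 1 / 2) ^ q) (Y' i) \<noteq> 0" by (rule nzy)
    then show ?thesis by auto
  qed
  have nX: "X' i \<noteq> 0" if dvd_i: "4 dvd i" for i
  proof -
    obtain p where p: "i = 4 * p" using dvd_i by auto
    have "pair.piece (wt n (- 1) \<alpha> (2 * real p)) (scl G (1 / (1 / 4) ^ p) (X' i), tw_x n ?u p)"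
      using piece_lscale[OF X'[of i], of "1 / (1 / 4) ^ p"] by (simp add: p tw_X_def)
    then have "scl G (1 / (1 / 4) ^ p) (X' i) \<noteq> 0" by (rule nzx)
    then show ?thesis by auto
  qed
  have "brk G F' (X' 0) = scl G 1 (Y' (Suc 0))" using fam' unfolding family_def by (metis dvd_0_right)
  then have nF: "F' \<noteq> 0" using nY[of 1] by auto
  have "Y' i \<in> root_space (wt n (- 1 / 2) \<alpha> (real i / 2))"
    "X' i \<in> root_space (wt n (- 1) \<alpha> (real i / 2))" for i
    using piece_root_space[OF Y'[of i]] piece_root_space[OF X'[of i]] by simp_all
  then have "twisted_root_family \<alpha> F' Y' X'"
    unfolding twisted_root_family_def using tf nY nX nF piece_root_space[OF F'] by blast
  then show "\<exists>F Y X. twisted_root_family \<alpha> F Y X" by blast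
  \<comment> \<open>The family of the full long root reuses the sequence \<open>tw_x\<close> up to a
    sign, so its lifts and their nonvanishing carry over.\<close>
  have lY: "tw_x n ?u p = lscale (- sg ?u) (long_Y n ?u p)" for p by (simp add: tw_x_def long_Y_def)
  have sg0: "- sg ?u \<noteq> 0" by (simp add: sg_def)
  have LF: "liftable (wt n 1 \<alpha> 2) (long_F n ?u)"
  proof -
    have "liftable (wt n 0 \<alpha> 1 + wt n (1 / 2) \<alpha> (1 / 2) + wt n (1 / 2) \<alpha> (1 / 2)) (lscale (6 * sg ?u) (long_F n ?u))"
      unfolding long_F_eq[OF d, symmetric] by (intro liftable_comm h0 F)
    then show ?thesis using liftable_unscale[of _ "6 * sg ?u"] sg0 by (simp add: wt_add)
  qed
  have LY: "liftable (wt n (- 1) \<alpha> (real p * 2)) (long_Y n ?u p)" for p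
  proof (rule liftable_unscale[OF _ sg0])
    show "liftable (wt n (- 1) \<alpha> (real p * 2)) (lscale (- sg ?u) (long_Y n ?u p))"
      using x[of p] unfolding lY by (simp only: mult.commute)
  qed
  have nzL: "g \<noteq> 0" if "pair.piece (wt n (- 1) \<alpha> (real p * 2)) (g, long_Y n ?u p)" for p g
  proof -
    have "pair.piece (wt n (- 1) \<alpha> (2 * real p)) (scl G (- sg ?u) g, tw_x n ?u p)"
      using piece_lscale[OF that, of "- sg ?u"] by (simp only: lY mult.commute)
    then have "scl G (- sg ?u) g \<noteq> 0" by (rule nzx)
    then show ?thesis by auto
  qed
  have "\<exists>F' Y'. sl2_root_family \<alpha> 2 F' Y' \<and> pair.piece (wt n 1 \<alpha> 2) (F', long_F n ?u) \<and>
      (\<forall>i. pair.piece (wt n (- 1) \<alpha> (real i * 2)) (Y' i, long_Y n ?u i))"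
    by (rule sl2_root_familyI[OF long_sl2_family[OF d2] \<alpha>0 _ LF LY]) (simp, rule nzL)
  then obtain F2 Y2 where FY: "sl2_root_family \<alpha> 2 F2 Y2"
    "\<And>i. pair.piece (wt n (- 1) \<alpha> (real i * 2)) (Y2 i, long_Y n ?u i)" by blast
  have "pair.piece (eps n ?v - eps n ?u) (Y2 0, Q n (- ?u) ?u (- 1))"
    using FY(2)[of 0] by (simp add: w0 long_Y_def)
  moreover have "pair.piece (eps n ?v - eps n ?u) (scl G (1 / 2) g0, Q n (- ?u) ?u (- 1))"
    using piece_lscale[OF g0(1), of "1 / 2"] by (simp add: mX0)
  moreover have "eps n ?v - eps n ?u \<noteq> 0" using eps_diff_nonzero[OF n_pos, of ?u ?v] ab by auto
  ultimately have "Y2 0 = scl G (1 / 2) g0" using piece_unique by blast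
  then have "Y2 0 \<in> fin_alg" using g0(2) fin_alg_subalgebra by (auto simp: lie_subalgebra_def intro: subspace_scale)
  then show "\<exists>F Y. sl2_root_family \<alpha> 2 F Y \<and> Y 0 \<in> fin_alg" using FY(1) by blast
qed

end

unbundle fps_syntax

section \<open>Garland-type identities\<close>

text \<open>Reduces each commutation law between power series to a sum of commutators along an
  antidiagonal.\<close>

lemma fps_commutator_nth:
  fixes f g :: "'a::ring_1 fps"
  shows "(f * g) $ k - (g * f) $ k = (\<Sum>i\<le>k. f $ i * g $ (k - i) - g $ (k - i) * f $ i)"
proof -
  have "(g * f) $ k = (\<Sum>i=0..k. g $ (k - i) * f $ i)"
    unfolding fps_mult_nth by (subst sum.atLeastAtMost_rev) (auto intro!: sum.cong)
  then show ?thesis by (simp add: fps_mult_nth sum_subtractf atLeast0AtMost)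
qed

lemma of_nat_lop_pscale: "app (of_nat k * T) v = pscale (of_nat k) (app T v)"
  by (simp add: of_nat_lop)

text \<open>The sums are the coefficientwise form of the hypotheses of
  \<open>heisenberg_exp\<close>. They are compared only as multiples of \<open>Y (Suc k)\<close> or
  \<open>X (Suc k)\<close>, because for the twisted family the bare scalars differ at indices where
  these operators are 0.\<close>

locale root_module =
  fixes F :: "'b lop" and Y X H :: "nat \<Rightarrow> 'b lop" and \<eta> :: "nat \<Rightarrow> complex" and \<mu> \<nu> \<tau> :: "nat \<Rightarrow> nat \<Rightarrow> complex"
    and w :: "'b \<Rightarrow>\<^sub>0 complex"
  assumes fam: "family lscale comm F Y X H \<eta> \<mu> \<nu> \<tau>"
    and \<mu>_sum: "lscale (\<Sum>i\<le>k. \<mu> i (k - i)) (Y (Suc k)) = lscale (2 * of_nat (Suc k) - 2 * \<eta> k) (Y (Suc k))"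
    and \<nu>_sum: "lscale (\<Sum>i\<le>k. \<nu> i (k - i)) (X (Suc k)) = lscale (of_nat (Suc k)) (X (Suc k))"
    and \<tau>_sum: "lscale (\<Sum>i\<le>k. of_nat (Suc i) * \<tau> (Suc i) (k - i)) (X (Suc k)) =
      lscale (- 2 * of_nat (Suc k)) (X (Suc k))"
    and \<eta>\<tau>_sum: "lscale (\<Sum>i\<le>k. \<eta> i * \<tau> (Suc i) (k - i)) (X (Suc k)) = lscale (of_nat (Suc k)) (X (Suc k))"
    and F_w: "app F w = 0" and H_w: "app (H i) w = 0"
begin

lemma F_Y: "F * Y i = Y i * F + H i"
  using fam by (simp add: family_def comm_def algebra_simps)

lemma F_X: "F * X i - X i * F = lscale (\<eta> i) (Y (Suc i))"
  using fam by (simp add: family_def comm_def)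

lemma H_Y: "H i * Y j - Y j * H i = lscale (\<mu> i j) (Y (Suc (i + j)))"
  using fam by (simp add: family_def comm_def)

lemma H_X: "H i * X j - X j * H i = lscale (\<nu> i j) (X (Suc (i + j)))"
  using fam by (simp add: family_def comm_def)

lemma Y_Y: "Y i * Y j - Y j * Y i = lscale (\<tau> i j) (X (i + j))"
  using fam by (simp add: family_def comm_def)

lemma X_X: "X i * X j = X j * X i" and X_Y: "X i * Y j = Y j * X i"
  using fam by (simp_all add: family_def comm_def)

fun P :: "nat \<Rightarrow> 'b lop fps" where
  "P 0 = 1"
| "P (Suc 0) = Abs_fps Y"
| "P (Suc (Suc m)) = fps_const (lscale (1 / of_nat (Suc (Suc m))) 1) *
     (Abs_fps Y * P (Suc m) + 2 * (Abs_fps X * P m))"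

lemma scale_cancel: "of_nat (Suc m) * (lscale (1 / of_nat (Suc m)) 1 * T) = (T :: 'b lop)"
  by (simp add: of_nat_lop del: of_nat_Suc)

lemma of_nat_fps_nth: "(of_nat m * f) $ k = of_nat m * (f $ k :: 'b lop)"
  by (induction m) (simp_all add: algebra_simps)

sublocale heis: heisenberg_exp P "Abs_fps Y" "Abs_fps X" "fps_const F" "Abs_fps H" fps_deriv
proof
  fix m :: nat and a b :: "'b lop fps"
  show "P 0 = 1" "P (Suc 0) = Abs_fps Y" by simp_all
  show "of_nat (Suc (Suc m)) * P (Suc (Suc m)) = Abs_fps Y * P (Suc m) + 2 * (Abs_fps X * P m)"
    by (rule fps_ext) (simp only: P.simps of_nat_fps_nth fps_mult_left_const_nth scale_cancel)
  show "a = 0" if "of_nat (Suc m) * a = 0"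
  proof (rule fps_ext)
    fix k
    have "of_nat (Suc m) * (a $ k) = 0" using that by (metis fps_zero_nth of_nat_fps_nth)
    then have "lscale (of_nat (Suc m)) (a $ k) = 0" by (simp only: of_nat_lop)
    then show "a $ k = 0 $ k" by (simp del: of_nat_Suc)
  qed
  show "fps_deriv (a + b) = fps_deriv a + fps_deriv b" by simp
  show "fps_deriv (a * b) = a * fps_deriv b + fps_deriv a * b" by simp
  have com: "f * g = g * f" if "\<And>i j. f $ i * g $ j = g $ j * (f $ i :: 'b lop)" for f g
  proof (rule fps_ext)
    fix k show "(f * g) $ k = (g * f) $ k"
      using fps_commutator_nth[of f g k] that by simp
  qed
  show "fps_deriv (Abs_fps X) * Abs_fps Y = Abs_fps Y * fps_deriv (Abs_fps X)"
    by (rule com) (simp only: fps_deriv_nth of_nat_lop Abs_fps_inverse fps_nth_Abs_fps lscale_mult_left lscale_mult_right X_Y)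
  show "fps_deriv (Abs_fps X) * Abs_fps X = Abs_fps X * fps_deriv (Abs_fps X)"
    by (rule com) (simp only: fps_deriv_nth of_nat_lop fps_nth_Abs_fps lscale_mult_left lscale_mult_right X_X)
  show "fps_deriv (Abs_fps Y) * Abs_fps X = Abs_fps X * fps_deriv (Abs_fps Y)"
    by (rule com) (simp only: fps_deriv_nth of_nat_lop fps_nth_Abs_fps lscale_mult_left lscale_mult_right X_Y)
  have Z: "(fps_const F * Abs_fps X - Abs_fps X * fps_const F) $ i = lscale (\<eta> i) (Y (Suc i))" for i
    using F_X[of i] by simp
  show "(fps_const F * Abs_fps X - Abs_fps X * fps_const F) * Abs_fps X =
      Abs_fps X * (fps_const F * Abs_fps X - Abs_fps X * fps_const F)"
    by (rule com) (simp only: Z fps_nth_Abs_fps lscale_mult_left lscale_mult_right X_Y)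
  show "fps_const F * Abs_fps Y = Abs_fps Y * fps_const F + Abs_fps H"
    by (rule fps_ext) (simp add: F_Y)
  show "Abs_fps H * Abs_fps Y = Abs_fps Y * Abs_fps H +
      2 * (fps_deriv (Abs_fps Y) - (fps_const F * Abs_fps X - Abs_fps X * fps_const F))"
  proof (rule fps_ext)
    fix k
    have "(Abs_fps H * Abs_fps Y) $ k - (Abs_fps Y * Abs_fps H) $ k = lscale (\<Sum>i\<le>k. \<mu> i (k - i)) (Y (Suc k))"
      unfolding fps_commutator_nth lscale.scale_sum_left by (rule sum.cong) (simp_all add: H_Y)
    also have "\<dots> = lscale (2 * of_nat (Suc k)) (Y (Suc k)) - lscale (2 * \<eta> k) (Y (Suc k))"
      unfolding \<mu>_sum by (rule lscale.scale_left_diff_distrib)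
    also have "\<dots> = (2 * (fps_deriv (Abs_fps Y) - (fps_const F * Abs_fps X - Abs_fps X * fps_const F))) $ k"
      unfolding mult_2 fps_add_nth fps_sub_nth[of "fps_deriv _"] Z fps_deriv_nth fps_nth_Abs_fps of_nat_lop
      by (simp add: lscale_double lscale.scale_right_distrib del: of_nat_Suc of_nat_add)
    finally show "(Abs_fps H * Abs_fps Y) $ k = (Abs_fps Y * Abs_fps H +
      2 * (fps_deriv (Abs_fps Y) - (fps_const F * Abs_fps X - Abs_fps X * fps_const F))) $ k"
      unfolding fps_add_nth by (simp only: diff_eq_eq add.commute)
  qed
  show "Abs_fps H * Abs_fps X = Abs_fps X * Abs_fps H + fps_deriv (Abs_fps X)"
  proof (rule fps_ext)
    fix k
    have "(Abs_fps H * Abs_fps X) $ k - (Abs_fps X * Abs_fps H) $ k = lscale (\<Sum>i\<le>k. \<nu> i (k - i)) (X (Suc k))"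
      unfolding fps_commutator_nth lscale.scale_sum_left by (rule sum.cong) (simp_all add: H_X)
    also have "\<dots> = fps_deriv (Abs_fps X) $ k" unfolding \<nu>_sum by (simp add: of_nat_lop del: of_nat_Suc of_nat_add)
    finally show "(Abs_fps H * Abs_fps X) $ k = (Abs_fps X * Abs_fps H + fps_deriv (Abs_fps X)) $ k"
      unfolding fps_add_nth by (simp only: diff_eq_eq add.commute)
  qed
  show "fps_deriv (Abs_fps Y) * Abs_fps Y = Abs_fps Y * fps_deriv (Abs_fps Y) - 2 * fps_deriv (Abs_fps X)"
  proof (rule fps_ext)
    fix k
    have "(fps_deriv (Abs_fps Y) * Abs_fps Y) $ k - (Abs_fps Y * fps_deriv (Abs_fps Y)) $ k =
        lscale (\<Sum>i\<le>k. of_nat (Suc i) * \<tau> (Suc i) (k - i)) (X (Suc k))"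
      unfolding fps_commutator_nth lscale.scale_sum_left
      by (rule sum.cong) (simp_all add: of_nat_lop Y_Y lscale.scale_right_diff_distrib[symmetric]
          del: of_nat_Suc of_nat_add)
    also have "\<dots> = - (2 * fps_deriv (Abs_fps X)) $ k"
      unfolding \<tau>_sum mult_2 fps_add_nth
      by (simp add: of_nat_lop lscale_double lscale.scale_right_distrib del: of_nat_Suc of_nat_add)
    finally show "(fps_deriv (Abs_fps Y) * Abs_fps Y) $ k =
        (Abs_fps Y * fps_deriv (Abs_fps Y) - 2 * fps_deriv (Abs_fps X)) $ k"
      unfolding fps_sub_nth by (simp only: diff_eq_eq add.commute) simp
  qed
  show "(fps_const F * Abs_fps X - Abs_fps X * fps_const F) * Abs_fps Y =
     Abs_fps Y * (fps_const F * Abs_fps X - Abs_fps X * fps_const F) + fps_deriv (Abs_fps X)"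
  proof (rule fps_ext)
    fix k
    let ?Z = "fps_const F * Abs_fps X - Abs_fps X * fps_const F"
    have "(?Z * Abs_fps Y) $ k - (Abs_fps Y * ?Z) $ k = lscale (\<Sum>i\<le>k. \<eta> i * \<tau> (Suc i) (k - i)) (X (Suc k))"
      unfolding fps_commutator_nth lscale.scale_sum_left Z
      by (rule sum.cong) (simp_all add: Y_Y lscale.scale_right_diff_distrib[symmetric])
    also have "\<dots> = fps_deriv (Abs_fps X) $ k"
      unfolding \<eta>\<tau>_sum by (simp add: of_nat_lop del: of_nat_Suc of_nat_add)
    finally show "(?Z * Abs_fps Y) $ k = (Abs_fps Y * ?Z + fps_deriv (Abs_fps X)) $ k"
      unfolding fps_add_nth by (simp only: diff_eq_eq add.commute)
  qed
qed

definition p :: "nat \<Rightarrow> nat \<Rightarrow> 'b \<Rightarrow>\<^sub>0 complex" where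
  "p m k = app (P m $ k) w"

text \<open>F and all H i kill w, so only the derivative term of \<open>F_P\<close>
  survives.\<close>

lemma F_p: "app F (p (Suc m) k) = pscale (of_nat (Suc k)) (p m (Suc k))"
proof -
  have "F * P (Suc m) $ k = (fps_const F * P (Suc m)) $ k" by simp
  also have "\<dots> = P (Suc m) $ k * F + (P m * Abs_fps H) $ k + of_nat (Suc k) * P m $ Suc k"
    unfolding heis.F_P by simp
  finally have "app (F * P (Suc m) $ k) w = app ((P m * Abs_fps H) $ k) w + app (of_nat (Suc k) * P m $ Suc k) w"
    by (simp add: F_w del: of_nat_Suc)
  also have "app ((P m * Abs_fps H) $ k) w = 0"
    by (simp add: fps_mult_nth app_lop_sum H_w)
  finally show ?thesis unfolding of_nat_lop_pscale by (simp add: p_def del: of_nat_Suc)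
qed

lemma F_pow_p: "(app F ^^ s) (p (m + s) k) = pscale (of_nat (\<Prod>i\<in>{Suc k..k + s}. i)) (p m (k + s))"
proof (induction s arbitrary: k)
  case (Suc s)
  have "(app F ^^ Suc s) (p (m + Suc s) k) = (app F ^^ s) (app F (p (Suc (m + s)) k))"
    by (simp add: funpow_swap1)
  also have "\<dots> = pscale (of_nat (Suc k)) ((app F ^^ s) (p (m + s) (Suc k)))"
  proof -
    have "(app F ^^ s) (pscale c v) = pscale c ((app F ^^ s) v)" for c v
      by (induction s) simp_all
    then show ?thesis by (simp only: F_p)
  qed
  also have "\<dots> = pscale (of_nat (Suc k * (\<Prod>i\<in>{Suc (Suc k)..Suc k + s}. i))) (p m (Suc k + s))"
    unfolding Suc pscale.scale_scale of_nat_mult ..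
  also have "Suc k * (\<Prod>i\<in>{Suc (Suc k)..Suc k + s}. i) = (\<Prod>i\<in>{Suc k..k + Suc s}. i)"
  proof -
    have "{Suc k..k + Suc s} = insert (Suc k) {Suc (Suc k)..Suc k + s}" by auto
    then show ?thesis by simp
  qed
  finally show ?case by simp
qed simp

lemma F_pow_p_eq_0: "(app F ^^ s) (p (m + s) 0) = 0 \<longleftrightarrow> p m s = 0"
proof -
  have "(\<Prod>i\<in>{Suc 0..0 + s}. i) \<noteq> 0" by simp
  then show ?thesis unfolding F_pow_p using pscale.scale_eq_0_iff by (simp del: of_nat_prod)
qed

lemma p_rec: "pscale (of_nat (Suc m)) (p (Suc m) k) = (\<Sum>i\<le>k. app (Y i) (p m (k - i))) +
   pscale 2 (\<Sum>i\<le>k. if m = 0 then 0 else app (X i) (p (m - 1) (k - i)))"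
proof -
  have "of_nat (Suc m) * P (Suc m) = Abs_fps Y * P m + 2 * (Abs_fps X * (if m = 0 then 0 else P (m - 1)))"
    using heis.P_rec[of "Suc m"] by (cases m) (simp_all add: heis.p_def)
  then have "of_nat (Suc m) * P (Suc m) $ k = (Abs_fps Y * P m) $ k +
      ((Abs_fps X * (if m = 0 then 0 else P (m - 1))) $ k + (Abs_fps X * (if m = 0 then 0 else P (m - 1))) $ k)"
    unfolding mult_2 by (metis fps_add_nth of_nat_fps_nth)
  then have "app (of_nat (Suc m) * P (Suc m) $ k) w = app ((Abs_fps Y * P m) $ k) w +
      (app ((Abs_fps X * (if m = 0 then 0 else P (m - 1))) $ k) w +
       app ((Abs_fps X * (if m = 0 then 0 else P (m - 1))) $ k) w)" by simp
  moreover have "pscale 2 v = v + v" for v :: "'b \<Rightarrow>\<^sub>0 complex"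
    using pscale.scale_left_distrib[of 1 1 v] by simp
  ultimately show ?thesis unfolding of_nat_lop_pscale
    by (cases "m = 0") (simp_all add: fps_mult_nth app_lop_sum p_def atLeast0AtMost del: of_nat_Suc P.simps)
qed

lemma p_0: "p 0 k = (if k = 0 then w else 0)"
  by (simp add: p_def)

lemma p_constant_Y: "X 0 = 0 \<Longrightarrow> pscale (fact m) (p m 0) = (app (Y 0) ^^ m) w"
proof (induction m)
  case (Suc m)
  have "pscale (fact (Suc m)) (p (Suc m) 0) = pscale (fact m) (pscale (of_nat (Suc m)) (p (Suc m) 0))"
    by (simp add: mult.commute)
  also have "\<dots> = app (Y 0) (pscale (fact m) (p m 0))"
    unfolding p_rec using Suc.prems by (cases "m = 0") simp_all
  finally show ?case using Suc by simp
qed (simp add: p_0)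

lemma p_constant_X: "Y 0 = 0 \<Longrightarrow> pscale (fact m) (p (2 * m) 0) = (app (X 0) ^^ m) w"
proof (induction m)
  case (Suc m)
  have "pscale (of_nat (Suc (Suc (2 * m)))) (p (Suc (Suc (2 * m))) 0) = pscale 2 (app (X 0) (p (2 * m) 0))"
    unfolding p_rec using Suc.prems by simp
  then have "pscale (1 / 2) (pscale (of_nat (Suc (Suc (2 * m)))) (p (2 * Suc m) 0)) =
      pscale (1 / 2) (pscale 2 (app (X 0) (p (2 * m) 0)))"
    by simp
  moreover have "(1 / 2) * of_nat (Suc (Suc (2 * m))) = (of_nat (Suc m) :: complex)"
    by simp
  ultimately have *: "pscale (of_nat (Suc m)) (p (2 * Suc m) 0) = app (X 0) (p (2 * m) 0)"
    unfolding pscale.scale_scale by (simp del: of_nat_Suc)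
  have "pscale (fact (Suc m)) (p (2 * Suc m) 0) = pscale (fact m) (pscale (of_nat (Suc m)) (p (2 * Suc m) 0))"
    by (simp add: mult.commute)
  also have "\<dots> = app (X 0) (pscale (fact m) (p (2 * m) 0))" unfolding * by simp
  finally show ?case using Suc by simp
qed (simp add: p_0)

end

section \<open>Words in the lowering operators\<close>

lemma pow_zero: "(app T ^^ s) 0 = 0"
  by (induction s) simp_all

lemma pow_scale: "(app T ^^ s) (pscale c v) = pscale c ((app T ^^ s) v)"
  by (induction s) simp_all

lemma pow_eq_0: "(app T ^^ l) v = 0 \<Longrightarrow> l \<le> l' \<Longrightarrow> (app T ^^ l') v = 0"
proof -
  assume v: "(app T ^^ l) v = 0" "l \<le> l'"
  then obtain r where "l' = r + l" by (metis le_Suc_ex add.commute)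
  then show ?thesis using v(1) by (simp add: funpow_add pow_zero)
qed

lemma app_pow_commute:
  assumes "\<And>v. app S (app T v) = app T (app S v)"
  shows "app S ((app T ^^ s) v) = (app T ^^ s) (app S v)"
  by (induction s) (simp_all add: assms)

context root_module
begin

text \<open>Combinations of words applied to w. The first number is the degree in T, where Y counts
  once and X twice; the second is the degree in z.\<close>

inductive Wd :: "nat \<Rightarrow> nat \<Rightarrow> ('b \<Rightarrow>\<^sub>0 complex) \<Rightarrow> bool" where
  Wd_w: "Wd 0 0 w"
| Wd_Y: "Wd m k v \<Longrightarrow> Wd (Suc m) (k + i) (app (Y i) v)"
| Wd_X: "Wd m k v \<Longrightarrow> Wd (Suc (Suc m)) (k + i) (app (X i) v)"
| Wd_zero: "Wd m k 0"
| Wd_add: "Wd m k v \<Longrightarrow> Wd m k v' \<Longrightarrow> Wd m k (v + v')"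
| Wd_scale: "Wd m k v \<Longrightarrow> Wd m k (pscale c v)"

lemma Wd_sum: "(\<And>i. i \<in> A \<Longrightarrow> Wd m k (f i)) \<Longrightarrow> Wd m k (sum f A)"
  by (induction A rule: infinite_finite_induct) (auto intro: Wd_zero Wd_add)

lemma p_rec': "p (Suc m) k = pscale (1 / of_nat (Suc m)) ((\<Sum>i\<le>k. app (Y i) (p m (k - i))) +
   pscale 2 (\<Sum>i\<le>k. if m = 0 then 0 else app (X i) (p (m - 1) (k - i))))"
  unfolding p_rec[symmetric] by (simp del: of_nat_Suc)

lemma Wd_p: "Wd m k (p m k)"
proof (induction m arbitrary: k rule: less_induct)
  case (less m)
  show ?case
  proof (cases m)
    case 0
    then show ?thesis by (auto simp: p_0 intro: Wd_w Wd_zero)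
  next
    case (Suc m')
    have 1: "Wd (Suc m') k (app (Y i) (p m' (k - i)))" if "i \<le> k" for i
      using Wd_Y[OF less[of m' "k - i"], of i] Suc that by simp
    have 2: "Wd (Suc m') k (if m' = 0 then 0 else app (X i) (p (m' - 1) (k - i)))" if "i \<le> k" for i
      using Wd_X[OF less[of "m' - 1" "k - i"], of i] Suc that by (cases m') (auto intro: Wd_zero)
    show ?thesis unfolding Suc p_rec'
      by (intro Wd_scale Wd_add Wd_sum 1 2) auto
  qed
qed

lemma app_X_Y: "app (X i) (app (Y j) v) = app (Y j) (app (X i) v)"
  and app_X_X: "app (X i) (app (X j) v) = app (X j) (app (X i) v)"
  by (metis X_Y app_lop(6)) (metis X_X app_lop(6))

lemma app_Y_Y: "app (Y i) (app (Y j) v) = app (Y j) (app (Y i) v) + pscale (\<tau> i j) (app (X (i + j)) v)"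
proof -
  have "app (Y i * Y j - Y j * Y i) v = app (lscale (\<tau> i j) (X (i + j))) v" by (simp only: Y_Y)
  then show ?thesis by (simp add: diff_eq_eq add.commute)
qed

lemma X_Wd_eq_0: "Wd m k v \<Longrightarrow> app (X i) w = 0 \<Longrightarrow> app (X i) v = 0"
  by (induction rule: Wd.induct) (auto simp: app_X_Y app_X_X[of i])

section \<open>The coefficient of top degree\<close>

context
  fixes t :: nat
  assumes Y_top: "t < i \<Longrightarrow> app (Y i) w = 0" and X_top: "2 * t \<le> i \<Longrightarrow> app (X i) w = 0"
begin

text \<open>Modulo words beginning with some \<open>X i\<close>, \<open>i < 2 * t\<close>, the operators \<open>Y i\<close> commute; these words drop
  out of the top coefficient because their degree is too small.\<close>

inductive XS :: "nat \<Rightarrow> nat \<Rightarrow> ('b \<Rightarrow>\<^sub>0 complex) \<Rightarrow> bool" where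
  XS_X: "Wd m k v \<Longrightarrow> i < 2 * t \<Longrightarrow> XS (Suc (Suc m)) (k + i) (app (X i) v)"
| XS_zero: "XS m k 0"
| XS_add: "XS m k v \<Longrightarrow> XS m k v' \<Longrightarrow> XS m k (v + v')"

lemma XS_Y: "XS m k v \<Longrightarrow> XS (Suc m) (k + j) (app (Y j) v)"
proof (induction rule: XS.induct)
  case (XS_X m k v i)
  have "XS (Suc (Suc (Suc m))) (k + j + i) (app (X i) (app (Y j) v))"
    by (intro XS.XS_X Wd_Y XS_X)
  then show ?case by (simp add: app_X_Y add_ac)
qed (auto intro: XS_zero XS_add)

lemma XS_X': "XS m k v \<Longrightarrow> XS (Suc (Suc m)) (k + j) (app (X j) v)"
proof (induction rule: XS.induct)
  case (XS_X m k v i)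
  have "XS (Suc (Suc (Suc (Suc m)))) (k + j + i) (app (X i) (app (X j) v))"
    by (intro XS.XS_X Wd_X XS_X)
  then show ?case by (simp add: app_X_X[of i] add_ac)
qed (auto intro: XS_zero XS_add)

lemma XS_scale: "XS m k v \<Longrightarrow> XS m k (pscale c v)"
proof (induction rule: XS.induct)
  case (XS_X m k v i)
  then show ?case using XS.XS_X[OF Wd_scale[OF XS_X(1)], of i c] by simp
qed (auto intro: XS_zero XS_add simp: pscale.scale_right_distrib)

text \<open>\<open>Y i\<close> is moved through the word to w, which it kills. Each exchange leaves
  some \<open>X (i + j)\<close>: either its index is below 2t, or it commutes through to w and kills
  it.\<close>

lemma XS_Y_high:
  assumes "Wd m k v" "t < i"
  shows "XS (Suc m) (k + i) (app (Y i) v)"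
  using assms(1)
proof (induction rule: Wd.induct)
  case Wd_w
  then show ?case using Y_top[OF assms(2)] by (simp add: XS_zero)
next
  case (Wd_Y m k v j)
  have "XS (Suc (Suc m)) (k + (i + j)) (app (X (i + j)) v)"
    using XS_X[OF Wd_Y(1), of "i + j"] X_Wd_eq_0[OF Wd_Y(1) X_top, of "i + j"]
    by (cases "i + j < 2 * t") (auto intro: XS_zero)
  moreover have "XS (Suc (Suc m)) (k + i + j) (app (Y j) (app (Y i) v))"
    by (rule XS_Y[OF Wd_Y(2)])
  ultimately show ?case unfolding app_Y_Y[of i] by (intro XS_add XS_scale) (simp_all add: add_ac)
next
  case (Wd_X m k v j)
  then show ?case using XS_X'[OF Wd_X(2), of j] by (simp add: app_X_Y add_ac)
qed (auto intro: XS_zero XS_add XS_scale)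

text \<open>Removing a letter X of index below 2t lowers the degree in T by 2, so the rest has
  degree above t times its degree in T.\<close>

lemma XS_eq_0:
  assumes "XS M K v" "t * M \<le> K" "\<And>m k v. Suc (Suc m) = M \<Longrightarrow> Wd m k v \<Longrightarrow> t * m < k \<Longrightarrow> v = 0"
  shows "v = 0"
  using assms
proof (induction rule: XS.induct)
  case (XS_X m k v i)
  then have "v = 0" by (intro XS_X(4)[OF refl XS_X(1)]) simp_all
  then show ?case by simp
qed auto

text \<open>A leading letter Y of index at most t, or X of index below 2t, uses no more than t per
  unit of T-degree, so the rest still exceeds the bound. A leading Y of larger index is first traded
  for such an X.\<close>

lemma Wd_eq_0: "Wd m k v \<Longrightarrow> t * m < k \<Longrightarrow> v = 0"
proof (induction m arbitrary: k v rule: less_induct)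
  case (less M)
  have "v = 0" if "Wd m k v" "m = M" "t * m < k" for m k v
    using that
  proof (induction rule: Wd.induct)
    case (Wd_Y m k v i)
    show ?case
    proof (cases "i \<le> t")
      case True
      then have "t * m < k" using Wd_Y(4) by simp
      moreover have "m < M" using Wd_Y(3) by simp
      ultimately have "v = 0" by (intro less.IH[OF _ Wd_Y(1)])
      then show ?thesis by simp
    next
      case False
      then have "XS (Suc m) (k + i) (app (Y i) v)" by (intro XS_Y_high[OF Wd_Y(1)]) simp
      then show ?thesis
      proof (rule XS_eq_0)
        show "t * Suc m \<le> k + i" using Wd_Y(4) by simp
        show "v = 0" if "Suc (Suc m') = Suc m" "Wd m' k v" "t * m' < k" for m' k v
          by (rule less.IH[OF _ that(2,3)]) (use that(1) Wd_Y(3) in simp)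
      qed
    qed
  next
    case (Wd_X m k v i)
    show ?case
    proof (cases "i < 2 * t")
      case True
      then have "t * m < k" using Wd_X(4) by simp
      moreover have "m < M" using Wd_X(3) by simp
      ultimately have "v = 0" by (intro less.IH[OF _ Wd_X(1)])
      then show ?thesis by simp
    next
      case False
      then show ?thesis using X_Wd_eq_0[OF Wd_X(1) X_top] by simp
    qed
  qed auto
  then show ?case using less.prems by blast
qed

text \<open>In the recursion only the term with i = t remains: for i < t the other factor has too
  high a degree, for i > t the term lies in \<open>XS\<close>, and the terms with X vanish by degree
  or at w.\<close>

theorem p_top: "pscale (fact m) (p m (t * m)) = (app (Y t) ^^ m) w"
proof (induction m)
  case (Suc m)
  let ?k = "t * Suc m"
  have Y: "app (Y i) (p m (?k - i)) = (if i = t then app (Y t) (p m (t * m)) else 0)" if "i \<le> ?k" for i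
  proof (cases i t rule: linorder_cases)
    case less
    then have "p m (?k - i) = 0" by (intro Wd_eq_0[OF Wd_p]) simp
    then show ?thesis using less by simp
  next
    case greater
    have "XS (Suc m) (?k - i + i) (app (Y i) (p m (?k - i)))" by (rule XS_Y_high[OF Wd_p greater])
    then have "app (Y i) (p m (?k - i)) = 0" by (rule XS_eq_0) (use that Wd_eq_0 in auto)
    then show ?thesis using greater by simp
  qed simp
  have X: "(if m = 0 then 0 else app (X i) (p (m - 1) (?k - i))) = 0" for i
  proof (cases "i < 2 * t \<and> m \<noteq> 0")
    case True
    then have "p (m - 1) (?k - i) = 0"
      by (intro Wd_eq_0[OF Wd_p]) (cases m; simp add: algebra_simps)
    then show ?thesis by simp
  qed (use X_Wd_eq_0[OF Wd_p X_top] in auto)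
  have "pscale (of_nat (Suc m)) (p (Suc m) ?k) = app (Y t) (p m (t * m))"
    unfolding p_rec X using Y by (simp add: sum.delta del: mult_Suc_right)
  moreover have "pscale (fact (Suc m)) (p (Suc m) ?k) = pscale (fact m) (pscale (of_nat (Suc m)) (p (Suc m) ?k))"
    by (simp add: mult.commute)
  ultimately have "pscale (fact (Suc m)) (p (Suc m) ?k) = app (Y t) (pscale (fact m) (p m (t * m)))"
    by simp
  then show ?case using Suc by simp
qed (simp add: p_0)

end

section \<open>A degree bound for nonvanishing coefficients\<close>

context
  fixes t u amax bmax :: nat and t' u' :: int
  assumes Y_high: "t < i \<Longrightarrow> app (Y i) w = 0" and X_high: "u < i \<Longrightarrow> app (X i) w = 0"
    and Y_pow: "(app (Y t) ^^ Suc amax) w = 0" and X_pow: "(app (X u) ^^ Suc bmax) w = 0"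
    and Y_low: "i < t \<Longrightarrow> Y i \<noteq> 0 \<Longrightarrow> int i \<le> t'" and X_low: "i < u \<Longrightarrow> X i \<noteq> 0 \<Longrightarrow> int i \<le> u'"
    and u_less: "u < 2 * t + 1"
begin

text \<open>Moving \<open>Y t\<close> and \<open>X u\<close> next to \<open>w\<close>, where their powers are bounded, every word becomes a combination
  of words whose other letters have small index; this bounds the degree.\<close>

inductive Nrm :: "nat \<Rightarrow> nat \<Rightarrow> ('b \<Rightarrow>\<^sub>0 complex) \<Rightarrow> bool" where
  Nrm_w: "Nrm (a + 2 * b) (t * a + u * b) ((app (X u) ^^ b) ((app (Y t) ^^ a) w))"
| Nrm_Y: "Nrm m k v \<Longrightarrow> i < t \<Longrightarrow> Nrm (Suc m) (k + i) (app (Y i) v)"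
| Nrm_X: "Nrm m k v \<Longrightarrow> i < u \<Longrightarrow> Nrm (Suc (Suc m)) (k + i) (app (X i) v)"
| Nrm_zero: "Nrm m k 0"
| Nrm_add: "Nrm m k v \<Longrightarrow> Nrm m k v' \<Longrightarrow> Nrm m k (v + v')"
| Nrm_scale: "Nrm m k v \<Longrightarrow> Nrm m k (pscale c v)"

lemma Nrm_X_all: "Nrm m k v \<Longrightarrow> Nrm (Suc (Suc m)) (k + i) (app (X i) v)"
proof (induction rule: Nrm.induct)
  case (Nrm_w a b)
  show ?case
  proof (cases i u rule: linorder_cases)
    case less
    then show ?thesis by (intro Nrm.Nrm_X Nrm.Nrm_w)
  next
    case equal
    then show ?thesis using Nrm.Nrm_w[of a "Suc b"] by (simp add: add_ac)
  next
    case greater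
    then have "app (X i) ((app (X u) ^^ b) ((app (Y t) ^^ a) w)) = 0"
      by (simp add: app_pow_commute app_X_X[of i] app_X_Y X_high pow_zero)
    then show ?thesis by (simp add: Nrm.Nrm_zero)
  qed
next
  case (Nrm_Y m k v j)
  then show ?case using Nrm.Nrm_Y[OF Nrm_Y(3,2)] by (simp add: app_X_Y add_ac)
next
  case (Nrm_X m k v j)
  then show ?case using Nrm.Nrm_X[OF Nrm_X(3,2)] by (simp add: app_X_X[of i] add_ac)
qed (auto intro: Nrm.intros)

lemma Nrm_Y_all:
  assumes "t \<le> i"
  shows "Nrm m k v \<Longrightarrow> Nrm (Suc m) (k + i) (app (Y i) v)"
proof (induction rule: Nrm.induct)
  case (Nrm_w a b)
  show ?case
  proof (cases "i = t")
    case True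
    then show ?thesis using Nrm.Nrm_w[of "Suc a" b]
      by (simp add: app_pow_commute[of "Y t" "X u"] app_X_Y add_ac)
  next
    case False
    then have i: "t < i" "u < i + t" using assms u_less by auto
    \<comment> \<open>Since i > t, the bound on u puts i + t beyond u; hence \<open>Y i\<close>
      commutes with \<open>Y t\<close> in front of w.\<close>
    have X0: "app (X (i + t)) ((app (Y t) ^^ a) w) = 0" for a
      using i by (simp add: app_pow_commute app_X_Y X_high pow_zero)
    have "app (Y i) ((app (Y t) ^^ a) w) = 0" for a
    proof (induction a)
      case (Suc a)
      then show ?case by (simp add: app_Y_Y[of i] X0)
    qed (simp add: Y_high i)
    then have "app (Y i) ((app (X u) ^^ b) ((app (Y t) ^^ a) w)) = 0"
      by (simp add: app_pow_commute[of "Y i" "X u"] app_X_Y pow_zero)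
    then show ?thesis by (simp add: Nrm.Nrm_zero)
  qed
next
  case (Nrm_Y m k v j)
  have "Nrm (Suc (Suc m)) (k + i + j) (app (Y j) (app (Y i) v))"
    by (intro Nrm.Nrm_Y Nrm_Y)
  moreover have "Nrm (Suc (Suc m)) (k + (i + j)) (app (X (i + j)) v)"
    by (intro Nrm_X_all Nrm_Y)
  ultimately show ?case unfolding app_Y_Y[of i] by (intro Nrm_add Nrm_scale) (simp_all add: add_ac)
next
  case (Nrm_X m k v j)
  then show ?case using Nrm.Nrm_X[OF Nrm_X(3,2)] by (simp add: app_X_Y[symmetric] add_ac)
qed (auto intro: Nrm.intros)

lemma Wd_Nrm: "Wd m k v \<Longrightarrow> Nrm m k v"
proof (induction rule: Wd.induct)
  case Wd_w
  then show ?case using Nrm_w[of 0 0] by simp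
next
  case (Wd_Y m k v i)
  then show ?case by (cases "i < t") (auto intro: Nrm_Y Nrm_Y_all)
qed (auto intro: Nrm.intros Nrm_X_all)

text \<open>A and B count the letters Y and X, a and b those equal to \<open>Y t\<close> and
  \<open>X u\<close>. The bound is over the integers, as \<open>t'\<close> and \<open>u'\<close> may
  be negative when there are no smaller letters.\<close>

lemma Nrm_nonzero:
  "Nrm m k v \<Longrightarrow> v \<noteq> 0 \<Longrightarrow> \<exists>A a B b. m = A + 2 * B \<and> a \<le> A \<and> a \<le> amax \<and> b \<le> B \<and> b \<le> bmax \<and>
     int k \<le> t' * int (A - a) + int (t * a) + u' * int (B - b) + int (u * b)"
proof (induction rule: Nrm.induct)
  case (Nrm_w a b)
  have "a \<le> amax"
  proof (rule ccontr)
    assume "\<not> a \<le> amax"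
    then obtain c where c: "a = c + Suc amax" by (metis add.commute not_less_eq_eq le_Suc_ex)
    have "(app (Y t) ^^ a) w = 0" unfolding c funpow_add o_apply Y_pow by (rule pow_zero)
    then show False using Nrm_w by (simp add: pow_zero)
  qed
  moreover have "b \<le> bmax"
  proof (rule ccontr)
    assume "\<not> b \<le> bmax"
    then obtain c where c: "b = c + Suc bmax" by (metis add.commute not_less_eq_eq le_Suc_ex)
    have *: "(app (X u) ^^ b) ((app (Y t) ^^ a) v) = (app (Y t) ^^ a) ((app (X u) ^^ b) v)" for b v
      by (induction b) (simp_all add: app_pow_commute app_X_Y)
    have "(app (X u) ^^ b) w = 0" unfolding c funpow_add o_apply X_pow by (rule pow_zero)
    then show False using Nrm_w by (simp add: * pow_zero)
  qed
  ultimately show ?case by (intro exI[of _ a] exI[of _ b]) auto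
next
  case (Nrm_Y m k v i)
  then have nz: "v \<noteq> 0" "Y i \<noteq> 0" by auto
  obtain A a B b where *: "m = A + 2 * B" "a \<le> A" "a \<le> amax" "b \<le> B" "b \<le> bmax"
    "int k \<le> t' * int (A - a) + int (t * a) + u' * int (B - b) + int (u * b)"
    using Nrm_Y(3)[OF nz(1)] by blast
  then have "int i \<le> t'" "int (Suc A - a) = int (A - a) + 1" using Y_low[OF Nrm_Y(2) nz(2)] by auto
  then have "int (k + i) \<le> t' * int (Suc A - a) + int (t * a) + u' * int (B - b) + int (u * b)"
    using *(6) by (simp add: algebra_simps)
  then show ?case using * by (intro exI[of _ "Suc A"] exI[of _ a] exI[of _ B] exI[of _ b]) auto
next
  case (Nrm_X m k v i)
  then have nz: "v \<noteq> 0" "X i \<noteq> 0" by auto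
  obtain A a B b where *: "m = A + 2 * B" "a \<le> A" "a \<le> amax" "b \<le> B" "b \<le> bmax"
    "int k \<le> t' * int (A - a) + int (t * a) + u' * int (B - b) + int (u * b)"
    using Nrm_X(3)[OF nz(1)] by blast
  then have "int i \<le> u'" "int (Suc B - b) = int (B - b) + 1" using X_low[OF Nrm_X(2) nz(2)] by auto
  then have "int (k + i) \<le> t' * int (A - a) + int (t * a) + u' * int (Suc B - b) + int (u * b)"
    using *(6) by (simp add: algebra_simps)
  then show ?case using * by (intro exI[of _ A] exI[of _ a] exI[of _ "Suc B"] exI[of _ b]) auto
next
  case (Nrm_add m k v v')
  then show ?case by (cases "v = 0") simp_all
qed auto

theorem p_nonzero:
  assumes "p m k \<noteq> 0"
  obtains A a B b where "m = A + 2 * B" "a \<le> A" "a \<le> amax" "b \<le> B" "b \<le> bmax"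
    "int k \<le> t' * int (A - a) + int (t * a) + u' * int (B - b) + int (u * b)"
  using Nrm_nonzero[OF Wd_Nrm[OF Wd_p] assms] that by blast

end

end

lemma sum_mod4:
  fixes f :: "nat \<Rightarrow> complex"
  shows "(\<Sum>i<4 * l. f (i mod 4)) = of_nat l * (f 0 + f 1 + f 2 + f 3)"
proof (induction l)
  case (Suc l)
  have "4 * Suc l = Suc (Suc (Suc (Suc (4 * l))))" by simp
  moreover have "Suc (4 * l) mod 4 = 1" "Suc (Suc (4 * l)) mod 4 = 2" "Suc (Suc (Suc (4 * l))) mod 4 = 3"
    by presburger+
  ultimately show ?case using Suc by (simp only: sum.lessThan_Suc) (simp add: algebra_simps)
qed simp

lemma root_module_sl2:
  assumes "sl2_family lscale comm F Y H" "app F w = 0" "\<And>i. app (H i) w = 0"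
  shows "root_module F Y (\<lambda>_. 0) H (\<lambda>_. 0) (\<lambda>_ _. 2) (\<lambda>_ _. 0) (\<lambda>_ _. 0) w"
  by unfold_locales (use assms in \<open>auto simp: sl2_family_def algebra_simps\<close>)

text \<open>Only few k matter: \<open>Y (Suc k)\<close> is nonzero only for even k and
  \<open>X (Suc k)\<close> only if 4 divides k+1. The sums then run over full periods of the
  constants, up to a short remainder in the first identity.\<close>

lemma root_module_twisted:
  assumes fam: "twisted_family lscale comm F Y X H" and w: "app F w = 0" "\<And>i. app (H i) w = 0"
  shows "root_module F Y X H (\<lambda>i. if 4 dvd i then 1 else 0)
    (\<lambda>i j. if i mod 4 = 1 then 6 else if i mod 4 = 3 then 2 else 0)
    (\<lambda>i j. if i mod 4 = 3 then 4 else 0)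
    (\<lambda>i j. if i mod 4 = 1 \<and> j mod 4 = 3 then 4 else if i mod 4 = 3 \<and> j mod 4 = 1 then - 4 else 0) w"
proof
  show "family lscale comm F Y X H (\<lambda>i. if 4 dvd i then 1 else 0)
    (\<lambda>i j. if i mod 4 = 1 then 6 else if i mod 4 = 3 then 2 else 0)
    (\<lambda>i j. if i mod 4 = 3 then 4 else 0)
    (\<lambda>i j. if i mod 4 = 1 \<and> j mod 4 = 3 then 4 else if i mod 4 = 3 \<and> j mod 4 = 1 then - 4 else 0)"
    using fam by (simp add: twisted_family_def)
  have Y0: "Y i = 0" if "even i" for i using fam that by (simp add: twisted_family_def)
  have X0: "X i = 0" if "\<not> 4 dvd i" for i using fam that by (simp add: twisted_family_def)
  have le: "{..k} = insert k {..<k}" for k :: nat by auto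
  fix k
  show "app F w = 0" "app (H k) w = 0" using w by auto
  show "lscale (\<Sum>i\<le>k. if i mod 4 = 1 then 6 else if i mod 4 = 3 then 2 else 0) (Y (Suc k)) =
      lscale (2 * of_nat (Suc k) - 2 * (if 4 dvd k then 1 else 0)) (Y (Suc k))"
  proof (cases "odd k")
    case False
    define l where "l = k div 4"
    have s: "(\<Sum>i<4 * l. if i mod 4 = 1 then 6 else if i mod 4 = 3 then 2 else (0::complex)) = 8 * of_nat l"
      using sum_mod4[of "\<lambda>i. if i = 1 then 6 else if i = 3 then 2 else 0" l] by simp
    have "k = 4 * l \<or> k = Suc (Suc (4 * l))" using False l_def by presburger
    then show ?thesis
    proof
      assume k: "k = 4 * l"
      show ?thesis unfolding k le using s by (simp add: algebra_simps)
    next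
      assume k: "k = Suc (Suc (4 * l))"
      have "Suc (4 * l) mod 4 = 1" "Suc (Suc (4 * l)) mod 4 = 2" "\<not> 4 dvd Suc (Suc (4 * l))"
        by presburger+
      then show ?thesis unfolding k lessThan_Suc_atMost[symmetric] sum.lessThan_Suc s
        by (simp add: algebra_simps)
    qed
  qed (simp add: Y0)
  have main: "lscale (\<Sum>i\<le>k. f i) (X (Suc k)) = lscale c (X (Suc k))"
    if f: "\<And>l. Suc k = 4 * l \<Longrightarrow> (\<Sum>i<4 * l. f i) = c" for f :: "nat \<Rightarrow> complex" and c
  proof (cases "4 dvd Suc k")
    case True
    then obtain l where "Suc k = 4 * l" by blast
    then show ?thesis using f[of l] unfolding lessThan_Suc_atMost[symmetric] by simp
  qed (simp add: X0)
  show "lscale (\<Sum>i\<le>k. if i mod 4 = 3 then 4 else 0) (X (Suc k)) = lscale (of_nat (Suc k)) (X (Suc k))"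
  proof (rule main)
    fix l assume l: "Suc k = 4 * l"
    show "(\<Sum>i<4 * l. if i mod 4 = 3 then 4 else (0::complex)) = of_nat (Suc k)"
      using sum_mod4[of "\<lambda>i. if i = 3 then 4 else 0" l] l by simp
  qed
  \<comment> \<open>When 4 divides k+1, the residue of i determines that of k - i, so the two
    conditions in \<tau> collapse to one.\<close>
  have mod: "(k - i) mod 4 = (if i mod 4 = 0 then 3 else 3 - i mod 4)" if "Suc k = 4 * l" "i \<le> k" for i l
  proof -
    define a b where "a = i mod 4" and "b = (k - i) mod 4"
    have "(a + b + 1) mod 4 = (i + (k - i) + 1) mod 4" unfolding a_def b_def
      by (intro mod_add_cong mod_mod_trivial refl)
    then have "(a + b + 1) mod 4 = 0" using that by simp
    moreover have "a \<in> {0, 1, 2, 3}" "b \<in> {0, 1, 2, 3}" unfolding a_def b_def by auto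
    ultimately show ?thesis unfolding a_def[symmetric] b_def[symmetric] by (auto; presburger)
  qed
  show "lscale (\<Sum>i\<le>k. of_nat (Suc i) * (if Suc i mod 4 = 1 \<and> (k - i) mod 4 = 3 then 4
        else if Suc i mod 4 = 3 \<and> (k - i) mod 4 = 1 then - 4 else 0)) (X (Suc k)) =
      lscale (- 2 * of_nat (Suc k)) (X (Suc k))"
  proof (rule main)
    fix l assume l: "Suc k = 4 * l"
    define g :: "nat \<Rightarrow> complex" where
      "g i = of_nat (Suc i) * (if i mod 4 = 0 then 4 else if i mod 4 = 2 then - 4 else 0)" for i
    have "(\<Sum>i<4 * l. of_nat (Suc i) * (if Suc i mod 4 = 1 \<and> (k - i) mod 4 = 3 then 4
        else if Suc i mod 4 = 3 \<and> (k - i) mod 4 = 1 then - 4 else (0::complex))) = (\<Sum>i<4 * l. g i)"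
    proof (rule sum.cong)
      fix i assume "i \<in> {..<4 * l}"
      then have "i \<le> k" using l by auto
      moreover have "Suc i mod 4 = 1 \<longleftrightarrow> i mod 4 = 0" "Suc i mod 4 = 3 \<longleftrightarrow> i mod 4 = 2" by presburger+
      ultimately show "of_nat (Suc i) * (if Suc i mod 4 = 1 \<and> (k - i) mod 4 = 3 then 4
        else if Suc i mod 4 = 3 \<and> (k - i) mod 4 = 1 then - 4 else (0::complex)) = g i"
        using mod[OF l, of i] by (auto simp: g_def)
    qed simp
    \<comment> \<open>Each block of four contributes 4 (4l + 1) - 4 (4l + 3) = - 8.\<close>
    also have "(\<Sum>i<4 * l. g i) = - 8 * of_nat l"
    proof (induction l)
      case (Suc l)
      have e: "4 * Suc l = Suc (Suc (Suc (Suc (4 * l))))" by simp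
      have m: "Suc (4 * l) mod 4 = 1" "Suc (Suc (4 * l)) mod 4 = 2" "Suc (Suc (Suc (4 * l))) mod 4 = 3"
        by presburger+
      have "g (4 * l) = 4 * (4 * of_nat l + 1)" "g (Suc (4 * l)) = 0"
        "g (Suc (Suc (4 * l))) = - 4 * (4 * of_nat l + 3)" "g (Suc (Suc (Suc (4 * l)))) = 0"
        by (simp_all add: g_def m)
      then show ?case unfolding e sum.lessThan_Suc Suc by (simp add: algebra_simps)
    qed simp
    finally show "(\<Sum>i<4 * l. of_nat (Suc i) * (if Suc i mod 4 = 1 \<and> (k - i) mod 4 = 3 then 4
        else if Suc i mod 4 = 3 \<and> (k - i) mod 4 = 1 then - 4 else (0::complex))) = - 2 * of_nat (Suc k)"
      unfolding l by simp
  qed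
  show "lscale (\<Sum>i\<le>k. (if 4 dvd i then 1 else 0) * (if Suc i mod 4 = 1 \<and> (k - i) mod 4 = 3 then 4
        else if Suc i mod 4 = 3 \<and> (k - i) mod 4 = 1 then - 4 else 0)) (X (Suc k)) =
      lscale (of_nat (Suc k)) (X (Suc k))"
  proof (rule main)
    fix l assume l: "Suc k = 4 * l"
    have "(\<Sum>i<4 * l. (if 4 dvd i then 1 else 0) * (if Suc i mod 4 = 1 \<and> (k - i) mod 4 = 3 then 4
        else if Suc i mod 4 = 3 \<and> (k - i) mod 4 = 1 then - 4 else (0::complex))) =
      (\<Sum>i<4 * l. if i mod 4 = 0 then 4 else 0)"
    proof (rule sum.cong)
      fix i assume "i \<in> {..<4 * l}"
      then have "i \<le> k" using l by auto
      moreover have "Suc i mod 4 = 1 \<longleftrightarrow> i mod 4 = 0" "4 dvd i \<longleftrightarrow> i mod 4 = 0" by presburger+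
      ultimately show "(if 4 dvd i then 1 else 0) * (if Suc i mod 4 = 1 \<and> (k - i) mod 4 = 3 then 4
        else if Suc i mod 4 = 3 \<and> (k - i) mod 4 = 1 then - 4 else (0::complex)) =
        (if i mod 4 = 0 then 4 else 0)"
        using mod[OF l, of i] by auto
    qed simp
    also have "\<dots> = of_nat (Suc k)" using sum_mod4[of "\<lambda>i. if i = 0 then 4 else 0" l] l by simp
    finally show "(\<Sum>i<4 * l. (if 4 dvd i then 1 else 0) * (if Suc i mod 4 = 1 \<and> (k - i) mod 4 = 3 then 4
        else if Suc i mod 4 = 3 \<and> (k - i) mod 4 = 1 then - 4 else (0::complex))) = of_nat (Suc k)" .
  qed
qed

section \<open>Rectangles and special fat hooks\<close>

text \<open>For \<open>K = 0\<close> this is the rectangle with \<open>c\<close> rows.\<close>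

definition hook :: "nat \<Rightarrow> nat \<Rightarrow> nat \<Rightarrow> nat \<Rightarrow> nat" where
  "hook c k1 K = (\<lambda>j. if j < c then k1 else if j = c then K else 0)"

lemma rectangular_or_special_cases:
  assumes "rectangular \<xi> \<or> special \<xi>"
  shows "\<xi> = (\<lambda>_. 0) \<or> (\<exists>c k1 K. 1 \<le> c \<and> K < k1 \<and> \<xi> = hook c k1 K)"
  using assms
proof
  assume "rectangular \<xi>"
  then consider "\<xi> = (\<lambda>_. 0)" | k c where "1 \<le> k" "1 \<le> c" "\<xi> = (\<lambda>j. if j < c then k else 0)"
    unfolding rectangular_def by blast
  then show ?thesis
  proof cases
    case 2
    then have "1 \<le> c \<and> 0 < k \<and> \<xi> = hook c k 0" by (auto simp: hook_def)
    then show ?thesis by blast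
  qed simp
next
  assume "special \<xi>"
  then show ?thesis unfolding special_def hook_def by blast
qed

lemma special_zero: "\<not> special (\<lambda>_. 0)"
  by (auto simp: special_def fun_eq_iff split: if_splits)

context
  fixes c k1 K :: nat
  assumes c: "1 \<le> c" and K: "K < k1"
begin

lemma special_hook: "special (hook c k1 K) \<longleftrightarrow> K \<noteq> 0"
proof
  assume "special (hook c k1 K)"
  then obtain l1 l2 d where l: "l2 < l1" "1 \<le> l2" "1 \<le> d"
    "hook c k1 K = (\<lambda>j. if j < d then l1 else if j = d then l2 else 0)"
    unfolding special_def by blast
  have "hook c k1 K 0 = l1" "hook c k1 K d = l2" using l by (auto simp: hook_def fun_eq_iff)
  then show "K \<noteq> 0" using c l(1,2) by (auto simp: hook_def split: if_splits)
next
  assume "K \<noteq> 0"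
  then show "special (hook c k1 K)" unfolding special_def hook_def using c K
    by (intro exI[of _ k1] exI[of _ K] exI[of _ c]) auto
qed

lemma tail_hook: "tail (hook c k1 K) (Suc k) = (if k < c then K + (c - 1 - k) * k1 else 0)"
proof -
  have "tail (hook c k1 K) (Suc k) = (\<Sum>j\<in>{Suc k..c}. hook c k1 K j)"
    unfolding tail_def by (rule sum.mono_neutral_left) (auto simp: hook_def split: if_splits)
  also have "\<dots> = (if k < c then K + (c - 1 - k) * k1 else 0)"
  proof (cases "k < c")
    case True
    then have "{Suc k..c} = insert c {Suc k..<c}" by auto
    then show ?thesis using True by (simp add: hook_def)
  qed simp
  finally show ?thesis .
qed

text \<open>The part at index 0 is not counted, so a rectangle with c rows has c - 1.\<close>

lemma nparts_hook: "nparts (hook c k1 K) = (if K = 0 then c - 1 else c)"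
proof -
  have "{j. 1 \<le> j \<and> hook c k1 K j \<noteq> 0} = (if K = 0 then {1..<c} else {1..c})"
    using c K by (auto simp: hook_def split: if_splits)
  then show ?thesis by (simp add: nparts_def)
qed

lemma phi_hook:
  "k + 2 \<le> c \<Longrightarrow> 2 * phi (hook c k1 K) k = 2 * real K + 2 * real (c - 1 - k) * real k1 - real k1"
  "2 * phi (hook c k1 K) (c - 1) = real (2 * K - k1)"
  "c \<le> k \<Longrightarrow> phi (hook c k1 K) k = 0"
proof -
  show "phi (hook c k1 K) k = 0" if "c \<le> k"
  proof -
    have "\<not> k + 2 \<le> nparts (hook c k1 K)" "k + 1 \<noteq> nparts (hook c k1 K)"
      using that c unfolding nparts_hook by auto
    then show ?thesis by (simp add: phi_def)
  qed
  show "2 * phi (hook c k1 K) (c - 1) = real (2 * K - k1)"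
  proof (cases "K = 0")
    case False
    have "hook c k1 K c = K" "hook c k1 K (c - 1) = k1" using c by (auto simp: hook_def)
    then show ?thesis using False c by (auto simp: phi_def nparts_hook max_def of_nat_diff)
  next
    case True
    then have "\<not> c - 1 + 2 \<le> nparts (hook c k1 K)" "c - 1 + 1 \<noteq> nparts (hook c k1 K)"
      using c unfolding nparts_hook by auto
    then show ?thesis using True by (simp add: phi_def)
  qed
  show "2 * phi (hook c k1 K) k = 2 * real K + 2 * real (c - 1 - k) * real k1 - real k1" if "k + 2 \<le> c"
  \<comment> \<open>For a rectangle k + 1 = c - 1 is \<open>nparts\<close>, so \<open>phi\<close> is
    given by its middle branch; the value k1 - k1/2 agrees with the general formula.\<close>
  proof (cases "K = 0 \<and> k + 2 = c")
    case True
    then have "nparts (hook c k1 K) = k + 1" "c - 1 - k = 1" unfolding nparts_hook by auto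
    moreover have "hook c k1 K (k + 1) = k1" "hook c k1 K k = k1"
      using True by (auto simp: hook_def)
    moreover have "\<not> k + 2 \<le> k + 1" by simp
    ultimately show ?thesis using True by (simp add: phi_def flip: One_nat_def)
  next
    case False
    then have "k + 2 \<le> nparts (hook c k1 K)" using that by (auto simp: nparts_hook)
    moreover have "hook c k1 K (k + 1) = k1" using that by (simp add: hook_def)
    ultimately show ?thesis using that by (simp add: phi_def tail_hook)
  qed
qed

text \<open>Confronts the inequality of a relator with the largest degree of a nonzero word. For k
  \<ge> c, or for k < c and r \<le> k1, they contradict each other; for k < c and r > k1 the relator
  alone pushes s + r beyond the size of the partition.\<close>

lemma sl2_bound:
  assumes rel: "1 + r * k + tail (hook c k1 K) (k + 1) \<le> s + r"
    and bound: "a \<le> K" "a \<le> r" "int s \<le> (int c - 2) * int r + int a"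
  shows "tail (hook c k1 K) 1 < s + r"
proof (rule ccontr)
  assume less: "\<not> ?thesis"
  have t1: "tail (hook c k1 K) 1 = K + (c - 1) * k1" using tail_hook[of 0] c by simp
  show False
  proof (cases "c \<le> k")
    case True
    then have "r * c \<le> r * k" by simp
    then have "1 + int r * int c \<le> int s + int r"
    proof -
      have "int (1 + r * c) \<le> int (s + r)" unfolding of_nat_le_iff using rel \<open>r * c \<le> r * k\<close> by linarith
      then show ?thesis by simp
    qed
    then show ?thesis using bound by (simp add: algebra_simps)
  next
    case False
    then obtain e where e: "c = Suc (k + e)" using less_imp_Suc_add by (metis not_le)
    have rel': "1 + r * k + (K + e * k1) \<le> s + r" using rel tail_hook[of k] e by simp
    show ?thesis
    proof (cases "r \<le> k1")
      case True
      then have "e * r \<le> e * k1" by simp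
      then have "1 + r * k + K + e * r \<le> s + r" using rel' by linarith
      then have "int (1 + r * k + K + e * r) \<le> int (s + r)" by (simp only: of_nat_le_iff)
      then show ?thesis using bound e by (simp add: algebra_simps)
    next
      case False
      then have "k1 * k \<le> r * k" by simp
      then have "1 + K + (k1 * k + e * k1) \<le> s + r" using rel' by linarith
      then have "1 + K + (k + e) * k1 \<le> s + r" by (simp add: algebra_simps)
      then show ?thesis using less t1 e by simp
    qed
  qed
qed

text \<open>The analogue for the half-long family. Here 2c - 1 and 4c - 4 are the largest indices,
  in units of \<delta>/2, of letters Y and X that may act nontrivially on w; 2c - 3 and 4c - 8 are
  the next smaller ones.\<close>

lemma twisted_bound:
  assumes rel: "1 / 2 + real r * real k + phi (hook c k1 K) k \<le> real s / 2"
    and bound: "r = A + 2 * B" "a \<le> A" "a \<le> 2 * K - k1" "b \<le> B" "b \<le> K"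
      "int s \<le> (2 * int c - 3) * int (A - a) + (2 * int c - 1) * int a + (4 * int c - 8) * int (B - b)
        + (4 * int c - 4) * int b"
  shows "2 * tail (hook c k1 K) 1 < s + r"
proof (rule ccontr)
  assume less: "\<not> ?thesis"
  have t1: "tail (hook c k1 K) 1 = K + (c - 1) * k1" using tail_hook[of 0] c by simp
  \<comment> \<open>As r = A + 2B, every letter is compared with 2c - 4 per unit of T-degree; A + 2a
    + 4b is the excess.\<close>
  have s: "int s \<le> (2 * int c - 4) * int r + int A + 2 * int a + 4 * int b"
    using bound by (simp add: of_nat_diff algebra_simps)
  consider "c \<le> k" | "k = c - 1" | "k + 2 \<le> c" using c by linarith
  then show False
  proof cases
    case 1
    have "real r * real c \<le> real r * real k" using 1 by (simp add: mult_left_mono)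
    then have "real (1 + 2 * (r * c)) \<le> real s" using rel 1 by (simp add: phi_hook)
    then have "1 + 2 * (r * c) \<le> s" by (simp only: of_nat_le_iff)
    then have "int (1 + 2 * (r * c)) \<le> int s" by (simp only: of_nat_le_iff)
    then have "1 + 2 * (int r * int c) \<le> int s" by simp
    then show ?thesis using s bound by (simp add: algebra_simps)
  next
    case 2
    have "real (1 + 2 * (r * (c - 1)) + (2 * K - k1)) \<le> real s"
      using rel phi_hook(2) unfolding 2 by simp
    then have "1 + 2 * (r * (c - 1)) + (2 * K - k1) \<le> s" by (simp only: of_nat_le_iff)
    then have "int (1 + 2 * (r * (c - 1)) + (2 * K - k1)) \<le> int s" by (simp only: of_nat_le_iff)
    then have "1 + 2 * (int r * (int c - 1)) + int (2 * K - k1) \<le> int s" using c by (simp add: of_nat_diff)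
    moreover have "int a \<le> int (2 * K - k1)" "int a \<le> int A" "int b \<le> int B" "int r = int A + 2 * int B"
      using bound by auto
    ultimately show ?thesis using s by (simp add: algebra_simps)
  next
    case 3
    then obtain e where e: "c = k + e + 2" by (metis le_Suc_ex add.assoc add.commute)
    have ce: "c - 1 - k = Suc e" using e by simp
    have "real (1 + 2 * (r * k) + 2 * K + 2 * (Suc e * k1)) \<le> real (s + k1)"
      using rel phi_hook(1)[OF 3] unfolding ce by (simp add: algebra_simps)
    then have rel': "1 + 2 * (r * k) + 2 * K + 2 * (Suc e * k1) \<le> s + k1" by (simp only: of_nat_le_iff)
    show ?thesis
    proof (cases "r \<le> k1")
      case True
      then have "e * r \<le> e * k1" by simp
      then have "1 + 2 * (r * k) + 2 * (e * r) + 2 * K + k1 \<le> s"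
      proof -
        \<comment> \<open>With the products abstracted to variables the problem becomes
          linear.\<close>
        have "1 + 2 * z + 2 * x + 2 * K + k1 \<le> s"
          if "x \<le> y" "1 + 2 * z + 2 * K + 2 * (k1 + y) \<le> s + k1" for x y z
        proof -
          have "s + k1 = s + k1" ..
          show ?thesis using that by presburger
        qed
        then show ?thesis using \<open>e * r \<le> e * k1\<close> rel' unfolding mult_Suc by blast
      qed
      then have "int (1 + 2 * (r * k) + 2 * (e * r) + 2 * K + k1) \<le> int s" by (simp only: of_nat_le_iff)
      then have "1 + (2 * int c - 4) * int r + 2 * int K + int k1 \<le> int s" using e by (simp add: algebra_simps)
      then have "1 + 2 * int K + int k1 \<le> int A + 2 * int a + 4 * int b" using s by linarith
      moreover have "int a \<le> int A" "int b \<le> int B" "int b \<le> int K" "int A + 2 * int B \<le> int k1"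
        "int a \<le> max 0 (2 * int K - int k1)"
        using bound True by auto
      \<comment> \<open>If 2K \<le> k1, then a = 0 and A + 4b \<le> k1 + 2K; otherwise use 4b \<le>
        2 (k1 - A), a \<le> A and a \<le> 2K - k1.\<close>
      ultimately show ?thesis by (auto simp: max_def split: if_splits)
    next
      case False
      then have "k1 * k \<le> r * k" by simp
      moreover have "2 * (K + (x + z + k1)) < s + r"
        if "x \<le> y" "1 + 2 * y + 2 * K + 2 * (k1 + z) \<le> s + k1" for x y z
        using that False by presburger
      ultimately have "2 * (K + (k1 * k + e * k1 + k1)) < s + r"
        using rel' unfolding mult_Suc by blast
      then have "2 * (K + (k + e + 1) * k1) < s + r" by (simp add: algebra_simps)
      then show ?thesis using less t1 e by simp
    qed
  qed
qed

end

section \<open>Relations in a single family\<close>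

context root_module
begin

lemma p_eq_0_of_top: "p (m + s) 0 = 0 \<Longrightarrow> p m s = 0"
  using F_pow_p_eq_0[of s m] by (simp add: pow_zero)

lemma p_1: "p (Suc 0) k = app (Y k) w"
  by (simp add: p_def)

lemma sl2_relation_iff:
  assumes "X 0 = 0"
  shows "(app F ^^ s) ((app (Y 0) ^^ (s + r)) w) = 0 \<longleftrightarrow> p r s = 0"
proof -
  have "(app F ^^ s) ((app (Y 0) ^^ (s + r)) w) = pscale (fact (s + r)) ((app F ^^ s) (p (r + s) 0))"
    unfolding p_constant_Y[OF assms, symmetric] pow_scale by (simp add: add.commute)
  then show ?thesis using F_pow_p_eq_0[of s r] by simp
qed

lemma twisted_relation_iff:
  assumes "Y 0 = 0" "2 * b = s + r"
  shows "(app F ^^ s) ((app (X 0) ^^ b) w) = 0 \<longleftrightarrow> p r s = 0"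
proof -
  have "(app F ^^ s) ((app (X 0) ^^ b) w) = pscale (fact b) ((app F ^^ s) (p (r + s) 0))"
    unfolding p_constant_X[OF assms(1), symmetric] pow_scale assms(2) by (simp add: add.commute)
  then show ?thesis using F_pow_p_eq_0[of s r] by simp
qed

text \<open>All H i kill w, so vanishing at w propagates to higher indices.\<close>

lemma Y_w_step:
  assumes "app (Y j) w = 0" "\<mu> i j \<noteq> 0"
  shows "app (Y (Suc (i + j))) w = 0"
proof -
  have "app (H i * Y j - Y j * H i) w = app (lscale (\<mu> i j) (Y (Suc (i + j)))) w" by (simp only: H_Y)
  then show ?thesis using assms by (simp add: H_w)
qed

lemma X_w_step:
  assumes "app (X j) w = 0" "\<nu> i j \<noteq> 0"
  shows "app (X (Suc (i + j))) w = 0"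
proof -
  have "app (H i * X j - X j * H i) w = app (lscale (\<nu> i j) (X (Suc (i + j)))) w" by (simp only: H_X)
  then show ?thesis using assms by (simp add: H_w)
qed

text \<open>The reduced relations are extremal relators, identified by \<open>p_top\<close>.
  Conversely a coefficient that survives them would, by \<open>p_nonzero\<close> and
  \<open>sl2_bound\<close>, sit in a degree already killed by dominance.\<close>

theorem sl2_relations_iff:
  assumes X0: "\<And>i. X i = 0" and \<mu>: "\<And>i j. \<mu> i j \<noteq> 0"
    and dom: "(app (Y 0) ^^ Suc (tail \<xi> 1)) w = 0"
    and shape: "rectangular \<xi> \<or> special \<xi>"
  shows "(\<forall>s r. 1 \<le> s \<longrightarrow> 1 \<le> r \<longrightarrow> (\<exists>k. 1 + r * k + tail \<xi> (k + 1) \<le> s + r) \<longrightarrow>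
        (app F ^^ s) ((app (Y 0) ^^ (s + r)) w) = 0) \<longleftrightarrow>
     app (Y (nparts \<xi>)) w = 0 \<and>
     (special \<xi> \<longrightarrow> (app (Y (nparts \<xi> - 1)) ^^ Suc (\<xi> (nparts \<xi>))) w = 0)"
    (is "?L \<longleftrightarrow> ?R")
proof -
  have up: "app (Y i) w = 0" if "app (Y j) w = 0" "j \<le> i" for i j
    using Y_w_step[OF that(1) \<mu>, of "i - j - 1"] that by (cases "i = j") auto
  have large: "p r s = 0" if "tail \<xi> 1 < s + r" for r s
  proof (rule p_eq_0_of_top)
    have "(app (Y 0) ^^ (r + s)) w = 0" by (rule pow_eq_0[OF dom]) (use that in simp)
    then show "p (r + s) 0 = 0" using p_constant_Y[OF X0, of "r + s"] by simp
  qed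
  show ?thesis unfolding sl2_relation_iff[OF X0]
    using rectangular_or_special_cases[OF shape]
  proof (elim disjE exE conjE)
    assume 1: "\<xi> = (\<lambda>_. 0)"
    then have "tail \<xi> k = 0" "nparts \<xi> = 0" for k by (auto simp: tail_def nparts_def)
    then show "(\<forall>s r. 1 \<le> s \<longrightarrow> 1 \<le> r \<longrightarrow> (\<exists>k. 1 + r * k + tail \<xi> (k + 1) \<le> s + r) \<longrightarrow> p r s = 0) \<longleftrightarrow> ?R"
      using dom large special_zero 1 by auto
  next
    fix c k1 K assume 2: "1 \<le> c" "K < k1" "\<xi> = hook c k1 K"
    note h = nparts_hook[OF 2(1,2), folded 2(3)] special_hook[OF 2(1,2), folded 2(3)]
      tail_hook[OF 2(1,2), folded 2(3)]
    have \<xi>c: "\<xi> c = K" using 2(3) by (simp add: hook_def)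
    show "(\<forall>s r. 1 \<le> s \<longrightarrow> 1 \<le> r \<longrightarrow> (\<exists>k. 1 + r * k + tail \<xi> (k + 1) \<le> s + r) \<longrightarrow> p r s = 0) \<longleftrightarrow> ?R"
      (is "?L' \<longleftrightarrow> _")
    proof
      assume L: ?L'
      have Ys: "app (Y (nparts \<xi>)) w = 0"
      proof (cases "nparts \<xi> = 0")
        case True
        then have "tail \<xi> 1 = 0" using h(3)[of 0] 2(1,2) h(1) by (auto split: if_splits)
        then show ?thesis using True dom by simp
      next
        case False
        have "tail \<xi> (nparts \<xi> + 1) = 0" using h(3)[of "nparts \<xi>"] h(1) 2(1) by (auto split: if_splits)
        \<comment> \<open>The relator with r = 1 and s = k = \<open>nparts \<xi>\<close>.\<close>
        then have "p 1 (nparts \<xi>) = 0" using L False by (metis One_nat_def Suc_leI add.commute add_0_right le_refl nat_mult_1 neq0_conv plus_1_eq_Suc)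
        then show ?thesis using p_1 by simp
      qed
      have "(app (Y (nparts \<xi> - 1)) ^^ Suc (\<xi> (nparts \<xi>))) w = 0" if "special \<xi>"
      proof -
        have K: "K \<noteq> 0" "nparts \<xi> = c" using that h by auto
        show ?thesis
        \<comment> \<open>For c = 1 the matching relator would have s = 0, which is not allowed; the
          relation is then the dominance relation itself, as the size is K.\<close>
        proof (cases "c = 1")
          case True
          then have "tail \<xi> 1 = K" using h(3)[of 0] by simp
          then show ?thesis using dom K True \<xi>c by simp
        next
          case False
          \<comment> \<open>The relator with r = K + 1, s = (c - 1) r and k = c - 1; its inequality
            is an equality because the tail from c on is K.\<close>
          have "p (Suc K) ((c - 1) * Suc K) = 0"
          proof -
            have "1 + Suc K * (c - 1) + tail \<xi> ((c - 1) + 1) \<le> (c - 1) * Suc K + Suc K"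
              using h(3)[of "c - 1"] 2(1) by (simp add: algebra_simps)
            moreover have "1 \<le> (c - 1) * Suc K" using False 2(1) by (cases c) auto
            ultimately show ?thesis using L by (metis One_nat_def Suc_leI zero_less_Suc)
          qed
          moreover have "pscale (fact (Suc K)) (p (Suc K) ((c - 1) * Suc K)) = (app (Y (c - 1)) ^^ Suc K) w"
            by (rule p_top) (use up[OF Ys] K 2(1) X0 in auto)
          ultimately show ?thesis using K \<xi>c by simp
        qed
      qed
      then show ?R using Ys by blast
    next
      assume R: ?R
      have "p r s = 0" if rel: "1 + r * k + tail \<xi> (k + 1) \<le> s + r" for r s k
      proof (rule ccontr)
        assume nz: "p r s \<noteq> 0"
        have c1: "app (Y i) w = 0" if "c - 1 < i" for i
          by (rule up[of "nparts \<xi>"]) (use R that h(1) in auto)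
        \<comment> \<open>For K = 0 the index c - 1 is \<open>nparts \<xi>\<close>, and the first
          relation gives the power 1.\<close>
        have c2: "(app (Y (c - 1)) ^^ Suc K) w = 0"
        proof (cases "K = 0")
          case True
          then show ?thesis using R h(1) by simp
        qed (use R h \<xi>c in auto)
        have "r = A + 2 * B \<Longrightarrow> a \<le> A \<Longrightarrow> a \<le> K \<Longrightarrow> b \<le> B \<Longrightarrow> b \<le> 0 \<Longrightarrow>
          int s \<le> (int c - 2) * int (A - a) + int ((c - 1) * a) + 2 * (int c - 2) * int (B - b) + int (0 * b)
          \<Longrightarrow> tail \<xi> 1 < s + r" for A a B b
        proof -
          assume A: "r = A + 2 * B" "a \<le> A" "a \<le> K" "b \<le> B" "b \<le> 0"
            "int s \<le> (int c - 2) * int (A - a) + int ((c - 1) * a) + 2 * (int c - 2) * int (B - b) + int (0 * b)"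
          have "int s \<le> (int c - 2) * int r + int a"
            using A 2(1) by (simp add: of_nat_diff algebra_simps)
          then show "tail \<xi> 1 < s + r"
            using sl2_bound[OF 2(1,2) rel[unfolded 2(3)] A(3)] A(1,2) unfolding 2(3) by simp
        qed
        \<comment> \<open>The letters X are 0 here and are capped by u = 0 with exponent 0; taking
          \<open>u'\<close> as twice \<open>t'\<close> makes the bound a multiple of r plus
          a.\<close>
        then have "tail \<xi> 1 < s + r"
          by (rule p_nonzero[of "c - 1" 0 K 0 "int c - 2" "2 * (int c - 2)", OF c1 _ c2 _ _ _ _ nz, rotated -1])
             (use X0 2(1) in auto)
        then show False using large nz by blast
      qed
      then show ?L' by blast
    qed
  qed
qed

text \<open>\<open>X (4 * k)\<close> belongs to the weight -\<alpha> + 2k\<delta>, so the hypotheses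
  on X are the reduced relations of the full long root; they cap the letters X in the normal
  form.\<close>

theorem twisted_relations_iff:
  assumes Y0: "\<And>i. even i \<Longrightarrow> Y i = 0" and X0: "\<And>i. \<not> 4 dvd i \<Longrightarrow> X i = 0"
    and \<mu>: "\<And>i j. odd i \<Longrightarrow> \<mu> i j \<noteq> 0" and \<nu>: "\<And>i j. i mod 4 = 3 \<Longrightarrow> \<nu> i j \<noteq> 0"
    and dom: "(app (X 0) ^^ Suc (tail \<xi> 1)) w = 0"
    and Xs: "app (X (4 * nparts \<xi>)) w = 0"
    and Xs': "special \<xi> \<Longrightarrow> (app (X (4 * (nparts \<xi> - 1))) ^^ Suc (\<xi> (nparts \<xi>))) w = 0"
    and shape: "rectangular \<xi> \<or> special \<xi>"
  shows "(\<forall>s r b. 1 \<le> s \<longrightarrow> 1 \<le> r \<longrightarrow> 2 * b = s + r \<longrightarrow>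
        (\<exists>k. 1 / 2 + real r * real k + phi \<xi> k \<le> real s / 2) \<longrightarrow>
        (app F ^^ s) ((app (X 0) ^^ b) w) = 0) \<longleftrightarrow>
     app (Y (2 * nparts \<xi> + 1)) w = 0 \<and>
     (special \<xi> \<longrightarrow> (\<forall>m. real m = 2 * phi \<xi> (nparts \<xi> - 1) + 1 \<longrightarrow> (app (Y (2 * nparts \<xi> - 1)) ^^ m) w = 0))"
    (is "?L \<longleftrightarrow> ?R")
proof -
  have upY: "app (Y i) w = 0" if "app (Y j) w = 0" "odd j" "j \<le> i" for i j
  proof (cases "even i \<or> i = j")
    case False
    then have "odd (i - j - 1)" "Suc (i - j - 1 + j) = i" using that by auto
    then show ?thesis using Y_w_step[OF that(1) \<mu>, of "i - j - 1"] by simp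
  next
    case True
    then show ?thesis using that(1) Y0[of i] by (cases "i = j") simp_all
  qed
  have upX: "app (X i) w = 0" if "app (X (4 * j)) w = 0" "4 * j \<le> i" for i j
  proof (cases "4 dvd i \<and> i \<noteq> 4 * j")
    case True
    then obtain l where l: "i = 4 * l" by blast
    then have "j < l" using that True by auto
    then obtain d where d: "l = Suc (j + d)" using less_imp_Suc_add by blast
    have "(4 * d + 3) mod 4 = 3" by presburger
    then have "app (X (Suc (4 * d + 3 + 4 * j))) w = 0" by (intro X_w_step[OF that(1)] \<nu>)
    moreover have "Suc (4 * d + 3 + 4 * j) = i" using l d by simp
    ultimately show ?thesis by simp
  next
    case False
    then show ?thesis using that(1) X0[of i] by (cases "i = 4 * j") simp_all
  qed
  have large: "p r s = 0" if "2 * tail \<xi> 1 < s + r" "even (s + r)" for r s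
  proof (rule p_eq_0_of_top)
    obtain b where b: "r + s = 2 * b" using \<open>even (s + r)\<close> unfolding add.commute[of s] by (rule evenE)
    then have "(app (X 0) ^^ b) w = 0" using that by (intro pow_eq_0[OF dom]) simp
    then show "p (r + s) 0 = 0" using p_constant_X[of b] Y0 unfolding b by simp
  qed
  have "?L \<longleftrightarrow> (\<forall>s r. 1 \<le> s \<longrightarrow> 1 \<le> r \<longrightarrow> even (s + r) \<longrightarrow>
        (\<exists>k. 1 / 2 + real r * real k + phi \<xi> k \<le> real s / 2) \<longrightarrow> p r s = 0)"
    (is "_ \<longleftrightarrow> ?L'")
    using twisted_relation_iff[OF Y0[of 0, simplified]] by (metis dvd_def)
  also have "\<dots> \<longleftrightarrow> ?R"
    using rectangular_or_special_cases[OF shape]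
  proof (elim disjE exE conjE)
    assume 1: "\<xi> = (\<lambda>_. 0)"
    then have z: "tail \<xi> k = 0" "nparts \<xi> = 0" for k by (auto simp: tail_def nparts_def)
    then have phi0: "phi \<xi> k = 0" for k by (simp add: phi_def)
    have L': ?L' using large z by simp
    then have "p 1 1 = 0" by (elim allE[of _ 1] impE) (auto intro!: exI[of _ 0] simp: phi0)
    then show "?L' \<longleftrightarrow> ?R" using L' special_zero 1 z p_1 by auto
  next
    fix c k1 K assume 2: "1 \<le> c" "K < k1" "\<xi> = hook c k1 K"
    note h = nparts_hook[OF 2(1,2), folded 2(3)] special_hook[OF 2(1,2), folded 2(3)]
      tail_hook[OF 2(1,2), folded 2(3)] phi_hook[OF 2(1,2), folded 2(3)]
    have \<xi>c: "\<xi> c = K" using 2(3) by (simp add: hook_def)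
    show "?L' \<longleftrightarrow> ?R"
    proof
      assume L: ?L'
      have phis: "phi \<xi> (nparts \<xi>) = 0" by (simp add: phi_def)
      \<comment> \<open>In undoubled terms r = 1/2, s = \<open>nparts \<xi>\<close> + 1/2 and k =
        \<open>nparts \<xi>\<close>, where \<open>phi\<close> is 0.\<close>
      have "p 1 (2 * nparts \<xi> + 1) = 0"
        by (rule L[rule_format]) (auto intro!: exI[of _ "nparts \<xi>"] simp: phis)
      then have Ys: "app (Y (2 * nparts \<xi> + 1)) w = 0" using p_1 by simp
      have "(app (Y (2 * nparts \<xi> - 1)) ^^ m) w = 0"
        if sp: "special \<xi>" and m: "real m = 2 * phi \<xi> (nparts \<xi> - 1) + 1" for m
      proof -
        have K: "K \<noteq> 0" "nparts \<xi> = c" using sp h by auto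
        have m1: "1 \<le> m" using m h(5) unfolding K by linarith
        \<comment> \<open>Equality case with k = c - 1: half of (2c - 1) m is m (c - 1) + m/2, and
          m/2 is 1/2 plus the value of \<open>phi\<close>.\<close>
        have "p m ((2 * c - 1) * m) = 0"
        proof (rule L[rule_format])
          show "1 \<le> (2 * c - 1) * m" using m1 2(1) by simp
          have "(2 * c - 1) * m + m = 2 * (c * m)" using 2(1) by (cases c) (auto simp: algebra_simps)
          then show "even ((2 * c - 1) * m + m)" by simp
          have "real ((2 * c - 1) * m) = 2 * (real m * real (c - 1)) + real m"
            using 2(1) by (simp add: of_nat_diff algebra_simps)
          then show "\<exists>k. 1 / 2 + real m * real k + phi \<xi> k \<le> real ((2 * c - 1) * m) / 2"
            using m K by (intro exI[of _ "c - 1"]) simp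
        qed (rule m1)
        moreover have "pscale (fact m) (p m ((2 * c - 1) * m)) = (app (Y (2 * c - 1)) ^^ m) w"
        proof (rule p_top)
          show "app (Y i) w = 0" if "2 * c - 1 < i" for i
          proof (cases "even i")
            case False
            then obtain l where l: "i = 2 * l + 1" by (rule oddE)
            then have "2 * nparts \<xi> + 1 \<le> i" using that K(2) by simp
            then show ?thesis by (intro upY[OF Ys]) simp_all
          qed (simp add: Y0)
          \<comment> \<open>\<open>X i\<close> is nonzero only for multiples of 4, and the first one
            not below 4c - 2 is 4c.\<close>
          show "app (X i) w = 0" if "2 * (2 * c - 1) \<le> i" for i
          proof (cases "4 dvd i")
            case True
            then obtain l where l: "i = 4 * l" by (rule dvdE)
            then have "4 * nparts \<xi> \<le> i" using that 2(1) K(2) by simp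
            then show ?thesis by (rule upX[OF Xs])
          qed (simp add: X0)
        qed
        ultimately show ?thesis using K by simp
      qed
      then show ?R using Ys by blast
    next
      assume R: ?R
      have Y1: "app (Y i) w = 0" if "2 * c - 1 < i" for i
      proof (cases "even i")
        case False
        then obtain l where l: "i = 2 * l + 1" by (rule oddE)
        have "nparts \<xi> + (if K = 0 then 1 else 0) = c" using h(1) 2(1) by simp
        then have "2 * nparts \<xi> + 1 \<le> i" using that l by (simp split: if_splits)
        then show ?thesis by (intro upY[OF R[THEN conjunct1]]) simp_all
      qed (simp add: Y0)
      have nK: "nparts \<xi> = c - 1" if "K = 0"
        using that h(1) by simp
      have nK': "nparts \<xi> = c" "special \<xi>" if "K \<noteq> 0"
        using that h(1,2) by simp_all
      \<comment> \<open>Truncated subtraction matches the positive part in \<open>phi\<close>. For K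
        = 0 the exponent is 1 and 2c - 1 is \<open>2 * nparts \<xi> + 1\<close>.\<close>
      have Y2: "(app (Y (2 * c - 1)) ^^ Suc (2 * K - k1)) w = 0"
      proof (cases "K = 0")
        case True
        have "2 * nparts \<xi> + 1 = 2 * c - 1" unfolding nK[OF True] using 2(1) by presburger
        then have "app (Y (2 * c - 1)) w = 0" using R by metis
        then show ?thesis using True by simp
      next
        case False
        have "real (Suc (2 * K - k1)) = 2 * phi \<xi> (nparts \<xi> - 1) + 1"
          unfolding nK'(1)[OF False] h(5) by simp
        then have "(app (Y (2 * nparts \<xi> - 1)) ^^ Suc (2 * K - k1)) w = 0"
          using R nK'(2)[OF False] by blast
        then show ?thesis unfolding nK'(1)[OF False] .
      qed
      have X1: "app (X i) w = 0" if "4 * c - 4 < i" for i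
      proof (cases "4 dvd i")
        case True
        then obtain l where l: "i = 4 * l" by (rule dvdE)
        have "nparts \<xi> \<le> c" using nK nK' by fastforce
        then have "4 * nparts \<xi> \<le> i" using that l 2(1) by simp
        then show ?thesis by (rule upX[OF Xs])
      qed (simp add: X0)
      have c4: "4 * c - 4 = 4 * (c - 1)" by simp
      have X2: "(app (X (4 * c - 4)) ^^ Suc K) w = 0"
      proof (cases "K = 0")
        case True
        then show ?thesis using Xs unfolding c4 nK[OF True] by simp
      next
        case False
        then show ?thesis using Xs'[OF nK'(2)[OF False]] unfolding c4 nK'(1)[OF False] \<xi>c by simp
      qed
      have Ylow: "int i \<le> 2 * int c - 3" if "i < 2 * c - 1" "Y i \<noteq> 0" for i
      proof -
        have "odd i" using that Y0 by blast
        then obtain l where l: "i = 2 * l + 1" by (rule oddE)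
        have "l + 2 \<le> c" using that(1) unfolding l by presburger
        then show ?thesis using l by simp
      qed
      have Xlow: "int i \<le> 4 * int c - 8" if "i < 4 * c - 4" "X i \<noteq> 0" for i
      proof -
        have "4 dvd i" using that X0 by blast
        then obtain l where l: "i = 4 * l" by (rule dvdE)
        have "l + 2 \<le> c" using that(1) unfolding l by presburger
        then show ?thesis using l by simp
      qed
      have "p r s = 0" if rel: "1 / 2 + real r * real k + phi \<xi> k \<le> real s / 2" and ev: "even (s + r)" for r s k
      proof (rule ccontr)
        assume nz: "p r s \<noteq> 0"
        have "r = A + 2 * B \<Longrightarrow> a \<le> A \<Longrightarrow> a \<le> 2 * K - k1 \<Longrightarrow> b \<le> B \<Longrightarrow> b \<le> K \<Longrightarrow>
          int s \<le> (2 * int c - 3) * int (A - a) + int ((2 * c - 1) * a) + (4 * int c - 8) * int (B - b)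
            + int ((4 * c - 4) * b)
          \<Longrightarrow> 2 * tail \<xi> 1 < s + r" for A a B b
          using twisted_bound[OF 2(1,2) rel[unfolded 2(3)], of A B a b] 2(1) unfolding 2(3)
          by (simp add: of_nat_diff)
        then have "2 * tail \<xi> 1 < s + r"
          by (rule p_nonzero[of "2 * c - 1" "4 * c - 4" "2 * K - k1" K "2 * int c - 3" "4 * int c - 8",
                OF Y1 X1 Y2 X2 Ylow Xlow _ nz, rotated -1])
             (use 2(1) in auto)
        then show False using large ev nz by blast
      qed
      then show ?L' by blast
    qed
  qed
  finally show ?thesis .
qed

end

section \<open>Modules presented by the free algebra\<close>

lemma const_mult: "const c * p = pscale c p"
  by (simp add: const_def pscale_def mult_map_scale_conv_mult)

lemma mult_const: "p * const c = pscale c p"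
proof (induction p rule: update_induct)
  case (update f a b)
  have e: "Poly_Mapping.update a b f = f + Poly_Mapping.single a b"
    using update(1) by (intro poly_mapping_eqI)
      (auto simp: lookup_add update.rep_eq lookup_single when_def in_keys_iff)
  have "Poly_Mapping.single a b * const c = pscale c (Poly_Mapping.single a b)"
    by (intro poly_mapping_eqI) (simp add: const_def mult_single lookup_single when_def mult.commute)
  then show ?case unfolding e distrib_right pscale.scale_right_distrib update(3) by simp
qed simp

lemma mult_pscale_left: "pscale c p * q = pscale c (p * (q :: 'a free_alg))"
  by (simp only: const_mult[symmetric] mult.assoc)

lemma mult_pscale_right: "p * pscale c q = pscale c (p * (q :: 'a free_alg))"
proof -
  have "p * pscale c q = p * const c * q" by (simp only: const_mult mult.assoc)
  then show ?thesis by (simp only: mult_const mult_pscale_left)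
qed

lemma free_alg_on_zero: "0 \<in> free_alg_on L" and free_alg_on_one: "1 \<in> free_alg_on L"
  by (simp_all add: free_alg_on_def zero_word_def)

lemma free_alg_on_add: "p \<in> free_alg_on L \<Longrightarrow> q \<in> free_alg_on L \<Longrightarrow> p + q \<in> free_alg_on L"
  unfolding free_alg_on_def using keys_add[of p q] by blast

lemma free_alg_on_scale: "p \<in> free_alg_on L \<Longrightarrow> pscale c p \<in> free_alg_on L"
  by (auto simp: free_alg_on_def in_keys_iff)

lemma free_alg_on_diff: "p \<in> free_alg_on L \<Longrightarrow> q \<in> free_alg_on L \<Longrightarrow> p - q \<in> free_alg_on L"
  unfolding free_alg_on_def using keys_diff[of p q] by blast

lemma free_alg_on_mult: "p \<in> free_alg_on L \<Longrightarrow> q \<in> free_alg_on L \<Longrightarrow> p * q \<in> free_alg_on L"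
  unfolding free_alg_on_def using keys_mult[of p q] by (fastforce simp: plus_word_def)

lemma free_alg_on_gen: "z \<in> L \<Longrightarrow> gen z \<in> free_alg_on L"
  by (simp add: free_alg_on_def gen_def)

lemma free_alg_on_subspace: "pscale.subspace (free_alg_on L)"
  by (intro pscale.subspaceI free_alg_on_zero free_alg_on_add free_alg_on_scale)

text \<open>\<open>pr\<close> exhibits \<open>M\<close> as the quotient of the free algebra on \<open>L\<close> by the left ideal \<open>J\<close>.\<close>

definition presents :: "'g set \<Rightarrow> ('g, 'm) lie_mod \<Rightarrow> ('g free_alg \<Rightarrow> 'm) \<Rightarrow> 'g free_alg set \<Rightarrow> bool" where
  "presents L M pr J \<longleftrightarrow>
     J \<subseteq> free_alg_on L \<and> pscale.subspace J \<and> (\<forall>z\<in>L. \<forall>p\<in>J. gen z * p \<in> J) \<and>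
     mcar M = pr ` free_alg_on L \<and>
     (\<forall>p\<in>free_alg_on L. \<forall>q\<in>free_alg_on L. pr p = pr q \<longleftrightarrow> p - q \<in> J) \<and>
     (\<forall>p\<in>free_alg_on L. \<forall>q\<in>free_alg_on L. madd M (pr p) (pr q) = pr (p + q)) \<and>
     (\<forall>c. \<forall>p\<in>free_alg_on L. mscl M c (pr p) = pr (pscale c p)) \<and>
     (\<forall>z\<in>L. \<forall>p\<in>free_alg_on L. mact M z (pr p) = pr (gen z * p))"

lemma presentsD:
  assumes "presents L M pr J"
  shows "J \<subseteq> free_alg_on L" "pscale.subspace J" "\<And>z p. z \<in> L \<Longrightarrow> p \<in> J \<Longrightarrow> gen z * p \<in> J"
    "mcar M = pr ` free_alg_on L"
    "\<And>p q. p \<in> free_alg_on L \<Longrightarrow> q \<in> free_alg_on L \<Longrightarrow> pr p = pr q \<longleftrightarrow> p - q \<in> J"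
    "\<And>p q. p \<in> free_alg_on L \<Longrightarrow> q \<in> free_alg_on L \<Longrightarrow> madd M (pr p) (pr q) = pr (p + q)"
    "\<And>c p. p \<in> free_alg_on L \<Longrightarrow> mscl M c (pr p) = pr (pscale c p)"
    "\<And>z p. z \<in> L \<Longrightarrow> p \<in> free_alg_on L \<Longrightarrow> mact M z (pr p) = pr (gen z * p)"
  using assms unfolding presents_def by auto

text \<open>The nested cosets of the enveloping algebra, the local Weyl module and its quotients all
  become quotients of one free algebra by growing left ideals.\<close>

lemma presents_quot:
  assumes M: "presents L M pr J" and N: "submodule L M N"
  shows "presents L (quot_mod M N) (\<lambda>p. coset M N (pr p)) {p \<in> free_alg_on L. pr p \<in> N}"
proof -
  let ?A = "free_alg_on L" and ?J = "{p \<in> free_alg_on L. pr p \<in> N}"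
  note D = presentsD[OF M]
  have sub: "N \<subseteq> pr ` ?A" "N \<noteq> {}" "\<And>u v. u \<in> N \<Longrightarrow> v \<in> N \<Longrightarrow> madd M u v \<in> N"
    "\<And>c v. v \<in> N \<Longrightarrow> mscl M c v \<in> N" "\<And>x v. x \<in> L \<Longrightarrow> v \<in> N \<Longrightarrow> mact M x v \<in> N"
    using N D(4) unfolding submodule_def by blast+
  obtain p0 where p0: "p0 \<in> ?A" "pr p0 \<in> N" using sub(1,2) by blast
  have J0: "0 \<in> ?J" using sub(4)[OF p0(2), of 0] D(7)[OF p0(1), of 0] by (simp add: free_alg_on_zero)
  have Jadd: "p + q \<in> ?J" if "p \<in> ?J" "q \<in> ?J" for p q
    using that sub(3)[of "pr p" "pr q"] D(6)[of p q] by (simp add: free_alg_on_add)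
  have Jscl: "pscale c p \<in> ?J" if "p \<in> ?J" for c p
    using that sub(4)[of "pr p" c] D(7)[of p c] by (simp add: free_alg_on_scale)
  have J: "pscale.subspace ?J" by (rule pscale.subspaceI[OF J0 Jadd Jscl])
  have Jact: "gen z * p \<in> ?J" if "z \<in> L" "p \<in> ?J" for z p
    using that sub(5)[of z "pr p"] D(8)[of z p] by (simp add: free_alg_on_mult free_alg_on_gen)
  have Jd: "p - q \<in> ?J" if "p \<in> ?J" "q \<in> ?J" for p q by (rule pscale.subspace_diff[OF J that])
  have cs: "coset M N (pr p) = (\<lambda>u. pr (p + u)) ` ?J" if p: "p \<in> ?A" for p
  proof -
    have "coset M N (pr p) = (\<lambda>u. madd M (pr p) (pr u)) ` ?J"
      unfolding coset_def using sub(1) by blast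
    also have "\<dots> = (\<lambda>u. pr (p + u)) ` ?J" using D(6)[OF p] by (intro image_cong) auto
    finally show ?thesis .
  qed
  have JA: "u \<in> ?A" if "u \<in> ?J" for u using that by simp
  have JJ: "J \<subseteq> ?J"
  proof
    fix j assume j: "j \<in> J"
    then have "pr j = pr 0" using D(1) D(5)[of j 0] by (auto simp: free_alg_on_zero)
    then show "j \<in> ?J" using j D(1) J0 by auto
  qed
  have incl: "(\<lambda>u. pr (p + u)) ` ?J \<subseteq> (\<lambda>u. pr (q + u)) ` ?J" if "p - q \<in> ?J" for p q
  proof (rule image_subsetI)
    fix u assume u: "u \<in> ?J"
    show "pr (p + u) \<in> (\<lambda>u. pr (q + u)) ` ?J" by (rule image_eqI[OF _ Jadd[OF that u]]) simp
  qed
  have shift: "(\<lambda>u. pr (p + u)) ` ?J = (\<lambda>u. pr (q + u)) ` ?J \<longleftrightarrow> p - q \<in> ?J"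
    if p: "p \<in> ?A" and q: "q \<in> ?A" for p q
  proof
    assume eq: "(\<lambda>u. pr (p + u)) ` ?J = (\<lambda>u. pr (q + u)) ` ?J"
    have "pr (p + 0) \<in> (\<lambda>u. pr (p + u)) ` ?J" by (rule imageI[OF J0])
    then obtain u where u: "u \<in> ?J" "pr (p + 0) = pr (q + u)" unfolding eq by (rule imageE)
    then have "p + 0 - (q + u) \<in> J"
      using D(5)[of "p + 0" "q + u"] free_alg_on_add[OF p free_alg_on_zero] free_alg_on_add[OF q JA[OF u(1)]]
      by blast
    then have "(p + 0 - (q + u)) + u \<in> ?J" using Jadd[OF _ u(1)] JJ by blast
    then show "p - q \<in> ?J" by simp
  next
    assume d: "p - q \<in> ?J"
    moreover have "q - p \<in> ?J" using Jd[OF J0 d] by simp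
    ultimately show "(\<lambda>u. pr (p + u)) ` ?J = (\<lambda>u. pr (q + u)) ` ?J" using incl by (intro equalityI) auto
  qed
  show ?thesis unfolding presents_def
  proof (intro conjI ballI allI)
    fix p q assume p: "p \<in> ?A" and q: "q \<in> ?A"
    show "coset M N (pr p) = coset M N (pr q) \<longleftrightarrow> p - q \<in> ?J" unfolding cs[OF p] cs[OF q] by (rule shift[OF p q])
    have m: "madd M (pr (p + u)) (pr (q + v)) = pr (p + q + (u + v))" if "u \<in> ?J" "v \<in> ?J" for u v
    proof -
      have "p + u + (q + v) = p + q + (u + v)" by (simp add: add_ac)
      then show ?thesis using D(6)[OF free_alg_on_add[OF p JA[OF that(1)]] free_alg_on_add[OF q JA[OF that(2)]]]
        by (simp only:)
    qed
    have "{madd M a b | a b. a \<in> coset M N (pr p) \<and> b \<in> coset M N (pr q)} = (\<lambda>u. pr (p + q + u)) ` ?J"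
    proof (intro equalityI subsetI)
      fix x assume "x \<in> {madd M a b | a b. a \<in> coset M N (pr p) \<and> b \<in> coset M N (pr q)}"
      then obtain u v where uv: "u \<in> ?J" "v \<in> ?J" "x = madd M (pr (p + u)) (pr (q + v))"
        unfolding cs[OF p] cs[OF q] by blast
      then show "x \<in> (\<lambda>u. pr (p + q + u)) ` ?J" unfolding uv(3) m[OF uv(1,2)]
          by (intro imageI Jadd uv(1,2))
    next
      fix x assume "x \<in> (\<lambda>u. pr (p + q + u)) ` ?J"
      then obtain u where u: "u \<in> ?J" "x = pr (p + q + u)" by (rule imageE)
      then have "x = madd M (pr (p + u)) (pr (q + 0))" using m[OF u(1) J0] by simp
      then show "x \<in> {madd M a b | a b. a \<in> coset M N (pr p) \<and> b \<in> coset M N (pr q)}"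
        unfolding cs[OF p] cs[OF q] using u(1) J0 by blast
    qed
    then show "madd (quot_mod M N) (coset M N (pr p)) (coset M N (pr q)) = coset M N (pr (p + q))"
      by (simp add: quot_mod_def cs[OF free_alg_on_add[OF p q]])
  next
    \<comment> \<open>Treats scalars and the Lie algebra action at once: f acts on the module, g on
      representatives, and g has to preserve the ideal.\<close>
    have op: "{madd M (f a) u | a u. a \<in> coset M N (pr p) \<and> u \<in> N} = coset M N (pr (g p))"
      if p: "p \<in> ?A" and f: "\<And>p. p \<in> ?A \<Longrightarrow> f (pr p) = pr (g p)" and g: "\<And>p. p \<in> ?A \<Longrightarrow> g p \<in> ?A"
        "\<And>p q. g (p + q) = g p + g q" "\<And>p. p \<in> ?J \<Longrightarrow> g p \<in> ?J" for f g p
    proof -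
      have m: "madd M (f (pr (p + u))) (pr v) = pr (g p + (g u + v))" if u: "u \<in> ?J" and v: "v \<in> ?J" for u v
      proof -
        have "p + u \<in> ?A" by (rule free_alg_on_add[OF p JA[OF u]])
        then show ?thesis using D(6)[OF g(1) JA[OF v], of "p + u"] f[of "p + u"] g(2)[of p u]
          by (simp only: add.assoc)
      qed
      show ?thesis unfolding cs[OF p] cs[OF g(1)[OF p]]
      proof (intro equalityI subsetI)
        fix x assume "x \<in> {madd M (f a) u | a u. a \<in> (\<lambda>u. pr (p + u)) ` ?J \<and> u \<in> N}"
        then obtain u v where "u \<in> ?J" "v \<in> N" and x: "x = madd M (f (pr (p + u))) v" by blast
        then obtain v' where v': "v' \<in> ?J" "v = pr v'" using sub(1) by blast
        show "x \<in> (\<lambda>u. pr (g p + u)) ` ?J" unfolding x v'(2) m[OF \<open>u \<in> ?J\<close> v'(1)]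
          by (intro imageI Jadd g(3) \<open>u \<in> ?J\<close> v'(1))
      next
        fix x assume "x \<in> (\<lambda>u. pr (g p + u)) ` ?J"
        then obtain u where u: "u \<in> ?J" "x = pr (g p + u)" by (rule imageE)
        have "g 0 = 0" using g(2)[of 0 0] by simp
        then have "x = madd M (f (pr (p + 0))) (pr u)" using m[OF J0 u(1)] u(2) by simp
        moreover have "pr u \<in> N" using u(1) by simp
        ultimately show "x \<in> {madd M (f a) u | a u. a \<in> (\<lambda>u. pr (p + u)) ` ?J \<and> u \<in> N}"
          using J0 by blast
      qed
    qed
    fix p assume p: "p \<in> ?A"
    show "mscl (quot_mod M N) c (coset M N (pr p)) = coset M N (pr (pscale c p))" for c
      using op[where f = "mscl M c" and g = "pscale c", OF p D(7) free_alg_on_scale pscale.scale_right_distrib Jscl] by (simp add: quot_mod_def)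
    show "mact (quot_mod M N) z (coset M N (pr p)) = coset M N (pr (gen z * p))" if z: "z \<in> L" for z
      using op[where f = "mact M z" and g = "(*) (gen z)", OF p D(8)[OF z] free_alg_on_mult[OF free_alg_on_gen[OF z]] distrib_left Jact[OF z]]
      by (simp add: quot_mod_def)
  qed (use J Jact D(4) in \<open>auto simp: quot_mod_def\<close>)
qed

lemma presents_act_pow:
  assumes M: "presents L M pr J" and z: "z \<in> L" and p: "p \<in> free_alg_on L"
  shows "act_pow M z k (pr p) = pr (gen z ^ k * p) \<and> gen z ^ k * p \<in> free_alg_on L"
proof (induction k)
  case (Suc k)
  then show ?case using presentsD(8)[OF M z, of "gen z ^ k * p"] free_alg_on_gen[OF z]
    by (simp add: act_pow_def mult.assoc free_alg_on_mult)
qed (simp add: act_pow_def p)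

context lie_algebra
begin

lemma uea_ideal_relator: "j \<in> uea_relators L \<Longrightarrow> j \<in> uea_ideal L"
  and uea_ideal_zero: "0 \<in> uea_ideal L"
  and uea_ideal_add: "p \<in> uea_ideal L \<Longrightarrow> q \<in> uea_ideal L \<Longrightarrow> p + q \<in> uea_ideal L"
  and uea_ideal_mult: "p \<in> uea_ideal L \<Longrightarrow> q \<in> free_alg_on L \<Longrightarrow> q * p \<in> uea_ideal L"
    "p \<in> uea_ideal L \<Longrightarrow> q \<in> free_alg_on L \<Longrightarrow> p * q \<in> uea_ideal L"
  unfolding uea_ideal_def by blast+

lemma uea_ideal_scale: "p \<in> uea_ideal L \<Longrightarrow> pscale c p \<in> uea_ideal L"
proof -
  assume p: "p \<in> uea_ideal L"
  have "const c \<in> free_alg_on L"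
    using free_alg_on_scale[OF free_alg_on_one, of c L] by (metis const_mult mult_1_right)
  then show ?thesis using uea_ideal_mult(1)[OF p, of "const c"] by (simp only: const_mult)
qed

lemma uea_ideal_diff: "p \<in> uea_ideal L \<Longrightarrow> q \<in> uea_ideal L \<Longrightarrow> p - q \<in> uea_ideal L"
  using uea_ideal_add[of p L "pscale (- 1) q"] uea_ideal_scale[of q L "- 1"] by simp

text \<open>For an arbitrary set L, sums and brackets of its elements may leave L, so the ideal need
  not lie in \<open>free_alg_on L\<close>; hence the intersection.\<close>

lemma presents_uea: "presents L (uea L) (coset (free_alg_mod L) (uea_ideal L)) (uea_ideal L \<inter> free_alg_on L)"
proof -
  let ?J = "uea_ideal L" and ?A = "free_alg_on L"
  have cs: "coset (free_alg_mod L) ?J p = (\<lambda>u. p + u) ` ?J" for p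
    by (auto simp: coset_def free_alg_mod_def)
  have incl: "(\<lambda>u. p + u) ` ?J \<subseteq> (\<lambda>u. q + u) ` ?J" if "p - q \<in> ?J" for p q
  proof (rule image_subsetI)
    fix u assume u: "u \<in> ?J"
    show "p + u \<in> (\<lambda>u. q + u) ` ?J" by (rule image_eqI[OF _ uea_ideal_add[OF that u]]) simp
  qed
  have shift: "(\<lambda>u. p + u) ` ?J = (\<lambda>u. q + u) ` ?J \<longleftrightarrow> p - q \<in> ?J" for p q
  proof
    assume eq: "(\<lambda>u. p + u) ` ?J = (\<lambda>u. q + u) ` ?J"
    have "p + 0 \<in> (\<lambda>u. p + u) ` ?J" by (rule imageI[OF uea_ideal_zero])
    then obtain u where "u \<in> ?J" "p + 0 = q + u" unfolding eq by (rule imageE)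
    then show "p - q \<in> ?J" by (simp add: algebra_simps)
  next
    assume d: "p - q \<in> ?J"
    moreover have "q - p \<in> ?J" using uea_ideal_diff[OF uea_ideal_zero d] by simp
    ultimately show "(\<lambda>u. p + u) ` ?J = (\<lambda>u. q + u) ` ?J" using incl by (intro equalityI) auto
  qed
  have op: "{f a + u | a u. a \<in> (\<lambda>u. p + u) ` ?J \<and> u \<in> ?J} = (\<lambda>u. f p + u) ` ?J"
    if f: "\<And>p q. f (p + q) = f p + f q" "\<And>p. p \<in> ?J \<Longrightarrow> f p \<in> ?J" for f p
  proof (intro equalityI subsetI)
    fix x assume "x \<in> {f a + u | a u. a \<in> (\<lambda>u. p + u) ` ?J \<and> u \<in> ?J}"
    then obtain u v where uv: "u \<in> ?J" "v \<in> ?J" "x = f (p + u) + v" by blast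
    then have "x = f p + (f u + v)" by (simp add: f add.assoc)
    then show "x \<in> (\<lambda>u. f p + u) ` ?J" using uv(1,2) by (auto intro!: uea_ideal_add f)
  next
    fix x assume "x \<in> (\<lambda>u. f p + u) ` ?J"
    then obtain u where u: "u \<in> ?J" "x = f p + u" by (rule imageE)
    then have "x = f (p + 0) + u" by simp
    then show "x \<in> {f a + u | a u. a \<in> (\<lambda>u. p + u) ` ?J \<and> u \<in> ?J}" using u(1) uea_ideal_zero by blast
  qed
  show ?thesis unfolding presents_def cs
  proof (intro conjI ballI allI)
    show "pscale.subspace (?J \<inter> ?A)"
      by (intro pscale.subspaceI IntI)
         (auto intro: uea_ideal_zero uea_ideal_add uea_ideal_scale free_alg_on_zero free_alg_on_add free_alg_on_scale)
    show "gen z * p \<in> ?J \<inter> ?A" if "z \<in> L" "p \<in> ?J \<inter> ?A" for z p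
      using that by (auto intro: uea_ideal_mult free_alg_on_mult free_alg_on_gen)
    show "mcar (uea L) = (\<lambda>p. (\<lambda>u. p + u) ` ?J) ` ?A"
      by (simp add: uea_def quot_mod_def cs) (simp add: free_alg_mod_def)
    fix p assume p: "p \<in> ?A"
    show "(\<lambda>u. p + u) ` ?J = (\<lambda>u. q + u) ` ?J \<longleftrightarrow> p - q \<in> ?J \<inter> ?A" if "q \<in> ?A" for q
      using shift free_alg_on_diff[OF p that] by blast
    show "madd (uea L) ((\<lambda>u. p + u) ` ?J) ((\<lambda>u. q + u) ` ?J) = (\<lambda>u. p + q + u) ` ?J" for q
    proof -
      have "madd (uea L) ((\<lambda>u. p + u) ` ?J) ((\<lambda>u. q + u) ` ?J) =
          {a + b | a b. a \<in> (\<lambda>u. p + u) ` ?J \<and> b \<in> (\<lambda>u. q + u) ` ?J}"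
        by (simp add: uea_def quot_mod_def free_alg_mod_def)
      also have "\<dots> = (\<lambda>u. p + q + u) ` ?J"
      proof (intro equalityI subsetI)
        fix x assume "x \<in> {a + b | a b. a \<in> (\<lambda>u. p + u) ` ?J \<and> b \<in> (\<lambda>u. q + u) ` ?J}"
        then obtain u v where uv: "u \<in> ?J" "v \<in> ?J" "x = (p + u) + (q + v)" by blast
        then have "x = p + q + (u + v)" by (simp add: add_ac)
        then show "x \<in> (\<lambda>u. p + q + u) ` ?J" using uea_ideal_add[OF uv(1,2)] by blast
      next
        fix x assume "x \<in> (\<lambda>u. p + q + u) ` ?J"
        then obtain u where u: "u \<in> ?J" "x = p + q + u" by (rule imageE)
        then have "x = (p + u) + (q + 0)" by (simp add: add_ac)
        then show "x \<in> {a + b | a b. a \<in> (\<lambda>u. p + u) ` ?J \<and> b \<in> (\<lambda>u. q + u) ` ?J}"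
          using u(1) uea_ideal_zero by blast
      qed
      finally show ?thesis .
    qed
    show "mscl (uea L) c ((\<lambda>u. p + u) ` ?J) = (\<lambda>u. pscale c p + u) ` ?J" for c
      using op[of "pscale c" p] uea_ideal_scale
      by (simp add: uea_def quot_mod_def free_alg_mod_def const_mult pscale.scale_right_distrib)
    show "mact (uea L) z ((\<lambda>u. p + u) ` ?J) = (\<lambda>u. gen z * p + u) ` ?J" if z: "z \<in> L" for z
      using op[of "(*) (gen z)" p] uea_ideal_mult(1)[OF _ free_alg_on_gen[OF z]]
      by (simp add: uea_def quot_mod_def free_alg_mod_def distrib_left)
  qed simp
qed

end

text \<open>Realizes the quotient by \<open>J\<close> inside the free algebra, so that its endomorphisms are of type \<open>lop\<close>.\<close>

lemma quotient_projection:
  assumes J: "pscale.subspace J" and A: "pscale.subspace A" and JA: "J \<subseteq> A"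
  shows "\<exists>q. Vector_Spaces.linear pscale pscale q \<and> range q \<subseteq> A \<and> (\<forall>p\<in>A. q p - p \<in> J) \<and> (\<forall>p\<in>J. q p = 0)"
proof -
  interpret vp: vector_space_pair pscale pscale by unfold_locales
  obtain B where B: "B \<subseteq> J" "pscale.independent B" "J \<subseteq> pscale.span B"
    by (rule pscale.maximal_independent_subset)
  obtain B' where B': "B \<subseteq> B'" "B' \<subseteq> A" "pscale.independent B'" "A \<subseteq> pscale.span B'"
    using pscale.maximal_independent_subset_extend[of B A] B JA by blast
  define f where "f b = (if b \<in> B then 0 else b)" for b
  define q where "q = vp.construct B' f"
  have lin: "Vector_Spaces.linear pscale pscale q" unfolding q_def by (rule vp.linear_construct[OF B'(3)])
  have qb: "q b = f b" if "b \<in> B'" for b unfolding q_def by (rule vp.construct_basis[OF B'(3) that])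
  have "q p \<in> A" for p
  proof -
    have "q p \<in> pscale.span (f ` B')" unfolding q_def by (rule vp.construct_in_span[OF B'(3)])
    moreover have "f ` B' \<subseteq> A" using B'(2) pscale.subspace_0[OF A] by (auto simp: f_def)
    ultimately show ?thesis using pscale.span_minimal[OF _ A] by blast
  qed
  moreover have "q p - p \<in> J" if "p \<in> A" for p
  proof -
    have "p \<in> pscale.span B'" using that B'(4) by blast
    then show ?thesis
    proof (induction rule: pscale.span_induct_alt)
      case base
      then show ?case using vp.linear_0[OF lin] pscale.subspace_0[OF J] by simp
    next
      case (step c b p)
      have "q b - b \<in> J" using qb[OF step(1)] B(1) pscale.subspace_0[OF J] pscale.subspace_neg[OF J]
        by (auto simp: f_def)
      then have "pscale c (q b - b) + (q p - p) \<in> J"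
        using step by (intro pscale.subspace_add[OF J] pscale.subspace_scale[OF J])
      moreover have "q (pscale c b + p) - (pscale c b + p) = pscale c (q b - b) + (q p - p)"
        by (simp add: vp.linear_add[OF lin] vp.linear_scale[OF lin] pscale.scale_right_diff_distrib algebra_simps)
      ultimately show ?case by (simp only:)
    qed
  qed
  moreover have "q p = 0" if "p \<in> J" for p
  proof -
    have "p \<in> pscale.span B" using that B(3) by blast
    then show ?thesis
    proof (induction rule: pscale.span_induct_alt)
      case (step c b p)
      then show ?case using qb[of b] B'(1) by (auto simp: f_def vp.linear_add[OF lin] vp.linear_scale[OF lin])
    qed (rule vp.linear_0[OF lin])
  qed
  ultimately show ?thesis using lin by blast
qed

context lie_algebra
begin

text \<open>The laws for R are conditional on membership in L, so that closure of L under brackets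
  is not presupposed.\<close>

definition represents :: "'g set \<Rightarrow> 'g free_alg set \<Rightarrow> ('g \<Rightarrow> 'g word lop) \<Rightarrow> ('g free_alg \<Rightarrow> 'g free_alg) \<Rightarrow> bool" where
  "represents L J R q \<longleftrightarrow>
     (\<forall>p\<in>free_alg_on L. q p = 0 \<longleftrightarrow> p \<in> J) \<and> (\<forall>c p. q (pscale c p) = pscale c (q p)) \<and>
     (\<forall>z\<in>L. \<forall>p\<in>free_alg_on L. app (R z) (q p) = q (gen z * p)) \<and>
     (\<forall>c. \<forall>y\<in>L. scale c y \<in> L \<longrightarrow> R (scale c y) = lscale c (R y)) \<and>
     (\<forall>y\<in>L. \<forall>z\<in>L. bracket y z \<in> L \<longrightarrow> R (bracket y z) = comm (R y) (R z))"

text \<open>The action on the quotient is carried over to the image of the projection q. Projecting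
  before and after multiplication makes each R z an operator on the whole space.\<close>

theorem operator_representation:
  assumes M: "presents L M pr J" and U: "\<And>j. j \<in> uea_ideal L \<Longrightarrow> j \<in> free_alg_on L \<Longrightarrow> j \<in> J"
  shows "\<exists>R q. represents L J R q"
proof -
  note D = presentsD[OF M]
  obtain q where lin: "Vector_Spaces.linear pscale pscale q" and q: "range q \<subseteq> free_alg_on L"
    "\<And>p. p \<in> free_alg_on L \<Longrightarrow> q p - p \<in> J" "\<And>p. p \<in> J \<Longrightarrow> q p = 0"
    using quotient_projection[OF D(2) free_alg_on_subspace D(1)] by blast
  interpret vp: vector_space_pair pscale pscale by unfold_locales
  note ql = vp.linear_add[OF lin] vp.linear_scale[OF lin] vp.linear_diff[OF lin]
  have qA: "q p \<in> free_alg_on L" for p using q(1) by blast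
  have eq: "q p = q p'" if "p - p' \<in> J" for p p'
    using q(3)[OF that] by (simp add: ql)
  define R where "R z = Lop (\<lambda>p. q (gen z * q p))" for z
  have R: "app (R z) p = q (gen z * q p)" for z p
  proof -
    have "Vector_Spaces.linear pscale pscale (\<lambda>p. q (gen z * q p))"
      by (rule linear_pscaleI) (simp_all add: ql distrib_left mult_pscale_right)
    then show ?thesis unfolding R_def by (simp add: app_Lop)
  qed
  have act: "q (gen z * q p) = q (gen z * p)" if "z \<in> L" "p \<in> free_alg_on L" for z p
    by (rule eq) (use D(3)[OF that(1) q(2)[OF that(2)]] in \<open>simp add: right_diff_distrib\<close>)
  \<comment> \<open>The ideal of the enveloping algebra is two-sided and thus absorbs the right
    factor; so a relator acts by 0.\<close>
  have rel: "q (j * q p) = 0" if "j \<in> uea_relators L" "j \<in> free_alg_on L" for j p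
    by (rule q(3)) (intro U uea_ideal_mult(2) uea_ideal_relator free_alg_on_mult qA that)
  show ?thesis unfolding represents_def
  proof (intro exI[of _ R] exI[of _ q] conjI ballI allI impI)
    show "q p = 0 \<longleftrightarrow> p \<in> J" if "p \<in> free_alg_on L" for p
      using q(2)[OF that] q(3)[of p] pscale.subspace_neg[OF D(2), of "- p"] by auto
    show "q (pscale c p) = pscale c (q p)" for c p by (simp add: ql)
    show "app (R z) (q p) = q (gen z * p)" if z: "z \<in> L" and p: "p \<in> free_alg_on L" for z p
      unfolding R by (simp only: act[OF z qA] act[OF z p])
    show "R (scale c y) = lscale c (R y)" if y: "y \<in> L" "scale c y \<in> L" for c y
    proof (rule lop_eqI)
      fix v
      have "q ((gen (scale c y) - const c * gen y) * q v) = 0"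
      proof (rule rel)
        show "gen (scale c y) - const c * gen y \<in> uea_relators L"
          unfolding uea_relators_def using y by blast
        show "gen (scale c y) - const c * gen y \<in> free_alg_on L"
          unfolding const_mult by (intro free_alg_on_diff free_alg_on_gen free_alg_on_scale y)
      qed
      then show "app (R (scale c y)) v = app (lscale c (R y)) v"
        unfolding left_diff_distrib const_mult mult_pscale_left ql by (simp add: R)
    qed
    show "R (bracket y z) = comm (R y) (R z)" if y: "y \<in> L" "z \<in> L" "bracket y z \<in> L" for y z
    proof (rule lop_eqI)
      fix v
      have "q ((gen y * gen z - gen z * gen y - gen (bracket y z)) * q v) = 0"
      proof (rule rel)
        show "gen y * gen z - gen z * gen y - gen (bracket y z) \<in> uea_relators L"
          unfolding uea_relators_def using y by blast
        show "gen y * gen z - gen z * gen y - gen (bracket y z) \<in> free_alg_on L"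
          by (intro free_alg_on_diff free_alg_on_gen free_alg_on_mult y)
      qed
      then have "q (gen y * (gen z * q v)) - q (gen z * (gen y * q v)) - q (gen (bracket y z) * q v) = 0"
        unfolding left_diff_distrib ql mult.assoc .
      then have e: "q (gen (bracket y z) * q v) = q (gen y * (gen z * q v)) - q (gen z * (gen y * q v))" by simp
      have u: "gen u * q v \<in> free_alg_on L" if "u \<in> L" for u
        by (rule free_alg_on_mult[OF free_alg_on_gen[OF that] qA])
      show "app (R (bracket y z)) v = app (comm (R y) (R z)) v"
        unfolding comm_def app_lop R act[OF y(1) qA] act[OF y(2) qA] act[OF y(1) u[OF y(2)]] act[OF y(2) u[OF y(1)]] by (rule e)
    qed
  qed
qed

lemma family_image:
  assumes fam: "family scale bracket F Y X H \<eta> \<mu> \<nu> \<tau>"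
    and L: "subspace L" "F \<in> L" "\<And>i. Y i \<in> L" "\<And>i. X i \<in> L" "\<And>i. H i \<in> L"
    and Rs: "\<And>c y. y \<in> L \<Longrightarrow> scale c y \<in> L \<Longrightarrow> R (scale c y) = lscale c (R y)"
    and Rb: "\<And>y z. y \<in> L \<Longrightarrow> z \<in> L \<Longrightarrow> bracket y z \<in> L \<Longrightarrow> R (bracket y z) = comm (R y) (R z)"
  shows "family lscale comm (R F) (\<lambda>i. R (Y i)) (\<lambda>i. R (X i)) (\<lambda>i. R (H i)) \<eta> \<mu> \<nu> \<tau>"
proof -
  have R0: "R 0 = 0" using Rs[OF L(2), of 0] subspace_0[OF L(1)] by simp
  have "comm (R y) (R z) = lscale c (R u)" if "bracket y z = scale c u" "y \<in> L" "z \<in> L" "u \<in> L" for y z c u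
    using Rb[OF that(2,3)] Rs[OF that(4), of c] subspace_scale[OF L(1) that(4), of c] that(1) by simp
  moreover have "comm (R y) (R z) = 0" if "bracket y z = 0" "y \<in> L" "z \<in> L" for y z
    using Rb[OF that(2,3)] R0 subspace_0[OF L(1)] that(1) by simp
  moreover have "comm (R F) (R (Y i)) = R (H i)" for i
    using Rb[OF L(2,3), of i] L(5)[of i] fam by (simp add: family_def)
  ultimately show ?thesis using fam L(2-5) unfolding family_def by (elim conjE) (intro conjI allI; simp)
qed

end

section \<open>The current algebra\<close>

context affine_A2n2
begin

lemma bracket_root_space:
  assumes "f \<in> root_space \<gamma>" "g \<in> root_space \<delta>"
  shows "brk G f g \<in> root_space (\<gamma> + \<delta>)"
  unfolding root_space_def
proof safe
  fix h assume h: "h \<in> cartan G"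
  have "brk G h (brk G f g) = brk G (brk G h f) g + brk G f (brk G h g)"
    by (simp add: bracket_bracket_left)
  then show "brk G h (brk G f g) = scl G (wt_eval (\<gamma> + \<delta>) h) (brk G f g)"
    using assms h by (simp add: root_space_def bracket_scale_left bracket_scale_right wt_eval_add scale_left_distrib)
qed

lemma Cg_subspace: "subspace Cg"
  by (simp add: Cg_def)

lemma nplus_Cg: "affine_nplus \<subseteq> Cg"
  unfolding Cg_def by (rule order_trans[OF _ span_superset]) blast

lemma nminus_Cg: "fin_nminus \<subseteq> Cg"
  unfolding Cg_def by (rule order_trans[OF _ span_superset]) blast

lemma fin_cartan_Cg: "fin_cartan \<subseteq> Cg"
  unfolding Cg_def by (rule order_trans[OF _ span_superset]) blast

text \<open>In these coordinates positivity is a comparison of two indices; the membership facts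
  about \<open>affine_nplus\<close> below reduce to it.\<close>

lemma eps_root_space_nplus:
  assumes "u < v"
  shows "root_space (eps n u - eps n v) \<subseteq> affine_nplus"
proof (cases "root_space (eps n u - eps n v) = {0}")
  case True
  then show ?thesis by (simp add: affine_nplus_def span_zero)
next
  case False
  have "eps n u - eps n v \<in> affine_pos_roots"
    unfolding affine_pos_roots_def
  proof (intro CollectI conjI allI impI False)
    show "(eps n u - eps n v) i \<in> \<nat>" for i using assms by (intro eps_diff_nonneg) simp
    show "(eps n u - eps n v) i = 0" if "n < i" for i using that by (simp add: weight_apply eps_def)
    show "eps n u - eps n v \<noteq> (\<lambda>_. 0)"
    proof
      assume "eps n u - eps n v = (\<lambda>_. 0)"
      then have "eps n u - eps n v = 0" by (simp add: zero_fun_def)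
      then show False using eps_diff_nonzero[OF n_pos assms] by simp
    qed
  qed
  then show ?thesis unfolding affine_nplus_def by (intro order_trans[OF _ span_superset]) blast
qed

lemma pos_root_space_nplus:
  assumes "\<alpha> \<in> pos_roots"
  shows "root_space (wt n 1 \<alpha> (real k)) \<subseteq> affine_nplus"
    "1 \<le> k \<Longrightarrow> root_space (wt n (- 1) \<alpha> (real k)) \<subseteq> affine_nplus"
    "\<alpha> \<in> long_roots \<Longrightarrow> root_space (wt n (1 / 2) \<alpha> (real k + 1 / 2)) \<subseteq> affine_nplus"
    "\<alpha> \<in> long_roots \<Longrightarrow> root_space (wt n (- 1 / 2) \<alpha> (real k + 1 / 2)) \<subseteq> affine_nplus"
proof -
  obtain a b where ab: "1 \<le> a" "a < b" "b \<le> 2 * n" "\<alpha> = eps n (int a) - eps n (int b)"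
    using pos_roots_eps[OF assms] by blast
  have per: "0 < per n" "int b < per n" using ab by auto
  have mono: "per n \<le> per n * int k" if "1 \<le> k" using that per(1) by (simp add: mult_le_cancel_left1)
  have nn: "0 \<le> per n * int k" using per(1) by simp
  have k: "real k = of_int (int k)" by simp
  show "root_space (wt n 1 \<alpha> (real k)) \<subseteq> affine_nplus"
    unfolding k wt_eps_diff(1)[OF ab(4)] using ab(2) nn by (intro eps_root_space_nplus) linarith
  show "root_space (wt n (- 1) \<alpha> (real k)) \<subseteq> affine_nplus" if "1 \<le> k"
    unfolding k wt_eps_diff(2)[OF ab(4)] using ab(1) per(2) mono[OF that]
    by (intro eps_root_space_nplus) linarith
  assume "\<alpha> \<in> long_roots"
  then have "a + b = 2 * n + 1"
    using long_root_iff[of \<alpha> a b] assms ab unfolding pos_roots_def by auto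
  then have "int b = per n - int a" by linarith
  then have \<alpha>: "\<alpha> = eps n (int a) - eps n (per n - int a)" using ab(4) by simp
  have "int a < per n * (int k + 1)" using ab(2) per(2) nn unfolding distrib_left mult_1_right by linarith
  then show "root_space (wt n (1 / 2) \<alpha> (real k + 1 / 2)) \<subseteq> affine_nplus"
    unfolding k wt_eps_half(1)[OF \<alpha>] by (rule eps_root_space_nplus)
  show "root_space (wt n (- 1 / 2) \<alpha> (real k + 1 / 2)) \<subseteq> affine_nplus"
    unfolding k wt_eps_half(2)[OF \<alpha>] using ab(1) nn by (intro eps_root_space_nplus) linarith
qed

lemma wt_real_0: "wt n 1 \<alpha> 0 = \<alpha>"
  by (simp add: wt_def)

lemma Cnplus_nplus: "Cnplus \<subseteq> affine_nplus"
  unfolding Cnplus_def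
proof (rule span_minimal)
  show "subspace affine_nplus" by (simp add: affine_nplus_def)
  have "root_space \<gamma> \<subseteq> affine_nplus" if \<gamma>: "\<gamma> \<in> Cnplus_roots" for \<gamma>
  proof -
    consider "\<gamma> \<in> pos_roots" | \<alpha> k where "\<alpha> \<in> pos_roots" "\<gamma> = wt n 1 \<alpha> (real k)"
      | \<alpha> k where "\<alpha> \<in> pos_roots" "\<gamma> = wt n 1 \<alpha> (2 * real k)"
      | \<alpha> k where "\<alpha> \<in> pos_roots" "\<alpha> \<in> long_roots" "\<gamma> = wt n (1 / 2) \<alpha> ((2 * real k + 1) / 2)"
      using \<gamma> unfolding Cnplus_roots_def by blast
    then show ?thesis
    proof cases
      case 1
      then show ?thesis using pos_root_space_nplus(1)[of \<gamma> 0] by (simp add: wt_real_0)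
    next
      case 2
      then show ?thesis using pos_root_space_nplus(1) by simp
    next
      case (3 \<alpha> k)
      then show ?thesis using pos_root_space_nplus(1)[of \<alpha> "2 * k"] by simp
    next
      case (4 \<alpha> k)
      then show ?thesis using pos_root_space_nplus(3)[of \<alpha> k] by (simp add: add_divide_distrib)
    qed
  qed
  then show "(\<Union>\<gamma>\<in>Cnplus_roots. root_space \<gamma>) \<subseteq> affine_nplus" by blast
qed

lemma Chplus_nplus: "Chplus \<subseteq> affine_nplus"
  unfolding Chplus_def
proof (rule span_minimal)
  show "subspace affine_nplus" by (simp add: affine_nplus_def)
  have "root_space (wt n 0 (\<lambda>_. 0) (real k)) \<subseteq> affine_nplus" if "1 \<le> k" for k
    using eps_root_space_nplus[of 0 "per n * int k"] wt_eps_imaginary[of n "\<lambda>_. 0" "int k"] that by simp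
  then show "(\<Union>k\<in>{1::nat..}. root_space (wt n 0 (\<lambda>_. 0) (real k))) \<subseteq> affine_nplus" by auto
qed

lemma imaginary_Chplus: "1 \<le> k \<Longrightarrow> h \<in> root_space (wt n 0 \<alpha> (real k)) \<Longrightarrow> h \<in> Chplus"
proof -
  assume k: "1 \<le> k" "h \<in> root_space (wt n 0 \<alpha> (real k))"
  have "wt n 0 \<alpha> (real k) = wt n 0 (\<lambda>_. 0) (real k)" by (simp add: wt_def)
  then show ?thesis unfolding Chplus_def using k by (intro span_base) auto
qed

lemma Cnplus_memI: "\<gamma> \<in> Cnplus_roots \<Longrightarrow> f \<in> root_space \<gamma> \<Longrightarrow> f \<in> Cnplus"
  unfolding Cnplus_def by (intro span_base) auto

text \<open>Replaces the given root vectors by those of the explicit families; nonzero factors do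
  not change whether a relator lies in a submodule.\<close>

lemma root_vector_multiple:
  assumes x: "root_vectors x" and \<gamma>: "\<gamma> \<in> real_roots" and f: "f \<in> root_space \<gamma>" "f \<noteq> 0"
  obtains c where "c \<noteq> 0" "x \<gamma> = scl G c f"
proof -
  have "f \<in> span {x \<gamma>}" using x \<gamma> f unfolding root_vectors_def by auto
  then obtain k where k: "f = scl G k (x \<gamma>)" unfolding span_singleton by blast
  then have "k \<noteq> 0" using f(2) by auto
  then have "1 / k \<noteq> 0" "x \<gamma> = scl G (1 / k) f" using k by simp_all
  then show ?thesis using that by blast
qed

lemma pos_root_cases:
  assumes "\<alpha> \<in> pos_roots"
  obtains F Y where "sl2_root_family \<alpha> (real (dd \<alpha>)) F Y" "Y 0 \<in> fin_alg"
proof -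
  obtain a b where ab: "1 \<le> a" "a < b" "b \<le> 2 * n" "\<alpha> = eps n (int a) - eps n (int b)"
    using pos_roots_eps[OF assms] by blast
  have long: "\<alpha> \<in> long_roots \<longleftrightarrow> a + b = 2 * n + 1"
    using long_root_iff[of \<alpha> a b] assms ab unfolding pos_roots_def by auto
  show ?thesis
  proof (cases "a + b = 2 * n + 1")
    case True
    then show ?thesis using long_root_families(1)[OF ab(1,2) True ab(4)] long that by (auto simp: dd_def)
  next
    case False
    then show ?thesis using short_root_family[OF ab(1-3) False ab(4)] long that by (auto simp: dd_def)
  qed
qed

lemma long_root_twisted_family:
  assumes "\<alpha> \<in> pos_roots" "\<alpha> \<in> long_roots"
  obtains F Y X where "twisted_root_family \<alpha> F Y X"
proof -
  obtain a b where ab: "1 \<le> a" "a < b" "b \<le> 2 * n" "\<alpha> = eps n (int a) - eps n (int b)"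
    using pos_roots_eps[OF assms(1)] by blast
  have "a + b = 2 * n + 1"
    using long_root_iff[of \<alpha> a b] assms ab unfolding pos_roots_def by auto
  then show ?thesis using long_root_families(2)[OF ab(1,2) _ ab(4)] that by blast
qed

text \<open>\<open>Y 0\<close> of the family attached to \<alpha> is a nonzero vector of weight
  -\<alpha> in the finite-dimensional subalgebra.\<close>

lemma neg_pos_root:
  assumes \<alpha>: "\<alpha> \<in> pos_roots"
  shows "(\<lambda>i. - \<alpha> i) \<in> neg_roots" "\<alpha> \<in> long_roots \<Longrightarrow> (\<lambda>i. - \<alpha> i) \<in> long_roots"
    "\<alpha> \<notin> long_roots \<Longrightarrow> (\<lambda>i. - \<alpha> i) \<in> short_roots"
proof -
  obtain F Y where Y: "sl2_root_family \<alpha> (real (dd \<alpha>)) F Y" "Y 0 \<in> fin_alg"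
    using pos_root_cases[OF \<alpha>] .
  have w: "wt n (- 1) \<alpha> 0 = (\<lambda>i. - \<alpha> i)" by (simp add: wt_def)
  have Y0: "Y 0 \<in> root_space (\<lambda>i. - \<alpha> i)" "Y 0 \<noteq> 0"
    using Y(1) unfolding sl2_root_family_def by (auto simp flip: w dest: spec[of _ 0])
  have "Y 0 \<in> fin_root_space (\<lambda>i. - \<alpha> i)"
    using Y0(1) Y(2) fin_cartan_cartan unfolding fin_root_space_def root_space_def by blast
  then have "fin_root_space (\<lambda>i. - \<alpha> i) \<noteq> {0}" using Y0(2) by blast
  moreover have "(\<lambda>i. - \<alpha> i) \<noteq> (\<lambda>_. 0)" "\<And>i. - \<alpha> i \<in> \<int>" "\<And>i. i \<notin> {1..n} \<Longrightarrow> - \<alpha> i = 0"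
    using \<alpha> by (auto simp: pos_roots_def roots_def fun_eq_iff)
  ultimately have r: "(\<lambda>i. - \<alpha> i) \<in> roots" unfolding roots_def by blast
  then show "(\<lambda>i. - \<alpha> i) \<in> neg_roots" using \<alpha> by (simp add: neg_roots_def pos_roots_def)
  have f: "form n (\<lambda>i. - \<alpha> i) (\<lambda>i. - \<alpha> i) = form n \<alpha> \<alpha>" by (simp add: form_def)
  have "\<alpha> \<in> roots" using \<alpha> by (simp add: pos_roots_def)
  then have "(\<lambda>i. - \<alpha> i) \<in> long_roots \<longleftrightarrow> \<alpha> \<in> long_roots" using r f unfolding long_roots_def by simp
  then show "\<alpha> \<in> long_roots \<Longrightarrow> (\<lambda>i. - \<alpha> i) \<in> long_roots"
    "\<alpha> \<notin> long_roots \<Longrightarrow> (\<lambda>i. - \<alpha> i) \<in> short_roots"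
    using r by (auto simp: short_roots_def)
qed

lemma real_root_mem:
  assumes \<alpha>: "\<alpha> \<in> pos_roots"
  shows "wt n 1 \<alpha> (real (dd \<alpha>)) \<in> real_roots" "wt n (- 1) \<alpha> (real k * real (dd \<alpha>)) \<in> real_roots"
    "\<alpha> \<in> long_roots \<Longrightarrow> wt n (1 / 2) \<alpha> (1 / 2) \<in> real_roots"
    "\<alpha> \<in> long_roots \<Longrightarrow> wt n (- 1 / 2) \<alpha> (real k + 1 / 2) \<in> real_roots"
    "wt n 1 \<alpha> (real (dd \<alpha>)) \<in> Cnplus_roots" "\<alpha> \<in> long_roots \<Longrightarrow> wt n (1 / 2) \<alpha> (1 / 2) \<in> Cnplus_roots"
proof -
  note neg = neg_pos_root[OF \<alpha>]
  have r: "\<alpha> \<in> roots" using \<alpha> by (simp add: pos_roots_def)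
  have 1: "\<exists>k. wt n 1 \<alpha> 2 = wt n 1 \<alpha> (2 * real k) \<and> 1 \<le> k" "\<exists>k. wt n 1 \<alpha> 1 = wt n 1 \<alpha> (real k) \<and> 1 \<le> k"
    "\<exists>k. wt n (1 / 2) \<alpha> (1 / 2) = wt n (1 / 2) \<alpha> ((2 * real k + 1) / 2)"
    by (rule exI[of _ 1], simp, rule exI[of _ 1], simp, rule exI[of _ 0], simp)
  show C: "wt n 1 \<alpha> (real (dd \<alpha>)) \<in> Cnplus_roots"
    using 1 r \<alpha> unfolding Cnplus_roots_def dd_def short_roots_def
    by (cases "\<alpha> \<in> long_roots") (simp_all, blast+)
  show C2: "\<alpha> \<in> long_roots \<Longrightarrow> wt n (1 / 2) \<alpha> (1 / 2) \<in> Cnplus_roots"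
    using 1 \<alpha> unfolding Cnplus_roots_def by blast
  have "Cnplus_roots \<subseteq> real_roots" unfolding Cnplus_roots_def real_roots_def pos_real_roots_def by blast
  then show "wt n 1 \<alpha> (real (dd \<alpha>)) \<in> real_roots" "\<alpha> \<in> long_roots \<Longrightarrow> wt n (1 / 2) \<alpha> (1 / 2) \<in> real_roots"
    using C C2 by auto
  show "wt n (- 1) \<alpha> (real k * real (dd \<alpha>)) \<in> real_roots"
  proof (cases "k = 0")
    case True
    then have "wt n (- 1) \<alpha> (real k * real (dd \<alpha>)) = (\<lambda>i. - \<alpha> i)" by (simp add: wt_def)
    then show ?thesis using \<alpha> unfolding real_roots_def pos_real_roots_def by blast
  next
    case False
    have e: "wt n (- 1) \<alpha> (real k * real (dd \<alpha>)) = wt n 1 (\<lambda>i. - \<alpha> i) (real (dd \<alpha>) * real k)"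
      by (simp add: wt_def mult.commute)
    show ?thesis
    proof (cases "\<alpha> \<in> long_roots")
      case True
      then have "\<exists>\<beta> l. wt n 1 (\<lambda>i. - \<alpha> i) (real (dd \<alpha>) * real k) = wt n 1 \<beta> (2 * real l) \<and> \<beta> \<in> long_roots \<and> 1 \<le> l"
        using neg(2) False by (intro exI[of _ "\<lambda>i. - \<alpha> i"] exI[of _ k]) (simp add: dd_def)
      then show ?thesis unfolding e real_roots_def pos_real_roots_def by blast
    next
      case sh: False
      then have "\<exists>\<beta> l. wt n 1 (\<lambda>i. - \<alpha> i) (real (dd \<alpha>) * real k) = wt n 1 \<beta> (real l) \<and> \<beta> \<in> short_roots \<and> 1 \<le> l"
        using neg(3) False by (intro exI[of _ "\<lambda>i. - \<alpha> i"] exI[of _ k]) (simp add: dd_def)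
      then show ?thesis unfolding e real_roots_def pos_real_roots_def by blast
    qed
  qed
  assume "\<alpha> \<in> long_roots"
  then have "\<exists>\<beta> l. wt n (- 1 / 2) \<alpha> (real k + 1 / 2) = wt n (1 / 2) \<beta> ((2 * real l + 1) / 2) \<and> \<beta> \<in> long_roots"
    using neg(2) by (intro exI[of _ "\<lambda>i. - \<alpha> i"] exI[of _ k]) (simp add: wt_def add_divide_distrib)
  then show "wt n (- 1 / 2) \<alpha> (real k + 1 / 2) \<in> real_roots"
    unfolding real_roots_def pos_real_roots_def by blast
qed

text \<open>\<open>fin_nminus\<close> is built from root spaces inside \<open>fin_alg\<close>. Since
  the affine root space is spanned by one vector, it is enough that \<open>Y 0\<close> lies in
  \<open>fin_alg\<close>.\<close>

lemma neg_root_space_Cg: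
  assumes x: "root_vectors x" and \<alpha>: "\<alpha> \<in> pos_roots"
  shows "root_space (wt n (- 1) \<alpha> 0) \<subseteq> Cg"
proof -
  obtain F Y where Y: "sl2_root_family \<alpha> (real (dd \<alpha>)) F Y" "Y 0 \<in> fin_alg"
    using pos_root_cases[OF \<alpha>] .
  have w: "wt n (- 1) \<alpha> 0 = (\<lambda>i. - \<alpha> i)" by (simp add: wt_def)
  have Y0: "Y 0 \<in> root_space (wt n (- 1) \<alpha> 0)" "Y 0 \<noteq> 0"
    using Y(1) unfolding sl2_root_family_def by (auto dest: spec[of _ 0])
  have "Y 0 \<in> fin_root_space (\<lambda>i. - \<alpha> i)"
    using Y0(1) Y(2) fin_cartan_cartan unfolding w fin_root_space_def root_space_def by blast
  then have Y0C: "Y 0 \<in> Cg"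
    using neg_pos_root(1)[OF \<alpha>] nminus_Cg unfolding fin_nminus_def by (blast intro: span_base)
  have r: "wt n (- 1) \<alpha> 0 \<in> real_roots" using real_root_mem(2)[OF \<alpha>, of 0] by simp
  obtain c where "c \<noteq> 0" "x (wt n (- 1) \<alpha> 0) = scl G c (Y 0)"
    using root_vector_multiple[OF x r Y0] .
  then have "x (wt n (- 1) \<alpha> 0) \<in> Cg" using Y0C Cg_subspace by (simp add: subspace_scale)
  then have "span {x (wt n (- 1) \<alpha> 0)} \<subseteq> Cg" using Cg_subspace by (intro span_minimal) auto
  then show ?thesis using x r unfolding root_vectors_def by auto
qed

end

section \<open>Submodules of the local Weyl module\<close>

lemma submodule_has_zero:
  assumes M: "presents L M pr J" and N: "submodule L M N"
  shows "pr 0 \<in> N"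
  using presentsD(2)[OF presents_quot[OF M N]] by (auto dest: pscale.subspace_0)

lemma submodule_gen_submodule:
  assumes M: "presents L M pr J" and S: "S \<subseteq> mcar M"
  shows "submodule L M (submodule_gen L M S)"
proof -
  note D = presentsD[OF M]
  let ?K = "submodule_gen L M S"
  have M0: "submodule L M (mcar M)" unfolding submodule_def D(4)
    using free_alg_on_zero[of L]
    by (auto simp: D(6-8) free_alg_on_add free_alg_on_scale free_alg_on_mult free_alg_on_gen)
  have I: "v \<in> ?K" if "\<And>N. submodule L M N \<Longrightarrow> S \<subseteq> N \<Longrightarrow> v \<in> N" for v
    using that by (auto simp: submodule_gen_def)
  have E: "v \<in> N" if "v \<in> ?K" "submodule L M N" "S \<subseteq> N" for v N
    using that by (auto simp: submodule_gen_def)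
  show ?thesis unfolding submodule_def
  proof (intro conjI ballI allI)
    show "?K \<subseteq> mcar M" using E[OF _ M0 S] by blast
    show "?K \<noteq> {}" using I[of "pr 0"] submodule_has_zero[OF M] by blast
    show "madd M u v \<in> ?K" if uv: "u \<in> ?K" "v \<in> ?K" for u v
    proof (rule I)
      fix N assume N: "submodule L M N" "S \<subseteq> N"
      then show "madd M u v \<in> N" using E[OF uv(1) N] E[OF uv(2) N] by (simp add: submodule_def)
    qed
    show "mscl M c v \<in> ?K" if v: "v \<in> ?K" for c v
    proof (rule I)
      fix N assume N: "submodule L M N" "S \<subseteq> N"
      then show "mscl M c v \<in> N" using E[OF v N] by (simp add: submodule_def)
    qed
    show "mact M z v \<in> ?K" if z: "z \<in> L" and v: "v \<in> ?K" for z v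
    proof (rule I)
      fix N assume N: "submodule L M N" "S \<subseteq> N"
      then show "mact M z v \<in> N" using E[OF v N] z by (simp add: submodule_def)
    qed
  qed
qed

lemma submodule_gen_base: "v \<in> S \<Longrightarrow> v \<in> submodule_gen L M S"
  by (auto simp: submodule_gen_def)

lemma presents_relation:
  assumes M: "presents L M pr J" and S: "S \<subseteq> mcar M"
    and N: "submodule L (quot_mod M (submodule_gen L M S)) N"
    and p: "p \<in> free_alg_on L" "pr p \<in> submodule_gen L M S"
  shows "coset M (submodule_gen L M S) (pr p) \<in> N"
proof -
  let ?K = "submodule_gen L M S"
  have Q: "presents L (quot_mod M ?K) (\<lambda>p. coset M ?K (pr p)) {p \<in> free_alg_on L. pr p \<in> ?K}"
    by (rule presents_quot[OF M submodule_gen_submodule[OF M S]])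
  have "coset M ?K (pr p) = coset M ?K (pr 0)"
    using presentsD(5)[OF Q p(1) free_alg_on_zero] p by simp
  then show ?thesis using submodule_has_zero[OF Q N] by simp
qed

text \<open>A submodule \<open>N\<close> of the local Weyl module is encoded by operators representing the action on the
  quotient by \<open>N\<close>; \<open>T v u\<close> says that \<open>u\<close> represents the image of \<open>v\<close>.\<close>

locale operator_model = affine_A2n2 n G for n :: nat and G :: "'g::ab_group_add km_data" +
  fixes x :: "weight \<Rightarrow> 'g" and lam :: "'g \<Rightarrow> complex" and N :: "'g free_alg set set set"
    and R :: "'g \<Rightarrow> 'g word lop" and w0 :: "'g free_alg" and T :: "'g free_alg set set \<Rightarrow> 'g free_alg \<Rightarrow> bool"
  assumes T_w: "T (wloc x lam) w0"
    and T_N: "T v u \<Longrightarrow> v \<in> N \<longleftrightarrow> u = 0"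
    and T_act: "T v u \<Longrightarrow> z \<in> Cg \<Longrightarrow> T (mact (Wloc x lam) z v) (app (R z) u)"
    and T_scl: "T v u \<Longrightarrow> T (mscl (Wloc x lam) c v) (pscale c u)"
    and R_scl: "y \<in> Cg \<Longrightarrow> R (scl G c y) = lscale c (R y)"
    and R_brk: "y \<in> Cg \<Longrightarrow> z \<in> Cg \<Longrightarrow> brk G y z \<in> Cg \<Longrightarrow> R (brk G y z) = comm (R y) (R z)"
    and R_pos: "y \<in> Cnplus \<union> Chplus \<Longrightarrow> app (R y) w0 = 0"
    and R_dom: "\<alpha> \<in> pos_roots \<Longrightarrow> of_nat k = lam (coroot \<alpha>) \<Longrightarrow>
      (app (R (x (wt n (- 1) \<alpha> 0))) ^^ Suc k) w0 = 0"
    and x: "root_vectors x"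

context affine_A2n2
begin

text \<open>The quotient by N is again a quotient of the free algebra, by the left ideal of all p
  whose image lies in N, and \<open>operator_representation\<close> applies to that ideal.\<close>

lemma Wloc_operator_model:
  assumes x: "root_vectors x" and N: "submodule Cg (Wloc x lam) N"
  shows "\<exists>R w0 T. operator_model n G x lam N R w0 T"
proof -
  let ?A = "free_alg_on Cg" and ?U = "uea Cg" and ?K = "Wloc_ker x lam" and ?W = "Wloc x lam"
  define prU where "prU = coset (free_alg_mod Cg) (uea_ideal Cg)"
  have U: "presents Cg ?U prU (uea_ideal Cg \<inter> ?A)" unfolding prU_def by (rule presents_uea)
  note DU = presentsD[OF U]
  have one: "uea_one Cg = prU 1" by (simp add: uea_one_def prU_def)
  have CC: "Cnplus \<union> Chplus \<subseteq> Cg" using Cnplus_nplus Chplus_nplus nplus_Cg by blast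
  then have CCs: "span (Cnplus \<union> Chplus) \<subseteq> Cg" by (intro span_minimal Cg_subspace)
  have xneg: "x (wt n (- 1) \<alpha> 0) \<in> Cg" if "\<alpha> \<in> pos_roots" for \<alpha>
  proof -
    have "wt n (- 1) \<alpha> 0 \<in> real_roots" using real_root_mem(2)[OF that, of 0] by simp
    then have "span {x (wt n (- 1) \<alpha> 0)} \<subseteq> Cg"
      using neg_root_space_Cg[OF x that] x unfolding root_vectors_def by blast
    then show ?thesis using span_base[of "x (wt n (- 1) \<alpha> 0)" "{x (wt n (- 1) \<alpha> 0)}"] by blast
  qed
  have g1: "gen z * 1 \<in> ?A" if "z \<in> Cg" for z using free_alg_on_gen[OF that] by simp
  have actU: "mact ?U z (prU 1) = prU (gen z * 1)" if "z \<in> Cg" for z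
    by (rule DU(8)[OF that free_alg_on_one])
  have powU: "act_pow ?U z k (prU 1) = prU (gen z ^ k * 1)" "gen z ^ k * 1 \<in> ?A" if "z \<in> Cg" for z k
    using presents_act_pow[OF U that free_alg_on_one] by blast+
  have S: "Wloc_relators x lam \<subseteq> mcar ?U"
  proof -
    have 1: "mact ?U y (prU 1) \<in> mcar ?U" if "y \<in> span (Cnplus \<union> Chplus)" for y
      unfolding DU(4) actU[OF subsetD[OF CCs that]] by (rule imageI[OF g1[OF subsetD[OF CCs that]]])
    have 2: "madd ?U (mact ?U h (prU 1)) (mscl ?U (- lam h) (prU 1)) \<in> mcar ?U" if "h \<in> fin_cartan" for h
    proof -
      have h: "h \<in> Cg" using that fin_cartan_Cg by blast
      have s: "pscale (- lam h) 1 \<in> ?A" by (rule free_alg_on_scale[OF free_alg_on_one])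
      show ?thesis unfolding actU[OF h] DU(7)[OF free_alg_on_one] DU(6)[OF g1[OF h] s] DU(4)
        by (rule imageI[OF free_alg_on_add[OF g1[OF h] s]])
    qed
    have 3: "act_pow ?U (x (wt n (- 1) \<alpha> 0)) (k + 1) (prU 1) \<in> mcar ?U" if "\<alpha> \<in> pos_roots" for \<alpha> k
      unfolding powU(1)[OF xneg[OF that]] DU(4) by (rule imageI[OF powU(2)[OF xneg[OF that]]])
    show ?thesis unfolding Wloc_relators_def Let_def one using 1 2 3 by blast
  qed
  define pr where "pr p = coset ?U ?K (prU p)" for p
  have W: "presents Cg ?W pr {p \<in> ?A. prU p \<in> ?K}"
    unfolding pr_def Wloc_def Wloc_ker_def by (rule presents_quot[OF U submodule_gen_submodule[OF U S]])
  note DW = presentsD[OF W]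
  \<comment> \<open>The relators are 0 in the local Weyl module and so lie in every
    submodule.\<close>
  have rel: "pr p \<in> N" if "p \<in> ?A" "prU p \<in> Wloc_relators x lam" for p
    using presents_relation[OF U S N[unfolded Wloc_def Wloc_ker_def] that(1) submodule_gen_base[OF that(2)]]
    unfolding pr_def Wloc_ker_def .
  define I where "I = {p \<in> ?A. pr p \<in> N}"
  have Q: "presents Cg (quot_mod ?W N) (\<lambda>p. coset ?W N (pr p)) I"
    unfolding I_def by (rule presents_quot[OF W N])
  have UI: "j \<in> I" if "j \<in> uea_ideal Cg" "j \<in> ?A" for j
  proof -
    have "prU j = prU 0" using DU(5)[OF that(2) free_alg_on_zero] that by simp
    then have "pr j = pr 0" by (simp add: pr_def)
    then show ?thesis using that(2) submodule_has_zero[OF W N] by (simp add: I_def)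
  qed
  obtain R q where rep: "represents Cg I R q" using operator_representation[OF Q UI] by blast
  have q: "\<And>p. p \<in> ?A \<Longrightarrow> q p = 0 \<longleftrightarrow> p \<in> I" "\<And>c p. q (pscale c p) = pscale c (q p)"
    and Rq: "\<And>z p. z \<in> Cg \<Longrightarrow> p \<in> ?A \<Longrightarrow> app (R z) (q p) = q (gen z * p)"
    and R: "\<And>c y. y \<in> Cg \<Longrightarrow> scl G c y \<in> Cg \<Longrightarrow> R (scl G c y) = lscale c (R y)"
    "\<And>y z. y \<in> Cg \<Longrightarrow> z \<in> Cg \<Longrightarrow> brk G y z \<in> Cg \<Longrightarrow> R (brk G y z) = comm (R y) (R z)"
    using rep unfolding represents_def by blast+
  \<comment> \<open>A relation rather than a function, which avoids a choice of
    representatives.\<close>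
  define T where "T v u \<longleftrightarrow> (\<exists>p\<in>?A. v = pr p \<and> u = q p)" for v u
  have Rpow: "(app (R z) ^^ k) (q 1) = q (gen z ^ k * 1)" if "z \<in> Cg" for z k
  proof (induction k)
    case (Suc k)
    then show ?case using Rq[OF that powU(2)[OF that], of k] by (simp add: mult.assoc)
  qed simp
  have "operator_model n G x lam N R (q 1) T"
  proof (intro operator_model.intro operator_model_axioms.intro affine_A2n2_axioms x)
    show "T (wloc x lam) (q 1)" unfolding T_def wloc_def one pr_def
      by (intro bexI[OF _ free_alg_on_one] conjI refl)
    show "v \<in> N \<longleftrightarrow> u = 0" if Tvu: "T v u" for v u
    proof -
      obtain p where p: "p \<in> ?A" "v = pr p" "u = q p" using Tvu unfolding T_def by blast
      then show ?thesis using q(1)[OF p(1)] by (simp add: I_def)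
    qed
    show "T (mact ?W z v) (app (R z) u)" if Tvu: "T v u" and z: "z \<in> Cg" for v u z
    proof -
      obtain p where p: "p \<in> ?A" "v = pr p" "u = q p" using Tvu unfolding T_def by blast
      show ?thesis unfolding T_def p(2,3) DW(8)[OF z p(1)] Rq[OF z p(1)]
        by (intro bexI[OF _ free_alg_on_mult[OF free_alg_on_gen[OF z] p(1)]] conjI refl)
    qed
    show "T (mscl ?W c v) (pscale c u)" if Tvu: "T v u" for v u c
    proof -
      obtain p where p: "p \<in> ?A" "v = pr p" "u = q p" using Tvu unfolding T_def by blast
      show ?thesis unfolding T_def p(2,3) DW(7)[OF p(1)] q(2)[symmetric]
        by (intro bexI[OF _ free_alg_on_scale[OF p(1), of c]] conjI refl)
    qed
    show "R (scl G c y) = lscale c (R y)" if "y \<in> Cg" for c y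
      by (rule R(1)[OF that subspace_scale[OF Cg_subspace that]])
    show "R (brk G y z) = comm (R y) (R z)" if "y \<in> Cg" "z \<in> Cg" "brk G y z \<in> Cg" for y z
      by (rule R(2)[OF that])
    show "app (R y) (q 1) = 0" if y: "y \<in> Cnplus \<union> Chplus" for y
    proof -
      have yC: "y \<in> Cg" using y CC by blast
      have "mact ?U y (uea_one Cg) \<in> Wloc_relators x lam"
        unfolding Wloc_relators_def Let_def using span_base[OF y] by blast
      then have "pr (gen y * 1) \<in> N" unfolding one actU[OF yC] by (rule rel[OF g1[OF yC]])
      then show ?thesis unfolding Rq[OF yC free_alg_on_one] q(1)[OF g1[OF yC]] I_def using g1[OF yC] by blast
    qed
    show "(app (R (x (wt n (- 1) \<alpha> 0))) ^^ Suc k) (q 1) = 0"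
      if \<alpha>: "\<alpha> \<in> pos_roots" and k: "of_nat k = lam (coroot \<alpha>)" for \<alpha> k
    proof -
      note z = xneg[OF \<alpha>]
      have "act_pow ?U (x (wt n (- 1) \<alpha> 0)) (Suc k) (uea_one Cg) \<in> Wloc_relators x lam"
        unfolding Wloc_relators_def Let_def Suc_eq_plus1 using \<alpha> k by blast
      then have "pr (gen (x (wt n (- 1) \<alpha> 0)) ^ Suc k * 1) \<in> N"
        unfolding one powU(1)[OF z] by (rule rel[OF powU(2)[OF z]])
      then show ?thesis unfolding Rpow[OF z] q(1)[OF powU(2)[OF z]] I_def using powU(2)[OF z] by blast
    qed
  qed
  then show ?thesis by blast
qed

end

section \<open>Relators as equations between operators\<close>

context operator_model
begin

abbreviation "W \<equiv> Wloc x lam"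
abbreviation "w \<equiv> wloc x lam"

lemma lscale_pow: "(app (lscale c S) ^^ s) v = pscale (c ^ s) ((app S ^^ s) v)"
  by (induction s) (simp_all add: pow_scale mult.commute)

lemma T_pow:
  assumes "T v u" "f \<in> Cg"
  shows "T (act_pow W (scl G c f) s v) (pscale (c ^ s) ((app (R f) ^^ s) u))"
proof -
  have z: "scl G c f \<in> Cg" by (rule subspace_scale[OF Cg_subspace assms(2)])
  have "T (act_pow W (scl G c f) s v) ((app (R (scl G c f)) ^^ s) u)"
    by (induction s) (simp_all add: act_pow_def assms(1) T_act z)
  then show ?thesis unfolding R_scl[OF assms(2)] lscale_pow .
qed

lemma pow_mem_N:
  assumes "f \<in> Cg" "c \<noteq> 0"
  shows "act_pow W (scl G c f) s w \<in> N \<longleftrightarrow> (app (R f) ^^ s) w0 = 0"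
  using T_N[OF T_pow[OF T_w assms(1), of c s]] assms(2) by simp

lemma act_mem_N:
  assumes "f \<in> Cg" "c \<noteq> 0"
  shows "mact W (scl G c f) w \<in> N \<longleftrightarrow> app (R f) w0 = 0"
  using pow_mem_N[OF assms, of 1] by (simp add: act_pow_def)

lemma T_dpow:
  assumes "T v u" "f \<in> Cg"
  shows "T (act_dpow W (scl G c f) s v) (pscale (1 / fact s) (pscale (c ^ s) ((app (R f) ^^ s) u)))"
  unfolding act_dpow_def by (rule T_scl[OF T_pow[OF assms]])

lemma dpow_mem_N:
  assumes "f \<in> Cg" "c \<noteq> 0" "f' \<in> Cg" "c' \<noteq> 0"
  shows "act_dpow W (scl G c f) s (act_dpow W (scl G c' f') b w) \<in> N \<longleftrightarrow>
    (app (R f) ^^ s) ((app (R f') ^^ b) w0) = 0"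
  using T_N[OF T_dpow[OF T_dpow[OF T_w assms(3), of c' b] assms(1), of c s]] assms(2,4)
  by (simp add: pow_scale)

lemma R_zero: "R 0 = 0"
  using R_scl[of 0 0] subspace_0[OF Cg_subspace] by simp

lemma R_family:
  assumes "family (scl G) (brk G) F Y X H \<eta> \<mu> \<nu> \<tau>"
    and "F \<in> Cg" "\<And>i. Y i \<in> Cg" "\<And>i. X i \<in> Cg" "\<And>i. H i \<in> Cg"
  shows "family lscale comm (R F) (\<lambda>i. R (Y i)) (\<lambda>i. R (X i)) (\<lambda>i. R (H i)) \<eta> \<mu> \<nu> \<tau>"
  by (rule family_image[OF assms(1) Cg_subspace assms(2-5)]) (auto intro: R_scl R_brk)

lemma special_nparts: "special \<xi> \<Longrightarrow> 1 \<le> nparts \<xi>"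
  using rectangular_or_special_cases[of \<xi>] special_zero nparts_hook special_hook by fastforce

lemma sl2_family_facts:
  assumes \<alpha>: "\<alpha> \<in> pos_roots" and fam: "sl2_root_family \<alpha> (real (dd \<alpha>)) F Y"
  shows "F \<in> Cnplus" "F \<in> Cg" "Y i \<in> Cg" "brk G F (Y i) \<in> Chplus" "brk G F (Y i) \<in> Cg"
    "F \<in> root_space (wt n 1 \<alpha> (real (dd \<alpha>)))" "F \<noteq> 0"
    "Y i \<in> root_space (wt n (- 1) \<alpha> (real i * real (dd \<alpha>)))" "Y i \<noteq> 0"
proof -
  show f: "F \<in> root_space (wt n 1 \<alpha> (real (dd \<alpha>)))" "F \<noteq> 0"
    "Y i \<in> root_space (wt n (- 1) \<alpha> (real i * real (dd \<alpha>)))" "Y i \<noteq> 0"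
    using fam unfolding sl2_root_family_def by blast+
  have d: "1 \<le> dd \<alpha>" by (simp add: dd_def)
  show F: "F \<in> Cnplus" by (rule Cnplus_memI[OF real_root_mem(5)[OF \<alpha>] f(1)])
  then show "F \<in> Cg" using Cnplus_nplus nplus_Cg by blast
  show "Y i \<in> Cg"
  proof (cases "i = 0")
    case True
    then show ?thesis using f(3) neg_root_space_Cg[OF x \<alpha>] by auto
  next
    case False
    then have "1 \<le> i * dd \<alpha>" using d by simp
    then have "root_space (wt n (- 1) \<alpha> (real (i * dd \<alpha>))) \<subseteq> affine_nplus"
      by (rule pos_root_space_nplus(2)[OF \<alpha>])
    then show ?thesis using f(3) nplus_Cg by auto
  qed
  have "brk G F (Y i) \<in> root_space (wt n 1 \<alpha> (real (dd \<alpha>)) + wt n (- 1) \<alpha> (real i * real (dd \<alpha>)))"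
    by (rule bracket_root_space[OF f(1,3)])
  also have "wt n 1 \<alpha> (real (dd \<alpha>)) + wt n (- 1) \<alpha> (real i * real (dd \<alpha>)) = wt n 0 \<alpha> (real (Suc i * dd \<alpha>))"
    unfolding wt_add by (simp add: algebra_simps)
  finally show H: "brk G F (Y i) \<in> Chplus" using d by (intro imaginary_Chplus[of "Suc i * dd \<alpha>"]) auto
  then show "brk G F (Y i) \<in> Cg" using Chplus_nplus nplus_Cg by blast
qed

lemma sl2_root_vectors:
  assumes \<alpha>: "\<alpha> \<in> pos_roots" and fam: "sl2_root_family \<alpha> (real (dd \<alpha>)) F Y"
  shows "\<exists>c. c \<noteq> 0 \<and> x (wt n 1 \<alpha> (real (dd \<alpha>))) = scl G c F"
    "\<exists>c. c \<noteq> 0 \<and> x (wt n (- 1) \<alpha> (real i * real (dd \<alpha>))) = scl G c (Y i)"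
  by (rule root_vector_multiple[OF x real_root_mem(1)[OF \<alpha>] sl2_family_facts(6,7)[OF assms]], blast)
     (rule root_vector_multiple[OF x real_root_mem(2)[OF \<alpha>] sl2_family_facts(8,9)[OF assms]], blast)

theorem sl2_relators:
  assumes \<alpha>: "\<alpha> \<in> pos_roots" and wt: "of_nat (tail \<xi> 1) = lam (coroot \<alpha>)"
    and shape: "rectangular \<xi> \<or> special \<xi>"
  shows "(\<forall>s r. 1 \<le> s \<longrightarrow> 1 \<le> r \<longrightarrow> (\<exists>k. 1 + r * k + tail \<xi> (k + 1) \<le> s + r) \<longrightarrow>
      act_dpow W (x (wt n 1 \<alpha> (real (dd \<alpha>)))) s (act_dpow W (x (wt n (- 1) \<alpha> 0)) (s + r) w) \<in> N) \<longleftrightarrow>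
    mact W (x (wt n (- 1) \<alpha> (real (dd \<alpha>) * real (nparts \<xi>)))) w \<in> N \<and>
    (special \<xi> \<longrightarrow>
      act_pow W (x (wt n (- 1) \<alpha> (real (dd \<alpha>) * (real (nparts \<xi>) - 1)))) (\<xi> (nparts \<xi>) + 1) w \<in> N)"
proof -
  obtain F Y where fam: "sl2_root_family \<alpha> (real (dd \<alpha>)) F Y" using pos_root_cases[OF \<alpha>] .
  note f = sl2_family_facts[OF \<alpha> fam]
  obtain cF where cF: "cF \<noteq> 0" "x (wt n 1 \<alpha> (real (dd \<alpha>))) = scl G cF F"
    using sl2_root_vectors(1)[OF \<alpha> fam] by blast
  obtain c where c: "\<And>i. c i \<noteq> 0" "\<And>i. x (wt n (- 1) \<alpha> (real i * real (dd \<alpha>))) = scl G (c i) (Y i)"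
    using sl2_root_vectors(2)[OF \<alpha> fam] by metis
  have c0: "x (wt n (- 1) \<alpha> 0) = scl G (c 0) (Y 0)" using c(2)[of 0] by simp
  have cs: "x (wt n (- 1) \<alpha> (real (dd \<alpha>) * real i)) = scl G (c i) (Y i)" for i
    using c(2)[of i] by (simp add: mult.commute)
  have "family (scl G) (brk G) F Y (\<lambda>_. 0) (\<lambda>i. brk G F (Y i)) (\<lambda>_. 0) (\<lambda>_ _. 2) (\<lambda>_ _. 0) (\<lambda>_ _. 0)"
    using fam unfolding sl2_root_family_def sl2_family_def by blast
  from R_family[OF this f(2,3) subspace_0[OF Cg_subspace] f(5)]
  have "sl2_family lscale comm (R F) (\<lambda>i. R (Y i)) (\<lambda>i. R (brk G F (Y i)))"
    unfolding sl2_family_def R_zero .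
  then have rm: "root_module (R F) (\<lambda>i. R (Y i)) (\<lambda>_. 0) (\<lambda>i. R (brk G F (Y i))) (\<lambda>_. 0) (\<lambda>_ _. 2)
      (\<lambda>_ _. 0) (\<lambda>_ _. 0) w0"
    by (rule root_module_sl2) (use R_pos f in auto)
  have dom: "(app (R (Y 0)) ^^ Suc (tail \<xi> 1)) w0 = 0"
    using R_dom[OF \<alpha> wt] c(1)[of 0] unfolding c0 R_scl[OF f(3)] lscale_pow by simp
  have s: "real (nparts \<xi>) - 1 = real (nparts \<xi> - 1)" if "special \<xi>"
    using special_nparts[OF that] by (simp add: of_nat_diff)
  have "special \<xi> \<Longrightarrow>
      act_pow W (x (wt n (- 1) \<alpha> (real (dd \<alpha>) * (real (nparts \<xi>) - 1)))) (\<xi> (nparts \<xi>) + 1) w \<in> N \<longleftrightarrow>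
      (app (R (Y (nparts \<xi> - 1))) ^^ Suc (\<xi> (nparts \<xi>))) w0 = 0"
    unfolding s cs Suc_eq_plus1 by (rule pow_mem_N[OF f(3) c(1)])
  moreover have "mact W (x (wt n (- 1) \<alpha> (real (dd \<alpha>) * real (nparts \<xi>)))) w \<in> N \<longleftrightarrow>
      app (R (Y (nparts \<xi>))) w0 = 0"
    unfolding cs by (rule act_mem_N[OF f(3) c(1)])
  ultimately show ?thesis
    using root_module.sl2_relations_iff[OF rm _ _ dom shape]
    unfolding cF(2) c0 dpow_mem_N[OF f(2) cF(1) f(3) c(1)] by auto
qed

lemma twisted_family_facts:
  assumes \<alpha>: "\<alpha> \<in> pos_roots" "\<alpha> \<in> long_roots" and fam: "twisted_root_family \<alpha> F Y X"
  shows "F \<in> Cnplus" "F \<in> Cg" "Y i \<in> Cg" "X i \<in> Cg" "brk G F (Y i) \<in> Chplus" "brk G F (Y i) \<in> Cg"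
    "even i \<Longrightarrow> Y i = 0" "\<not> 4 dvd i \<Longrightarrow> X i = 0"
    "\<exists>c. c \<noteq> 0 \<and> x (wt n (1 / 2) \<alpha> (1 / 2)) = scl G c F"
    "\<exists>c. c \<noteq> 0 \<and> x (wt n (- 1 / 2) \<alpha> (real k + 1 / 2)) = scl G c (Y (2 * k + 1))"
    "\<exists>c. c \<noteq> 0 \<and> x (wt n (- 1) \<alpha> (real (dd \<alpha>) * real k)) = scl G c (X (4 * k))"
proof -
  have f: "F \<in> root_space (wt n (1 / 2) \<alpha> (1 / 2))" "F \<noteq> 0"
    "\<And>i. Y i \<in> root_space (wt n (- 1 / 2) \<alpha> (real i / 2))" "\<And>i. odd i \<Longrightarrow> Y i \<noteq> 0"
    "\<And>i. X i \<in> root_space (wt n (- 1) \<alpha> (real i / 2))" "\<And>i. 4 dvd i \<Longrightarrow> X i \<noteq> 0"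
    using fam unfolding twisted_root_family_def by blast+
  have z: "\<And>i. even i \<Longrightarrow> Y i = 0" "\<And>i. \<not> 4 dvd i \<Longrightarrow> X i = 0"
    using fam unfolding twisted_root_family_def twisted_family_def by blast+
  then show "even i \<Longrightarrow> Y i = 0" "\<not> 4 dvd i \<Longrightarrow> X i = 0" by blast+
  have d: "real (dd \<alpha>) = 2" using \<alpha>(2) by (simp add: dd_def)
  have Y: "Y (2 * k + 1) \<in> root_space (wt n (- 1 / 2) \<alpha> (real k + 1 / 2))" for k
  proof -
    have "real (2 * k + 1) / 2 = real k + 1 / 2" by (simp add: add_divide_distrib)
    then show ?thesis using f(3)[of "2 * k + 1"] by (simp only:)
  qed
  have X: "X (4 * k) \<in> root_space (wt n (- 1) \<alpha> (real k * real (dd \<alpha>)))" for k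
    using f(5)[of "4 * k"] d by (simp add: mult.commute)
  show F: "F \<in> Cnplus" by (rule Cnplus_memI[OF real_root_mem(6)[OF \<alpha>] f(1)])
  then show "F \<in> Cg" using Cnplus_nplus nplus_Cg by blast
  show "Y i \<in> Cg"
  proof (cases "even i")
    case True
    then show ?thesis using z(1) subspace_0[OF Cg_subspace] by simp
  next
    case False
    then obtain k where "i = 2 * k + 1" by (rule oddE)
    then show ?thesis using Y[of k] pos_root_space_nplus(4)[OF \<alpha>, of k] nplus_Cg by blast
  qed
  show "X i \<in> Cg"
  proof (cases "4 dvd i")
    case False
    then show ?thesis using z(2) subspace_0[OF Cg_subspace] by simp
  next
    case True
    then obtain k where k: "i = 4 * k" by (rule dvdE)
    show ?thesis
    proof (cases "k = 0")
      case True
      then show ?thesis using X[of 0] k neg_root_space_Cg[OF x \<alpha>(1)] by auto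
    next
      case False
      then have "root_space (wt n (- 1) \<alpha> (real (k * dd \<alpha>))) \<subseteq> affine_nplus"
        by (intro pos_root_space_nplus(2)[OF \<alpha>(1)]) (simp add: dd_def)
      then show ?thesis using X[of k] k nplus_Cg by auto
    qed
  qed
  show H: "brk G F (Y i) \<in> Chplus"
  proof (cases "even i")
    case True
    then show ?thesis using z(1) by (simp add: Chplus_def span_zero)
  next
    case False
    then obtain k where k: "i = 2 * k + 1" by (rule oddE)
    have "brk G F (Y i) \<in> root_space (wt n (1 / 2) \<alpha> (1 / 2) + wt n (- 1 / 2) \<alpha> (real k + 1 / 2))"
      unfolding k by (rule bracket_root_space[OF f(1) Y])
    also have "wt n (1 / 2) \<alpha> (1 / 2) + wt n (- 1 / 2) \<alpha> (real k + 1 / 2) = wt n 0 \<alpha> (real (Suc k))"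
      unfolding wt_add by simp
    finally show ?thesis by (intro imaginary_Chplus[of "Suc k"]) auto
  qed
  then show "brk G F (Y i) \<in> Cg" using Chplus_nplus nplus_Cg by blast
  show "\<exists>c. c \<noteq> 0 \<and> x (wt n (1 / 2) \<alpha> (1 / 2)) = scl G c F"
    by (rule root_vector_multiple[OF x real_root_mem(3)[OF \<alpha>] f(1,2)]) blast
  show "\<exists>c. c \<noteq> 0 \<and> x (wt n (- 1 / 2) \<alpha> (real k + 1 / 2)) = scl G c (Y (2 * k + 1))"
    by (rule root_vector_multiple[OF x real_root_mem(4)[OF \<alpha>] Y f(4)]) auto
  show "\<exists>c. c \<noteq> 0 \<and> x (wt n (- 1) \<alpha> (real (dd \<alpha>) * real k)) = scl G c (X (4 * k))"
    unfolding mult.commute[of "real (dd \<alpha>)"]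
    by (rule root_vector_multiple[OF x real_root_mem(2)[OF \<alpha>(1)] X f(6)]) auto
qed

text \<open>The assumptions \<open>S\<close> are the reduced relators for the integral multiples of
  \<alpha>; they are turned into the hypotheses on X of
  \<open>twisted_relations_iff\<close>.\<close>

theorem twisted_relators:
  assumes \<alpha>: "\<alpha> \<in> pos_roots" "\<alpha> \<in> long_roots" and wt: "of_nat (tail \<xi> 1) = lam (coroot \<alpha>)"
    and shape: "rectangular \<xi> \<or> special \<xi>"
    and S: "mact W (x (wt n (- 1) \<alpha> (real (dd \<alpha>) * real (nparts \<xi>)))) w \<in> N"
      "special \<xi> \<Longrightarrow>
        act_pow W (x (wt n (- 1) \<alpha> (real (dd \<alpha>) * (real (nparts \<xi>) - 1)))) (\<xi> (nparts \<xi>) + 1) w \<in> N"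
  shows "(\<forall>s r b. 1 \<le> s \<longrightarrow> 1 \<le> r \<longrightarrow> 2 * b = s + r \<longrightarrow>
      (\<exists>k. 1 / 2 + real r * real k + phi \<xi> k \<le> real s / 2) \<longrightarrow>
      act_dpow W (x (wt n (1 / 2) \<alpha> (1 / 2))) s (act_dpow W (x (wt n (- 1) \<alpha> 0)) b w) \<in> N) \<longleftrightarrow>
    mact W (x (wt n (- 1 / 2) \<alpha> (real (nparts \<xi>) + 1 / 2))) w \<in> N \<and>
    (special \<xi> \<longrightarrow> (\<forall>m. real m = 2 * phi \<xi> (nparts \<xi> - 1) + 1 \<longrightarrow>
      act_pow W (x (wt n (- 1 / 2) \<alpha> (real (nparts \<xi>) - 1 / 2))) m w \<in> N))"
proof -
  obtain F Y X where fam: "twisted_root_family \<alpha> F Y X" using long_root_twisted_family[OF \<alpha>] .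
  note f = twisted_family_facts[OF \<alpha> fam]
  obtain cF where cF: "cF \<noteq> 0" "x (wt n (1 / 2) \<alpha> (1 / 2)) = scl G cF F" using f(9) by blast
  obtain c where c: "\<And>k. c k \<noteq> 0"
    "\<And>k. x (wt n (- 1 / 2) \<alpha> (real k + 1 / 2)) = scl G (c k) (Y (2 * k + 1))" using f(10) by metis
  obtain e where e: "\<And>k. e k \<noteq> 0"
    "\<And>k. x (wt n (- 1) \<alpha> (real (dd \<alpha>) * real k)) = scl G (e k) (X (4 * k))" using f(11) by metis
  have e0: "x (wt n (- 1) \<alpha> 0) = scl G (e 0) (X 0)" using e(2)[of 0] by simp
  have "family (scl G) (brk G) F Y X (\<lambda>i. brk G F (Y i)) (\<lambda>i. if 4 dvd i then 1 else 0)
      (\<lambda>i j. if i mod 4 = 1 then 6 else if i mod 4 = 3 then 2 else 0)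
      (\<lambda>i j. if i mod 4 = 3 then 4 else 0)
      (\<lambda>i j. if i mod 4 = 1 \<and> j mod 4 = 3 then 4 else if i mod 4 = 3 \<and> j mod 4 = 1 then - 4 else 0)"
    using fam unfolding twisted_root_family_def twisted_family_def by blast
  from R_family[OF this f(2,3,4,6)]
  have "twisted_family lscale comm (R F) (\<lambda>i. R (Y i)) (\<lambda>i. R (X i)) (\<lambda>i. R (brk G F (Y i)))"
    unfolding twisted_family_def using f(7,8) R_zero by simp
  then have rm: "root_module (R F) (\<lambda>i. R (Y i)) (\<lambda>i. R (X i)) (\<lambda>i. R (brk G F (Y i)))
      (\<lambda>i. if 4 dvd i then 1 else 0)
      (\<lambda>i j. if i mod 4 = 1 then 6 else if i mod 4 = 3 then 2 else 0)
      (\<lambda>i j. if i mod 4 = 3 then 4 else 0)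
      (\<lambda>i j. if i mod 4 = 1 \<and> j mod 4 = 3 then 4 else if i mod 4 = 3 \<and> j mod 4 = 1 then - 4 else 0) w0"
    by (rule root_module_twisted) (use R_pos f in auto)
  have dom: "(app (R (X 0)) ^^ Suc (tail \<xi> 1)) w0 = 0"
    using R_dom[OF \<alpha>(1) wt] e(1)[of 0] unfolding e0 R_scl[OF f(4)] lscale_pow by simp
  \<comment> \<open>A special partition has \<open>nparts\<close> \<ge> 1, so the real differences
    agree with natural ones.\<close>
  have s: "real (nparts \<xi>) - 1 = real (nparts \<xi> - 1)"
    "real (nparts \<xi>) - 1 / 2 = real (nparts \<xi> - 1) + 1 / 2" "2 * (nparts \<xi> - 1) + 1 = 2 * nparts \<xi> - 1"
    if "special \<xi>"
    using special_nparts[OF that] by (simp_all add: of_nat_diff)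
  have S1: "app (R (X (4 * nparts \<xi>))) w0 = 0"
    using S(1) unfolding e(2) act_mem_N[OF f(4) e(1)] .
  have S2: "(app (R (X (4 * (nparts \<xi> - 1)))) ^^ Suc (\<xi> (nparts \<xi>))) w0 = 0" if "special \<xi>"
    using S(2)[OF that] unfolding s(1)[OF that] e(2) pow_mem_N[OF f(4) e(1)] Suc_eq_plus1 .
  have "act_pow W (x (wt n (- 1 / 2) \<alpha> (real (nparts \<xi>) - 1 / 2))) m w \<in> N \<longleftrightarrow>
      (app (R (Y (2 * nparts \<xi> - 1))) ^^ m) w0 = 0" if "special \<xi>" for m
    unfolding s(2)[OF that] c(2) pow_mem_N[OF f(3) c(1)] s(3)[OF that] ..
  moreover have "mact W (x (wt n (- 1 / 2) \<alpha> (real (nparts \<xi>) + 1 / 2))) w \<in> N \<longleftrightarrow>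
      app (R (Y (2 * nparts \<xi> + 1))) w0 = 0"
    unfolding c(2) act_mem_N[OF f(3) c(1)] ..
  moreover have "(\<forall>s r b. 1 \<le> s \<longrightarrow> 1 \<le> r \<longrightarrow> 2 * b = s + r \<longrightarrow>
        (\<exists>k. 1 / 2 + real r * real k + phi \<xi> k \<le> real s / 2) \<longrightarrow>
        (app (R F) ^^ s) ((app (R (X 0)) ^^ b) w0) = 0) \<longleftrightarrow>
     app (R (Y (2 * nparts \<xi> + 1))) w0 = 0 \<and>
     (special \<xi> \<longrightarrow> (\<forall>m. real m = 2 * phi \<xi> (nparts \<xi> - 1) + 1 \<longrightarrow>
        (app (R (Y (2 * nparts \<xi> - 1))) ^^ m) w0 = 0))"
  proof (rule root_module.twisted_relations_iff[OF rm _ _ _ _ dom S1 S2 shape])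
    show "R (Y i) = 0" if "even i" for i using f(7)[OF that] R_zero by simp
    show "R (X i) = 0" if "\<not> 4 dvd i" for i using f(8)[OF that] R_zero by simp
    show "(if i mod 4 = 1 then 6 else if i mod 4 = 3 then 2 else 0 :: complex) \<noteq> 0" if "odd i" for i :: nat
    proof -
      have "i mod 4 = 1 \<or> i mod 4 = 3" using that by presburger
      then show ?thesis by auto
    qed
  qed simp
  ultimately show ?thesis unfolding cF(2) e0 dpow_mem_N[OF f(2) cF(1) f(4) e(1)] by simp
qed

end

section \<open>Comparison of the two sets of relators\<close>

context affine_A2n2
begin

definition reduced_relators ::
    "(weight \<Rightarrow> 'g) \<Rightarrow> ('g \<Rightarrow> complex) \<Rightarrow> (weight \<Rightarrow> nat \<Rightarrow> nat) \<Rightarrow> 'g free_alg set set set" where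
  "reduced_relators x lam \<xi> = (let W = Wloc x lam; w = wloc x lam;
     s = (\<lambda>\<alpha>. nparts (\<xi> \<alpha>)); d = (\<lambda>\<alpha>. real (dd \<alpha>)) in
     {mact W (x (wt n (- 1) \<alpha> (d \<alpha> * real (s \<alpha>)))) w | \<alpha>. \<alpha> \<in> pos_roots}
     \<union> {act_pow W (x (wt n (- 1) \<alpha> (d \<alpha> * (real (s \<alpha>) - 1)))) (\<xi> \<alpha> (s \<alpha>) + 1) w | \<alpha>.
          \<alpha> \<in> pos_roots \<and> special (\<xi> \<alpha>)}
     \<union> {mact W (x (wt n (- 1 / 2) \<alpha> (real (s \<alpha>) + 1 / 2))) w | \<alpha>. \<alpha> \<in> long_roots \<inter> pos_roots}
     \<union> {act_pow W (x (wt n (- 1 / 2) \<alpha> (real (s \<alpha>) - 1 / 2))) m w | \<alpha> m.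
          \<alpha> \<in> long_roots \<inter> pos_roots \<and> special (\<xi> \<alpha>) \<and> real m = 2 * phi (\<xi> \<alpha>) (s \<alpha> - 1) + 1})"

theorem V_relators_subset_iff:
  assumes x: "root_vectors x" and lam: "compatible lam \<xi>"
    and shape: "\<And>\<alpha>. \<alpha> \<in> pos_roots \<Longrightarrow> rectangular (\<xi> \<alpha>) \<or> special (\<xi> \<alpha>)"
    and N: "submodule Cg (Wloc x lam) N"
  shows "V_relators x lam \<xi> \<subseteq> N \<longleftrightarrow> reduced_relators x lam \<xi> \<subseteq> N"
proof -
  obtain R w0 T where "operator_model n G x lam N R w0 T" using Wloc_operator_model[OF x N] by blast
  then interpret om: operator_model n G x lam N R w0 T .
  let ?W = "Wloc x lam" and ?w = "wloc x lam"
  have tl: "of_nat (tail (\<xi> \<alpha>) 1) = lam (coroot \<alpha>)" if "\<alpha> \<in> pos_roots" for \<alpha>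
    using lam that unfolding compatible_def by blast
  define V1 where "V1 \<alpha> \<longleftrightarrow> (\<forall>s r. 1 \<le> s \<longrightarrow> 1 \<le> r \<longrightarrow> (\<exists>k. 1 + r * k + tail (\<xi> \<alpha>) (k + 1) \<le> s + r) \<longrightarrow>
      act_dpow ?W (x (wt n 1 \<alpha> (real (dd \<alpha>)))) s (act_dpow ?W (x (wt n (- 1) \<alpha> 0)) (s + r) ?w) \<in> N)" for \<alpha>
  define V2 where "V2 \<alpha> \<longleftrightarrow> (\<forall>s r b. 1 \<le> s \<longrightarrow> 1 \<le> r \<longrightarrow> 2 * b = s + r \<longrightarrow>
      (\<exists>k. 1 / 2 + real r * real k + phi (\<xi> \<alpha>) k \<le> real s / 2) \<longrightarrow>
      act_dpow ?W (x (wt n (1 / 2) \<alpha> (1 / 2))) s (act_dpow ?W (x (wt n (- 1) \<alpha> 0)) b ?w) \<in> N)" for \<alpha>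
  define S1 where "S1 \<alpha> \<longleftrightarrow> mact ?W (x (wt n (- 1) \<alpha> (real (dd \<alpha>) * real (nparts (\<xi> \<alpha>))))) ?w \<in> N \<and>
    (special (\<xi> \<alpha>) \<longrightarrow> act_pow ?W (x (wt n (- 1) \<alpha> (real (dd \<alpha>) * (real (nparts (\<xi> \<alpha>)) - 1))))
       (\<xi> \<alpha> (nparts (\<xi> \<alpha>)) + 1) ?w \<in> N)" for \<alpha>
  define S2 where "S2 \<alpha> \<longleftrightarrow> mact ?W (x (wt n (- 1 / 2) \<alpha> (real (nparts (\<xi> \<alpha>)) + 1 / 2))) ?w \<in> N \<and>
    (special (\<xi> \<alpha>) \<longrightarrow> (\<forall>m. real m = 2 * phi (\<xi> \<alpha>) (nparts (\<xi> \<alpha>) - 1) + 1 \<longrightarrow>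
      act_pow ?W (x (wt n (- 1 / 2) \<alpha> (real (nparts (\<xi> \<alpha>)) - 1 / 2))) m ?w \<in> N))" for \<alpha>
  have 1: "V1 \<alpha> \<longleftrightarrow> S1 \<alpha>" if "\<alpha> \<in> pos_roots" for \<alpha>
    unfolding V1_def S1_def by (rule om.sl2_relators[OF that tl[OF that] shape[OF that]])
  have 2: "V2 \<alpha> \<longleftrightarrow> S2 \<alpha>" if \<alpha>: "\<alpha> \<in> pos_roots" "\<alpha> \<in> long_roots" and S1: "S1 \<alpha>" for \<alpha>
    unfolding V2_def S2_def
    by (rule om.twisted_relators[OF \<alpha> tl[OF \<alpha>(1)] shape[OF \<alpha>(1)]]) (use S1 in \<open>simp_all add: S1_def\<close>)
  \<comment> \<open>Doubling turns \<open>bold_N\<close> into the pairs of positive integers with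
    even sum, and b is half of that sum.\<close>
  have bold: "V2 \<alpha> \<longleftrightarrow> (\<forall>r s a b. (r, s) \<in> bold_N \<longrightarrow> real a = 2 * s \<longrightarrow> real b = s + r \<longrightarrow>
      (\<exists>k::nat. 1 / 2 + 2 * r * real k + phi (\<xi> \<alpha>) k \<le> s) \<longrightarrow>
      act_dpow ?W (x (wt n (1 / 2) \<alpha> (1 / 2))) a (act_dpow ?W (x (wt n (- 1) \<alpha> 0)) b ?w) \<in> N)" for \<alpha>
  proof
    assume V: "V2 \<alpha>"
    show "\<forall>r s a b. (r, s) \<in> bold_N \<longrightarrow> real a = 2 * s \<longrightarrow> real b = s + r \<longrightarrow>
      (\<exists>k::nat. 1 / 2 + 2 * r * real k + phi (\<xi> \<alpha>) k \<le> s) \<longrightarrow>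
      act_dpow ?W (x (wt n (1 / 2) \<alpha> (1 / 2))) a (act_dpow ?W (x (wt n (- 1) \<alpha> 0)) b ?w) \<in> N"
    proof (intro allI impI)
      fix r s a b assume rs: "(r, s) \<in> bold_N" and a: "real a = 2 * s" and b: "real b = s + r"
        and k: "\<exists>k::nat. 1 / 2 + 2 * r * real k + phi (\<xi> \<alpha>) k \<le> s"
      obtain p q where p: "1 \<le> p" "r = real p / 2" and q: "1 \<le> q" "s = real q / 2"
        using rs unfolding bold_N_def by auto
      have "q = a" using a q by simp
      moreover have "real (2 * b) = real (a + p)" using a b p by simp
      then have "2 * b = a + p" by (simp only: of_nat_eq_iff)
      moreover have "\<exists>k. 1 / 2 + real p * real k + phi (\<xi> \<alpha>) k \<le> real a / 2"
        using k p(2) a by simp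
      ultimately show "act_dpow ?W (x (wt n (1 / 2) \<alpha> (1 / 2))) a (act_dpow ?W (x (wt n (- 1) \<alpha> 0)) b ?w) \<in> N"
        using V p(1) q(1) unfolding V2_def by blast
    qed
  next
    assume V: "\<forall>r s a b. (r, s) \<in> bold_N \<longrightarrow> real a = 2 * s \<longrightarrow> real b = s + r \<longrightarrow>
      (\<exists>k::nat. 1 / 2 + 2 * r * real k + phi (\<xi> \<alpha>) k \<le> s) \<longrightarrow>
      act_dpow ?W (x (wt n (1 / 2) \<alpha> (1 / 2))) a (act_dpow ?W (x (wt n (- 1) \<alpha> 0)) b ?w) \<in> N"
    show "V2 \<alpha>" unfolding V2_def
    proof (intro allI impI)
      fix s r b :: nat assume sr: "1 \<le> s" "1 \<le> r" "2 * b = s + r"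
        and k: "\<exists>k. 1 / 2 + real r * real k + phi (\<xi> \<alpha>) k \<le> real s / 2"
      have "real (2 * b) = real (s + r)" using sr(3) by (simp only:)
      then have b: "real b = real s / 2 + real r / 2" by simp
      then have "real r / 2 + real s / 2 \<in> \<nat>" by (metis add.commute of_nat_in_Nats)
      then have "(real r / 2, real s / 2) \<in> bold_N" unfolding bold_N_def using sr(1,2) by auto
      then show "act_dpow ?W (x (wt n (1 / 2) \<alpha> (1 / 2))) s (act_dpow ?W (x (wt n (- 1) \<alpha> 0)) b ?w) \<in> N"
        using V[rule_format, of "real r / 2" "real s / 2" s b] b k by simp
    qed
  qed
  have "V_relators x lam \<xi> \<subseteq> N \<longleftrightarrow> (\<forall>\<alpha>\<in>pos_roots. V1 \<alpha>) \<and> (\<forall>\<alpha>\<in>long_roots \<inter> pos_roots. V2 \<alpha>)"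
    unfolding V_relators_def Let_def Un_subset_iff V1_def bold
    by (intro arg_cong2[where f = "(\<and>)"]) blast+
  \<comment> \<open>The equivalence for \<open>V2\<close> presupposes \<open>S1\<close>, which is
    available because both sides contain the condition for all positive roots.\<close>
  also have "\<dots> \<longleftrightarrow> (\<forall>\<alpha>\<in>pos_roots. S1 \<alpha>) \<and> (\<forall>\<alpha>\<in>long_roots \<inter> pos_roots. S2 \<alpha>)"
    using 1 2 by blast
  also have "\<dots> \<longleftrightarrow> reduced_relators x lam \<xi> \<subseteq> N"
    unfolding reduced_relators_def Let_def Un_subset_iff S1_def S2_def by blast
  finally show ?thesis .
qed

end

lemma module_iso_refl: "module_iso L M M"
  unfolding module_iso_def by (rule exI[of _ id]) simp

theorem theorem1:
  fixes n :: nat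
    and G :: "'g::ab_group_add km_data"
    and x :: "weight \<Rightarrow> 'g"
    and lam :: "'g \<Rightarrow> complex"
    and \<xi> :: "weight \<Rightarrow> nat \<Rightarrow> nat"
  assumes affine: "affine_A2n2 n G"
    and root_vectors: "affine_A2n2.root_vectors n G x"
    and dominant: "affine_A2n2.dominant_integral n G lam"
    and compatible: "affine_A2n2.compatible n G lam \<xi>"
    and shape: "\<forall>\<alpha>\<in>affine_A2n2.pos_roots n G. rectangular (\<xi> \<alpha>) \<or> special (\<xi> \<alpha>)"
  shows "let Cg = affine_A2n2.Cg n G;
             W = affine_A2n2.Wloc n G x lam;
             w = affine_A2n2.wloc n G x lam;
             Rp = affine_A2n2.pos_roots n G;
             Rlp = affine_A2n2.long_roots n G \<inter> Rp;
             d = (\<lambda>\<alpha>. real (affine_A2n2.dd n G \<alpha>));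
             s = (\<lambda>\<alpha>. nparts (\<xi> \<alpha>))
         in module_iso Cg (affine_A2n2.V n G x lam \<xi>)
              (quot_mod W (submodule_gen Cg W
                ({mact W (x (wt n (-1) \<alpha> (d \<alpha> * real (s \<alpha>)))) w | \<alpha>. \<alpha> \<in> Rp}
                 \<union> {act_pow W (x (wt n (-1) \<alpha> (d \<alpha> * (real (s \<alpha>) - 1)))) (\<xi> \<alpha> (s \<alpha>) + 1) w | \<alpha>.
                      \<alpha> \<in> Rp \<and> special (\<xi> \<alpha>)}
                 \<union> {mact W (x (wt n (-1/2) \<alpha> (real (s \<alpha>) + 1/2))) w | \<alpha>. \<alpha> \<in> Rlp}
                 \<union> {act_pow W (x (wt n (-1/2) \<alpha> (real (s \<alpha>) - 1/2))) m w | \<alpha> m.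
                      \<alpha> \<in> Rlp \<and> special (\<xi> \<alpha>) \<and> real m = 2 * phi (\<xi> \<alpha>) (s \<alpha> - 1) + 1})))"
proof -
  interpret affine_A2n2 n G by (rule affine)
  have "V_relators x lam \<xi> \<subseteq> N \<longleftrightarrow> reduced_relators x lam \<xi> \<subseteq> N" if "submodule Cg (Wloc x lam) N" for N
    by (rule V_relators_subset_iff[OF root_vectors compatible _ that]) (use shape in blast)
  \<comment> \<open>A generated submodule depends only on which submodules contain the generators;
    hence the two quotients are equal and the identity is an isomorphism.\<close>
  then have "{N. submodule Cg (Wloc x lam) N \<and> V_relators x lam \<xi> \<subseteq> N} =
      {N. submodule Cg (Wloc x lam) N \<and> reduced_relators x lam \<xi> \<subseteq> N}"
    by (intro Collect_cong conj_cong refl)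
  then have "V x lam \<xi> =
      quot_mod (Wloc x lam) (submodule_gen Cg (Wloc x lam) (reduced_relators x lam \<xi>))"
    unfolding V_def submodule_gen_def by (simp only:)
  then show ?thesis using module_iso_refl[of Cg "V x lam \<xi>"]
    unfolding reduced_relators_def Let_def by (simp only:)
qed

end
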